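(* For $k\in\{0,1\}$ let $(\mathcal{D}_{F_k},F_k)$ be a Denjoy system with invariants $(\alpha_k,A_k)$, where $0\in A_k$. Consider the condition: ( * ) there exists $M=(m_{ij})\in\mathrm{PGL}_2(\mathbb{Q})$ such that $$\alpha_1=\frac{m_{11}\alpha_0+m_{12}}{m_{21}\alpha_0+m_{22}}\qquad\text{and}\qquad \mathbb{Q}A_1\equiv\frac{1}{m_{21}\alpha_0+m_{22}}\cdot\mathbb{Q}A_0 .$$ 1. If ( * ) holds, then the systems $(\mathcal{D}_{F_0},F_0)$ and $(\mathcal{D}_{F_1},F_1)$ are isogenous. 2. If $(\mathcal{D}_{F_0},F_0)$ and $(\mathcal{D}_{F_1},F_1)$ are isogenous through a chain of Denjoy systems, then ( * ) holds.
   Context: A system $(X,S)$ is a non-empty compact metric space with a homeomorphism; a factor map is a continuous surjection commuting with the homeomorphisms. Denjoy systems. Let $\mathbb{T}=\mathbb{R}/\mathbb{Z}$, $R_\alpha(t)=t+\alpha$. A Denjoy homeomorphism is an orientation-preserving homeomorphism $F$ of $\mathbb{T}$ with irrational rotation number $\alpha$ that is not conjugate to $R_\alpha$. There is then a continuous surjection $H:\mathbb{T}\to\mathbb{T}$ with $HF=R_\alpha H$, unique up to post-composition with a rotation, and $F$ has a unique minimal set $\mathcal{D}_F$, a Cantor set; the Denjoy system is $(\mathcal{D}_F,F|_{\mathcal{D}_F})$. $H$ collapses the closure of each component of $\mathbb{T}\setminus\mathcal{D}_F$ to a point; the set $A\subset\mathbb{T}$ of these points is countable, $R_\alpha$-invariant,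 and well defined up to rotation. It is normalized by a rotation so that $0\in A$; $(\alpha,A)$ are the invariants of the system. Every pair ($\alpha$ irrational, $A\ni0$ countable $R_\alpha$-invariant) occurs. Notation. Rotation numbers are represented by real numbers. A subset of $\mathbb{T}$ containing $0$ is multiplied by a real number by lifting it to its full preimage in $\mathbb{R}$, scaling, and projecting back to $\mathbb{T}$. $\mathbb{Q}A\subset\mathbb{T}$ is the image in $\mathbb{T}$ of the $\mathbb{Q}$-linear span in $\mathbb{R}$ of the preimage of $A$. The symbol $\equiv$ means equality of subsets of $\mathbb{T}$ up to rotation. Flow equivalence. The suspension of $(X,S)$ is $\Sigma_SX=(X\times\mathbb{R})/\mathbb{Z}$, $n\cdot(x,s)=(S^n(x),s-n)$, with flow $(x,s)\mapsto(x,s+s')$. Systems are flow equivalent if there is a homeomorphism between their suspensions mapping flow orbits onto flow orbits and preserving their orientation. 2-AI factors. $\mathcal{G}_S=C(X,\mathbb{Z})/\{f-f\circ S\}$. A state is a homomorphism $\tau:\mathcal{G}_S\to\mathbb{R}$ with $\tau([1])=1$ and $\tau([f])\ge0$ for $f\ge0$; $\mathrm{Inf}_S$ is the intersection of the kernels of all states. Points $x,x'$ are asymptotic if $d(S^nx,S^nx')\to0$ as $n\to\pm\infty$. A factor map $\pi:(X,S)\to(Y,T)$ is 2-asymptotic (2-A) if there is a countable $B\subset Y$ such that $|\pi^{-1}(y)|>1$ iff $y\in B$, and for $y\in B$ the fiber consists of exactly two points, which are asymptotic. Choosing a representative $y$ of each $T$-orbit in $B$ and an ordering $(x,x')$ of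 $\pi^{-1}(y)$, put $\mathcal{I}_y([f])=\sum_{n\in\mathbb{Z}}(f(S^nx)-f(S^nx'))$ and $\mathcal{I}=\bigoplus_y\mathcal{I}_y:\mathcal{G}_S\to\bigoplus_{B\bmod T}\mathbb{Z}$. A 2-A factor is infinitesimal (2-AI) if $\mathcal{I}(\mathcal{G}_S)/\mathcal{I}(\mathrm{Inf}_S)$ is torsion. 2-AI equivalence is the equivalence relation generated by: $(Y_1,T_1)\sim(Y_2,T_2)$ whenever some system $(X,S)$ has 2-AI factor maps onto both. Isogeny. Two systems are virtually 2-AI equivalent if $(X,S^m)$ and $(Y,T^n)$ are 2-AI equivalent for some $m,n\in\mathbb{N}_{>0}$. Zero-dimensional systems are isogenous if they are joined by a finite chain of systems in which consecutive ones are virtually 2-AI equivalent or flow equivalent. They are isogenous through a chain of Denjoy systems if this can be done with every system involved (including those occurring in the chains of 2-AI factor maps) a Denjoy system; a power $(\mathcal{D}_F,F^m)$, $m\geq 1$, of a Denjoy system with invariants $(\alpha,A)$ is itself a Denjoy system, with invariants $(m\alpha,A)$. *)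

theory Defs
  imports
    "HOL-Analysis.Analysis"
    "HOL-Algebra.Product_Groups"
    "HOL-Library.Groups_Big_Fun"
begin

section \<open>Systems and factor maps\<close>

text \<open>
  A system is a pair of a metric space (with carrier \<open>points X\<close>) and a self-map.  The
  behaviour of the self-map outside the carrier is irrelevant.  A compact metric space has at
  most continuum many points, so every system is isometrically conjugate to one whose
  underlying type is any given type of that cardinality; we shall use \<^typ>\<open>complex\<close>, which also
  contains the circle.  The metric is \<^emph>\<open>not\<close> required to be the one of the ambient type.
\<close>

type_synonym 'a system = "'a metric \<times> ('a \<Rightarrow> 'a)"

abbreviation points :: "'a system \<Rightarrow> 'a set" where
  "points X \<equiv> mspace (fst X)"

abbreviation sys_top :: "'a system \<Rightarrow> 'a topology" where
  "sys_top X \<equiv> mtopology_of (fst X)"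

abbreviation sys_map :: "'a system \<Rightarrow> 'a \<Rightarrow> 'a" where
  "sys_map X \<equiv> snd X"

definition is_system :: "'a system \<Rightarrow> bool" where
  "is_system X \<longleftrightarrow>
     points X \<noteq> {} \<and> compact_space (sys_top X) \<and>
     homeomorphic_map (sys_top X) (sys_top X) (sys_map X)"

definition sys_iter :: "'a system \<Rightarrow> int \<Rightarrow> 'a \<Rightarrow> 'a" where
  "sys_iter X n =
     (if 0 \<le> n then sys_map X ^^ nat n
      else inv_into (points X) (sys_map X) ^^ nat (- n))"

definition sys_power :: "'a system \<Rightarrow> nat \<Rightarrow> 'a system" where
  "sys_power X m = (fst X, sys_map X ^^ m)"

definition zero_dimensional :: "'a system \<Rightarrow> bool" where
  "zero_dimensional X \<longleftrightarrow>
     (\<forall>U x. openin (sys_top X) U \<and> x \<in> U \<longrightarrow>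
        (\<exists>V. openin (sys_top X) V \<and> closedin (sys_top X) V \<and> x \<in> V \<and> V \<subseteq> U))"

definition factor_map :: "'a system \<Rightarrow> 'b system \<Rightarrow> ('a \<Rightarrow> 'b) \<Rightarrow> bool" where
  "factor_map X Y p \<longleftrightarrow>
     continuous_map (sys_top X) (sys_top Y) p \<and> p ` points X = points Y \<and>
     (\<forall>x\<in>points X. p (sys_map X x) = sys_map Y (p x))"

section \<open>Suspensions and flow equivalence\<close>

text \<open>The points of the suspension are the orbits of the action of the integers on the product
  of the space with the real line.\<close>

definition susp_class :: "'a system \<Rightarrow> 'a \<times> real \<Rightarrow> ('a \<times> real) set" where
  "susp_class X = (\<lambda>(x, s). {(sys_iter X n x, s - of_int n) | n. True})"

definition suspension :: "'a system \<Rightarrow> ('a \<times> real) set topology" where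
  "suspension X = topology (\<lambda>U.
     U \<subseteq> susp_class X ` (points X \<times> UNIV) \<and>
     openin (prod_topology (sys_top X) euclideanreal)
       {p \<in> points X \<times> UNIV. susp_class X p \<in> U})"

lemma openin_suspension:
  "openin (suspension X) U \<longleftrightarrow>
     U \<subseteq> susp_class X ` (points X \<times> UNIV) \<and>
     openin (prod_topology (sys_top X) euclideanreal)
       {p \<in> points X \<times> UNIV. susp_class X p \<in> U}"
proof -
  let ?P = "\<lambda>U. U \<subseteq> susp_class X ` (points X \<times> UNIV) \<and>
     openin (prod_topology (sys_top X) euclideanreal)
       {p \<in> points X \<times> UNIV. susp_class X p \<in> U}"
  have "istopology ?P"
    unfolding istopology_def
  proof (intro conjI allI impI)
    fix S T assume S: "?P S" and T: "?P T"
    show "S \<inter> T \<subseteq> susp_class X ` (points X \<times> UNIV)" using S by blast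
    have "{p \<in> points X \<times> UNIV. susp_class X p \<in> S \<inter> T} =
      {p \<in> points X \<times> UNIV. susp_class X p \<in> S} \<inter> {p \<in> points X \<times> UNIV. susp_class X p \<in> T}"
      by blast
    then show "openin (prod_topology (sys_top X) euclideanreal)
       {p \<in> points X \<times> UNIV. susp_class X p \<in> S \<inter> T}"
      using S T by (simp only: openin_Int)
  next
    fix K assume K: "\<forall>S\<in>K. ?P S"
    show "\<Union> K \<subseteq> susp_class X ` (points X \<times> UNIV)" using K by blast
    have "{p \<in> points X \<times> UNIV. susp_class X p \<in> \<Union> K} =
      \<Union> ((\<lambda>S. {p \<in> points X \<times> UNIV. susp_class X p \<in> S}) ` K)"
      by blast
    then show "openin (prod_topology (sys_top X) euclideanreal)
       {p \<in> points X \<times> UNIV. susp_class X p \<in> \<Union> K}"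
      using K by (metis (no_types, lifting) imageE openin_Union)
  qed
  then show ?thesis
    unfolding suspension_def by (simp add: topology_inverse')
qed

definition susp_flow :: "real \<Rightarrow> ('a \<times> real) set \<Rightarrow> ('a \<times> real) set" where
  "susp_flow t c = (\<lambda>(x, s). (x, s + t)) ` c"

definition flow_orbit :: "('a \<times> real) set \<Rightarrow> ('a \<times> real) set set" where
  "flow_orbit c = range (\<lambda>t. susp_flow t c)"

text \<open>The map \<open>g\<close> below expresses that the orbit of \<open>c\<close> is mapped to the orbit of \<open>h c\<close> by an
  increasing reparametrization of time.\<close>

definition flow_equivalent :: "'a system \<Rightarrow> 'b system \<Rightarrow> bool" where
  "flow_equivalent X Y \<longleftrightarrow>
     (\<exists>h. homeomorphic_map (suspension X) (suspension Y) h \<and>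
        (\<forall>c\<in>topspace (suspension X).
           h ` flow_orbit c = flow_orbit (h c) \<and>
           (\<exists>g::real \<Rightarrow> real. continuous_on UNIV g \<and> strict_mono g \<and>
              (\<forall>t. h (susp_flow t c) = susp_flow (g t) (h c)))))"

section \<open>The group of coinvariants, states and infinitesimals\<close>

text \<open>Integer-valued continuous functions are represented by functions that are undefined
  outside the carrier (\<^const>\<open>extensional\<close>), so that functions equal on the space are equal.\<close>

definition int_functions :: "'a system \<Rightarrow> ('a \<Rightarrow> int) monoid" where
  "int_functions X =
     \<lparr>carrier = {f \<in> extensional (points X).
                    continuous_map (sys_top X) (discrete_topology UNIV) f},
      monoid.mult = (\<lambda>f g. \<lambda>x\<in>points X. f x + g x),
      one = (\<lambda>x\<in>points X. 0)\<rparr>"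

definition coboundaries :: "'a system \<Rightarrow> ('a \<Rightarrow> int) set" where
  "coboundaries X =
     (\<lambda>f. \<lambda>x\<in>points X. f x - f (sys_map X x)) ` carrier (int_functions X)"

definition coinvariants :: "'a system \<Rightarrow> ('a \<Rightarrow> int) set monoid" where
  "coinvariants X = int_functions X Mod coboundaries X"

definition coinv_class :: "'a system \<Rightarrow> ('a \<Rightarrow> int) \<Rightarrow> ('a \<Rightarrow> int) set" where
  "coinv_class X f = coboundaries X #>\<^bsub>int_functions X\<^esub> f"

definition real_group :: "real monoid" where
  "real_group = \<lparr>carrier = UNIV, monoid.mult = (+), one = 0\<rparr>"

definition is_state :: "'a system \<Rightarrow> (('a \<Rightarrow> int) set \<Rightarrow> real) \<Rightarrow> bool" where
  "is_state X \<tau> \<longleftrightarrow>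
     \<tau> \<in> hom (coinvariants X) real_group \<and>
     \<tau> (coinv_class X (\<lambda>x\<in>points X. 1)) = 1 \<and>
     (\<forall>f\<in>carrier (int_functions X). (\<forall>x\<in>points X. 0 \<le> f x) \<longrightarrow> 0 \<le> \<tau> (coinv_class X f))"

definition infinitesimals :: "'a system \<Rightarrow> ('a \<Rightarrow> int) set set" where
  "infinitesimals X =
     {g \<in> carrier (coinvariants X).
        \<forall>\<tau>. is_state X \<tau> \<longrightarrow> g \<in> kernel (coinvariants X) real_group \<tau>}"

section \<open>2-asymptotic and infinitesimal 2-asymptotic factors\<close>

definition asymptotic :: "'a system \<Rightarrow> 'a \<Rightarrow> 'a \<Rightarrow> bool" where
  "asymptotic X x x' \<longleftrightarrow>
     ((\<lambda>n. mdist (fst X) (sys_iter X n x) (sys_iter X n x')) \<longlongrightarrow> 0) at_top \<and>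
     ((\<lambda>n. mdist (fst X) (sys_iter X n x) (sys_iter X n x')) \<longlongrightarrow> 0) at_bot"

definition fiber :: "'a system \<Rightarrow> ('a \<Rightarrow> 'b) \<Rightarrow> 'b \<Rightarrow> 'a set" where
  "fiber X p y = {x \<in> points X. p x = y}"

text \<open>The fibers of a factor map are non-empty, so the points whose fiber has more than one
  element are those whose fiber is not a singleton (\<^const>\<open>card\<close> would miss infinite fibers).\<close>

definition branch_points :: "'a system \<Rightarrow> 'b system \<Rightarrow> ('a \<Rightarrow> 'b) \<Rightarrow> 'b set" where
  "branch_points X Y p = {y \<in> points Y. \<not> is_singleton (fiber X p y)}"

definition two_asymptotic :: "'a system \<Rightarrow> 'b system \<Rightarrow> ('a \<Rightarrow> 'b) \<Rightarrow> bool" where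
  "two_asymptotic X Y p \<longleftrightarrow>
     factor_map X Y p \<and> countable (branch_points X Y p) \<and>
     (\<forall>y\<in>branch_points X Y p.
        \<exists>x x'. x \<noteq> x' \<and> fiber X p y = {x, x'} \<and> asymptotic X x x')"

definition orbit_representatives :: "'b system \<Rightarrow> 'b set \<Rightarrow> 'b set \<Rightarrow> bool" where
  "orbit_representatives Y B R \<longleftrightarrow>
     R \<subseteq> B \<and> (\<forall>y\<in>B. \<exists>!r. r \<in> R \<and> (\<exists>n. r = sys_iter Y n y))"

text \<open>The map on the coinvariants induced by the indices
  \<open>f \<mapsto> (\<Sum>n\<in>\<int>. f (S\<^sup>n x) - f (S\<^sup>n x'))\<close>, where \<open>y\<close> runs through the chosen representatives
  \<open>R\<close> and \<open>(x, x') = (u y, v y)\<close> is the chosen ordering of the fiber over \<open>y\<close>.  The summands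
  vanish for all but finitely many \<open>n\<close> because \<open>x\<close> and \<open>x'\<close> are asymptotic.\<close>

definition index_map ::
    "'a system \<Rightarrow> 'b set \<Rightarrow> ('b \<Rightarrow> 'a) \<Rightarrow> ('b \<Rightarrow> 'a) \<Rightarrow> ('a \<Rightarrow> int) set \<Rightarrow> 'b \<Rightarrow> int" where
  "index_map X R u v g =
     the_elem ((\<lambda>f. \<lambda>y\<in>R. Sum_any (\<lambda>n::int. f (sys_iter X n (u y)) - f (sys_iter X n (v y)))) ` g)"

definition torsion_group :: "('a, 'b) monoid_scheme \<Rightarrow> bool" where
  "torsion_group G \<longleftrightarrow> (\<forall>g\<in>carrier G. \<exists>n::nat. 0 < n \<and> g [^]\<^bsub>G\<^esub> n = \<one>\<^bsub>G\<^esub>)"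

text \<open>\<^const>\<open>sum_group\<close> is the direct sum.  Other choices of \<open>R\<close>, \<open>u\<close> and \<open>v\<close> change the index
  map only by signs and a relabelling of the summands, so the choice is immaterial.\<close>

definition two_AI :: "'a system \<Rightarrow> 'b system \<Rightarrow> ('a \<Rightarrow> 'b) \<Rightarrow> bool" where
  "two_AI X Y p \<longleftrightarrow>
     two_asymptotic X Y p \<and>
     (\<exists>R u v.
        orbit_representatives Y (branch_points X Y p) R \<and>
        (\<forall>y\<in>R. u y \<noteq> v y \<and> fiber X p y = {u y, v y}) \<and>
        (let D = sum_group R (\<lambda>_. integer_group); I = index_map X R u v in
           I \<in> hom (coinvariants X) D \<and>
           torsion_group
             (D\<lparr>carrier := I ` carrier (coinvariants X)\<rparr> Mod (I ` infinitesimals X))))"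

text \<open>The equivalence relation generated by common 2-AI extensions, where all systems involved
  are taken from the class \<open>P\<close>.\<close>

definition two_AI_equivalent_in ::
    "('a system \<Rightarrow> bool) \<Rightarrow> 'a system \<Rightarrow> 'a system \<Rightarrow> bool" where
  "two_AI_equivalent_in P Y Z \<longleftrightarrow>
     P Y \<and> P Z \<and>
     equivclp (\<lambda>Y\<^sub>1 Y\<^sub>2. P Y\<^sub>1 \<and> P Y\<^sub>2 \<and>
       (\<exists>X p q. P X \<and> two_AI X Y\<^sub>1 p \<and> two_AI X Y\<^sub>2 q)) Y Z"

section \<open>Isogeny\<close>

definition virtually_two_AI_equivalent_in ::
    "('a system \<Rightarrow> bool) \<Rightarrow> 'a system \<Rightarrow> 'a system \<Rightarrow> bool" where
  "virtually_two_AI_equivalent_in P X Y \<longleftrightarrow>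
     (\<exists>m n. 0 < m \<and> 0 < n \<and> two_AI_equivalent_in P (sys_power X m) (sys_power Y n))"

definition isogenous_in :: "('a system \<Rightarrow> bool) \<Rightarrow> 'a system \<Rightarrow> 'a system \<Rightarrow> bool" where
  "isogenous_in P X Y \<longleftrightarrow>
     P X \<and> P Y \<and>
     (\<lambda>X\<^sub>1 X\<^sub>2. P X\<^sub>1 \<and> P X\<^sub>2 \<and>
        (virtually_two_AI_equivalent_in P X\<^sub>1 X\<^sub>2 \<or> flow_equivalent X\<^sub>1 X\<^sub>2))\<^sup>*\<^sup>* X Y"

definition isogenous :: "'a system \<Rightarrow> 'a system \<Rightarrow> bool" where
  "isogenous X Y \<longleftrightarrow>
     zero_dimensional X \<and> zero_dimensional Y \<and> isogenous_in is_system X Y"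

section \<open>The circle and Denjoy systems\<close>

text \<open>The circle \<open>\<real>/\<int>\<close> is identified with the unit circle by \<open>t \<mapsto> cis (2 \<pi> t)\<close>; in particular
  its element \<open>0\<close> becomes the complex number \<^term>\<open>1::complex\<close>.\<close>

abbreviation circle :: "complex set" where
  "circle \<equiv> sphere 0 1"

definition circle_proj :: "real \<Rightarrow> complex" where
  "circle_proj t = cis (2 * pi * t)"

definition rotation :: "real \<Rightarrow> complex \<Rightarrow> complex" where
  "rotation \<alpha> z = circle_proj \<alpha> * z"

definition increasing_lift :: "(complex \<Rightarrow> complex) \<Rightarrow> (real \<Rightarrow> real) \<Rightarrow> bool" where
  "increasing_lift F f \<longleftrightarrow>
     continuous_on UNIV f \<and> strict_mono f \<and> (\<forall>t. f (t + 1) = f t + 1) \<and>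
     (\<forall>t. F (circle_proj t) = circle_proj (f t))"

definition orientation_preserving_homeo :: "(complex \<Rightarrow> complex) \<Rightarrow> bool" where
  "orientation_preserving_homeo F \<longleftrightarrow>
     (\<exists>G. homeomorphism circle circle F G) \<and> (\<exists>f. increasing_lift F f)"

text \<open>The rotation number is only determined modulo \<open>\<int>\<close>: the real numbers representing it are
  the translation numbers of the various lifts.\<close>

definition has_rotation_number :: "(complex \<Rightarrow> complex) \<Rightarrow> real \<Rightarrow> bool" where
  "has_rotation_number F \<alpha> \<longleftrightarrow>
     (\<exists>f. increasing_lift F f \<and> (\<forall>t. (\<lambda>n. (f ^^ n) t / real n) \<longlonglongrightarrow> \<alpha>))"

definition conjugate_on_circle :: "(complex \<Rightarrow> complex) \<Rightarrow> (complex \<Rightarrow> complex) \<Rightarrow> bool" where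
  "conjugate_on_circle F G \<longleftrightarrow>
     (\<exists>h k. homeomorphism circle circle h k \<and> (\<forall>z\<in>circle. h (F z) = G (h z)))"

definition denjoy_homeomorphism :: "(complex \<Rightarrow> complex) \<Rightarrow> bool" where
  "denjoy_homeomorphism F \<longleftrightarrow>
     orientation_preserving_homeo F \<and>
     (\<exists>\<alpha>. \<alpha> \<notin> \<rat> \<and> has_rotation_number F \<alpha> \<and> \<not> conjugate_on_circle F (rotation \<alpha>))"

definition minimal_set :: "(complex \<Rightarrow> complex) \<Rightarrow> complex set \<Rightarrow> bool" where
  "minimal_set F D \<longleftrightarrow>
     D \<subseteq> circle \<and> closed D \<and> D \<noteq> {} \<and> F ` D = D \<and>
     (\<forall>E. E \<subseteq> D \<and> closed E \<and> E \<noteq> {} \<and> F ` E = E \<longrightarrow> E = D)"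

text \<open>A Denjoy homeomorphism has exactly one minimal set.\<close>

definition denjoy_set :: "(complex \<Rightarrow> complex) \<Rightarrow> complex set" where
  "denjoy_set F = (THE D. minimal_set F D)"

definition denjoy_system :: "(complex \<Rightarrow> complex) \<Rightarrow> complex system" where
  "denjoy_system F = (submetric euclidean_metric (denjoy_set F), restrict F (denjoy_set F))"

definition is_denjoy_system :: "complex system \<Rightarrow> bool" where
  "is_denjoy_system X \<longleftrightarrow>
     (\<exists>F. denjoy_homeomorphism F \<and> fst X = fst (denjoy_system F) \<and>
        (\<forall>z\<in>denjoy_set F. sys_map X z = F z))"

text \<open>\<open>\<alpha>\<close> and \<open>A\<close> are only unique up to the choice of a real representative of the rotation
  number and of a semiconjugacy \<open>H\<close> sending some complementary interval to \<open>0\<close>, whence a relation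
  instead of a function.\<close>

definition denjoy_invariants ::
    "(complex \<Rightarrow> complex) \<Rightarrow> real \<Rightarrow> complex set \<Rightarrow> bool" where
  "denjoy_invariants F \<alpha> A \<longleftrightarrow>
     denjoy_homeomorphism F \<and> has_rotation_number F \<alpha> \<and>
     (\<exists>H. continuous_on circle H \<and> H ` circle = circle \<and>
        (\<forall>z\<in>circle. H (F z) = rotation \<alpha> (H z)) \<and>
        A = (\<Union>C\<in>components (circle - denjoy_set F). H ` closure C)) \<and>
     circle_proj 0 \<in> A"

section \<open>Arithmetic of subsets of the circle\<close>

definition circle_lift :: "complex set \<Rightarrow> real set" where
  "circle_lift A = {t. circle_proj t \<in> A}"

definition circle_scale :: "real \<Rightarrow> complex set \<Rightarrow> complex set" where
  "circle_scale c A = circle_proj ` ((\<lambda>t. c * t) ` circle_lift A)"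

definition rat_scale :: "rat \<Rightarrow> real \<Rightarrow> real" where
  "rat_scale q t = of_rat q * t"

lemma vector_space_rat_scale: "vector_space rat_scale"
  by standard (simp_all add: rat_scale_def algebra_simps of_rat_add of_rat_mult)

definition rational_hull :: "complex set \<Rightarrow> complex set" where
  "rational_hull A = circle_proj ` module.span rat_scale (circle_lift A)"

definition equal_up_to_rotation :: "complex set \<Rightarrow> complex set \<Rightarrow> bool" where
  "equal_up_to_rotation A B \<longleftrightarrow> (\<exists>\<theta>. A = rotation \<theta> ` B)"

text \<open>An element of \<open>PGL\<^sub>2(\<rat>)\<close> is given by an invertible matrix representing it.  Both conditions
  are invariant under multiplying the matrix by a non-zero rational number.\<close>

definition projectively_related ::
    "real \<Rightarrow> complex set \<Rightarrow> real \<Rightarrow> complex set \<Rightarrow> bool" where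
  "projectively_related \<alpha>\<^sub>0 A\<^sub>0 \<alpha>\<^sub>1 A\<^sub>1 \<longleftrightarrow>
     (\<exists>M :: rat^2^2. invertible M \<and>
        \<alpha>\<^sub>1 = (of_rat (M$1$1) * \<alpha>\<^sub>0 + of_rat (M$1$2)) / (of_rat (M$2$1) * \<alpha>\<^sub>0 + of_rat (M$2$2)) \<and>
        equal_up_to_rotation (rational_hull A\<^sub>1)
          (circle_scale (1 / (of_rat (M$2$1) * \<alpha>\<^sub>0 + of_rat (M$2$2))) (rational_hull A\<^sub>0)))"

end

theory Submission
  imports Defs
begin

text \<open>
  A Denjoy system is the rotation by \<open>\<alpha>\<close> with the points of a countable invariant set \<open>\<Gamma> \<subseteq> \<real>\<close>
  (the lift of \<open>A\<close>) split in two: the semiconjugacy lifts to a monotone map \<open>h\<close> of degree one, the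
  Cantor set consists of the points where \<open>h\<close> grows, and \<open>\<Gamma>\<close> is the set of values at which \<open>h\<close> is
  locally constant.  Such a system is uniquely ergodic, and the rational multiples of the integrals
  of integer-valued continuous functions form the \<open>\<rat>\<close>-span of \<open>\<Gamma>\<close> (if \<open>0 \<in> \<Gamma>\<close>).

  A 2-AI factor map does not change this span, since torsion in the index quotient means that
  every function is, up to multiples, the sum of an infinitesimal and a function coming from the
  factor; nor does it change the rational plane spanned by \<open>1\<close> and \<open>\<alpha>\<close>, because \<open>e\<^sup>2\<^sup>\<pi>\<^sup>i\<^sup>\<beta>\<close> is an
  eigenvalue of the factor.  A flow equivalence multiplies both by a number \<open>\<rho>\<close> of
  that plane, which is found by counting the windings of an orbit.  Hence an isogeny through Denjoy
  systems gives \<open>\<rho>\<close> and \<open>\<rho> \<alpha>\<^sub>1\<close> in the plane of \<open>\<alpha>\<^sub>0\<close>, that is, a matrix.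

  Conversely, enlarging \<open>\<Gamma>\<close> within its span is a 2-AI extension, so \<open>\<Gamma>\<close> may be taken to be a
  \<open>\<rat>\<close>-subspace.  Powers and the orientation reversal \<open>\<alpha> \<mapsto> - \<alpha>\<close> then realize all rational affine
  changes of \<open>\<alpha>\<close>, and the suspension, read along the other circle, realizes \<open>\<alpha> \<mapsto> - 1 / \<alpha>\<close>; these
  generate all fractional linear maps.
\<close>

section \<open>Irrational rotations\<close>

text \<open>The integrals of functions on a Denjoy system fill a rational vector space that is in
  general larger than the plane of 1 and \<alpha>, so the difficulty is to see which numbers fall
  into Z + Z \<alpha>. The tool is the index: the jumps of an integer-valued function along a gap
  orbit have a finite sum, and if all these sums vanish, its mean lies in Z + Z \<alpha>.
  Eigenfunctions and time changes yield integer functions that are real coboundaries up to simple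
  terms. Their jumps telescope, because the two sides of a gap are asymptotic and continuous
  functions take asymptotically equal values there. For a flow equivalence the unknown time changes
  on the two sides are eliminated between two windings, that of the clock and that of the rotation.
  What remains is j - j' \<beta> = 0 with integers j and j', and irrationality of \<beta> makes both
  vanish.

  Points are described by pairs (side, real number). In these coordinates the maps between systems
  are affine, and their continuity follows from monotonicity on the line.\<close>

lemma circle_proj_add: "circle_proj (s + t) = circle_proj s * circle_proj t"
  by (simp add: circle_proj_def cis_mult distrib_left)

lemma circle_proj_0 [simp]: "circle_proj 0 = 1"
  by (simp add: circle_proj_def)

lemma circle_proj_nz [simp]: "circle_proj t \<noteq> 0"
  by (simp add: circle_proj_def)

lemma norm_circle_proj [simp]: "norm (circle_proj t) = 1"
  by (simp add: circle_proj_def)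

lemma circle_proj_diff: "circle_proj (s - t) = circle_proj s / circle_proj t"
  using circle_proj_add[of "s - t" t] by (simp add: field_simps)

lemma circle_proj_minus: "circle_proj (- t) = cnj (circle_proj t)"
  by (simp add: circle_proj_def cis_cnj)

lemma circle_proj_eq_1_iff: "circle_proj t = 1 \<longleftrightarrow> t \<in> \<int>"
proof
  assume "circle_proj t = 1"
  then have "cos (2 * pi * t) = 1"
    by (simp add: circle_proj_def complex_eq_iff)
  then obtain n :: int where "2 * pi * t = of_int n * (2 * pi)"
    by (subst (asm) cos_one_2pi_int) auto
  then show "t \<in> \<int>" by simp
next
  assume "t \<in> \<int>"
  then obtain n :: int where "t = of_int n" by (elim Ints_cases)
  then show "circle_proj t = 1"
    by (simp add: circle_proj_def cis_multiple_2pi)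
qed

lemma circle_proj_eq_iff: "circle_proj s = circle_proj t \<longleftrightarrow> s - t \<in> \<int>"
  using circle_proj_eq_1_iff[of "s - t"] by (auto simp: circle_proj_diff)

lemma circle_proj_add_int [simp]: "n \<in> \<int> \<Longrightarrow> circle_proj (t + n) = circle_proj t"
  by (simp add: circle_proj_eq_iff)

lemma circle_proj_in_circle [simp]: "circle_proj t \<in> circle"
  by simp

lemma circle_proj_surj: "z \<in> circle \<Longrightarrow> \<exists>t. z = circle_proj t"
  by (rule exI[of _ "Arg z / (2 * pi)"]) (metis cis_Arg circle_proj_def divide_self_if mem_sphere_0 mult.commute nonzero_eq_divide_eq norm_zero pi_neq_zero scaleR_one sgn_div_norm inverse_1 mult_eq_0_iff zero_neq_numeral zero_neq_one)

lemma range_circle_proj: "range circle_proj = circle"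
  using circle_proj_surj circle_proj_in_circle by fast

lemma continuous_on_circle_proj [continuous_intros]:
  assumes "continuous_on S f"
  shows "continuous_on S (\<lambda>x. circle_proj (f x))"
proof -
  have "(\<lambda>x. circle_proj (f x)) = (\<lambda>x. cis (2 * pi * f x))"
    by (simp add: circle_proj_def)
  then show ?thesis using assms
    by (simp only:) (intro continuous_intros)
qed

lemma irrational_mult_int:
  fixes \<alpha> :: real
  assumes "\<alpha> \<notin> \<rat>" and "of_int k * \<alpha> \<in> \<rat>"
  shows "k = 0"
  using assms by (metis Rats_divide Rats_of_int nonzero_mult_div_cancel_left of_int_0_eq_iff)

lemma irrational_lin_eq:
  fixes \<alpha> :: real
  assumes "\<alpha> \<notin> \<rat>" and "a \<in> \<rat>" "b \<in> \<rat>" "a + b * \<alpha> = 0"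
  shows "a = 0" "b = 0"
proof -
  show "b = 0"
  proof (rule ccontr)
    assume "b \<noteq> 0"
    then have "\<alpha> = - a / b" using assms(4) by (simp add: field_simps)
    then show False using assms by (metis Rats_divide Rats_minus_iff)
  qed
  then show "a = 0" using assms by simp
qed

lemma Ints_subset_Rats': "x \<in> \<int> \<Longrightarrow> (x::real) \<in> \<rat>"
  using Ints_subset_Rats by blast

lemma irrational_int_unique:
  fixes \<alpha> x :: real
  assumes "\<alpha> \<notin> \<rat>" "x + of_int j * \<alpha> \<in> \<int>" "x + of_int k * \<alpha> \<in> \<int>"
  shows "j = k"
proof -
  have "(x + of_int j * \<alpha>) - (x + of_int k * \<alpha>) \<in> \<int>"
    using assms Ints_diff by blast
  then have "of_int (j - k) * \<alpha> \<in> \<rat>"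
    by (simp add: algebra_simps Ints_subset_Rats')
  then show ?thesis using irrational_mult_int[OF assms(1)] by fastforce
qed

lemma irrational_orbit_dense:
  fixes \<alpha> x y :: real
  assumes "\<alpha> \<notin> \<rat>" "x < y"
  obtains k :: nat and m :: int where "0 < k" "x < of_nat k * \<alpha> + of_int m" "of_nat k * \<alpha> + of_int m < y"
proof -
  have "0 < (y - x) / 2" using assms(2) by simp
  then obtain h k :: int where "k > 0" and *: "\<bar>of_int k * \<alpha> - of_int h - (x + y) / 2\<bar> < (y - x) / 2"
    by (rule sequence_of_fractional_parts_is_dense[OF assms(1)])
  have "real (nat k) = of_int k" using \<open>k > 0\<close> by simp
  then show thesis
    using that[of "nat k" "- h"] * \<open>k > 0\<close> by (auto simp: abs_if field_simps split: if_splits)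
qed

text \<open>One bound \<open>J\<close> serves all x and y because only y - x modulo 1 matters, and
  this may be replaced by one of finitely many grid points, each with its own visiting time.\<close>

lemma irrational_orbit_uniformly_dense:
  fixes \<alpha> \<delta> :: real
  assumes "\<alpha> \<notin> \<rat>" "0 < \<delta>"
  obtains J :: nat where
    "\<And>x y. \<exists>j m. j \<le> J \<and> y \<le> x + of_nat j * \<alpha> + of_int m \<and> x + of_nat j * \<alpha> + of_int m \<le> y + \<delta>"
proof -
  obtain N :: nat where N: "0 < N" "1 / real N < \<delta> / 2"
    using assms(2) by (metis half_gt_zero inverse_eq_divide real_arch_inverse of_nat_0_less_iff gr0I)
  have "\<forall>i::nat. \<exists>(k::nat) (m::int). real i / N < of_nat k * \<alpha> + of_int m \<and> of_nat k * \<alpha> + of_int m < real i / N + \<delta> / 2"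
    using irrational_orbit_dense[OF assms(1)] assms(2) by (metis half_gt_zero less_add_same_cancel1)
  then obtain k :: "nat \<Rightarrow> nat" and m :: "nat \<Rightarrow> int" where km:
    "\<And>i. real i / N < of_nat (k i) * \<alpha> + of_int (m i)"
    "\<And>i. of_nat (k i) * \<alpha> + of_int (m i) < real i / N + \<delta> / 2"
    by metis
  define J where "J = Max (k ` {..N})"
  show thesis
  proof (rule that[of J])
    fix x y :: real
    \<comment> \<open>The grid point just above frac (y - x). Rounding up costs at most 1/N <
      \<delta>/2, and the visiting time of the grid point costs the other \<delta>/2.\<close>
    define i where "i = nat \<lceil>frac (y - x) * N\<rceil>"
    have "frac (y - x) * N \<le> N" using frac_lt_1[of "y - x"] N by (simp add: mult_left_le_one_le)
    then have "i \<le> N" unfolding i_def by linarith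
    have ge: "0 \<le> frac (y - x) * N" by simp
    have i: "frac (y - x) * N \<le> i" "i \<le> frac (y - x) * N + 1"
      using ge unfolding i_def by linarith+
    then have i': "frac (y - x) \<le> i / N" "i / N \<le> frac (y - x) + 1 / N"
      using N by (auto simp: field_simps)
    have eq: "y = x + frac (y - x) + \<lfloor>y - x\<rfloor>" by (simp add: frac_def)
    have "k i \<le> J" unfolding J_def using \<open>i \<le> N\<close> by (intro Max_ge) auto
    moreover have "y \<le> x + of_nat (k i) * \<alpha> + of_int (m i + \<lfloor>y - x\<rfloor>)"
      using km[of i] i' eq by simp
    moreover have "x + of_nat (k i) * \<alpha> + of_int (m i + \<lfloor>y - x\<rfloor>) \<le> y + \<delta>"
      using km[of i] i' eq N by simp
    ultimately show "\<exists>j m. j \<le> J \<and> y \<le> x + of_nat j * \<alpha> + of_int m \<and> x + of_nat j * \<alpha> + of_int m \<le> y + \<delta>"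
      by blast
  qed
qed

text \<open>The discrepancy \<open>\<Sum>k<n. \<lfloor>x + k \<alpha>\<rfloor>\<close> minus \<open>n x\<close> changes by at most 1 when \<open>x\<close> moves
  along the orbit, and decreases at speed at most \<open>n\<close>; so it is almost constant.\<close>

lemma floor_sum_equidistribution:
  fixes \<alpha> \<epsilon> :: real
  assumes "\<alpha> \<notin> \<rat>" "0 < \<epsilon>"
  shows "\<exists>N. \<forall>n\<ge>N. \<forall>x y. \<bar>(\<Sum>k<n. real_of_int \<lfloor>x + of_nat k * \<alpha>\<rfloor>) - (\<Sum>k<n. real_of_int \<lfloor>y + of_nat k * \<alpha>\<rfloor>)
            - real n * (x - y)\<bar> \<le> \<epsilon> * real n"
proof -
  define G where "G n x = (\<Sum>k<n. real_of_int \<lfloor>x + of_nat k * \<alpha>\<rfloor>) - real n * x" for n x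
  have G_int: "G n (x + of_int m) = G n x" for n x and m :: int
  proof -
    have "\<lfloor>x + of_int m + of_nat k * \<alpha>\<rfloor> = \<lfloor>x + of_nat k * \<alpha>\<rfloor> + m" for k
      by (metis add.assoc add.commute floor_add_int)
    then show ?thesis by (simp add: G_def sum.distrib algebra_simps)
  qed
  have G_step: "\<bar>G n (x + \<alpha>) - G n x\<bar> \<le> 1" for n x
  proof -
    have "(\<Sum>k<n. real_of_int \<lfloor>x + \<alpha> + of_nat k * \<alpha>\<rfloor>) - (\<Sum>k<n. real_of_int \<lfloor>x + of_nat k * \<alpha>\<rfloor>)
      = (\<Sum>k<n. real_of_int \<lfloor>x + of_nat (Suc k) * \<alpha>\<rfloor> - real_of_int \<lfloor>x + of_nat k * \<alpha>\<rfloor>)"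
      by (simp add: sum_subtractf algebra_simps)
    also have "\<dots> = \<lfloor>x + of_nat n * \<alpha>\<rfloor> - \<lfloor>x\<rfloor>"
      by (subst sum_lessThan_telescope[of "\<lambda>k. real_of_int \<lfloor>x + of_nat k * \<alpha>\<rfloor>"]) simp
    finally have "G n (x + \<alpha>) - G n x = \<lfloor>x + of_nat n * \<alpha>\<rfloor> - \<lfloor>x\<rfloor> - n * \<alpha>"
      by (simp add: G_def algebra_simps)
    then show ?thesis by linarith
  qed
  have G_iter: "\<bar>G n (x + of_nat j * \<alpha>) - G n x\<bar> \<le> real j" for n x j
  proof (induction j)
    case (Suc j)
    have "x + of_nat (Suc j) * \<alpha> = (x + of_nat j * \<alpha>) + \<alpha>" by (simp add: algebra_simps)
    then show ?case using Suc G_step[of n "x + of_nat j * \<alpha>"] by (simp only:)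
  qed simp
  obtain J :: nat where J:
    "\<And>x y. \<exists>j m. j \<le> J \<and> y \<le> x + of_nat j * \<alpha> + of_int m \<and> x + of_nat j * \<alpha> + of_int m \<le> y + \<epsilon> / 2"
    using irrational_orbit_uniformly_dense[OF assms(1), of "\<epsilon> / 2"] assms(2) by auto
  \<comment> \<open>Floor sums increase with the base point, so y may be pushed up by at most
    \<epsilon>/2 to a point of the orbit of x; only the linear term of \<open>G\<close> pays for
    it.\<close>
  have le: "G n y \<le> G n x + J + n * (\<epsilon> / 2)" for n x y
  proof -
    obtain j m where jm: "j \<le> J" "y \<le> x + of_nat j * \<alpha> + of_int m" "x + of_nat j * \<alpha> + of_int m \<le> y + \<epsilon> / 2"
      using J by blast
    let ?y = "x + of_nat j * \<alpha> + of_int m"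
    have "(\<Sum>k<n. real_of_int \<lfloor>y + of_nat k * \<alpha>\<rfloor>) \<le> (\<Sum>k<n. real_of_int \<lfloor>?y + of_nat k * \<alpha>\<rfloor>)"
      using jm by (intro sum_mono of_int_le_iff[THEN iffD2] floor_mono) simp
    moreover have "real n * ?y \<le> n * y + n * (\<epsilon> / 2)"
      using mult_left_mono[OF jm(3), of "real n"] by (simp add: algebra_simps)
    ultimately have "G n y \<le> G n ?y + n * (\<epsilon> / 2)" by (simp add: G_def)
    also have "G n ?y = G n (x + of_nat j * \<alpha>)" by (rule G_int)
    finally show ?thesis using G_iter[of n x j] jm(1) by linarith
  qed
  obtain N :: nat where N: "2 * J / \<epsilon> \<le> N" using real_arch_simple by blast
  have "\<bar>G n x - G n y\<bar> \<le> \<epsilon> * n" if "n \<ge> N" for n x y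
  proof -
    have "2 * J / \<epsilon> \<le> n" using N that by linarith
    then have "J \<le> n * (\<epsilon> / 2)" using assms(2) by (simp add: field_simps)
    then show ?thesis using le[of n x y] le[of n y x] by (simp add: algebra_simps)
  qed
  then show ?thesis by (intro exI[of _ N]) (auto simp: G_def algebra_simps)
qed

text \<open>The floor function as seen from the right and from the left side of a split point.\<close>

definition fl :: "bool \<Rightarrow> real \<Rightarrow> int" where
  "fl s x = (if s then \<lfloor>x\<rfloor> else \<lceil>x\<rceil> - 1)"

lemma fl_add_int: "fl s (x + of_int m) = fl s x + m"
  by (auto simp: fl_def)

lemma fl_add_one: "fl s (x + 1) = fl s x + 1"
  using fl_add_int[of s x 1] by simp

lemma fl_jump: "fl True x - fl False x = (if x \<in> \<int> then 1 else 0)"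
proof (cases "x \<in> \<int>")
  case True then show ?thesis by (auto elim: Ints_cases simp: fl_def)
next
  case False
  then have "\<lceil>x\<rceil> = \<lfloor>x\<rfloor> + 1" by (metis Ints_of_int ceiling_altdef)
  then show ?thesis using False by (simp add: fl_def)
qed

text \<open>The two kinds of floor differ only at integers, and by irrationality at most one of the
  points x + k \<alpha> is an integer.\<close>

lemma fl_sum_floor:
  fixes \<alpha> :: real
  assumes "\<alpha> \<notin> \<rat>"
  shows "\<bar>(\<Sum>k<n. real_of_int (fl s (x + of_nat k * \<alpha>))) - (\<Sum>k<n. real_of_int \<lfloor>x + of_nat k * \<alpha>\<rfloor>)\<bar> \<le> 1"
proof -
  define K where "K = {k. k < n \<and> x + of_nat k * \<alpha> \<in> \<int>}"
  have "j = k" if "j \<in> K" "k \<in> K" for j k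
    using irrational_int_unique[OF assms, of x "int j" "int k"] that by (simp add: K_def)
  moreover have "finite K" by (simp add: K_def)
  ultimately have card: "card K \<le> 1" by (metis One_nat_def card_le_Suc0_iff_eq)
  have eq: "real_of_int (fl s (x + of_nat k * \<alpha>)) - real_of_int \<lfloor>x + of_nat k * \<alpha>\<rfloor> =
      (if x + of_nat k * \<alpha> \<in> \<int> then (if s then 0 else - 1) else 0)" for k
    using fl_jump[of "x + of_nat k * \<alpha>"] by (cases s) (auto simp: fl_def)
  have "(\<Sum>k<n. real_of_int (fl s (x + of_nat k * \<alpha>))) - (\<Sum>k<n. real_of_int \<lfloor>x + of_nat k * \<alpha>\<rfloor>)
     = (\<Sum>k<n. if x + of_nat k * \<alpha> \<in> \<int> then (if s then 0 else - 1) else 0)"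
    by (simp only: eq[symmetric] sum_subtractf)
  also have "\<dots> = (\<Sum>k\<in>K. if s then 0 else - 1)"
    unfolding K_def by (intro sum.mono_neutral_cong_right) auto
  finally show ?thesis using card by (auto simp: of_nat_le_1_iff)
qed

text \<open>Up to o(n), each sum of floors is a common reference sum \<open>Sa\<close> minus n times
  \<open>b i\<close>. As the coefficients add up to 0, the uncontrolled \<open>Sa\<close>
  cancels.\<close>

lemma fl_combination_mean:
  fixes \<alpha> \<epsilon> :: real and d :: "nat \<Rightarrow> int" and b :: "nat \<Rightarrow> real"
  assumes "\<alpha> \<notin> \<rat>" "0 < \<epsilon>" "(\<Sum>i<N. d i) = 0"
  shows "\<exists>M. \<forall>n\<ge>M. \<forall>s a. \<bar>(\<Sum>k<n. \<Sum>i<N. real_of_int (d i * fl s (a + of_nat k * \<alpha> - b i)))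
           + real n * (\<Sum>i<N. of_int (d i) * b i)\<bar> \<le> \<epsilon> * real n"
proof -
  define C where "C = (\<Sum>i<N. \<bar>real_of_int (d i)\<bar>) + 1"
  have C: "C \<ge> 1" unfolding C_def by (simp add: sum_nonneg)
  define \<epsilon>' where "\<epsilon>' = \<epsilon> / (2 * C)"
  have "\<epsilon>' > 0" using assms C by (simp add: \<epsilon>'_def)
  obtain M where M: "\<And>n x y. n \<ge> M \<Longrightarrow> \<bar>(\<Sum>k<n. real_of_int \<lfloor>x + of_nat k * \<alpha>\<rfloor>) -
      (\<Sum>k<n. real_of_int \<lfloor>y + of_nat k * \<alpha>\<rfloor>) - real n * (x - y)\<bar> \<le> \<epsilon>' * real n"
    using floor_sum_equidistribution[OF assms(1) \<open>\<epsilon>' > 0\<close>] by blast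
  obtain M' :: nat where M': "1 / \<epsilon>' \<le> M'" using real_arch_simple by blast
  show ?thesis
  proof (intro exI[of _ "max M M'"] allI impI)
    fix n s a assume n: "max M M' \<le> n"
    define Sa where "Sa = (\<Sum>k<n. real_of_int \<lfloor>a + of_nat k * \<alpha>\<rfloor>)"
    define T where "T i = (\<Sum>k<n. real_of_int (fl s ((a - b i) + of_nat k * \<alpha>)))" for i
    have d0: "(\<Sum>i<N. real_of_int (d i)) = 0" using assms(3) by (metis of_int_0 of_int_sum)
    \<comment> \<open>For large n the constant error 1 of \<open>fl_sum_floor\<close> is absorbed
      into a multiple of n.\<close>
    have "1 / \<epsilon>' \<le> n" using M' n by linarith
    then have one: "1 \<le> \<epsilon>' * n" using \<open>\<epsilon>' > 0\<close> by (simp add: field_simps)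
    have T: "\<bar>T i - Sa + n * b i\<bar> \<le> 2 * \<epsilon>' * n" for i
      using fl_sum_floor[OF assms(1), where n = n and s = s and x = "a - b i"] M[of n "a - b i" a] n one
      unfolding T_def Sa_def by (simp add: algebra_simps)
    have "(\<Sum>k<n. \<Sum>i<N. real_of_int (d i * fl s (a + of_nat k * \<alpha> - b i))) = (\<Sum>i<N. of_int (d i) * T i)"
      by (subst sum.swap) (simp add: T_def sum_distrib_left algebra_simps)
    also have "\<dots> + real n * (\<Sum>i<N. of_int (d i) * b i) = (\<Sum>i<N. of_int (d i) * (T i - Sa + n * b i)) + Sa * (\<Sum>i<N. real_of_int (d i))"
      by (simp add: sum_distrib_left sum.distrib sum_subtractf algebra_simps)
    also have "\<dots> = (\<Sum>i<N. of_int (d i) * (T i - Sa + n * b i))" by (simp add: d0)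
    also have "\<bar>\<dots>\<bar> \<le> (\<Sum>i<N. \<bar>real_of_int (d i)\<bar> * (2 * \<epsilon>' * n))"
      by (intro order_trans[OF sum_abs] sum_mono) (simp add: abs_mult mult_left_mono[OF T])
    also have "\<dots> = (C - 1) * (2 * \<epsilon>' * n)" by (simp add: C_def sum_distrib_right)
    also have "\<dots> \<le> C * (2 * \<epsilon>' * n)" using \<open>\<epsilon>' > 0\<close> by (intro mult_right_mono) auto
    also have "\<dots> = \<epsilon> * n" using C by (simp add: \<epsilon>'_def)
    finally show "\<bar>(\<Sum>k<n. \<Sum>i<N. real_of_int (d i * fl s (a + of_nat k * \<alpha> - b i)))
           + real n * (\<Sum>i<N. of_int (d i) * b i)\<bar> \<le> \<epsilon> * real n" .
  qed
qed

section \<open>The group Z + Z \<alpha> of differences within an orbit\<close>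

definition rotation_group :: "real \<Rightarrow> real set" where
  "rotation_group \<alpha> = {of_int m + of_int k * \<alpha> | m k. True}"

lemma rotation_groupI: "x = of_int m + of_int k * \<alpha> \<Longrightarrow> x \<in> rotation_group \<alpha>"
  by (auto simp: rotation_group_def)

lemma rotation_groupE:
  assumes "x \<in> rotation_group \<alpha>"
  obtains m k where "x = of_int m + of_int k * \<alpha>"
  using assms by (auto simp: rotation_group_def)

lemma rotation_group_of_int [simp]: "of_int m \<in> rotation_group \<alpha>"
  by (rule rotation_groupI[of _ m 0]) simp

lemma rotation_group_zero [simp]: "0 \<in> rotation_group \<alpha>"
  by (rule rotation_groupI[of _ 0 0]) simp

lemma rotation_group_add: "x \<in> rotation_group \<alpha> \<Longrightarrow> y \<in> rotation_group \<alpha> \<Longrightarrow> x + y \<in> rotation_group \<alpha>"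
  by (elim rotation_groupE, rule rotation_groupI[of _ "_ + _" "_ + _"])
     (auto simp: algebra_simps)

lemma rotation_group_minus: "x \<in> rotation_group \<alpha> \<Longrightarrow> - x \<in> rotation_group \<alpha>"
  by (elim rotation_groupE, rule rotation_groupI[of _ "- _" "- _"]) (auto simp: algebra_simps)

lemma rotation_group_diff: "x \<in> rotation_group \<alpha> \<Longrightarrow> y \<in> rotation_group \<alpha> \<Longrightarrow> x - y \<in> rotation_group \<alpha>"
  using rotation_group_add[of x \<alpha> "- y"] rotation_group_minus by simp

lemma rotation_group_scale: "x \<in> rotation_group \<alpha> \<Longrightarrow> of_int n * x \<in> rotation_group \<alpha>"
  by (metis distrib_left mult.assoc of_int_mult rotation_groupE rotation_groupI)

lemma rotation_group_sum: "(\<And>i. i \<in> I \<Longrightarrow> f i \<in> rotation_group \<alpha>) \<Longrightarrow> sum f I \<in> rotation_group \<alpha>"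
  by (induction I rule: infinite_finite_induct) (auto simp: rotation_group_add)

text \<open>In a coset with base point \<open>x j\<close> the coefficients sum to 0, so every
  \<open>x i\<close> may be replaced by \<open>x i - x j\<close>, which lies in the group. The
  induction removes one coset at a time.\<close>

lemma weighted_sum_in_rotation_group:
  fixes d :: "'i \<Rightarrow> int" and x :: "'i \<Rightarrow> real"
  assumes "finite I"
    and "\<And>j. j \<in> I \<Longrightarrow> (\<Sum>i\<in>{i \<in> I. x i - x j \<in> rotation_group \<alpha>}. d i) = 0"
  shows "(\<Sum>i\<in>I. of_int (d i) * x i) \<in> rotation_group \<alpha>"
  using assms
proof (induction I rule: finite_psubset_induct)
  case (psubset I)
  show ?case
  proof (cases "I = {}")
    case False
    then obtain j where j: "j \<in> I" by blast
    define C where "C = {i \<in> I. x i - x j \<in> rotation_group \<alpha>}"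
    have jC: "j \<in> C" using j by (simp add: C_def)
    have CI: "C \<subseteq> I" by (auto simp: C_def)
    have fC: "finite C" using CI psubset.hyps by (rule finite_subset)
    have dC: "(\<Sum>i\<in>C. real_of_int (d i)) = 0"
      using psubset.prems[OF j] unfolding C_def[symmetric] by (metis of_int_0 of_int_sum)
    have "(\<Sum>i\<in>C. of_int (d i) * x i) = (\<Sum>i\<in>C. of_int (d i) * (x i - x j)) + (\<Sum>i\<in>C. real_of_int (d i)) * x j"
      by (simp add: algebra_simps sum.distrib sum_distrib_right sum_subtractf sum_distrib_left)
    moreover have "(\<Sum>i\<in>C. of_int (d i) * (x i - x j)) \<in> rotation_group \<alpha>"
      by (intro rotation_group_sum rotation_group_scale) (auto simp: C_def)
    ultimately have 1: "(\<Sum>i\<in>C. of_int (d i) * x i) \<in> rotation_group \<alpha>"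
      unfolding dC by simp
    have 2: "(\<Sum>i\<in>I - C. of_int (d i) * x i) \<in> rotation_group \<alpha>"
    proof (rule psubset.IH)
      show "I - C \<subset> I" using jC CI by blast
      fix k assume k: "k \<in> I - C"
      \<comment> \<open>Cosets are disjoint, so deleting \<open>C\<close> leaves the coset of k
        untouched.\<close>
      have "{i \<in> I - C. x i - x k \<in> rotation_group \<alpha>} = {i \<in> I. x i - x k \<in> rotation_group \<alpha>}"
      proof -
        have "i \<notin> C" if "i \<in> I" "x i - x k \<in> rotation_group \<alpha>" for i
        proof
          assume "i \<in> C"
          then have "(x i - x j) - (x i - x k) \<in> rotation_group \<alpha>"
            using that(2) by (metis (no_types, lifting) C_def mem_Collect_eq rotation_group_diff)
          then show False using k by (auto simp: C_def)
        qed
        then show ?thesis by blast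
      qed
      then show "(\<Sum>i\<in>{i \<in> I - C. x i - x k \<in> rotation_group \<alpha>}. d i) = 0"
        using psubset.prems[of k] k by simp
    qed
    have "(\<Sum>i\<in>I. of_int (d i) * x i) = (\<Sum>i\<in>C. of_int (d i) * x i) + (\<Sum>i\<in>I - C. of_int (d i) * x i)"
      using sum.subset_diff[OF CI psubset.hyps(1)] by (simp add: add.commute)
    then show ?thesis using rotation_group_add[OF 1 2] by simp
  qed simp
qed

section \<open>Monotone maps of degree one and split points\<close>

definition growth_points :: "(real \<Rightarrow> real) \<Rightarrow> real set" where
  "growth_points h = {t. \<forall>a b. a < t \<and> t < b \<longrightarrow> h a < h b}"

definition left_pt :: "(real \<Rightarrow> real) \<Rightarrow> real \<Rightarrow> real" where
  "left_pt h a = Inf {t. h t = a}"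

definition right_pt :: "(real \<Rightarrow> real) \<Rightarrow> real \<Rightarrow> real" where
  "right_pt h a = Sup {t. h t = a}"

text \<open>The pairs (s, a) serve as coordinates on the growth points, \<open>True\<close> standing
  for the right end. The two sides of a differ exactly when a is a gap value.\<close>

definition side_pt :: "(real \<Rightarrow> real) \<Rightarrow> bool \<Rightarrow> real \<Rightarrow> real" where
  "side_pt h s a = (if s then right_pt h a else left_pt h a)"

definition split_pt :: "(real \<Rightarrow> real) \<Rightarrow> bool \<Rightarrow> real \<Rightarrow> complex" where
  "split_pt h s a = circle_proj (side_pt h s a)"

definition gap_values :: "(real \<Rightarrow> real) \<Rightarrow> real set" where
  "gap_values h = {a. left_pt h a < right_pt h a}"

section \<open>Continuity criteria on the line and on the circle\<close>

lemma circle_proj_close: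
  assumes "0 < \<epsilon>"
  shows "\<exists>\<delta>>0. \<forall>s t. \<bar>s - t\<bar> < \<delta> \<longrightarrow> dist (circle_proj s) (circle_proj t) < \<epsilon>"
proof -
  have "isCont circle_proj 0"
    using continuous_on_circle_proj[OF continuous_on_id, of UNIV]
    by (simp add: continuous_on_eq_continuous_at)
  then obtain \<delta> where \<delta>: "\<delta> > 0" "\<And>x. \<bar>x\<bar> < \<delta> \<Longrightarrow> dist (circle_proj x) 1 < \<epsilon>"
    using assms unfolding continuous_at_eps_delta by (auto simp: dist_real_def)
  have "dist (circle_proj s) (circle_proj t) = dist (circle_proj (s - t)) 1" for s t
  proof -
    have "circle_proj s = circle_proj (s - t) * circle_proj t"
      by (simp flip: circle_proj_add)
    then have "circle_proj s - circle_proj t = (circle_proj (s - t) - 1) * circle_proj t"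
      by (simp add: algebra_simps)
    then show ?thesis by (simp add: dist_norm norm_mult)
  qed
  then show ?thesis using \<delta> by auto
qed

lemma continuous_on_discrete_iff:
  fixes f :: "'a::topological_space \<Rightarrow> int"
  shows "continuous_map (top_of_set S) (discrete_topology UNIV) f \<longleftrightarrow> continuous_on S (\<lambda>x. real_of_int (f x))"
proof
  assume "continuous_map (top_of_set S) (discrete_topology UNIV) f"
  then have "continuous_map (top_of_set S) euclideanreal (real_of_int \<circ> f)"
    by (rule continuous_map_compose) (simp add: continuous_map_from_discrete_topology)
  then show "continuous_on S (\<lambda>x. real_of_int (f x))" by (simp add: o_def)
next
  assume c: "continuous_on S (\<lambda>x. real_of_int (f x))"
  have op: "openin (top_of_set S) (S \<inter> f -` {k})" for k
  proof -
    have "S \<inter> f -` {k} = S \<inter> (\<lambda>x. real_of_int (f x)) -` {of_int k - 1<..<of_int k + 1}"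
      by auto
    then show ?thesis using continuous_openin_preimage[OF c, of UNIV "{of_int k - 1<..<of_int k + 1}"]
      by (auto intro: continuous_openin_preimage_gen c)
  qed
  show "continuous_map (top_of_set S) (discrete_topology UNIV) f"
  proof (subst continuous_map, intro conjI allI impI)
    fix U :: "int set"
    have "{x \<in> topspace (top_of_set S). f x \<in> U} = (\<Union>k\<in>U. S \<inter> f -` {k})" by auto
    then show "openin (top_of_set S) {x \<in> topspace (top_of_set S). f x \<in> U}"
      using op by (simp only:) (intro openin_Union, blast)
  qed simp
qed

text \<open>A monotone map onto a closed set cannot jump. At a jump, the infimum of the values to
  the right of t would be attained at some t' > t, so T would be constant on the points of A between
  them. These accumulate at t, which contradicts the finiteness of fibers.\<close>

lemma mono_surj_continuous_aux:
  fixes T :: "real \<Rightarrow> real"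
  assumes mono: "\<And>x y. x \<in> A \<Longrightarrow> y \<in> A \<Longrightarrow> x \<le> y \<Longrightarrow> T x \<le> T y"
    and surj: "T ` A = B" and cl: "closed B" and fib: "\<And>y. finite {x \<in> A. T x = y}"
    and t: "t \<in> A" and e: "0 < \<epsilon>"
  shows "\<exists>\<delta>>0. \<forall>x\<in>A. t < x \<and> x < t + \<delta> \<longrightarrow> T x < T t + \<epsilon>"
proof (rule ccontr)
  assume H: "\<not> ?thesis"
  let ?P = "A \<inter> {t<..}"
  have big: "T x \<ge> T t + \<epsilon>" if x: "x \<in> ?P" for x
  proof (rule ccontr)
    assume "\<not> ?thesis"
    then have "\<forall>x'\<in>A. t < x' \<and> x' < t + (x - t) \<longrightarrow> T x' < T t + \<epsilon>"
      using mono[of _ x] x by fastforce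
    then show False using H x by (auto dest!: spec[of _ "x - t"])
  qed
  have acc: "\<exists>x\<in>?P. x < t + \<delta>" if "\<delta> > 0" for \<delta>
    using H that by blast
  define L where "L = Inf (T ` ?P)"
  have ne: "T ` ?P \<noteq> {}" using acc[of 1] by auto
  have bdd: "bdd_below (T ` ?P)" using big by (intro bdd_belowI[of _ "T t + \<epsilon>"]) auto
  have "L \<in> closure (T ` ?P)" unfolding L_def using ne bdd by (rule closure_contains_Inf)
  also have "\<dots> \<subseteq> B" using cl surj by (intro closure_minimal) auto
  finally obtain t' where t': "t' \<in> A" "L = T t'" using surj by auto
  have "L \<ge> T t + \<epsilon>" unfolding L_def using ne big by (intro cInf_greatest) auto
  then have tt': "t < t'" using mono[OF t'(1) t] e t' by fastforce
  have "A \<inter> {t<..<t'} \<subseteq> {x \<in> A. T x = L}"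
  proof
    fix x assume x: "x \<in> A \<inter> {t<..<t'}"
    have "L \<le> T x" unfolding L_def using x bdd by (intro cInf_lower) auto
    moreover have "T x \<le> L" using mono[of x t'] x t' by auto
    ultimately show "x \<in> {x \<in> A. T x = L}" using x by auto
  qed
  then have fin: "finite (A \<inter> {t<..<t'})" using fib finite_subset by blast
  obtain x0 where x0: "x0 \<in> A \<inter> {t<..<t'}" using acc[of "t' - t"] tt' by auto
  define m where "m = Min (A \<inter> {t<..<t'})"
  have m: "m \<in> A \<inter> {t<..<t'}" unfolding m_def using fin x0 by (intro Min_in) auto
  obtain x where "x \<in> A \<inter> {t<..<m}" using acc[of "m - t"] m by auto
  then show False using Min_le[OF fin, of x] m unfolding m_def by auto
qed

lemma mono_surj_continuous:
  fixes T :: "real \<Rightarrow> real"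
  assumes mono: "\<And>x y. x \<in> A \<Longrightarrow> y \<in> A \<Longrightarrow> x \<le> y \<Longrightarrow> T x \<le> T y"
    and surj: "T ` A = B" and cl: "closed B" and fib: "\<And>y. finite {x \<in> A. T x = y}"
  shows "continuous_on A T"
  unfolding continuous_on_iff
proof (intro ballI allI impI)
  fix t \<epsilon> :: real assume t: "t \<in> A" and e: "0 < \<epsilon>"
  obtain \<delta>1 where d1: "\<delta>1 > 0" "\<forall>x\<in>A. t < x \<and> x < t + \<delta>1 \<longrightarrow> T x < T t + \<epsilon>"
    using mono_surj_continuous_aux[OF mono surj cl fib t e] by blast
  \<comment> \<open>Left continuity is right continuity of the map conjugated by x \<mapsto> -
    x.\<close>
  let ?T = "\<lambda>x. - T (- x)"
  have "\<exists>\<delta>>0. \<forall>x\<in>uminus ` A. - t < x \<and> x < - t + \<delta> \<longrightarrow> ?T x < ?T (- t) + \<epsilon>"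
  proof (rule mono_surj_continuous_aux)
    show "?T ` uminus ` A = uminus ` B" using surj by (auto simp: image_image)
    show "closed (uminus ` B)" using cl by (rule closed_negations)
    show "finite {x \<in> uminus ` A. ?T x = y}" for y
    proof -
      have "{x \<in> uminus ` A. ?T x = y} \<subseteq> uminus ` {x \<in> A. T x = - y}" by force
      then show ?thesis using fib finite_subset by blast
    qed
  qed (use t e mono in auto)
  then obtain \<delta>2 where d2: "\<delta>2 > 0" "\<forall>x\<in>A. x < t \<and> t - \<delta>2 < x \<longrightarrow> T t - \<epsilon> < T x"
    by (force simp: algebra_simps)
  show "\<exists>d>0. \<forall>x'\<in>A. dist x' t < d \<longrightarrow> dist (T x') (T t) < \<epsilon>"
  proof (intro exI[of _ "min \<delta>1 \<delta>2"] conjI ballI impI)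
    fix x assume x: "x \<in> A" "dist x t < min \<delta>1 \<delta>2"
    consider "x = t" | "x < t" | "t < x" by linarith
    then show "dist (T x) (T t) < \<epsilon>"
    proof cases
      case 2 then show ?thesis using x d2 mono[of x t] t by (auto simp: dist_real_def)
    next
      case 3 then show ?thesis using x d1 mono[of t x] t by (auto simp: dist_real_def)
    qed (use e in auto)
  qed (use d1 d2 in auto)
qed

text \<open>The compact part of P in [0,1] meets every class modulo 1, so a preimage of a closed set
  on the circle is the image of a compact set on the line.\<close>

lemma continuous_on_circle_quotient:
  fixes P :: "real set" and \<phi> :: "real \<Rightarrow> 'b::topological_space"
  assumes cl: "closed P" and per: "\<And>t n. t \<in> P \<Longrightarrow> t + of_int n \<in> P"
    and cont: "continuous_on P \<phi>" and eq: "\<And>t. t \<in> P \<Longrightarrow> \<psi> (circle_proj t) = \<phi> t"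
  shows "continuous_on (circle_proj ` P) \<psi>"
proof -
  let ?K = "P \<inter> {0..1}"
  have red: "\<exists>t'\<in>?K. circle_proj t' = circle_proj t" if "t \<in> P" for t
    using per[OF that, of "- \<lfloor>t\<rfloor>"] by (intro bexI[of _ "t + of_int (- \<lfloor>t\<rfloor>)"]) (auto simp: circle_proj_eq_iff, linarith+)
  have "\<exists>T. closed T \<and> T \<inter> (circle_proj ` P) = \<psi> -` C \<inter> (circle_proj ` P)" if "closed C" for C
  proof (intro exI conjI)
    let ?S = "circle_proj ` (?K \<inter> \<phi> -` C)"
    have "closed (?K \<inter> \<phi> -` C)"
      using cl that by (intro continuous_closed_preimage continuous_on_subset[OF cont]) (auto intro: closed_Int)
    then have "compact (?K \<inter> \<phi> -` C)"
      by (meson Int_lower1 Int_lower2 bounded_closed_interval bounded_subset compact_eq_bounded_closed order_trans)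
    then have "compact ?S"
      by (intro compact_continuous_image continuous_on_circle_proj continuous_on_id)
    then show "closed ?S" by (rule compact_imp_closed)
    show "?S \<inter> circle_proj ` P = \<psi> -` C \<inter> circle_proj ` P"
    proof (intro equalityI subsetI)
      fix z assume "z \<in> \<psi> -` C \<inter> circle_proj ` P"
      then obtain t where t: "t \<in> P" "z = circle_proj t" "\<psi> z \<in> C" by auto
      obtain t' where t': "t' \<in> ?K" "circle_proj t' = circle_proj t" using red[OF t(1)] by blast
      then have "\<phi> t' \<in> C" using eq[of t'] t by auto
      then have "z \<in> ?S" using t t' by (intro image_eqI[of _ _ t']) auto
      then show "z \<in> ?S \<inter> circle_proj ` P" using t by blast
    next
      fix z assume "z \<in> ?S \<inter> circle_proj ` P"
      then obtain t where "t \<in> P" "z = circle_proj t" "\<phi> t \<in> C" by auto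
      then show "z \<in> \<psi> -` C \<inter> circle_proj ` P" using eq[of t] by auto
    qed
  qed
  then show ?thesis unfolding continuous_on_closed_invariant by (auto simp: Int_commute)
qed

locale degree_one =
  fixes h :: "real \<Rightarrow> real"
  assumes cont: "continuous_on UNIV h" and mono: "mono h" and period: "\<And>t. h (t + 1) = h t + 1"
begin

lemma h_add_int: "h (t + of_int m) = h t + of_int m"
proof -
  have nat: "h (t + of_nat n) = h t + of_nat n" for t n
  proof (induction n)
    case (Suc n) then show ?case using period[of "t + of_nat n"] by (simp add: algebra_simps)
  qed simp
  show ?thesis
  proof (cases "m \<ge> 0")
    case True then show ?thesis using nat[of t "nat m"] by simp
  next
    case False then show ?thesis using nat[of "t + of_int m" "nat (- m)"] by simp
  qed
qed

lemma h_mono: "s \<le> t \<Longrightarrow> h s \<le> h t"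
  using mono by (rule monoD)

lemma h_less_imp: "h s < h t \<Longrightarrow> s < t"
  using h_mono[of t s] by force

text \<open>Makes the fibers bounded, so that the infimum and supremum in \<open>left_pt\<close> and
  \<open>right_pt\<close> are attained.\<close>

lemma h_bounds: "h t = a \<Longrightarrow> a - h 0 - 1 \<le> t \<and> t \<le> a - h 0 + 1"
proof -
  assume a: "h t = a"
  have "h (0 + of_int \<lfloor>t\<rfloor>) \<le> h t" "h t \<le> h (0 + of_int (\<lfloor>t\<rfloor> + 1))"
    by (rule h_mono; simp; linarith)+
  then have "h 0 + \<lfloor>t\<rfloor> \<le> a" "a \<le> h 0 + \<lfloor>t\<rfloor> + 1"
    unfolding h_add_int a by auto
  then show ?thesis by linarith
qed

lemma h_surj: "\<exists>t. h t = a"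
proof -
  let ?m = "\<lfloor>a - h 0\<rfloor>"
  have "h (0 + of_int ?m) \<le> a" "a \<le> h (0 + of_int (?m + 1))"
    unfolding h_add_int by linarith+
  then have "\<exists>t\<ge>0 + of_int ?m. t \<le> 0 + of_int (?m + 1) \<and> h t = a"
    by (intro IVT' continuous_on_subset[OF cont]) auto
  then show ?thesis by blast
qed

lemma fiber_closed: "closed {t. h t = a}"
  using continuous_closed_vimage[of "{a}" h] cont
  by (simp add: continuous_on_eq_continuous_at vimage_def)

lemma fiber_bdd: "bdd_below {t. h t = a}" "bdd_above {t. h t = a}"
  using h_bounds by (auto intro!: bdd_belowI[of _ "a - h 0 - 1"] bdd_aboveI[of _ "a - h 0 + 1"])

lemma h_left [simp]: "h (left_pt h a) = a"
  using closed_contains_Inf[OF _ fiber_bdd(1) fiber_closed, of a] h_surj[of a] by (auto simp: left_pt_def)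

lemma h_right [simp]: "h (right_pt h a) = a"
  using closed_contains_Sup[OF _ fiber_bdd(2) fiber_closed, of a] h_surj[of a] by (auto simp: right_pt_def)

lemma h_side [simp]: "h (side_pt h s a) = a"
  by (simp add: side_pt_def)

lemma left_le: "a \<le> h t \<Longrightarrow> left_pt h a \<le> t"
proof -
  assume "a \<le> h t"
  then consider "h t = a" | "h (left_pt h a) < h t" by fastforce
  then show ?thesis
  proof cases
    case 1 then show ?thesis by (auto simp: left_pt_def intro!: cInf_lower fiber_bdd)
  next
    case 2 then show ?thesis using h_less_imp by fastforce
  qed
qed

lemma le_right: "h t \<le> a \<Longrightarrow> t \<le> right_pt h a"
proof -
  assume "h t \<le> a"
  then consider "h t = a" | "h t < h (right_pt h a)" by fastforce
  then show ?thesis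
  proof cases
    case 1 then show ?thesis by (auto simp: right_pt_def intro!: cSup_upper fiber_bdd)
  next
    case 2 then show ?thesis using h_less_imp by fastforce
  qed
qed

lemma fiber_iff: "h t = a \<longleftrightarrow> left_pt h a \<le> t \<and> t \<le> right_pt h a"
  using left_le[of a t] le_right[of t a] h_mono[of "left_pt h a" t] h_mono[of t "right_pt h a"] by force

lemma left_le_right: "left_pt h a \<le> right_pt h a"
  by (rule left_le) simp

lemma left_add_int: "left_pt h (a + of_int m) = left_pt h a + of_int m"
proof (rule antisym)
  show "left_pt h (a + of_int m) \<le> left_pt h a + of_int m"
    by (rule left_le) (simp add: h_add_int)
  have "left_pt h a \<le> left_pt h (a + of_int m) + of_int (- m)"
    by (rule left_le) (simp only: h_add_int, simp)
  then show "left_pt h a + of_int m \<le> left_pt h (a + of_int m)" by simp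
qed

lemma right_add_int: "right_pt h (a + of_int m) = right_pt h a + of_int m"
proof (rule antisym)
  show "right_pt h a + of_int m \<le> right_pt h (a + of_int m)"
    by (rule le_right) (simp add: h_add_int)
  have "right_pt h (a + of_int m) + of_int (- m) \<le> right_pt h a"
    by (rule le_right) (simp only: h_add_int, simp)
  then show "right_pt h (a + of_int m) \<le> right_pt h a + of_int m" by simp
qed

lemma side_add_int: "side_pt h s (a + of_int m) = side_pt h s a + of_int m"
  by (simp add: side_pt_def left_add_int right_add_int)

lemma split_add_int: "split_pt h s (a + of_int m) = split_pt h s a"
  by (simp add: split_pt_def side_add_int)

lemma split_add_Ints: "m \<in> \<int> \<Longrightarrow> split_pt h s (a + m) = split_pt h s a"
  by (elim Ints_cases) (simp add: split_add_int)

lemma gap_add_int: "a + of_int m \<in> gap_values h \<longleftrightarrow> a \<in> gap_values h"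
  by (simp add: gap_values_def left_add_int right_add_int)

lemma nongap: "a \<notin> gap_values h \<Longrightarrow> side_pt h s a = side_pt h s' a"
  using left_le_right[of a] by (auto simp: gap_values_def side_pt_def)

lemma growth_iff: "t \<in> growth_points h \<longleftrightarrow> t = left_pt h (h t) \<or> t = right_pt h (h t)"
proof
  assume t: "t \<in> growth_points h"
  show "t = left_pt h (h t) \<or> t = right_pt h (h t)"
  proof (rule ccontr)
    assume "\<not> ?thesis"
    then have "left_pt h (h t) < t" "t < right_pt h (h t)"
      using fiber_iff[of t "h t"] by auto
    then have "h (left_pt h (h t)) < h (right_pt h (h t))"
      using t unfolding growth_points_def by blast
    then show False by simp
  qed
next
  assume R: "t = left_pt h (h t) \<or> t = right_pt h (h t)"
  show "t \<in> growth_points h"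
    unfolding growth_points_def
  proof (intro CollectI allI impI)
    fix a b assume ab: "a < t \<and> t < b"
    show "h a < h b"
    proof (rule ccontr)
      assume "\<not> ?thesis"
      moreover have "h a \<le> h t" "h t \<le> h b" using ab by (auto intro: h_mono)
      ultimately have "h a = h t" "h b = h t" by auto
      then show False using R ab fiber_iff[of a "h t"] fiber_iff[of b "h t"] by auto
    qed
  qed
qed

lemma side_in_growth [simp]: "side_pt h s a \<in> growth_points h"
  by (simp add: growth_iff side_pt_def)

lemma growth_eq: "growth_points h = {side_pt h s a | s a. True}"
proof (intro equalityI subsetI)
  fix t assume "t \<in> growth_points h"
  then have "t = side_pt h False (h t) \<or> t = side_pt h True (h t)"
    by (auto simp: growth_iff side_pt_def)
  then show "t \<in> {side_pt h s a | s a. True}" by blast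
qed auto

lemma growthE:
  assumes "t \<in> growth_points h"
  obtains s where "t = side_pt h s (h t)"
  using assms by (auto simp: growth_eq)

lemma not_growthD:
  assumes "t \<notin> growth_points h"
  shows "h t \<in> gap_values h" "left_pt h (h t) < t" "t < right_pt h (h t)"
  using assms fiber_iff[of t "h t"] by (auto simp: growth_iff gap_values_def)

lemma not_growthI:
  assumes "left_pt h a < t" "t < right_pt h a"
  shows "t \<notin> growth_points h" "h t = a"
proof -
  show "h t = a" using assms by (simp add: fiber_iff)
  then show "t \<notin> growth_points h" using assms by (simp add: growth_iff)
qed

lemma gapE:
  assumes "a \<in> gap_values h"
  obtains z where "z \<notin> growth_points h" "h z = a"
  using not_growthI[of a "(left_pt h a + right_pt h a) / 2"] assms by (force simp: gap_values_def)

lemma growth_closed: "closed (growth_points h)"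
proof -
  have "open (- growth_points h)"
  proof (rule openI)
    fix t assume "t \<in> - growth_points h"
    then have t: "t \<in> {left_pt h (h t)<..<right_pt h (h t)}" using not_growthD by auto
    then obtain e where "e > 0" "ball t e \<subseteq> {left_pt h (h t)<..<right_pt h (h t)}"
      using open_greaterThanLessThan open_contains_ball by metis
    moreover have "{left_pt h (h t)<..<right_pt h (h t)} \<subseteq> - growth_points h"
      using not_growthI(1)[of "h t"] by auto
    ultimately show "\<exists>e>0. ball t e \<subseteq> - growth_points h" by blast
  qed
  then show ?thesis by (simp add: closed_def)
qed

lemma growth_add_int: "t + of_int m \<in> growth_points h \<longleftrightarrow> t \<in> growth_points h"
  by (simp add: growth_iff h_add_int left_add_int right_add_int)

lemma image_growth: "circle_proj ` growth_points h = {split_pt h s a | s a. True}"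
  by (auto simp: growth_eq split_pt_def image_iff)

lemma compact_image_growth: "compact (circle_proj ` growth_points h)"
proof -
  have "circle_proj ` growth_points h = circle_proj ` (growth_points h \<inter> {0..1})"
  proof (intro equalityI subsetI)
    fix z assume "z \<in> circle_proj ` growth_points h"
    then obtain t where t: "t \<in> growth_points h" "z = circle_proj t" by auto
    have "t - of_int \<lfloor>t\<rfloor> \<in> growth_points h" using growth_add_int[of t "- \<lfloor>t\<rfloor>"] t by simp
    moreover have "t - of_int \<lfloor>t\<rfloor> \<in> {0..1}" by auto linarith
    ultimately show "z \<in> circle_proj ` (growth_points h \<inter> {0..1})"
      using t by (intro image_eqI[of _ _ "t - of_int \<lfloor>t\<rfloor>"]) (auto simp: circle_proj_eq_iff)
  qed auto
  moreover have "compact (growth_points h \<inter> {0..1})"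
    using growth_closed by (simp add: closed_Int_compact)
  ultimately show ?thesis
    by (simp add: compact_continuous_image continuous_on_circle_proj)
qed

lemma split_eq_iff:
  "split_pt h s a = split_pt h s' a' \<longleftrightarrow> a - a' \<in> \<int> \<and> (s = s' \<or> a \<notin> gap_values h)"
proof
  assume "split_pt h s a = split_pt h s' a'"
  then obtain m where m: "side_pt h s a - side_pt h s' a' = of_int m"
    by (auto simp: split_pt_def circle_proj_eq_iff elim: Ints_cases)
  then have eq: "side_pt h s a = side_pt h s' (a' + of_int m)" by (simp add: side_add_int)
  then have "a = a' + of_int m" by (metis h_side)
  moreover from this have "s = s' \<or> a \<notin> gap_values h"
    using eq by (auto simp: side_pt_def gap_values_def split: if_splits)
  ultimately show "a - a' \<in> \<int> \<and> (s = s' \<or> a \<notin> gap_values h)" by auto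
next
  assume R: "a - a' \<in> \<int> \<and> (s = s' \<or> a \<notin> gap_values h)"
  then obtain m where m: "a = a' + of_int m" by (metis Ints_cases add.commute diff_add_cancel)
  then have "split_pt h s' a = split_pt h s' a'" by (simp add: split_add_int)
  then show "split_pt h s a = split_pt h s' a'" using R nongap[of a s s'] by (auto simp: split_pt_def)
qed

text \<open>Cutting the line at a point z inside a gap amounts to cutting the values at h z, with
  ties a - h z \<in> \<int> broken according to the side. This is what turns step functions on the
  Cantor set into formulas in (s, a).\<close>

lemma floor_side:
  assumes z: "z \<notin> growth_points h"
  shows "\<lfloor>side_pt h s a - z\<rfloor> = fl s (a - h z)"
proof -
  define m where "m = \<lfloor>side_pt h s a - z\<rfloor>"
  have m: "z + of_int m \<le> side_pt h s a" "side_pt h s a < z + of_int (m + 1)"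
    unfolding m_def by linarith+
  have ne: "side_pt h s a \<noteq> z + of_int m" for m
    using z growth_add_int side_in_growth by metis
  have ge: "h z + of_int m \<le> a" using h_mono[OF m(1)] by (simp add: h_add_int)
  have le: "a \<le> h z + of_int (m + 1)" using h_mono[of "side_pt h s a" "z + of_int (m + 1)"] m by (simp only: h_add_int h_side)
  show ?thesis
  proof (cases s)
    case True
    have "\<not> h z + of_int (m + 1) \<le> a"
    proof
      assume "h z + of_int (m + 1) \<le> a"
      then have "z + of_int (m + 1) \<le> right_pt h a" by (intro le_right) (simp only: h_add_int)
      then show False using m(2) True by (simp add: side_pt_def)
    qed
    then have "\<lfloor>a - h z\<rfloor> = m" using ge by (intro floor_unique) auto
    then show ?thesis using True by (simp add: fl_def m_def)
  next
    case False
    have "\<not> a \<le> h z + of_int m"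
    proof
      assume "a \<le> h z + of_int m"
      then have "left_pt h a \<le> z + of_int m" by (intro left_le) (simp only: h_add_int)
      then show False using m(1) ne[of m] False by (simp add: side_pt_def)
    qed
    then have "\<lceil>a - h z\<rceil> = m + 1" using le by (intro ceiling_unique) auto
    then show ?thesis using False by (simp add: fl_def m_def)
  qed
qed

text \<open>A plateau of length at least \<delta> contains a multiple of \<delta>, and only finitely
  many multiples lie in the bounded range of the plateaus over [0,1).\<close>

lemma finite_large_gaps:
  assumes "0 < \<delta>"
  shows "finite {a \<in> {0..<1}. \<delta> \<le> right_pt h a - left_pt h a}"
proof -
  define I where "I = {k::int. left_pt h 0 \<le> of_int k * \<delta> \<and> of_int k * \<delta> \<le> right_pt h 1}"
  have "I \<subseteq> {\<lfloor>left_pt h 0 / \<delta>\<rfloor>..\<lceil>right_pt h 1 / \<delta>\<rceil>}"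
    using assms by (auto simp: I_def field_simps floor_le_iff le_ceiling_iff)
  then have fin: "finite I" using finite_subset by blast
  have "{a \<in> {0..<1}. \<delta> \<le> right_pt h a - left_pt h a} \<subseteq> (\<lambda>k. h (of_int k * \<delta>)) ` I"
  proof
    fix a assume a: "a \<in> {a \<in> {0..<1}. \<delta> \<le> right_pt h a - left_pt h a}"
    define k where "k = \<lceil>left_pt h a / \<delta>\<rceil>"
    have "left_pt h a / \<delta> \<le> k" "k < left_pt h a / \<delta> + 1" unfolding k_def by linarith+
    then have k: "left_pt h a \<le> k * \<delta>" "k * \<delta> < left_pt h a + \<delta>"
      using assms by (auto simp: field_simps)
    then have "h (k * \<delta>) = a" using a by (auto simp: fiber_iff)
    moreover have "left_pt h 0 \<le> left_pt h a" using a by (intro left_le) auto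
    moreover have "right_pt h a \<le> right_pt h 1" using a by (intro le_right) auto
    ultimately show "a \<in> (\<lambda>k. h (of_int k * \<delta>)) ` I"
      using k a by (intro image_eqI[of _ _ k]) (auto simp: I_def)
  qed
  then show ?thesis using fin finite_subset by blast
qed

lemma countable_gap_values: "countable (gap_values h)"
proof -
  have "gap_values h \<subseteq> (\<Union>m::int. \<Union>n::nat. (\<lambda>a. a + of_int m) ` {a \<in> {0..<1}. 1 / real (Suc n) \<le> right_pt h a - left_pt h a})"
  proof
    fix a assume a: "a \<in> gap_values h"
    then have "right_pt h a - left_pt h a > 0" by (simp add: gap_values_def)
    then obtain n where n: "1 / real (Suc n) \<le> right_pt h a - left_pt h a"
      by (metis less_imp_le nat_approx_posE)
    define a' where "a' = a + of_int (- \<lfloor>a\<rfloor>)"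
    have "right_pt h a' - left_pt h a' = right_pt h a - left_pt h a"
      unfolding a'_def left_add_int right_add_int by simp
    moreover have "a' \<in> {0..<1}" using floor_correct[of a] unfolding a'_def atLeastLessThan_iff by linarith
    ultimately have "a' \<in> {a \<in> {0..<1}. 1 / real (Suc n) \<le> right_pt h a - left_pt h a}"
      using n by simp
    moreover have "a = a' + of_int \<lfloor>a\<rfloor>" by (simp add: a'_def)
    ultimately show "a \<in> (\<Union>m::int. \<Union>n::nat. (\<lambda>a. a + of_int m) ` {a \<in> {0..<1}. 1 / real (Suc n) \<le> right_pt h a - left_pt h a})"
      by blast
  qed
  moreover have "countable (\<Union>m::int. \<Union>n::nat. (\<lambda>a. a + of_int m) ` {a \<in> {0..<1}. 1 / real (Suc n) \<le> right_pt h a - left_pt h a})"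
    by (intro countable_UN countable_image countableI_type countable_finite[OF finite_large_gaps]) auto
  ultimately show ?thesis using countable_subset by blast
qed

text \<open>By irrationality the orbit meets each point modulo 1 at most once, so it visits the
  finitely many long gaps only finitely often. The filter is left open in order to cover
  \<open>at_top\<close> and \<open>at_bot\<close> together.\<close>

lemma gap_length_tendsto_0:
  assumes irr: "\<alpha> \<notin> \<rat>" and cof: "\<And>n::int. \<forall>\<^sub>F k in F. k \<noteq> n"
  shows "((\<lambda>k::int. right_pt h (a + of_int k * \<alpha>) - left_pt h (a + of_int k * \<alpha>)) \<longlongrightarrow> 0) F"
proof (rule tendstoI)
  fix \<delta> :: real assume \<delta>: "0 < \<delta>"
  let ?B = "{a \<in> {0..<1}. \<delta> \<le> right_pt h a - left_pt h a}"
  let ?fr = "\<lambda>k::int. frac (a + of_int k * \<alpha>)"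
  have "inj ?fr"
  proof (rule injI)
    fix j k :: int assume "?fr j = ?fr k"
    then have "of_int (j - k) * \<alpha> = of_int (\<lfloor>a + of_int j * \<alpha>\<rfloor> - \<lfloor>a + of_int k * \<alpha>\<rfloor>)"
      by (simp add: frac_def algebra_simps)
    then have "of_int (j - k) * \<alpha> \<in> \<rat>" by (simp only: Rats_of_int)
    then show "j = k" using irrational_mult_int[OF irr] by fastforce
  qed
  then have "finite (?fr -` ?B)"
    using finite_large_gaps[OF \<delta>] by (intro finite_vimageI) auto
  then have "\<forall>\<^sub>F k in F. \<forall>n\<in>?fr -` ?B. k \<noteq> n"
    by (intro eventually_ball_finite ballI cof) auto
  then show "\<forall>\<^sub>F k in F. dist (right_pt h (a + of_int k * \<alpha>) - left_pt h (a + of_int k * \<alpha>)) 0 < \<delta>"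
  proof eventually_elim
    case (elim k)
    let ?x = "a + of_int k * \<alpha>"
    have fr: "frac ?x = ?x + of_int (- \<lfloor>?x\<rfloor>)" by (simp add: frac_def)
    have len: "right_pt h (frac ?x) - left_pt h (frac ?x) = right_pt h ?x - left_pt h ?x"
      unfolding fr left_add_int right_add_int by simp
    have "k \<notin> ?fr -` ?B" using elim by blast
    then have "right_pt h (frac ?x) - left_pt h (frac ?x) < \<delta>"
      using frac_lt_1[of ?x] by auto
    then show ?case using len left_le_right[of ?x] by (simp add: dist_real_def)
  qed
qed

lemma split_pts_asymptotic:
  assumes irr: "\<alpha> \<notin> \<rat>" and cof: "\<And>n::int. \<forall>\<^sub>F k in F. k \<noteq> n"
  shows "((\<lambda>k::int. dist (split_pt h s (a + of_int k * \<alpha>)) (split_pt h s' (a + of_int k * \<alpha>))) \<longlongrightarrow> 0) F"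
proof (rule tendstoI)
  fix \<epsilon> :: real assume "0 < \<epsilon>"
  then obtain \<delta> where \<delta>: "\<delta> > 0" "\<And>s t. \<bar>s - t\<bar> < \<delta> \<Longrightarrow> dist (circle_proj s) (circle_proj t) < \<epsilon>"
    using circle_proj_close by blast
  have "\<forall>\<^sub>F k in F. dist (right_pt h (a + of_int k * \<alpha>) - left_pt h (a + of_int k * \<alpha>)) 0 < \<delta>"
    by (rule tendstoD[OF gap_length_tendsto_0[OF irr cof]]) fact
  then show "\<forall>\<^sub>F k in F. dist (dist (split_pt h s (a + of_int k * \<alpha>)) (split_pt h s' (a + of_int k * \<alpha>))) 0 < \<epsilon>"
    by eventually_elim (use \<open>0 < \<epsilon>\<close> in \<open>auto simp: split_pt_def side_pt_def dist_real_def abs_minus_commute intro!: \<delta>\<close>)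
qed

end

section \<open>Summation by parts and step functions on a split circle\<close>

lemma sum_by_parts_int:
  fixes c :: "nat \<Rightarrow> int" and u :: "nat \<Rightarrow> int"
  shows "(\<Sum>i<Suc n. c i * (u i - u (Suc i))) =
    (\<Sum>i<Suc n. (c i - (if i = 0 then 0 else c (i - 1))) * u i) - c n * u (Suc n)"
  by (induction n) (auto simp: algebra_simps)

text \<open>After one turn u drops by 1, so the boundary term of summation by parts returns to the
  first index; this is why the new coefficients sum to 0. They are obtained before u, so that one
  choice serves all points (s, a).\<close>

lemma sum_by_parts_cyclic:
  fixes c :: "nat \<Rightarrow> int"
  obtains d :: "nat \<Rightarrow> int" and e :: int where "(\<Sum>i<Suc n. d i) = 0"
    and "\<And>u. u (Suc n) = u 0 - 1 \<Longrightarrow> (\<Sum>i<Suc n. c i * (u i - u (Suc i))) = e + (\<Sum>i<Suc n. d i * u i)"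
proof -
  define d where "d i = c i - (if i = 0 then c n else c (i - 1))" for i
  have eq: "(\<Sum>i<Suc n. c i * (u i - u (Suc i))) = c n + (\<Sum>i<Suc n. d i * u i)" if "u (Suc n) = u 0 - 1" for u
  proof -
    have "(\<Sum>i<Suc n. (c i - (if i = 0 then 0 else c (i - 1))) * u i) = (\<Sum>i<Suc n. d i * u i) + c n * u 0"
      by (subst (1 2) sum.lessThan_Suc_shift) (simp add: d_def algebra_simps)
    then show ?thesis unfolding sum_by_parts_int that by (simp add: algebra_simps)
  qed
  have "(\<Sum>i<Suc n. d i) = 0"
  proof -
    have "(\<Sum>i<Suc n. d i) = c 0 - c n + (\<Sum>i<n. c (Suc i) - c i)"
      by (subst sum.lessThan_Suc_shift) (simp add: d_def)
    then show ?thesis by (simp add: sum_lessThan_telescope)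
  qed
  then show thesis using that eq by blast
qed

locale split_map = degree_one +
  fixes \<alpha> :: real
  assumes irrational: "\<alpha> \<notin> \<rat>"
    and gaps_nonempty: "gap_values h \<noteq> {}"
    and gaps_invariant: "\<And>a. a + \<alpha> \<in> gap_values h \<longleftrightarrow> a \<in> gap_values h"
begin

lemma gap_add_alpha: "a + of_int k * \<alpha> \<in> gap_values h \<longleftrightarrow> a \<in> gap_values h"
proof -
  have nat: "a + of_nat n * \<alpha> \<in> gap_values h \<longleftrightarrow> a \<in> gap_values h" for a n
  proof (induction n)
    case (Suc n)
    then show ?case using gaps_invariant[of "a + of_nat n * \<alpha>"] by (simp add: algebra_simps)
  qed simp
  show ?thesis
  proof (cases "k \<ge> 0")
    case True then show ?thesis using nat[of a "nat k"] by simp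
  next
    case False then show ?thesis using nat[of "a + of_int k * \<alpha>" "nat (- k)"] by simp
  qed
qed

lemma gap_add_group: "x \<in> rotation_group \<alpha> \<Longrightarrow> a + x \<in> gap_values h \<longleftrightarrow> a \<in> gap_values h"
  using gap_add_alpha gap_add_int by (auto simp: rotation_group_def algebra_simps)
    (metis add.commute gap_add_alpha gap_add_int group_cancel.add1 mult.commute)+

lemma gap_values_dense:
  assumes "x < y"
  obtains a where "a \<in> gap_values h" "x < a" "a < y"
proof -
  obtain a where a: "a \<in> gap_values h" using gaps_nonempty by blast
  have "x - a < y - a" using assms by simp
  then obtain k :: nat and m :: int where "0 < k" "x - a < of_nat k * \<alpha> + of_int m" "of_nat k * \<alpha> + of_int m < y - a"
    by (rule irrational_orbit_dense[OF irrational])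
  then show thesis
    using that[of "a + of_int (int k) * \<alpha> + of_int m"] a by (simp add: gap_add_int gap_add_alpha del: of_int_of_nat_eq)
qed

text \<open>Either h is constant on the interval, or some gap value lies strictly between its end
  values, and the plateau of this gap value lies inside the interval.\<close>

lemma growth_nowhere_dense:
  assumes "x < y"
  obtains z where "z \<notin> growth_points h" "x < z" "z < y"
proof (cases "h x < h y")
  case True
  then obtain a where a: "a \<in> gap_values h" "h x < a" "a < h y" by (rule gap_values_dense)
  obtain z where "z \<notin> growth_points h" "h z = a" using gapE[OF a(1)] .
  then show thesis using that[of z] h_less_imp[of x z] h_less_imp[of z y] a by auto
next
  case False
  then have "(x + y) / 2 \<notin> growth_points h"
    using assms unfolding growth_points_def by (simp, intro exI[of _ x] conjI exI[of _ y]) auto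
  then show thesis using that assms by force
qed

text \<open>By uniform continuity the function is constant between neighbouring cuts, once these are
  placed in gaps and are close enough. It is then a combination of indicators of cells, and
  summation by parts collects the floors based at each cut.\<close>

lemma int_function_form:
  fixes f :: "complex \<Rightarrow> int"
  assumes cf: "continuous_on (circle_proj ` growth_points h) (\<lambda>x. real_of_int (f x))"
  obtains c :: int and N :: nat and d :: "nat \<Rightarrow> int" and b :: "nat \<Rightarrow> real"
  where "\<And>i. b i \<in> gap_values h" "(\<Sum>i<N. d i) = 0"
    "\<And>s a. f (split_pt h s a) = c + (\<Sum>i<N. d i * fl s (a - b i))"
proof -
  define F where "F t = f (circle_proj t)" for t
  have F_int: "F (t + of_int m) = F t" for t m by (simp add: F_def)
  obtain \<delta> where \<delta>: "\<delta> > 0" "\<And>x y. x \<in> circle_proj ` growth_points h \<Longrightarrow> y \<in> circle_proj ` growth_points h \<Longrightarrow>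
      dist x y < \<delta> \<Longrightarrow> dist (real_of_int (f x)) (f y) < 1"
    using compact_uniformly_continuous[OF cf compact_image_growth] unfolding uniformly_continuous_on_def
    by (metis zero_less_one)
  obtain \<eta> where \<eta>: "\<eta> > 0" "\<And>s t. \<bar>s - t\<bar> < \<eta> \<Longrightarrow> dist (circle_proj s) (circle_proj t) < \<delta>"
    using circle_proj_close[OF \<delta>(1)] by blast
  have F_close: "F s = F t" if "s \<in> growth_points h" "t \<in> growth_points h" "\<bar>s - t\<bar> < \<eta>" for s t
    using \<delta>(2)[of "circle_proj s" "circle_proj t"] \<eta>(2)[of s t] that by (auto simp: F_def dist_real_def)
  \<comment> \<open>Neighbouring cuts will be chosen in adjacent cells of length 1/N, hence at
    distance at most 2/N.\<close>
  obtain n :: nat where n: "2 / \<eta> < real n" using reals_Archimedean2 by blast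
  define N where "N = Suc n"
  have N0: "real N > 0" by (simp add: N_def)
  have "2 / \<eta> < real N" using n by (simp add: N_def)
  then have N: "2 / real N < \<eta>" using \<eta>(1) N0 by (simp add: field_simps)
  obtain z0 where z0: "z0 \<notin> growth_points h" using growth_nowhere_dense[of 0 1] by auto
  have "\<forall>i::nat. \<exists>z. z \<notin> growth_points h \<and> z0 + i / N < z \<and> z < z0 + (real i + 1) / N"
  proof
    fix i :: nat
    have "z0 + i / N < z0 + (real i + 1) / N" using N0 by (simp add: divide_strict_right_mono)
    then show "\<exists>z. z \<notin> growth_points h \<and> z0 + i / N < z \<and> z < z0 + (real i + 1) / N"
      using growth_nowhere_dense by metis
  qed
  then obtain w where w: "\<And>i::nat. w i \<notin> growth_points h" "\<And>i. z0 + i / N < w i" "\<And>i. w i < z0 + (real i + 1) / N"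
    by metis
  \<comment> \<open>The last cut is the first one moved by a full turn, so that the cells close
    up.\<close>
  define z where "z i = (if i = 0 then z0 else if N \<le> i then z0 + 1 else w i)" for i
  have z_out: "z i \<notin> growth_points h" for i
    using w(1) z0 growth_add_int[of z0 1] by (simp add: z_def)
  have z_lo: "z0 + i / N \<le> z i" if "i \<le> N" for i
    using that w(2)[of i] N0 by (auto simp: z_def N_def)
  have z_hi: "z i \<le> z0 + (i + 1) / N" for i
  proof -
    have "1 \<le> (real i + 1) / N" if "N \<le> i" using that N0 by (simp add: field_simps)
    then show ?thesis using w(3)[of i] N0 by (auto simp: z_def add.commute)
  qed
  have z_step: "z i < z (Suc i)" if "i < N" for i
  proof (cases "Suc i < N")
    case True
    then show ?thesis using z_hi[of i] w(2)[of "Suc i"] by (simp add: z_def add.commute)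
  next
    case False
    then have "Suc i = N" using that by simp
    have "w i < z0 + 1" using w(3)[of i] \<open>Suc i = N\<close> N0 by (auto simp: add.commute)
    then show ?thesis using \<open>Suc i = N\<close> by (simp add: z_def)
  qed
  have z_mono: "z i \<le> z j" if "i \<le> j" "j \<le> N" for i j
    using that
  proof (induction j rule: dec_induct)
    case (step k) then show ?case using z_step[of k] by fastforce
  qed simp
  have z_diff: "z (Suc i) - z i < \<eta>" if "i < N" for i
  proof -
    have "z (Suc i) - z i \<le> 2 / N" if "Suc i < N"
      using z_hi[of "Suc i"] z_lo[of i] \<open>i < N\<close> by (simp add: add_divide_distrib)
    moreover have "z (Suc i) - z i \<le> 1 / N" if "Suc i = N"
    proof -
      have "real i = real N - 1" using that by auto
      then have "real i / N = 1 - 1 / N" using N0 by (simp add: field_simps)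
      moreover have "z (Suc i) = z0 + 1" using that by (simp add: z_def)
      ultimately show ?thesis using z_lo[of i] \<open>i < N\<close> by linarith
    qed
    moreover have "1 / real N \<le> 2 / real N" using N0 by (simp add: divide_right_mono)
    ultimately show ?thesis using N \<open>i < N\<close> by fastforce
  qed
  define c where "c i = F (SOME t. t \<in> growth_points h \<and> z i < t \<and> t < z (Suc i))" for i
  have c: "F t = c i" if t: "t \<in> growth_points h" "z i < t" "t < z (Suc i)" and i: "i < N" for t i
  proof -
    let ?s = "SOME t. t \<in> growth_points h \<and> z i < t \<and> t < z (Suc i)"
    have "?s \<in> growth_points h \<and> z i < ?s \<and> ?s < z (Suc i)"
      by (rule someI[of "\<lambda>t. t \<in> growth_points h \<and> z i < t \<and> t < z (Suc i)" t]) (use t in auto)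
    then show ?thesis unfolding c_def using t z_diff[OF i] by (intro F_close) auto
  qed
  \<comment> \<open>The difference of the floors at two neighbouring cuts is the indicator of the
    cell between them, up to integer translation of t.\<close>
  have main: "F t = (\<Sum>i<N. c i * (\<lfloor>t - z i\<rfloor> - \<lfloor>t - z (Suc i)\<rfloor>))" if t: "t \<in> growth_points h" for t
  proof -
    define m where "m = \<lfloor>t - z0\<rfloor>"
    define t' where "t' = t + of_int (- m)"
    have t': "t' \<in> growth_points h" unfolding t'_def growth_add_int by (rule t)
    have ne: "t' \<noteq> z i" for i using t' z_out by metis
    have b: "z 0 \<le> t'" "t' < z N" unfolding t'_def m_def z_def N_def by (simp; linarith)+
    define i where "i = (LEAST i. t' < z (Suc i))"
    have ex: "t' < z (Suc n)" using b by (simp add: N_def)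
    have i1: "t' < z (Suc i)" unfolding i_def by (rule LeastI[of "\<lambda>i. t' < z (Suc i)", OF ex])
    have "i \<le> n" unfolding i_def by (rule Least_le) (rule ex)
    then have iN: "i < N" by (simp add: N_def)
    have i2: "z i < t'"
    proof (cases i)
      case 0 then show ?thesis using b ne[of 0] by auto
    next
      case (Suc j)
      then have "\<not> t' < z (Suc j)" unfolding i_def by (metis lessI not_less_Least i_def)
      then show ?thesis using Suc ne[of "Suc j"] by auto
    qed
    have fl: "\<lfloor>t' - z j\<rfloor> = (if j \<le> i then 0 else - 1)" if "j \<le> N" for j
    proof -
      have "z j \<le> z i" if "j \<le> i" using z_mono[OF that] iN by simp
      moreover have "z (Suc i) \<le> z j" if "\<not> j \<le> i" using z_mono[of "Suc i" j] that \<open>j \<le> N\<close> by simp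
      moreover have "z j \<le> z N" using z_mono[of j N] that by simp
      moreover have "z 0 \<le> z j" using z_mono[of 0 j] that by simp
      moreover have "z N = z 0 + 1" by (simp add: z_def N_def)
      ultimately show ?thesis using i1 i2 b by (cases "j \<le> i") (auto intro!: floor_unique)
    qed
    have sh: "\<lfloor>t - z j\<rfloor> = \<lfloor>t' - z j\<rfloor> + m" for j
    proof -
      have "t - z j = (t' - z j) + of_int m" by (simp add: t'_def)
      then show ?thesis by (simp only: floor_add_int)
    qed
    have "(\<Sum>j<N. c j * (\<lfloor>t - z j\<rfloor> - \<lfloor>t - z (Suc j)\<rfloor>)) = (\<Sum>j<N. if j = i then c j else 0)"
      by (rule sum.cong) (auto simp: sh fl)
    also have "\<dots> = c i" using iN by simp
    also have "\<dots> = F t'" using c[OF t' i2 i1 iN] by simp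
    also have "\<dots> = F t" unfolding t'_def by (rule F_int)
    finally show ?thesis by simp
  qed
  define b where "b i = h (z i)" for i
  have b_gap: "b i \<in> gap_values h" for i unfolding b_def by (rule not_growthD(1)) (rule z_out)
  have b_per: "b (Suc n) = b 0 + 1" using period[of z0] by (simp add: b_def z_def N_def)
  obtain d e where d: "(\<Sum>i<Suc n. d i) = 0"
    and de: "\<And>u. u (Suc n) = u 0 - 1 \<Longrightarrow> (\<Sum>i<Suc n. c i * (u i - u (Suc i))) = e + (\<Sum>i<Suc n. d i * u i)"
    using sum_by_parts_cyclic[of n c] by blast
  have "f (split_pt h s a) = e + (\<Sum>i<N. d i * fl s (a - b i))" for s a
  proof -
    have "f (split_pt h s a) = (\<Sum>i<Suc n. c i * (fl s (a - b i) - fl s (a - b (Suc i))))"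
      using main[of "side_pt h s a"] by (simp add: F_def split_pt_def floor_side z_out b_def N_def)
    also have "\<dots> = e + (\<Sum>i<Suc n. d i * fl s (a - b i))"
    proof (rule de)
      have "a - b 0 = (a - b (Suc n)) + 1" using b_per by simp
      then show "fl s (a - b (Suc n)) = fl s (a - b 0) - 1" by (simp only: fl_add_one)
    qed
    finally show ?thesis by (simp add: N_def)
  qed
  then show thesis using that[of b d N e] b_gap d by (simp add: N_def)
qed

text \<open>On the line the formula is a combination of floors based at points outside the growth
  set, which are therefore continuous on it. The condition on \<open>d\<close> makes the combination
  periodic.\<close>

lemma int_function_of_form:
  fixes c :: int and N :: nat and d :: "nat \<Rightarrow> int" and b :: "nat \<Rightarrow> real"
  assumes b: "\<And>i. i < N \<Longrightarrow> b i \<in> gap_values h" and d: "(\<Sum>i<N. d i) = 0"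
  obtains f :: "complex \<Rightarrow> int" where
    "continuous_on (circle_proj ` growth_points h) (\<lambda>x. real_of_int (f x))"
    "\<And>s a. f (split_pt h s a) = c + (\<Sum>i<N. d i * fl s (a - b i))"
proof -
  have "\<forall>i. \<exists>z. i < N \<longrightarrow> z \<notin> growth_points h \<and> h z = b i" using b gapE by metis
  then obtain z where z: "\<And>i. i < N \<Longrightarrow> z i \<notin> growth_points h" "\<And>i. i < N \<Longrightarrow> h (z i) = b i" by metis
  define K where "K t = c + (\<Sum>i<N. d i * \<lfloor>t - z i\<rfloor>)" for t
  have K_int: "K (t + of_int m) = K t" for t m
  proof -
    have "\<lfloor>t + of_int m - z i\<rfloor> = \<lfloor>t - z i\<rfloor> + m" for i by linarith
    then have "K (t + of_int m) = K t + (\<Sum>i<N. d i) * m"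
      by (simp add: K_def algebra_simps sum.distrib sum_distrib_left)
    then show ?thesis by (simp add: d)
  qed
  define f where "f w = K (SOME t. circle_proj t = w)" for w
  have f: "f (circle_proj t) = K t" for t
  proof -
    let ?s = "SOME s. circle_proj s = circle_proj t"
    have "circle_proj ?s = circle_proj t" by (rule someI[of _ t]) simp
    then obtain m where "?s = t + of_int m"
      unfolding circle_proj_eq_iff by (metis Ints_cases add.commute diff_add_cancel)
    then show ?thesis by (simp add: f_def K_int)
  qed
  have cK: "continuous_on (growth_points h) (\<lambda>t. real_of_int (K t))"
  proof -
    have "continuous_on (growth_points h) (\<lambda>t. real_of_int \<lfloor>t - z i\<rfloor>)" if "i < N" for i
    proof (rule continuous_on_compose2[OF continuous_on_of_int_floor])
      show "(\<lambda>t. t - z i) ` growth_points h \<subseteq> UNIV - \<int>"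
      proof clarsimp
        fix t assume t: "t \<in> growth_points h" "t - z i \<in> \<int>"
        then obtain m where "t = z i + of_int m" by (metis Ints_cases add.commute diff_add_cancel)
        then show False using t z(1)[OF that] growth_add_int by metis
      qed
    qed (intro continuous_intros)
    then show ?thesis unfolding K_def of_int_add of_int_sum of_int_mult
      by (intro continuous_on_add continuous_on_const continuous_on_sum continuous_on_mult) auto
  qed
  show thesis
  proof (rule that[of f])
    show "continuous_on (circle_proj ` growth_points h) (\<lambda>x. real_of_int (f x))"
      by (rule continuous_on_circle_quotient[OF growth_closed _ cK]) (simp_all add: growth_add_int f)
    show "f (split_pt h s a) = c + (\<Sum>i<N. d i * fl s (a - b i))" for s a
      by (simp add: split_pt_def f K_def floor_side z)
  qed
qed

end

section \<open>Integer-valued functions, means and states\<close>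

definition int_continuous :: "'a system \<Rightarrow> ('a \<Rightarrow> int) \<Rightarrow> bool" where
  "int_continuous X f \<longleftrightarrow> continuous_map (sys_top X) (discrete_topology UNIV) f"

definition birkhoff :: "'a system \<Rightarrow> ('a \<Rightarrow> int) \<Rightarrow> nat \<Rightarrow> 'a \<Rightarrow> int" where
  "birkhoff X f n x = (\<Sum>k<n. f ((sys_map X ^^ k) x))"

text \<open>Uniform convergence of Birkhoff averages: the form that unique ergodicity takes for a
  single function, without speaking of measures.\<close>

definition has_mean :: "'a system \<Rightarrow> ('a \<Rightarrow> int) \<Rightarrow> real \<Rightarrow> bool" where
  "has_mean X f c \<longleftrightarrow>
     (\<forall>\<epsilon>>0. \<exists>M. \<forall>n\<ge>M. \<forall>x\<in>points X. \<bar>real_of_int (birkhoff X f n x) - real n * c\<bar> \<le> \<epsilon> * real n)"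

lemma int_continuous_iff: "int_continuous X f \<longleftrightarrow> (\<forall>k. openin (sys_top X) {x \<in> points X. f x = k})"
proof
  assume "int_continuous X f"
  then have "openin (sys_top X) {x \<in> topspace (sys_top X). f x \<in> {k}}" for k
    unfolding int_continuous_def by (rule openin_continuous_map_preimage) simp
  then show "\<forall>k. openin (sys_top X) {x \<in> points X. f x = k}" by simp
next
  assume R: "\<forall>k. openin (sys_top X) {x \<in> points X. f x = k}"
  have "openin (sys_top X) {x \<in> topspace (sys_top X). f x \<in> U}" for U
  proof -
    have "{x \<in> topspace (sys_top X). f x \<in> U} = (\<Union>k\<in>U. {x \<in> points X. f x = k})" by auto
    moreover have "openin (sys_top X) \<dots>" using R by (intro openin_Union) auto
    ultimately show ?thesis by simp
  qed
  then show "int_continuous X f" unfolding int_continuous_def continuous_map by simp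
qed

lemma int_continuous_cong: "(\<And>x. x \<in> points X \<Longrightarrow> f x = g x) \<Longrightarrow> int_continuous X f \<longleftrightarrow> int_continuous X g"
proof -
  assume "\<And>x. x \<in> points X \<Longrightarrow> f x = g x"
  then have "{x \<in> points X. f x = k} = {x \<in> points X. g x = k}" for k by auto
  then show ?thesis by (simp add: int_continuous_iff)
qed

lemma int_continuous_const [simp]: "int_continuous X (\<lambda>x. k)"
  by (simp add: int_continuous_def)

lemma int_continuous_op:
  fixes op :: "int \<Rightarrow> int \<Rightarrow> int"
  assumes "int_continuous X f" "int_continuous X g"
  shows "int_continuous X (\<lambda>x. op (f x) (g x))"
  unfolding int_continuous_iff
proof
  fix k
  have "{x \<in> points X. op (f x) (g x) = k} =
      (\<Union>(i, j)\<in>{(i, j). op i j = k}. {x \<in> points X. f x = i} \<inter> {x \<in> points X. g x = j})" by auto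
  moreover have "openin (sys_top X) \<dots>"
    using assms unfolding int_continuous_iff by (intro openin_Union) (auto intro!: openin_Int)
  ultimately show "openin (sys_top X) {x \<in> points X. op (f x) (g x) = k}" by simp
qed

lemma int_continuous_add: "int_continuous X f \<Longrightarrow> int_continuous X g \<Longrightarrow> int_continuous X (\<lambda>x. f x + g x)"
  using int_continuous_op[where op = "(+)"] .

lemma int_continuous_diff: "int_continuous X f \<Longrightarrow> int_continuous X g \<Longrightarrow> int_continuous X (\<lambda>x. f x - g x)"
  using int_continuous_op[where op = "(-)"] .

lemma int_continuous_scale: "int_continuous X f \<Longrightarrow> int_continuous X (\<lambda>x. k * f x)"
  using int_continuous_op[where f = f and g = f and op = "\<lambda>a b. k * a"] .

lemma int_continuous_compose:
  "continuous_map (sys_top X) (sys_top Y) p \<Longrightarrow> int_continuous Y f \<Longrightarrow> int_continuous X (\<lambda>x. f (p x))"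
  unfolding int_continuous_def using continuous_map_compose[of "sys_top X" "sys_top Y" p "discrete_topology UNIV" f]
  by (simp add: o_def)

locale compact_system =
  fixes X :: "'a system"
  assumes system: "is_system X"
begin

lemma points_nonempty: "points X \<noteq> {}"
  using system by (simp add: is_system_def)

lemma sys_map_homeo: "homeomorphic_map (sys_top X) (sys_top X) (sys_map X)"
  using system by (simp add: is_system_def)

lemma sys_map_cont: "continuous_map (sys_top X) (sys_top X) (sys_map X)"
  using sys_map_homeo homeomorphic_imp_continuous_map by blast

lemma sys_map_bij: "bij_betw (sys_map X) (points X) (points X)"
  using sys_map_homeo by (simp add: bij_betw_def homeomorphic_eq_everything_map)

lemma sys_map_in: "x \<in> points X \<Longrightarrow> sys_map X x \<in> points X"
  using sys_map_bij by (auto simp: bij_betw_def)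

lemma sys_pow_in: "x \<in> points X \<Longrightarrow> (sys_map X ^^ n) x \<in> points X"
  by (induction n) (auto simp: sys_map_in)

lemma inv_in: "x \<in> points X \<Longrightarrow> inv_into (points X) (sys_map X) x \<in> points X"
  using sys_map_bij by (auto simp: bij_betw_def intro: inv_into_into)

lemma inv_pow_in: "x \<in> points X \<Longrightarrow> (inv_into (points X) (sys_map X) ^^ n) x \<in> points X"
  by (induction n) (auto simp: inv_in)

lemma sys_iter_in: "x \<in> points X \<Longrightarrow> sys_iter X n x \<in> points X"
  by (simp add: sys_iter_def sys_pow_in inv_pow_in)

lemma sys_iter_nat: "sys_iter X (int n) = sys_map X ^^ n"
  by (simp add: sys_iter_def)

lemma sys_iter_0 [simp]: "sys_iter X 0 x = x"
  by (simp add: sys_iter_def)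

lemma sys_iter_Suc: 
  assumes x: "x \<in> points X"
  shows "sys_iter X (n + 1) x = sys_map X (sys_iter X n x)"
proof (cases "n \<ge> 0")
  case True
  then have "nat (n + 1) = Suc (nat n)" by simp
  then show ?thesis using True by (simp add: sys_iter_def)
next
  case False
  define m where "m = nat (- n - 1)"
  have n: "nat (- n) = Suc m" using False by (simp add: m_def)
  have "sys_map X (sys_iter X n x) = sys_map X (inv_into (points X) (sys_map X) ((inv_into (points X) (sys_map X) ^^ m) x))"
    using False n by (simp add: sys_iter_def)
  also have "\<dots> = (inv_into (points X) (sys_map X) ^^ m) x"
    using inv_pow_in[OF x, of m] sys_map_bij by (simp add: bij_betw_def f_inv_into_f)
  also have "\<dots> = sys_iter X (n + 1) x"
  proof (cases "n = - 1")
    case False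
    then show ?thesis using \<open>\<not> n \<ge> 0\<close> by (simp add: sys_iter_def m_def)
  qed (simp add: m_def)
  finally show ?thesis by simp
qed

lemma sys_iter_step: "x \<in> points X \<Longrightarrow> sys_iter X n (sys_map X x) = sys_iter X (n + 1) x"
proof (induction n rule: int_induct[of _ 0])
  case base then show ?case using sys_iter_Suc[of x 0] by simp
next
  case (step1 i)
  then show ?case using sys_iter_Suc[of "sys_map X x" i] sys_iter_Suc[of x "i + 1"] by (simp add: sys_map_in)
next
  case (step2 i)
  have "sys_map X (sys_iter X (i - 1) (sys_map X x)) = sys_map X (sys_iter X i x)"
    using step2 sys_iter_Suc[of "sys_map X x" "i - 1"] sys_iter_Suc[of x i] by (simp add: sys_map_in)
  then show ?case using sys_map_bij step2.prems by (auto simp: bij_betw_def sys_iter_in sys_map_in dest: inj_onD)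
qed

lemma int_continuous_bounded:
  assumes "int_continuous X f"
  obtains B :: nat where "\<And>x. x \<in> points X \<Longrightarrow> \<bar>f x\<bar> \<le> int B"
proof -
  have "compactin (sys_top X) (points X)" using system by (simp add: is_system_def compact_space_def)
  then have "compactin (discrete_topology UNIV) (f ` points X)"
    using assms unfolding int_continuous_def by (rule image_compactin)
  then have fin: "finite ((\<lambda>x. \<bar>f x\<bar>) ` points X)"
    by (metis compactin_discrete_topology finite_imageI image_image)
  have "\<bar>f x\<bar> \<le> int (nat (Max ((\<lambda>x. \<bar>f x\<bar>) ` points X)))" if "x \<in> points X" for x
  proof -
    have "\<bar>f x\<bar> \<le> Max ((\<lambda>x. \<bar>f x\<bar>) ` points X)" using Max_ge[OF fin, of "\<bar>f x\<bar>"] that by simp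
    then show ?thesis using abs_ge_zero[of "f x"] by linarith
  qed
  then show thesis by (rule that)
qed

lemma has_mean_unique:
  assumes "has_mean X f c" "has_mean X f c'"
  shows "c = c'"
proof (rule ccontr)
  assume "c \<noteq> c'"
  then have e: "0 < \<bar>c - c'\<bar> / 3" by simp
  obtain M where M: "\<And>n x. n \<ge> M \<Longrightarrow> x \<in> points X \<Longrightarrow> \<bar>real_of_int (birkhoff X f n x) - real n * c\<bar> \<le> \<bar>c - c'\<bar> / 3 * real n"
    using assms(1) e unfolding has_mean_def by blast
  obtain M' where M': "\<And>n x. n \<ge> M' \<Longrightarrow> x \<in> points X \<Longrightarrow> \<bar>real_of_int (birkhoff X f n x) - real n * c'\<bar> \<le> \<bar>c - c'\<bar> / 3 * real n"
    using assms(2) e unfolding has_mean_def by blast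
  obtain x where x: "x \<in> points X" using points_nonempty by blast
  define n where "n = Suc (max M M')"
  have "\<bar>real n * c - real n * c'\<bar> \<le> 2 * (\<bar>c - c'\<bar> / 3 * real n)"
    using M[of n x] M'[of n x] x unfolding n_def by linarith
  also have "\<bar>real n * c - real n * c'\<bar> = real n * \<bar>c - c'\<bar>"
    by (simp add: abs_mult flip: right_diff_distrib)
  finally have "\<bar>c - c'\<bar> * real n \<le> 0" by (simp add: field_simps)
  then show False using \<open>c \<noteq> c'\<close> by (simp add: n_def mult_le_0_iff)
qed

lemma has_mean_cong: "(\<And>x. x \<in> points X \<Longrightarrow> f x = g x) \<Longrightarrow> has_mean X f c \<longleftrightarrow> has_mean X g c"
  by (simp add: has_mean_def birkhoff_def sys_pow_in)

lemma has_mean_add: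
  assumes "has_mean X f c" "has_mean X g c'"
  shows "has_mean X (\<lambda>x. f x + g x) (c + c')"
  unfolding has_mean_def
proof (intro allI impI)
  fix \<epsilon> :: real assume "0 < \<epsilon>"
  then have e: "0 < \<epsilon> / 2" by simp
  obtain M where M: "\<And>n x. n \<ge> M \<Longrightarrow> x \<in> points X \<Longrightarrow> \<bar>real_of_int (birkhoff X f n x) - real n * c\<bar> \<le> \<epsilon> / 2 * real n"
    using assms(1) e unfolding has_mean_def by blast
  obtain M' where M': "\<And>n x. n \<ge> M' \<Longrightarrow> x \<in> points X \<Longrightarrow> \<bar>real_of_int (birkhoff X g n x) - real n * c'\<bar> \<le> \<epsilon> / 2 * real n"
    using assms(2) e unfolding has_mean_def by blast
  show "\<exists>M. \<forall>n\<ge>M. \<forall>x\<in>points X. \<bar>real_of_int (birkhoff X (\<lambda>x. f x + g x) n x) - real n * (c + c')\<bar> \<le> \<epsilon> * real n"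
  proof (intro exI[of _ "max M M'"] allI impI ballI)
    fix n x assume "n \<ge> max M M'" "x \<in> points X"
    then have "\<bar>real_of_int (birkhoff X f n x) - real n * c\<bar> \<le> \<epsilon> / 2 * real n"
      "\<bar>real_of_int (birkhoff X g n x) - real n * c'\<bar> \<le> \<epsilon> / 2 * real n"
      using M[of n x] M'[of n x] by simp_all
    moreover have "real_of_int (birkhoff X (\<lambda>x. f x + g x) n x) = real_of_int (birkhoff X f n x) + real_of_int (birkhoff X g n x)"
      by (simp add: birkhoff_def sum.distrib)
    moreover have "real n * (c + c') = real n * c + real n * c'" by (rule distrib_left)
    ultimately show "\<bar>real_of_int (birkhoff X (\<lambda>x. f x + g x) n x) - real n * (c + c')\<bar> \<le> \<epsilon> * real n"
      by linarith
  qed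
qed

lemma has_mean_scale:
  assumes "has_mean X f c"
  shows "has_mean X (\<lambda>x. k * f x) (of_int k * c)"
proof (cases "k = 0")
  case True then show ?thesis by (auto simp: has_mean_def birkhoff_def)
next
  case False
  show ?thesis
    unfolding has_mean_def
  proof (intro allI impI)
    fix \<epsilon> :: real assume "0 < \<epsilon>"
    then have e: "0 < \<epsilon> / \<bar>real_of_int k\<bar>" using False by simp
    obtain M where M: "\<And>n x. n \<ge> M \<Longrightarrow> x \<in> points X \<Longrightarrow> \<bar>real_of_int (birkhoff X f n x) - real n * c\<bar> \<le> \<epsilon> / \<bar>real_of_int k\<bar> * real n"
      using assms e unfolding has_mean_def by blast
    show "\<exists>M. \<forall>n\<ge>M. \<forall>x\<in>points X. \<bar>real_of_int (birkhoff X (\<lambda>x. k * f x) n x) - real n * (of_int k * c)\<bar> \<le> \<epsilon> * real n"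
    proof (intro exI[of _ M] allI impI ballI)
      fix n x assume "n \<ge> M" "x \<in> points X"
      then have "\<bar>real_of_int k\<bar> * \<bar>real_of_int (birkhoff X f n x) - real n * c\<bar> \<le> \<bar>real_of_int k\<bar> * (\<epsilon> / \<bar>real_of_int k\<bar> * real n)"
        by (intro mult_left_mono M) auto
      also have "\<dots> = \<epsilon> * real n" using False by simp
      also have "\<bar>real_of_int k\<bar> * \<bar>real_of_int (birkhoff X f n x) - real n * c\<bar> = \<bar>real_of_int (birkhoff X (\<lambda>x. k * f x) n x) - real n * (of_int k * c)\<bar>"
      proof -
        have "real_of_int (birkhoff X (\<lambda>x. k * f x) n x) = real_of_int k * real_of_int (birkhoff X f n x)"
          by (simp add: birkhoff_def sum_distrib_left)
        then have "real_of_int (birkhoff X (\<lambda>x. k * f x) n x) - real n * (of_int k * c) = real_of_int k * (real_of_int (birkhoff X f n x) - real n * c)"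
          by (simp add: right_diff_distrib)
        then show ?thesis by (simp only: abs_mult)
      qed
      finally show "\<bar>real_of_int (birkhoff X (\<lambda>x. k * f x) n x) - real n * (of_int k * c)\<bar> \<le> \<epsilon> * real n" .
    qed
  qed
qed

lemma has_mean_const: "has_mean X (\<lambda>x. k) (of_int k)"
  by (auto simp: has_mean_def birkhoff_def)

lemma has_mean_diff:
  assumes "has_mean X f c" "has_mean X g c'"
  shows "has_mean X (\<lambda>x. f x - g x) (c - c')"
  using has_mean_add[OF assms(1) has_mean_scale[OF assms(2), of "- 1"]] by simp

lemma has_mean_nonneg:
  assumes "has_mean X f c" "\<And>x. x \<in> points X \<Longrightarrow> 0 \<le> f x"
  shows "0 \<le> c"
proof (rule ccontr)
  assume "\<not> 0 \<le> c"
  then have e: "0 < - c / 2" by simp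
  obtain M where M: "\<And>n x. n \<ge> M \<Longrightarrow> x \<in> points X \<Longrightarrow> \<bar>real_of_int (birkhoff X f n x) - real n * c\<bar> \<le> - c / 2 * real n"
    using assms(1) e unfolding has_mean_def by blast
  obtain x where x: "x \<in> points X" using points_nonempty by blast
  have "0 \<le> real_of_int (birkhoff X f (Suc M) x)"
    unfolding birkhoff_def by (simp add: sum_nonneg assms(2) sys_pow_in x del: sum.lessThan_Suc)
  moreover have "\<bar>real_of_int (birkhoff X f (Suc M) x) - real (Suc M) * c\<bar> \<le> - c / 2 * real (Suc M)"
    using M[of "Suc M" x] x by simp
  moreover have "- c / 2 * real (Suc M) = - (real (Suc M) * c) / 2" by (simp add: field_simps)
  ultimately have "real (Suc M) * c \<ge> 0" by linarith
  then show False using \<open>\<not> 0 \<le> c\<close> by (simp add: zero_le_mult_iff)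
qed

lemma has_mean_bounded_birkhoff:
  assumes "\<And>n x. x \<in> points X \<Longrightarrow> \<bar>real_of_int (birkhoff X f n x) - real n * c\<bar> \<le> B"
  shows "has_mean X f c"
  unfolding has_mean_def
proof (intro allI impI)
  fix \<epsilon> :: real assume e: "0 < \<epsilon>"
  obtain M :: nat where M: "B / \<epsilon> \<le> M" using real_arch_simple by blast
  have "B \<le> \<epsilon> * real n" if "n \<ge> M" for n
  proof -
    have "B / \<epsilon> \<le> n" using M that by linarith
    then show ?thesis using e by (simp add: field_simps)
  qed
  then show "\<exists>M. \<forall>n\<ge>M. \<forall>x\<in>points X. \<bar>real_of_int (birkhoff X f n x) - real n * c\<bar> \<le> \<epsilon> * real n"
    using assms order_trans by (intro exI[of _ M]) blast
qed

lemma has_mean_coboundary: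
  assumes "int_continuous X f"
  shows "has_mean X (\<lambda>x. f x - f (sys_map X x)) 0"
proof -
  obtain B where B: "\<And>x. x \<in> points X \<Longrightarrow> \<bar>f x\<bar> \<le> int B" using int_continuous_bounded[OF assms] by blast
  have "\<bar>real_of_int (birkhoff X (\<lambda>x. f x - f (sys_map X x)) n x) - real n * 0\<bar> \<le> 2 * real B" if x: "x \<in> points X" for n x
  proof -
    have "birkhoff X (\<lambda>x. f x - f (sys_map X x)) n x = f x - f ((sys_map X ^^ n) x)"
      by (induction n) (auto simp: birkhoff_def)
    then show ?thesis using B[OF x] B[OF sys_pow_in[OF x, of n]] by simp
  qed
  then show ?thesis by (rule has_mean_bounded_birkhoff)
qed

section \<open>The group of coinvariants\<close>

abbreviation "IF \<equiv> int_functions X"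

lemma IF_carrier: "f \<in> carrier IF \<longleftrightarrow> f \<in> extensional (points X) \<and> int_continuous X f"
  by (simp add: int_functions_def int_continuous_def)

lemma IF_restrict: "int_continuous X f \<Longrightarrow> restrict f (points X) \<in> carrier IF"
  unfolding IF_carrier by (simp cong: int_continuous_cong)

lemma IF_mult: "f \<otimes>\<^bsub>IF\<^esub> g = (\<lambda>x\<in>points X. f x + g x)"
  by (simp add: int_functions_def)

lemma IF_one: "\<one>\<^bsub>IF\<^esub> = (\<lambda>x\<in>points X. 0)"
  by (simp add: int_functions_def)

lemma IF_group: "comm_group IF"
proof (rule comm_groupI)
  fix f g assume "f \<in> carrier IF" "g \<in> carrier IF"
  then show "f \<otimes>\<^bsub>IF\<^esub> g \<in> carrier IF" unfolding IF_mult by (intro IF_restrict int_continuous_add) (auto simp: IF_carrier)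
next
  show "\<one>\<^bsub>IF\<^esub> \<in> carrier IF" unfolding IF_one by (intro IF_restrict) simp
next
  fix f assume f: "f \<in> carrier IF"
  then show "\<one>\<^bsub>IF\<^esub> \<otimes>\<^bsub>IF\<^esub> f = f" by (auto simp: IF_mult IF_one IF_carrier extensional_def)
  show "\<exists>g\<in>carrier IF. g \<otimes>\<^bsub>IF\<^esub> f = \<one>\<^bsub>IF\<^esub>"
    using f by (intro bexI[of _ "\<lambda>x\<in>points X. - 1 * f x"] IF_restrict int_continuous_scale)
      (auto simp: IF_mult IF_one IF_carrier)
qed (auto simp: IF_mult)

lemma coboundaries_subgroup: "subgroup (coboundaries X) IF"
proof -
  interpret G: comm_group IF by (rule IF_group)
  have cob: "(\<lambda>x\<in>points X. f x - f (sys_map X x)) \<in> carrier IF" if "f \<in> carrier IF" for f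
    using that by (intro IF_restrict int_continuous_diff int_continuous_compose[OF sys_map_cont]) (auto simp: IF_carrier)
  show ?thesis
  proof (rule G.subgroupI)
    show "coboundaries X \<subseteq> carrier IF" by (auto simp: coboundaries_def cob)
    show "coboundaries X \<noteq> {}" using G.one_closed by (auto simp: coboundaries_def)
  next
    fix a assume "a \<in> coboundaries X"
    then obtain f where f: "f \<in> carrier IF" "a = (\<lambda>x\<in>points X. f x - f (sys_map X x))"
      by (auto simp: coboundaries_def)
    define g where "g = (\<lambda>x\<in>points X. - 1 * f x)"
    have g: "g \<in> carrier IF" unfolding g_def using f by (intro IF_restrict int_continuous_scale) (auto simp: IF_carrier)
    define b where "b = (\<lambda>x\<in>points X. g x - g (sys_map X x))"
    have "b \<otimes>\<^bsub>IF\<^esub> a = \<one>\<^bsub>IF\<^esub>" by (auto simp: IF_mult IF_one b_def g_def f sys_map_in)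
    then have "inv\<^bsub>IF\<^esub> a = b" using cob[OF g] cob[OF f(1)] by (intro G.inv_equality) (auto simp: b_def f)
    then show "inv\<^bsub>IF\<^esub> a \<in> coboundaries X" using g by (auto simp: coboundaries_def b_def)
  next
    fix a b assume "a \<in> coboundaries X" "b \<in> coboundaries X"
    then obtain f g where f: "f \<in> carrier IF" "a = (\<lambda>x\<in>points X. f x - f (sys_map X x))"
      and g: "g \<in> carrier IF" "b = (\<lambda>x\<in>points X. g x - g (sys_map X x))"
      by (auto simp: coboundaries_def)
    have "a \<otimes>\<^bsub>IF\<^esub> b = (\<lambda>x\<in>points X. (f \<otimes>\<^bsub>IF\<^esub> g) x - (f \<otimes>\<^bsub>IF\<^esub> g) (sys_map X x))"
      by (auto simp: IF_mult f g sys_map_in)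
    then show "a \<otimes>\<^bsub>IF\<^esub> b \<in> coboundaries X" using f g G.m_closed unfolding coboundaries_def by blast
  qed
qed

lemma coboundaries_normal: "normal (coboundaries X) IF"
  using comm_group.subgroup_imp_normal[OF IF_group coboundaries_subgroup] by simp

lemma coinv_class_mult:
  "f \<in> carrier IF \<Longrightarrow> g \<in> carrier IF \<Longrightarrow>
     coinv_class X f \<otimes>\<^bsub>coinvariants X\<^esub> coinv_class X g = coinv_class X (f \<otimes>\<^bsub>IF\<^esub> g)"
  using normal.rcos_sum[OF coboundaries_normal, of f g] by (simp add: coinv_class_def coinvariants_def FactGroup_def)

lemma coinvariants_carrier: "carrier (coinvariants X) = coinv_class X ` carrier IF"
  by (auto simp: coinvariants_def FactGroup_def RCOSETS_def coinv_class_def)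

lemma coinv_class_iff:
  assumes "f \<in> carrier IF"
  shows "k \<in> coinv_class X f \<longleftrightarrow> (\<exists>w\<in>carrier IF. k = (\<lambda>x\<in>points X. f x + (w x - w (sys_map X x))))"
proof -
  have "(\<lambda>x\<in>points X. w x - w (sys_map X x)) \<otimes>\<^bsub>IF\<^esub> f = (\<lambda>x\<in>points X. f x + (w x - w (sys_map X x)))" for w
    by (rule ext) (simp add: IF_mult restrict_def)
  then show ?thesis
    by (simp add: coinv_class_def r_coset_def coboundaries_def)
qed

lemma coinv_class_self: "f \<in> carrier IF \<Longrightarrow> f \<in> coinv_class X f"
  unfolding coinv_class_def using coboundaries_subgroup
  by (intro group.rcos_self[OF comm_group.axioms(2)[OF IF_group]]) auto

lemma coinv_class_shift:
  assumes f: "f \<in> carrier IF"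
  shows "coinv_class X (\<lambda>x\<in>points X. f (sys_map X x)) = coinv_class X f"
proof -
  interpret G: comm_group IF by (rule IF_group)
  have sf: "(\<lambda>x\<in>points X. f (sys_map X x)) \<in> carrier IF"
    using f by (intro IF_restrict int_continuous_compose[OF sys_map_cont]) (auto simp: IF_carrier)
  have "f \<in> coinv_class X (\<lambda>x\<in>points X. f (sys_map X x))"
    unfolding coinv_class_iff[OF sf] using f
    by (intro bexI[of _ f]) (auto simp: IF_carrier extensional_def)
  then show ?thesis unfolding coinv_class_def
    using G.repr_independence[OF _ sf coboundaries_subgroup] by simp
qed

end

lemma circle_proj_eqE:
  assumes "circle_proj s = circle_proj t"
  obtains m where "s = t + of_int m"
  using assms unfolding circle_proj_eq_iff by (metis Ints_cases add.commute diff_add_cancel)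

section \<open>States and infinitesimals\<close>

context compact_system
begin

lemma real_group_simps: "carrier real_group = UNIV" "x \<otimes>\<^bsub>real_group\<^esub> y = x + y" "\<one>\<^bsub>real_group\<^esub> = 0"
  by (simp_all add: real_group_def)

text \<open>A state does not distinguish f from its shifts, so n times its value on f is its value
  on the n-th Birkhoff sum. Positivity squeezes the latter between integers close to n c.\<close>

lemma state_eq_mean:
  assumes st: "is_state X \<tau>" and f: "f \<in> carrier IF" and mean: "has_mean X f c"
  shows "\<tau> (coinv_class X f) = c"
proof -
  define t where "t f = \<tau> (coinv_class X f)" for f
  have hom: "\<tau> \<in> hom (coinvariants X) real_group" and one: "t (\<lambda>x\<in>points X. 1) = 1"
    and pos: "\<And>f. f \<in> carrier IF \<Longrightarrow> (\<forall>x\<in>points X. 0 \<le> f x) \<Longrightarrow> 0 \<le> t f"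
    using st by (auto simp: is_state_def t_def)
  have add: "t (f \<otimes>\<^bsub>IF\<^esub> g) = t f + t g" if "f \<in> carrier IF" "g \<in> carrier IF" for f g
    using hom_mult[OF hom, of "coinv_class X f" "coinv_class X g"] that
    by (simp add: t_def coinv_class_mult coinvariants_carrier real_group_simps)
  have add': "t (\<lambda>x\<in>points X. f x + g x) = t f + t g" if "f \<in> carrier IF" "g \<in> carrier IF" for f g
    using add[OF that] by (simp add: IF_mult)
  have const_in: "(\<lambda>x\<in>points X. k) \<in> carrier IF" for k by (rule IF_restrict) simp
  have const_add: "t (\<lambda>x\<in>points X. j + k) = t (\<lambda>x\<in>points X. j) + t (\<lambda>x\<in>points X. k)" for j k
  proof -
    have "(\<lambda>x\<in>points X. j + k) = (\<lambda>x\<in>points X. (\<lambda>x\<in>points X. j) x + (\<lambda>x\<in>points X. k) x)" by auto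
    then show ?thesis using add'[OF const_in const_in, of j k] by simp
  qed
  define q where "q k = t (\<lambda>x\<in>points X. k)" for k
  have q_add: "q (j + k) = q j + q k" for j k unfolding q_def by (rule const_add)
  have q_eq: "q k = of_int k" for k
  proof (induction k rule: int_induct[of _ 0])
    case base then show ?case using q_add[of 0 0] by simp
  next
    case (step1 i) then show ?case using q_add[of i 1] one by (simp add: q_def)
  next
    case (step2 i) then show ?case using q_add[of "i - 1" 1] one by (simp add: q_def)
  qed
  have const: "t (\<lambda>x\<in>points X. k) = of_int k" for k using q_eq[of k] unfolding q_def .
  define P where "P n = (\<lambda>x\<in>points X. f ((sys_map X ^^ n) x))" for n
  have P: "P n \<in> carrier IF \<and> t (P n) = t f" for n
  proof (induction n)
    case 0
    have "P 0 = f" using f by (auto simp: P_def IF_carrier extensional_def)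
    then show ?case using f by simp
  next
    case (Suc n)
    have "P (Suc n) = (\<lambda>x\<in>points X. P n (sys_map X x))"
      by (auto simp: P_def sys_map_in funpow_swap1)
    moreover from Suc have "(\<lambda>x\<in>points X. P n (sys_map X x)) \<in> carrier IF"
      by (intro IF_restrict int_continuous_compose[OF sys_map_cont]) (auto simp: IF_carrier)
    ultimately show ?case using Suc coinv_class_shift[of "P n"] unfolding t_def by metis
  qed
  define B where "B n = (\<lambda>x\<in>points X. birkhoff X f n x)" for n
  have B: "B n \<in> carrier IF \<and> t (B n) = real n * t f" for n
  proof (induction n)
    case 0
    have e: "B 0 = (\<lambda>x\<in>points X. 0)" by (auto simp: B_def birkhoff_def)
    show ?case unfolding e using const_in[of 0] const[of 0]
      by (simp only: of_nat_0 mult_zero_left of_int_0 simp_thms)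
  next
    case (Suc n)
    have e: "B (Suc n) = (\<lambda>x\<in>points X. B n x + P n x)" by (auto simp: B_def P_def birkhoff_def)
    have "B (Suc n) \<in> carrier IF"
      unfolding e using Suc P[of n] by (intro IF_restrict int_continuous_add) (auto simp: IF_carrier)
    moreover have "t (B (Suc n)) = t (B n) + t (P n)"
      unfolding e using Suc P[of n] by (intro add') auto
    ultimately show ?case using Suc P[of n] by (simp add: algebra_simps)
  qed
  have le: "t g \<le> of_int k" if g: "g \<in> carrier IF" "\<And>x. x \<in> points X \<Longrightarrow> g x \<le> k" for g k
  proof -
    define g' where "g' = (\<lambda>x\<in>points X. k - g x)"
    have g': "g' \<in> carrier IF" unfolding g'_def using g(1) by (intro IF_restrict int_continuous_diff) (auto simp: IF_carrier)
    have "(\<lambda>x\<in>points X. g x + g' x) = (\<lambda>x\<in>points X. k)" by (auto simp: g'_def)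
    then have "t g + t g' = of_int k" using add'[OF g(1) g'] const[of k] by simp
    moreover have "0 \<le> t g'" using g' g by (intro pos) (auto simp: g'_def)
    ultimately show ?thesis by simp
  qed
  have ge: "of_int k \<le> t g" if g: "g \<in> carrier IF" "\<And>x. x \<in> points X \<Longrightarrow> k \<le> g x" for g k
  proof -
    define g' where "g' = (\<lambda>x\<in>points X. g x - k)"
    have g': "g' \<in> carrier IF" unfolding g'_def using g(1) by (intro IF_restrict int_continuous_diff) (auto simp: IF_carrier)
    have "(\<lambda>x\<in>points X. g' x + (\<lambda>x\<in>points X. k) x) = g" using g(1) by (auto simp: g'_def IF_carrier extensional_def)
    then have "t g' + of_int k = t g" using add'[OF g' const_in, of k] const[of k] by simp
    moreover have "0 \<le> t g'" using g' g by (intro pos) (auto simp: g'_def)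
    ultimately show ?thesis by simp
  qed
  have "\<bar>t f - c\<bar> \<le> \<epsilon>" if e: "0 < \<epsilon>" for \<epsilon>
  proof -
    have e2: "0 < \<epsilon> / 2" using e by simp
    obtain M where M: "\<And>n x. n \<ge> M \<Longrightarrow> x \<in> points X \<Longrightarrow> \<bar>real_of_int (birkhoff X f n x) - real n * c\<bar> \<le> \<epsilon> / 2 * real n"
      using mean e2 unfolding has_mean_def by blast
    \<comment> \<open>The bounds available for a state are integers, so rounding costs up to 1; this
      choice of n gives 1 \<le> \<epsilon> n / 2.\<close>
    obtain M' :: nat where M': "2 / \<epsilon> \<le> M'" using real_arch_simple by blast
    define n where "n = Suc (max M M')"
    have "2 / \<epsilon> \<le> real n" using M' by (simp add: n_def)
    then have "2 / \<epsilon> * \<epsilon> \<le> real n * \<epsilon>" using e by (intro mult_right_mono) auto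
    moreover have "2 / \<epsilon> * \<epsilon> = 2" using e by simp
    ultimately have n2: "1 \<le> \<epsilon> / 2 * real n" by (simp add: mult.commute)
    have nM: "n \<ge> M" by (simp add: n_def)
    define e where "e = \<epsilon> / 2 * real n"
    define y where "y = real n * c"
    have b: "\<bar>real_of_int (birkhoff X f n x) - y\<bar> \<le> e" if "x \<in> points X" for x
      using M[OF nM that] by (simp only: e_def y_def)
    have tB: "B n \<in> carrier IF" "t (B n) = real n * t f" using B[of n] by auto
    have "B n x \<le> \<lceil>y + e\<rceil>" if "x \<in> points X" for x
    proof -
      have "real_of_int (B n x) \<le> y + e" using b[OF that] that by (simp add: B_def abs_le_iff)
      then show ?thesis by (simp add: le_ceiling_iff)
    qed
    then have "t (B n) \<le> \<lceil>y + e\<rceil>" by (intro le tB)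
    then have up: "real n * t f \<le> y + e + 1"
      using of_int_ceiling_le_add_one[of "y + e"] tB(2) by linarith
    have "\<lfloor>y - e\<rfloor> \<le> B n x" if "x \<in> points X" for x
    proof -
      have "y - e \<le> real_of_int (B n x)" using b[OF that] that by (simp add: B_def abs_le_iff)
      then show ?thesis by (simp add: floor_le_iff)
    qed
    then have "\<lfloor>y - e\<rfloor> \<le> t (B n)" by (intro ge tB)
    then have lo: "y - e - 1 \<le> real n * t f"
      using real_of_int_floor_ge_diff_one[of "y - e"] tB(2) by linarith
    have e1: "1 \<le> e" "real n * \<epsilon> = 2 * e" using n2 by (simp_all add: e_def)
    have "real n * \<bar>t f - c\<bar> = \<bar>real n * t f - real n * c\<bar>" 
      unfolding right_diff_distrib[symmetric] abs_mult by (simp only: abs_of_nat)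
    also have "\<dots> \<le> real n * \<epsilon>" using up lo e1 unfolding y_def[symmetric] by linarith
    finally have "real n * \<bar>t f - c\<bar> \<le> real n * \<epsilon>" .
    moreover have "0 < real n" unfolding n_def by (simp only: of_nat_0_less_iff zero_less_Suc)
    ultimately show ?thesis by (rule mult_le_cancel_left_pos[THEN iffD1, rotated])
  qed
  note le_eps = this
  have "\<bar>t f - c\<bar> \<le> 0"
  proof (rule field_le_epsilon)
    fix e :: real assume "0 < e"
    then show "\<bar>t f - c\<bar> \<le> 0 + e" using le_eps[of e] by linarith
  qed
  then show ?thesis by (simp add: t_def)
qed

lemma infinitesimalI:
  assumes f: "f \<in> carrier IF" and mean: "has_mean X f 0"
  shows "coinv_class X f \<in> infinitesimals X"
  using state_eq_mean[OF _ f mean] f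
  by (auto simp: infinitesimals_def kernel_def coinvariants_carrier real_group_simps)

text \<open>If all means exist, the mean is itself a state, and an infinitesimal is in its
  kernel.\<close>

lemma infinitesimal_has_mean_0:
  assumes ue: "\<And>f. f \<in> carrier IF \<Longrightarrow> \<exists>c. has_mean X f c"
    and f: "f \<in> carrier IF" and inf: "coinv_class X f \<in> infinitesimals X"
  shows "has_mean X f 0"
proof -
  define m where "m f = (THE c. has_mean X f c)" for f
  have m: "has_mean X f (m f)" if "f \<in> carrier IF" for f
    unfolding m_def using ue[OF that] has_mean_unique by (metis theI')
  have m_eq: "m f = c" if "has_mean X f c" for f c
    unfolding m_def using that has_mean_unique by blast
  \<comment> \<open>States act on cosets; the value is the mean shared by all representatives, which
    exists because coboundaries have mean 0.\<close>
  define \<tau> where "\<tau> g = (THE c. \<exists>f\<in>g. f \<in> carrier IF \<and> has_mean X f c)" for g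
  have \<tau>: "\<tau> (coinv_class X f) = m f" if f: "f \<in> carrier IF" for f
    unfolding \<tau>_def
  proof (rule the_equality)
    show "\<exists>k\<in>coinv_class X f. k \<in> carrier IF \<and> has_mean X k (m f)"
      using coinv_class_self[OF f] m[OF f] f by blast
  next
    fix c assume "\<exists>k\<in>coinv_class X f. k \<in> carrier IF \<and> has_mean X k c"
    then obtain k w where w: "w \<in> carrier IF" "k = (\<lambda>x\<in>points X. f x + (w x - w (sys_map X x)))" "has_mean X k c"
      using coinv_class_iff[OF f] by auto
    have "has_mean X (\<lambda>x. f x + (w x - w (sys_map X x))) c" using w(2,3) by (simp cong: has_mean_cong)
    moreover have "has_mean X (\<lambda>x. f x + (w x - w (sys_map X x))) (m f + 0)"
      using w by (intro has_mean_add m f has_mean_coboundary) (auto simp: IF_carrier)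
    ultimately show "c = m f" using has_mean_unique by fastforce
  qed
  have "is_state X \<tau>"
    unfolding is_state_def
  proof (intro conjI ballI impI)
    show "\<tau> \<in> hom (coinvariants X) real_group"
    proof (rule homI)
      fix a b assume "a \<in> carrier (coinvariants X)" "b \<in> carrier (coinvariants X)"
      then obtain f g where fg: "f \<in> carrier IF" "g \<in> carrier IF" "a = coinv_class X f" "b = coinv_class X g"
        by (auto simp: coinvariants_carrier)
      have "has_mean X (f \<otimes>\<^bsub>IF\<^esub> g) (m f + m g)"
        using has_mean_add[OF m m, OF fg(1,2)] by (simp add: IF_mult cong: has_mean_cong)
      then have "m (f \<otimes>\<^bsub>IF\<^esub> g) = m f + m g" by (rule m_eq)
      moreover have "f \<otimes>\<^bsub>IF\<^esub> g \<in> carrier IF"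
        using fg comm_group.axioms(2)[OF IF_group] by (simp add: group.subgroup_self subgroup.m_closed)
      ultimately show "\<tau> (a \<otimes>\<^bsub>coinvariants X\<^esub> b) = \<tau> a \<otimes>\<^bsub>real_group\<^esub> \<tau> b"
        by (simp add: fg coinv_class_mult \<tau> real_group_simps)
    qed (simp add: real_group_simps)
    have "(\<lambda>x\<in>points X. 1) \<in> carrier IF" by (rule IF_restrict) simp
    moreover have "has_mean X (\<lambda>x\<in>points X. 1) 1" using has_mean_const[of 1] unfolding of_int_1 by (simp cong: has_mean_cong)
    ultimately show "\<tau> (coinv_class X (\<lambda>x\<in>points X. 1)) = 1" by (simp add: \<tau> m_eq)
  next
    fix f assume f: "f \<in> carrier IF" "\<forall>x\<in>points X. 0 \<le> f x"
    then have "0 \<le> m f" using has_mean_nonneg[OF m] by blast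
    then show "0 \<le> \<tau> (coinv_class X f)" by (simp add: \<tau> f)
  qed
  then have "\<tau> (coinv_class X f) = 0"
    using inf by (auto simp: infinitesimals_def kernel_def real_group_simps)
  then show ?thesis using m[OF f] by (simp add: \<tau> f)
qed

end

section \<open>Split systems\<close>

text \<open>In coordinates this is a \<mapsto> \<kappa> a + \<mu> with the side kept. It is well
  defined because the target splits only images of split points; it is monotone and onto, hence
  continuous. Slopes other than 1 occur between suspensions.\<close>

lemma monotone_transfer:
  assumes "degree_one h" "degree_one h'" "0 < \<kappa>"
    and gaps: "\<And>a. \<kappa> * a + \<mu> \<in> gap_values h' \<Longrightarrow> a \<in> gap_values h"
  obtains T where "continuous_on (growth_points h) T"
    "\<And>s a. T (side_pt h s a) = side_pt h' s (\<kappa> * a + \<mu>)"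
proof -
  interpret A: degree_one h by fact
  interpret B: degree_one h' by fact
  define T where "T t = side_pt h' (t = right_pt h (h t)) (\<kappa> * h t + \<mu>)" for t
  have T: "T (side_pt h s a) = side_pt h' s (\<kappa> * a + \<mu>)" for s a
  proof (cases "a \<in> gap_values h")
    case True
    then have "left_pt h a \<noteq> right_pt h a" by (simp add: gap_values_def)
    then show ?thesis by (auto simp: T_def side_pt_def)
  next
    case False
    then have "\<kappa> * a + \<mu> \<notin> gap_values h'" using gaps by blast
    then show ?thesis unfolding T_def by (simp only: A.h_side) (rule B.nongap)
  qed
  have hT: "h' (T t) = \<kappa> * h t + \<mu>" for t by (simp add: T_def)
  have "continuous_on (growth_points h) T"
  proof (rule mono_surj_continuous[OF _ _ B.growth_closed])
    fix x y assume xy: "x \<in> growth_points h" "y \<in> growth_points h" "x \<le> y"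
    obtain s where s1: "x = side_pt h s (h x)" using A.growthE[OF xy(1)] .
    obtain s' where s2: "y = side_pt h s' (h y)" using A.growthE[OF xy(2)] .
    note s = s1 s2
    show "T x \<le> T y"
    proof (cases "h x = h y")
      case True
      show ?thesis
      proof (cases "T x = T y")
        case ne: False
        have Ts: "T x = side_pt h' s (\<kappa> * h x + \<mu>)" "T y = side_pt h' s' (\<kappa> * h y + \<mu>)"
          using T[of s "h x"] T[of s' "h y"] s by simp_all
        have "s \<noteq> s'"
        proof
          assume "s = s'"
          then show False using Ts ne True by simp
        qed
        moreover have "\<not> (s \<and> \<not> s')"
        proof
          assume "s \<and> \<not> s'"
          then have "right_pt h (h x) \<le> left_pt h (h x)" using s True xy(3) by (simp add: side_pt_def)
          then have "h x \<notin> gap_values h" by (simp add: gap_values_def)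
          then have "\<kappa> * h x + \<mu> \<notin> gap_values h'" using gaps by blast
          then have "side_pt h' s (\<kappa> * h x + \<mu>) = side_pt h' s' (\<kappa> * h x + \<mu>)" by (rule B.nongap)
          then show False using ne Ts True by simp
        qed
        ultimately have "\<not> s" "s'" by blast+
        then show ?thesis using Ts True B.left_le_right by (simp add: side_pt_def)
      qed simp
    next
      case False
      then have "h x < h y" using A.h_mono[OF xy(3)] by simp
      then have "h' (T x) < h' (T y)" using assms(3) by (simp add: hT)
      then show ?thesis using B.h_less_imp by fastforce
    qed
  next
    show "T ` growth_points h = growth_points h'"
    proof (intro equalityI subsetI)
      fix y assume "y \<in> growth_points h'"
      then obtain s where "y = side_pt h' s (h' y)" by (rule B.growthE)
      then have "y = T (side_pt h s ((h' y - \<mu>) / \<kappa>))" using assms(3) by (simp add: T)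
      then show "y \<in> T ` growth_points h" by (metis A.side_in_growth imageI)
    next
      fix y assume "y \<in> T ` growth_points h"
      then show "y \<in> growth_points h'" by (auto simp: T_def)
    qed
  next
    fix y
    have "{x \<in> growth_points h. T x = y} \<subseteq> range (\<lambda>s. side_pt h s ((h' y - \<mu>) / \<kappa>))"
    proof
      fix x assume x: "x \<in> {x \<in> growth_points h. T x = y}"
      then have "h x = (h' y - \<mu>) / \<kappa>" using hT[of x] assms(3) by (auto simp: field_simps)
      moreover obtain s where "x = side_pt h s (h x)" using x by (auto elim: A.growthE)
      ultimately show "x \<in> range (\<lambda>s. side_pt h s ((h' y - \<mu>) / \<kappa>))" by (metis rangeI)
    qed
    then show "finite {x \<in> growth_points h. T x = y}" by (rule finite_subset) simp
  qed
  then show thesis using T that by blast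
qed

text \<open>With slope 1 the map on the line commutes with integer translations and so descends to
  the circle.\<close>

lemma circle_transfer:
  assumes "degree_one h" "degree_one h'"
    and gaps: "\<And>a. a + \<mu> \<in> gap_values h' \<Longrightarrow> a \<in> gap_values h"
  obtains p where "continuous_on (circle_proj ` growth_points h) p"
    "\<And>s a. p (split_pt h s a) = split_pt h' s (a + \<mu>)"
proof -
  interpret A: degree_one h by fact
  interpret B: degree_one h' by fact
  obtain T where T: "continuous_on (growth_points h) T" "\<And>s a. T (side_pt h s a) = side_pt h' s (1 * a + \<mu>)"
    using monotone_transfer[OF assms(1,2), of 1 \<mu>] gaps by auto
  define p where "p w = circle_proj (T (SOME t. t \<in> growth_points h \<and> circle_proj t = w))" for w
  have p: "p (circle_proj t) = circle_proj (T t)" if t: "t \<in> growth_points h" for t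
  proof -
    let ?u = "SOME u. u \<in> growth_points h \<and> circle_proj u = circle_proj t"
    have u: "?u \<in> growth_points h \<and> circle_proj ?u = circle_proj t" by (rule someI[of _ t]) (simp add: t)
    obtain s where s: "t = side_pt h s (h t)" using A.growthE[OF t] .
    obtain m where m: "?u = t + of_int m" using u circle_proj_eqE[of ?u t] by blast
    have "t + of_int m = side_pt h s (h t + of_int m)" unfolding A.side_add_int s[symmetric] ..
    then have "T (t + of_int m) = side_pt h' s (1 * (h t + of_int m) + \<mu>)" using T(2) by metis
    also have "1 * (h t + of_int m) + \<mu> = (h t + \<mu>) + of_int m" by simp
    also have "side_pt h' s \<dots> = side_pt h' s (h t + \<mu>) + of_int m" by (rule B.side_add_int)
    also have "side_pt h' s (h t + \<mu>) = T t" using T(2)[of s "h t"] s by simp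
    finally show ?thesis unfolding p_def m by simp
  qed
  show thesis
  proof (rule that[of p])
    show "continuous_on (circle_proj ` growth_points h) p"
      by (rule continuous_on_circle_quotient[OF A.growth_closed _ continuous_on_circle_proj[OF T(1)]])
        (simp_all add: A.growth_add_int p)
    show "p (split_pt h s a) = split_pt h' s (a + \<mu>)" for s a
      by (simp add: split_pt_def p T(2))
  qed
qed

text \<open>The pair of h and \<alpha> presents the system without being determined by it: h may be
  shifted by a constant, and \<alpha> changed by an integer.\<close>

locale split_system = split_map h \<alpha> for h \<alpha> +
  fixes X :: "complex system"
  assumes space: "fst X = submetric euclidean_metric (circle_proj ` growth_points h)"
    and sys_map_split: "\<And>s a. sys_map X (split_pt h s a) = split_pt h s (a + \<alpha>)"
begin

lemma points_eq: "points X = circle_proj ` growth_points h"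
  by (simp add: space)

lemma points_split: "points X = {split_pt h s a | s a. True}"
  by (simp add: points_eq image_growth)

lemma split_in_points [simp]: "split_pt h s a \<in> points X"
  by (auto simp: points_split)

lemma pointsE:
  assumes "x \<in> points X"
  obtains s a where "x = split_pt h s a"
  using assms by (auto simp: points_split)

lemma top_eq: "sys_top X = top_of_set (circle_proj ` growth_points h)"
  by (simp add: space mtopology_of_submetric)

lemma mdist_eq: "mdist (fst X) = dist"
  by (simp add: space)

lemma degree_one: "degree_one h" ..

lemma compact_space: "compact_space (sys_top X)"
  unfolding top_eq using compact_image_growth by (simp add: compact_space_subtopology)

lemma is_system: "is_system X"
proof -
  obtain p where p: "continuous_on (circle_proj ` growth_points h) p" "\<And>s a. p (split_pt h s a) = split_pt h s (a + \<alpha>)"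
    using circle_transfer[OF degree_one degree_one, of \<alpha>] gaps_invariant by blast
  have eq: "sys_map X x = p x" if "x \<in> circle_proj ` growth_points h" for x
  proof -
    obtain s a where "x = split_pt h s a" using \<open>x \<in> circle_proj ` growth_points h\<close> unfolding image_growth by blast
    then show ?thesis by (simp add: p(2) sys_map_split)
  qed
  have "continuous_on (circle_proj ` growth_points h) (sys_map X)"
    by (rule continuous_on_eq[OF p(1)]) (simp add: eq)
  moreover have maps: "sys_map X x \<in> circle_proj ` growth_points h" if "x \<in> circle_proj ` growth_points h" for x
  proof -
    obtain s a where "x = split_pt h s a" using \<open>x \<in> circle_proj ` growth_points h\<close> unfolding image_growth by blast
    then show ?thesis using split_in_points[of s "a + \<alpha>"] by (simp add: sys_map_split points_eq)
  qed
  ultimately have cont: "continuous_map (sys_top X) (sys_top X) (sys_map X)"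
    unfolding top_eq continuous_map_in_subtopology by (simp add: image_subset_iff)
  have surj: "sys_map X ` topspace (sys_top X) = topspace (sys_top X)"
  proof -
    have "x \<in> sys_map X ` points X" if x: "x \<in> points X" for x
    proof -
      obtain s a where "x = split_pt h s a" using pointsE[OF x] .
      then have "x = sys_map X (split_pt h s (a - \<alpha>))" by (simp add: sys_map_split)
      then show ?thesis by simp
    qed
    then show ?thesis using maps by (auto simp: points_eq[symmetric])
  qed
  have inj: "inj_on (sys_map X) (topspace (sys_top X))"
  proof (rule inj_onI)
    fix x y assume xy: "x \<in> topspace (sys_top X)" "y \<in> topspace (sys_top X)" and eq: "sys_map X x = sys_map X y"
    obtain s a where x: "x = split_pt h s a" using xy(1) pointsE by auto
    obtain s' a' where y: "y = split_pt h s' a'" using xy(2) pointsE by auto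
    show "x = y" using eq unfolding x y sys_map_split split_eq_iff gaps_invariant by simp
  qed
  have "Hausdorff_space (sys_top X)" unfolding top_eq by (simp add: Hausdorff_space_subtopology)
  then have "homeomorphic_map (sys_top X) (sys_top X) (sys_map X)"
    using continuous_imp_homeomorphic_map[OF cont compact_space _ surj inj] by simp
  moreover have "points X \<noteq> {}" using split_in_points by blast
  ultimately show ?thesis using compact_space by (simp add: is_system_def)
qed

sublocale compact_system X
  by standard (rule is_system)

lemma sys_pow_split: "(sys_map X ^^ k) (split_pt h s a) = split_pt h s (a + of_nat k * \<alpha>)"
  by (induction k) (auto simp: sys_map_split algebra_simps)

lemma sys_iter_split: "sys_iter X n (split_pt h s a) = split_pt h s (a + of_int n * \<alpha>)"
proof (induction n rule: int_induct[of _ 0])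
  case (step1 i)
  then show ?case using sys_iter_Suc[of "split_pt h s a" i] by (simp add: sys_map_split algebra_simps)
next
  case (step2 i)
  have "sys_map X (sys_iter X (i - 1) (split_pt h s a)) = sys_map X (split_pt h s (a + of_int (i - 1) * \<alpha>))"
    using step2 sys_iter_Suc[of "split_pt h s a" "i - 1"] by (simp add: sys_map_split algebra_simps)
  then show ?case using bij_betw_imp_inj_on[OF sys_map_bij] by (elim inj_onD) (simp_all add: sys_iter_in)
qed simp

lemma int_continuous_eq: "int_continuous X f \<longleftrightarrow> continuous_on (circle_proj ` growth_points h) (\<lambda>x. real_of_int (f x))"
  unfolding int_continuous_def top_eq by (rule continuous_on_discrete_iff)

text \<open>Continuous integer-valued functions on a split system are step functions: linear combinations
  of the floor functions based at finitely many gap values.\<close>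

definition jump_form ::
    "(complex \<Rightarrow> int) \<Rightarrow> int \<Rightarrow> nat \<Rightarrow> (nat \<Rightarrow> int) \<Rightarrow> (nat \<Rightarrow> real) \<Rightarrow> bool" where
  "jump_form f c N d b \<longleftrightarrow> (\<forall>i<N. b i \<in> gap_values h) \<and> (\<Sum>i<N. d i) = 0 \<and>
     (\<forall>s a. f (split_pt h s a) = c + (\<Sum>i<N. d i * fl s (a - b i)))"

lemma exists_jump_form:
  assumes "int_continuous X f"
  shows "\<exists>c N d b. jump_form f c N d b"
proof (rule int_function_form[OF assms[unfolded int_continuous_eq]])
  fix b :: "nat \<Rightarrow> real" and N :: nat and d :: "nat \<Rightarrow> int" and c :: int
  assume "\<And>i. b i \<in> gap_values h" "(\<Sum>i<N. d i) = 0"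
    "\<And>s a. f (split_pt h s a) = c + (\<Sum>i<N. d i * fl s (a - b i))"
  then have "jump_form f c N d b" by (simp add: jump_form_def)
  then show ?thesis by blast
qed

lemma jump_form_has_mean:
  assumes "jump_form f c N d b"
  shows "has_mean X f (of_int c - (\<Sum>i<N. of_int (d i) * b i))"
  unfolding has_mean_def
proof (intro allI impI)
  fix \<epsilon> :: real assume \<epsilon>: "0 < \<epsilon>"
  have d: "(\<Sum>i<N. d i) = 0" and f: "\<And>s a. f (split_pt h s a) = c + (\<Sum>i<N. d i * fl s (a - b i))"
    using assms by (auto simp: jump_form_def)
  obtain M where M: "\<And>n s a. n \<ge> M \<Longrightarrow> \<bar>(\<Sum>k<n. \<Sum>i<N. real_of_int (d i * fl s (a + of_nat k * \<alpha> - b i)))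
           + real n * (\<Sum>i<N. of_int (d i) * b i)\<bar> \<le> \<epsilon> * real n"
    using fl_combination_mean[OF irrational \<epsilon> d] by blast
  show "\<exists>M. \<forall>n\<ge>M. \<forall>x\<in>points X. \<bar>real_of_int (birkhoff X f n x) - real n * (of_int c - (\<Sum>i<N. of_int (d i) * b i))\<bar> \<le> \<epsilon> * real n"
  proof (intro exI[of _ M] allI impI ballI)
    fix n x assume n: "M \<le> n" and "x \<in> points X"
    then obtain s a where x: "x = split_pt h s a" by (auto elim: pointsE)
    have "real_of_int (birkhoff X f n x) = real n * c + (\<Sum>k<n. \<Sum>i<N. real_of_int (d i * fl s (a + of_nat k * \<alpha> - b i)))"
      by (simp add: birkhoff_def x sys_pow_split f sum.distrib)
    then show "\<bar>real_of_int (birkhoff X f n x) - real n * (of_int c - (\<Sum>i<N. of_int (d i) * b i))\<bar> \<le> \<epsilon> * real n"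
      using M[OF n, of s a] unfolding right_diff_distrib by linarith
  qed
qed

lemma exists_mean: "int_continuous X f \<Longrightarrow> \<exists>c. has_mean X f c"
  using exists_jump_form jump_form_has_mean by blast

text \<open>Two cuts in gaps close to the point divide the circle into two closed arcs whose traces
  on the Cantor set are disjoint, hence clopen.\<close>

lemma zero_dimensional: "zero_dimensional X"
  unfolding zero_dimensional_def
proof (intro allI impI, elim conjE)
  fix U x assume U: "openin (sys_top X) U" and x: "x \<in> U"
  then obtain O' where O: "open O'" "U = circle_proj ` growth_points h \<inter> O'"
    by (auto simp: top_eq openin_open)
  then obtain t where t: "t \<in> growth_points h" "x = circle_proj t" using x by auto
  obtain \<epsilon> where e: "\<epsilon> > 0" "ball x \<epsilon> \<subseteq> O'" using O x open_contains_ball by blast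
  obtain \<delta> where d: "\<delta> > 0" "\<And>s t. \<bar>s - t\<bar> < \<delta> \<Longrightarrow> dist (circle_proj s) (circle_proj t) < \<epsilon>"
    using circle_proj_close[OF e(1)] by blast
  define \<eta> where "\<eta> = min \<delta> (1 / 2)"
  have \<eta>: "0 < \<eta>" "\<eta> \<le> \<delta>" "\<eta> \<le> 1 / 2" using d by (auto simp: \<eta>_def)
  obtain z where z: "z \<notin> growth_points h" "t - \<eta> < z" "z < t" using growth_nowhere_dense[of "t - \<eta>" t] \<eta> by auto
  obtain z' where z': "z' \<notin> growth_points h" "t < z'" "z' < t + \<eta>" using growth_nowhere_dense[of t "t + \<eta>"] \<eta> by auto
  define V where "V = circle_proj ` (growth_points h \<inter> {z..z'})"
  define W where "W = circle_proj ` (growth_points h \<inter> {z'..z + 1})"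
  have cl: "closed (circle_proj ` (growth_points h \<inter> {a..b}))" for a b
    by (intro compact_imp_closed compact_continuous_image closed_Int_compact growth_closed continuous_on_circle_proj continuous_on_id compact_Icc)
  have union: "circle_proj ` growth_points h = V \<union> W"
  proof (intro equalityI subsetI)
    fix w assume "w \<in> circle_proj ` growth_points h"
    then obtain u where u: "u \<in> growth_points h" "w = circle_proj u" by auto
    define u' where "u' = u + of_int (- \<lfloor>u - z\<rfloor>)"
    have "u' \<in> growth_points h" unfolding u'_def growth_add_int by (rule u)
    moreover have "z \<le> u'" "u' \<le> z + 1" unfolding u'_def by (simp; linarith)+
    moreover have "w = circle_proj u'" using u by (simp add: u'_def circle_proj_eq_iff)
    ultimately show "w \<in> V \<union> W" by (cases "u' \<le> z'") (auto simp: V_def W_def)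
  qed (auto simp: V_def W_def)
  have disj: "V \<inter> W = {}"
  proof (rule ccontr)
    assume "V \<inter> W \<noteq> {}"
    then obtain u v where uv: "u \<in> growth_points h" "v \<in> growth_points h" "z \<le> u" "u \<le> z'" "z' \<le> v" "v \<le> z + 1" "circle_proj u = circle_proj v"
      by (auto simp: V_def W_def)
    obtain m where m: "v = u + of_int m" using circle_proj_eqE[OF uv(7)[symmetric]] .
    have "u \<noteq> z" "u \<noteq> z'" "v \<noteq> z'" "v \<noteq> z + 1" using uv z(1) z'(1) growth_add_int[of z 1] by auto
    then have "0 < real_of_int m" "real_of_int m < 1" using uv m by linarith+
    then show False by simp
  qed
  have "closedin (sys_top X) V" unfolding top_eq using cl[of z z'] union by (intro closed_subset) (auto simp: V_def)
  moreover have "closedin (sys_top X) W" unfolding top_eq using cl[of z' "z + 1"] union by (intro closed_subset) (auto simp: W_def)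
  then have "openin (sys_top X) V"
  proof -
    have "V = topspace (sys_top X) - W" using union disj by (auto simp: top_eq)
    then show ?thesis using \<open>closedin (sys_top X) W\<close> by (simp only:) (rule openin_diff[OF openin_topspace])
  qed
  moreover have "x \<in> V" using t z z' by (auto simp: V_def)
  moreover have "V \<subseteq> U"
  proof
    fix w assume "w \<in> V"
    then obtain u where u: "u \<in> growth_points h" "z \<le> u" "u \<le> z'" "w = circle_proj u" by (auto simp: V_def)
    then have "dist x w < \<epsilon>" using t z z' \<eta> by (auto intro!: d)
    then show "w \<in> U" using e u O by auto
  qed
  ultimately show "\<exists>V. openin (sys_top X) V \<and> closedin (sys_top X) V \<and> x \<in> V \<and> V \<subseteq> U" by blast
qed

lemma power_split_system:
  assumes "0 < m"
  shows "split_system h (of_nat m * \<alpha>) (sys_power X m)"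
proof
  show "of_nat m * \<alpha> \<notin> \<rat>" using irrational_mult_int[OF irrational, of "int m"] assms by auto
  show "gap_values h \<noteq> {}" by (rule gaps_nonempty)
  show "a + of_nat m * \<alpha> \<in> gap_values h \<longleftrightarrow> a \<in> gap_values h" for a
    using gap_add_alpha[of a "int m"] by simp
  show "fst (sys_power X m) = submetric euclidean_metric (circle_proj ` growth_points h)"
    by (simp add: sys_power_def space)
  show "sys_map (sys_power X m) (split_pt h s a) = split_pt h s (a + of_nat m * \<alpha>)" for s a
    by (simp add: sys_power_def sys_pow_split)
qed

end

section \<open>Logarithms on the Cantor set and sums along orbits\<close>

lemma circle_descend:
  assumes "\<And>t m. \<phi> (t + of_int m) = \<phi> t"
  shows "\<exists>\<psi>. \<forall>t. \<psi> (circle_proj t) = \<phi> t"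
proof (intro exI allI)
  fix t
  let ?u = "SOME u. circle_proj u = circle_proj t"
  have "circle_proj ?u = circle_proj t" by (rule someI[of _ t]) simp
  then obtain m where m: "?u = t + of_int m" by (rule circle_proj_eqE)
  show "(\<lambda>w. \<phi> (SOME u. circle_proj u = w)) (circle_proj t) = \<phi> t" unfolding m by (rule assms)
qed

text \<open>A point of the circle outside K joins the inner disc to the exterior.\<close>

lemma connected_Compl_circle_subset:
  assumes K: "K \<subseteq> circle" "K \<noteq> circle"
  shows "connected (- K)"
proof -
  let ?A = "ball (0::complex) 1 \<union> (circle - K)" and ?B = "(- cball (0::complex) 1) \<union> (circle - K)"
  have A: "connected ?A"
  proof (rule connected_intermediate_closure[OF connected_ball])
    show "?A \<subseteq> closure (ball 0 1)" by (auto simp: dist_norm)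
  qed auto
  have "connected (- cball (0::complex) 1)"
    by (rule connected_complement_bounded_convex) auto
  then have B: "connected ?B"
  proof (rule connected_intermediate_closure)
    have "closure (- cball (0::complex) 1) = - ball 0 1"
      by (simp add: closure_complement)
    then show "?B \<subseteq> closure (- cball 0 1)" by (auto simp: dist_norm)
  qed auto
  have "- K = ?A \<union> ?B" using K by (auto simp: dist_norm)
  moreover have "?A \<inter> ?B \<noteq> {}" using K by auto
  ultimately show ?thesis using connected_Un[OF A B] by simp
qed

context split_map
begin

text \<open>A compact subset of the plane with connected complement is Borsukian, that is, maps from
  it to the punctured plane have logarithms. It remains to see that the Cantor set misses a point of
  the circle, namely any point in a gap.\<close>

lemma real_logarithm:
  assumes cont: "continuous_on (circle_proj ` growth_points h) E" and norm: "\<And>x. x \<in> circle_proj ` growth_points h \<Longrightarrow> norm (E x) = 1"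
  shows "\<exists>g. continuous_on (circle_proj ` growth_points h) g \<and> (\<forall>x\<in>circle_proj ` growth_points h. E x = circle_proj (g x))"
proof -
  let ?K = "circle_proj ` growth_points h"
  obtain z where z: "z \<notin> growth_points h" using growth_nowhere_dense[of 0 1] by auto
  have "circle_proj z \<notin> ?K"
  proof
    assume "circle_proj z \<in> ?K"
    then obtain t where t: "t \<in> growth_points h" "circle_proj z = circle_proj t" by auto
    obtain m where "z = t + of_int m" using circle_proj_eqE[OF t(2)] .
    then show False using z t growth_add_int by simp
  qed
  then have ne: "?K \<noteq> circle" using circle_proj_in_circle[of z] by metis
  have sub: "?K \<subseteq> circle" using circle_proj_in_circle by blast
  have "Borsukian ?K"
    using Borsukian_separation_compact[OF compact_image_growth] connected_Compl_circle_subset[OF sub ne] by simp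
  moreover have "E \<in> ?K \<rightarrow> - {0}" using norm by fastforce
  ultimately obtain G where G: "continuous_on ?K G" "\<And>x. x \<in> ?K \<Longrightarrow> E x = exp (G x)"
    using cont unfolding Borsukian_continuous_logarithm by blast
  show ?thesis
  proof (intro exI[of _ "\<lambda>x. Im (G x) / (2 * pi)"] conjI ballI)
    show "continuous_on ?K (\<lambda>x. Im (G x) / (2 * pi))" using G(1) by (intro continuous_intros) auto
    fix x assume x: "x \<in> ?K"
    then have "exp (Re (G x)) = 1" using norm[OF x] G(2)[OF x] by (simp add: norm_exp_eq_Re)
    then have "Re (G x) = 0" by simp
    then have "exp (G x) = cis (Im (G x))" by (simp add: exp_eq_polar)
    then show "E x = circle_proj (Im (G x) / (2 * pi))" using G(2)[OF x] by (simp add: circle_proj_def)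
  qed
qed

lemma finite_hits: "finite {n::int. x + of_int n * \<alpha> \<in> \<int>}"
proof (cases "{n::int. x + of_int n * \<alpha> \<in> \<int>} = {}")
  case False
  then obtain n0 :: int where n0: "x + of_int n0 * \<alpha> \<in> \<int>" by auto
  have "{n::int. x + of_int n * \<alpha> \<in> \<int>} \<subseteq> {n0}"
    using irrational_int_unique[OF irrational _ n0] by auto
  then show ?thesis using finite_subset by blast
qed simp

text \<open>Irrationality allows at most one integer on the orbit of x, and there is one exactly
  when x lies in the group.\<close>

lemma sum_hits:
  assumes "finite A" "{n::int. x + of_int n * \<alpha> \<in> \<int>} \<subseteq> A"
  shows "(\<Sum>n\<in>A. if x + of_int n * \<alpha> \<in> \<int> then d else 0) = (if x \<in> rotation_group \<alpha> then d else (0::int))"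
proof (cases "x \<in> rotation_group \<alpha>")
  case True
  then obtain m k where x: "x = of_int m + of_int k * \<alpha>" by (rule rotation_groupE)
  have hit: "x + of_int n * \<alpha> \<in> \<int> \<longleftrightarrow> n = - k" for n :: int
  proof
    assume "x + of_int n * \<alpha> \<in> \<int>"
    moreover have "x + of_int (- k) * \<alpha> \<in> \<int>" by (simp add: x)
    ultimately show "n = - k" by (rule irrational_int_unique[OF irrational])
  qed (simp add: x)
  have "- k \<in> A" using assms(2) hit by blast
  then show ?thesis using True assms(1) by (simp add: hit)
next
  case False
  have "x + of_int n * \<alpha> \<notin> \<int>" for n :: int
  proof
    assume "x + of_int n * \<alpha> \<in> \<int>"
    then obtain m where "x + of_int n * \<alpha> = of_int m" by (elim Ints_cases)
    then have "x = of_int m + of_int (- n) * \<alpha>" by simp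
    then show False using False rotation_groupI by blast
  qed
  then show ?thesis using False by simp
qed

end

lemma half_not_in_rotation_group:
  assumes "\<alpha> \<notin> \<rat>"
  shows "1 / 2 \<notin> rotation_group \<alpha>"
proof
  assume "1 / 2 \<in> rotation_group \<alpha>"
  then obtain m k where mk: "1 / 2 = of_int m + of_int k * \<alpha>" by (rule rotation_groupE)
  then have "(of_int m - 1 / 2) + of_int k * \<alpha> = 0" by simp
  then have "of_int m - 1 / (2::real) = 0" by (rule irrational_lin_eq(1)[OF assms, rotated 2]) auto
  then have "2 * m = 1" by linarith
  then show False by presburger
qed

text \<open>Moving all points by a common t keeps their differences, hence the cosets, but moves the
  weighted sum by t times the sum S of the coefficients. With t = 1 / (2 S) the move is 1/2, which
  is not in the group.\<close>

lemma class_sums_zero_imp_sum_zero: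
  fixes d :: "'i \<Rightarrow> int" and x :: "'i \<Rightarrow> real"
  assumes irr: "\<alpha> \<notin> \<rat>" and fin: "finite I"
    and cl: "\<And>j. j \<in> I \<Longrightarrow> (\<Sum>i\<in>{i \<in> I. x i - x j \<in> rotation_group \<alpha>}. d i) = 0"
  shows "(\<Sum>i\<in>I. d i) = 0"
proof (rule ccontr)
  assume ne: "(\<Sum>i\<in>I. d i) \<noteq> 0"
  define S where "S = real_of_int (\<Sum>i\<in>I. d i)"
  define t where "t = 1 / (2 * S)"
  have S: "S \<noteq> 0" using ne by (simp add: S_def del: of_int_sum)
  have 1: "(\<Sum>i\<in>I. of_int (d i) * x i) \<in> rotation_group \<alpha>"
    by (rule weighted_sum_in_rotation_group[OF fin cl])
  have 2: "(\<Sum>i\<in>I. of_int (d i) * (x i + t)) \<in> rotation_group \<alpha>"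
    by (rule weighted_sum_in_rotation_group[OF fin]) (simp add: cl)
  have "(\<Sum>i\<in>I. of_int (d i) * (x i + t)) - (\<Sum>i\<in>I. of_int (d i) * x i) = S * t"
    by (simp add: S_def distrib_left sum.distrib sum_distrib_right)
  also have "\<dots> = 1 / 2" using S by (simp add: t_def)
  finally have "1 / 2 \<in> rotation_group \<alpha>" using rotation_group_diff[OF 2 1] by (simp only:)
  then show False using half_not_in_rotation_group[OF irr] by simp
qed

text \<open>The finite sum is a difference of two boundary terms far out. It will be applied with u
  the difference of a continuous function on the two sides of a gap, which tends to 0 in both
  directions.\<close>

lemma telescoping_Sum_any:
  fixes u v :: "int \<Rightarrow> real"
  assumes v: "\<And>j. v j = u j - u (j + 1)" and fin: "finite {j. v j \<noteq> 0}"
    and top: "(u \<longlongrightarrow> 0) at_top" and bot: "(u \<longlongrightarrow> 0) at_bot"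
  shows "Sum_any v = 0"
proof -
  obtain N :: nat where N: "\<And>j. v j \<noteq> 0 \<Longrightarrow> \<bar>j\<bar> < int N"
  proof -
    have "finite ((\<lambda>j. nat \<bar>j\<bar>) ` {j. v j \<noteq> 0})" using fin by simp
    then obtain N where "\<forall>n\<in>(\<lambda>j. nat \<bar>j\<bar>) ` {j. v j \<noteq> 0}. n < N" using finite_nat_set_iff_bounded by blast
    then show thesis by (intro that[of N]) auto
  qed
  have tele: "(\<Sum>j\<in>{- int n..<int n}. v j) = u (- int n) - u (int n)" for n
  proof (induction n)
    case (Suc n)
    have "{- int (Suc n)..<int (Suc n)} = insert (- int (Suc n)) (insert (int n) {- int n..<int n})" by auto
    then have "(\<Sum>j\<in>{- int (Suc n)..<int (Suc n)}. v j) = v (- int (Suc n)) + (v (int n) + (\<Sum>j\<in>{- int n..<int n}. v j))"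
      by simp
    then show ?case using Suc v[of "- int (Suc n)"] v[of "int n"] by (simp add: algebra_simps)
  qed simp
  have "Sum_any v = u (- int n) - u (int n)" if "n \<ge> N" for n
  proof -
    have "{j. v j \<noteq> 0} \<subseteq> {- int n..<int n}" using N that by fastforce
    then have "Sum_any v = (\<Sum>j\<in>{- int n..<int n}. v j)" by (intro Sum_any.expand_superset) auto
    then show ?thesis using tele by simp
  qed
  then have ev: "\<forall>\<^sub>F n in sequentially. u (- int n) - u (int n) = Sum_any v"
    unfolding eventually_sequentially by metis
  have t: "filterlim (\<lambda>n. int n) at_top sequentially" by (rule filterlim_int_sequentially)
  have b: "filterlim (\<lambda>n. - int n) at_bot sequentially"
  proof (unfold filterlim_at_bot eventually_sequentially, intro allI)
    fix Z :: int
    show "\<exists>N. \<forall>n\<ge>N. - int n \<le> Z" by (intro exI[of _ "nat (- Z)"]) auto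
  qed
  have "(\<lambda>n. u (- int n) - u (int n)) \<longlonglongrightarrow> 0 - 0"
    by (intro tendsto_diff filterlim_compose[OF bot b] filterlim_compose[OF top t])
  then have "(\<lambda>n. Sum_any v) \<longlonglongrightarrow> 0" using tendsto_cong[OF ev] by simp
  then show ?thesis by (simp add: LIMSEQ_const_iff)
qed

text \<open>Division by n makes this a rational vector space: the integrals of integer-valued
  functions, tensored with Q.\<close>

definition mean_values :: "'a system \<Rightarrow> real set" where
  "mean_values X = {r. \<exists>n::nat. 0 < n \<and> (\<exists>f. int_continuous X f \<and> has_mean X f (real n * r))}"

definition eigenvalue :: "'a system \<Rightarrow> real \<Rightarrow> bool" where
  "eigenvalue X \<beta> \<longleftrightarrow> (\<exists>E :: 'a \<Rightarrow> complex. continuous_map (sys_top X) euclidean E \<and>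
     (\<forall>x\<in>points X. norm (E x) = 1 \<and> E (sys_map X x) = circle_proj \<beta> * E x))"

interpretation Q: vector_space rat_scale
  by (rule vector_space_rat_scale)

lemma rat_scale_of_int: "rat_scale (of_int k) x = of_int k * x"
  by (simp add: rat_scale_def)

context compact_system
begin

lemma mean_valuesI: "int_continuous X f \<Longrightarrow> has_mean X f r \<Longrightarrow> r \<in> mean_values X"
  unfolding mean_values_def by (auto intro!: exI[of _ 1])

lemma mean_values_subspace: "Q.subspace (mean_values X)"
proof (rule Q.subspaceI)
  show "0 \<in> mean_values X" using mean_valuesI[OF int_continuous_const has_mean_const[of 0]] by simp
next
  fix r r' assume "r \<in> mean_values X" "r' \<in> mean_values X"
  then obtain n f n' f' where n: "0 < (n::nat)" "int_continuous X f" "has_mean X f (real n * r)"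
    and n': "0 < (n'::nat)" "int_continuous X f'" "has_mean X f' (real n' * r')"
    unfolding mean_values_def by blast
  have "has_mean X (\<lambda>x. int n' * f x + int n * f' x) (of_int (int n') * (real n * r) + of_int (int n) * (real n' * r'))"
    by (intro has_mean_add has_mean_scale n n')
  moreover have "of_int (int n') * (real n * r) + of_int (int n) * (real n' * r') = real (n * n') * (r + r')"
    by (simp add: algebra_simps)
  moreover have "int_continuous X (\<lambda>x. int n' * f x + int n * f' x)"
    by (intro int_continuous_add int_continuous_scale n n')
  ultimately show "r + r' \<in> mean_values X"
    unfolding mean_values_def using n(1) n'(1) by (intro CollectI exI[of _ "n * n'"] conjI exI[of _ "\<lambda>x. int n' * f x + int n * f' x"]) auto
next
  fix q r assume "r \<in> mean_values X"
  then obtain n f where n: "0 < (n::nat)" "int_continuous X f" "has_mean X f (real n * r)"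
    unfolding mean_values_def by blast
  obtain a b where ab: "quotient_of q = (a, b)" by (cases "quotient_of q")
  have b: "b > 0" using ab quotient_of_denom_pos by blast
  have q: "q = of_int a / of_int b" using ab quotient_of_div by blast
  have "has_mean X (\<lambda>x. a * f x) (of_int a * (real n * r))" by (intro has_mean_scale n)
  moreover have "of_int a * (real n * r) = real (nat b * n) * rat_scale q r"
    using b by (simp add: rat_scale_def q of_rat_divide)
  ultimately show "rat_scale q r \<in> mean_values X"
    unfolding mean_values_def using n b by (intro CollectI exI[of _ "nat b * n"] conjI exI[of _ "\<lambda>x. a * f x"]) (auto intro: int_continuous_scale)
qed

lemma one_in_mean_values: "1 \<in> mean_values X"
  using mean_valuesI[OF int_continuous_const has_mean_const[of 1]] by simp

lemma birkhoff_factor: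
  assumes "factor_map X Y p" "x \<in> points X"
  shows "birkhoff X (\<lambda>x. f (p x)) n x = birkhoff Y f n (p x)"
proof -
  have "p ((sys_map X ^^ k) x) = (sys_map Y ^^ k) (p x)" for k
    using assms by (induction k) (auto simp: factor_map_def sys_pow_in)
  then show ?thesis by (simp add: birkhoff_def)
qed

lemma has_mean_factor:
  assumes p: "factor_map X Y p"
  shows "has_mean X (\<lambda>x. f (p x)) c \<longleftrightarrow> has_mean Y f c"
proof -
  have "points Y = p ` points X" using p by (simp add: factor_map_def)
  then show ?thesis by (simp add: has_mean_def birkhoff_factor[OF p])
qed

lemma int_continuous_factor:
  "factor_map X Y p \<Longrightarrow> int_continuous Y f \<Longrightarrow> int_continuous X (\<lambda>x. f (p x))"
  by (rule int_continuous_compose) (auto simp: factor_map_def)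

lemma mean_values_factor:
  assumes p: "factor_map X Y p"
  shows "mean_values Y \<subseteq> mean_values X"
  using int_continuous_factor[OF p] has_mean_factor[OF p] unfolding mean_values_def by blast

lemma eigenvalue_factor:
  assumes p: "factor_map X Y p" and "eigenvalue Y \<beta>"
  shows "eigenvalue X \<beta>"
proof -
  obtain E :: "_ \<Rightarrow> complex" where E: "continuous_map (sys_top Y) euclidean E"
    "\<forall>x\<in>points Y. norm (E x) = 1 \<and> E (sys_map Y x) = circle_proj \<beta> * E x"
    using assms(2) unfolding eigenvalue_def by blast
  have "continuous_map (sys_top X) euclidean (E \<circ> p)"
    using p E(1) by (intro continuous_map_compose[of _ "sys_top Y"]) (auto simp: factor_map_def)
  then show ?thesis unfolding eigenvalue_def using p E(2)
    by (intro exI[of _ "E \<circ> p"]) (auto simp: factor_map_def)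
qed

end

section \<open>Jumps and index sums along gap orbits\<close>

context split_system
begin

definition jump :: "(complex \<Rightarrow> int) \<Rightarrow> real \<Rightarrow> int" where
  "jump f a = f (split_pt h True a) - f (split_pt h False a)"

text \<open>Up to the sign that depends on the ordering of the pair, this is the index of f for the
  asymptotic pair formed by the two sides of a.\<close>

definition jump_sum :: "(complex \<Rightarrow> int) \<Rightarrow> real \<Rightarrow> int" where
  "jump_sum f a = Sum_any (\<lambda>n. jump f (a + of_int n * \<alpha>))"

lemma jump_form_jump:
  assumes "jump_form f c N d b"
  shows "jump f a = (\<Sum>i<N. if a - b i \<in> \<int> then d i else 0)"
proof -
  have "jump f a = (\<Sum>i<N. d i * (fl True (a - b i) - fl False (a - b i)))"
    using assms by (simp add: jump_def jump_form_def right_diff_distrib sum_subtractf)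
  then show ?thesis by (simp add: fl_jump if_distrib cong: if_cong)
qed

lemma jump_form_hits:
  assumes "jump_form f c N d b"
  shows "finite (\<Union>i<N. {n::int. (a - b i) + of_int n * \<alpha> \<in> \<int>})"
    and "{n. jump f (a + of_int n * \<alpha>) \<noteq> 0} \<subseteq> (\<Union>i<N. {n::int. (a - b i) + of_int n * \<alpha> \<in> \<int>})"
proof -
  show "finite (\<Union>i<N. {n::int. (a - b i) + of_int n * \<alpha> \<in> \<int>})" by (intro finite_UN_I finite_hits) auto
  show "{n. jump f (a + of_int n * \<alpha>) \<noteq> 0} \<subseteq> (\<Union>i<N. {n::int. (a - b i) + of_int n * \<alpha> \<in> \<int>})"
  proof clarify
    fix n assume ne: "jump f (a + of_int n * \<alpha>) \<noteq> 0"
    show "n \<in> (\<Union>i<N. {n::int. (a - b i) + of_int n * \<alpha> \<in> \<int>})"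
    proof (rule ccontr)
      assume "\<not> ?thesis"
      then have "\<And>i. i < N \<Longrightarrow> a + of_int n * \<alpha> - b i \<notin> \<int>" by (auto simp: algebra_simps)
      then show False using ne unfolding jump_form_jump[OF assms] by simp
    qed
  qed
qed

lemma finite_jump_support: "int_continuous X f \<Longrightarrow> finite {n. jump f (a + of_int n * \<alpha>) \<noteq> 0}"
  using exists_jump_form jump_form_hits finite_subset by metis

text \<open>The orbit of a meets a base point \<open>b i\<close> modulo 1 at most once, and does so
  exactly when their difference lies in the group.\<close>

lemma jump_form_jump_sum:
  assumes "jump_form f c N d b"
  shows "jump_sum f a = (\<Sum>i\<in>{i. i < N \<and> a - b i \<in> rotation_group \<alpha>}. d i)"
proof -
  let ?A = "\<Union>i<N. {n::int. (a - b i) + of_int n * \<alpha> \<in> \<int>}"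
  have "jump_sum f a = (\<Sum>n\<in>?A. jump f (a + of_int n * \<alpha>))"
    unfolding jump_sum_def using jump_form_hits[OF assms, of a] by (intro Sum_any.expand_superset)
  also have "\<dots> = (\<Sum>n\<in>?A. \<Sum>i<N. if (a - b i) + of_int n * \<alpha> \<in> \<int> then d i else 0)"
    unfolding jump_form_jump[OF assms] by (simp add: algebra_simps)
  also have "\<dots> = (\<Sum>i<N. \<Sum>n\<in>?A. if (a - b i) + of_int n * \<alpha> \<in> \<int> then d i else 0)"
    by (rule sum.swap)
  also have "\<dots> = (\<Sum>i<N. if a - b i \<in> rotation_group \<alpha> then d i else 0)"
    by (rule sum.cong[OF refl], rule sum_hits[OF jump_form_hits(1)[OF assms]]) auto
  also have "\<dots> = (\<Sum>i\<in>{i. i < N \<and> a - b i \<in> rotation_group \<alpha>}. d i)"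
    by (rule sum.mono_neutral_cong_right) auto
  finally show ?thesis .
qed

lemma jump_sum_add_group:
  assumes "int_continuous X f" "g \<in> rotation_group \<alpha>"
  shows "jump_sum f (a + g) = jump_sum f a"
proof -
  obtain c N d b where form: "jump_form f c N d b" using exists_jump_form[OF assms(1)] by blast
  have "a + g - b i \<in> rotation_group \<alpha> \<longleftrightarrow> a - b i \<in> rotation_group \<alpha>" for i
    using rotation_group_add[OF _ assms(2), of "a - b i"] rotation_group_diff[OF _ assms(2), of "a + g - b i"]
    by (auto simp: algebra_simps)
  then show ?thesis unfolding jump_form_jump_sum[OF form] by simp
qed

lemma jump_sum_add:
  assumes "int_continuous X f" "int_continuous X g"
  shows "jump_sum (\<lambda>x. f x + g x) a = jump_sum f a + jump_sum g a"
proof -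
  have "jump (\<lambda>x. f x + g x) b = jump f b + jump g b" for b by (simp add: jump_def)
  then show ?thesis unfolding jump_sum_def using finite_jump_support assms
    by (simp add: Sum_any.distrib)
qed

lemma jump_sum_scale:
  assumes "int_continuous X f"
  shows "jump_sum (\<lambda>x. k * f x) a = k * jump_sum f a"
proof -
  have "jump (\<lambda>x. k * f x) b = k * jump f b" for b by (simp add: jump_def right_diff_distrib)
  then show ?thesis unfolding jump_sum_def using finite_jump_support[OF assms]
    by (simp add: Sum_any_right_distrib)
qed

lemma jump_sum_shift:
  assumes "int_continuous X f"
  shows "jump_sum (\<lambda>x. f (sys_map X x)) a = jump_sum f a"
proof -
  have "jump (\<lambda>x. f (sys_map X x)) b = jump f (b + \<alpha>)" for b by (simp add: jump_def sys_map_split)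
  then have "jump_sum (\<lambda>x. f (sys_map X x)) a = jump_sum f (a + \<alpha>)"
    by (simp add: jump_sum_def add.assoc add.commute)
  moreover have "\<alpha> \<in> rotation_group \<alpha>" by (rule rotation_groupI[of _ 0 1]) simp
  ultimately show ?thesis using jump_sum_add_group[OF assms] by simp
qed

text \<open>The index sums are the sums of the coefficients over the orbits of base points. If these
  vanish, the contribution of the base points to the mean lies in the group; the rest of the mean is
  an integer.\<close>

lemma jump_sum_zero_imp_mean:
  assumes f: "int_continuous X f" "has_mean X f c" and zero: "\<And>a. a \<in> gap_values h \<Longrightarrow> jump_sum f a = 0"
  shows "c \<in> rotation_group \<alpha>"
proof -
  obtain e N d b where form: "jump_form f e N d b" using exists_jump_form[OF f(1)] by blast
  have b: "b i \<in> gap_values h" if "i < N" for i using form that by (simp add: jump_form_def)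
  have "(\<Sum>i\<in>{..<N}. of_int (d i) * b i) \<in> rotation_group \<alpha>"
  proof (rule weighted_sum_in_rotation_group)
    fix j assume j: "j \<in> {..<N}"
    have "b i - b j \<in> rotation_group \<alpha> \<longleftrightarrow> b j - b i \<in> rotation_group \<alpha>" for i
      using rotation_group_minus[of "b i - b j" \<alpha>] rotation_group_minus[of "b j - b i" \<alpha>] by auto
    then have "{i \<in> {..<N}. b i - b j \<in> rotation_group \<alpha>} = {i. i < N \<and> b j - b i \<in> rotation_group \<alpha>}" by auto
    then show "(\<Sum>i\<in>{i \<in> {..<N}. b i - b j \<in> rotation_group \<alpha>}. d i) = 0"
      using zero[of "b j"] b[of j] j jump_form_jump_sum[OF form, of "b j"] by simp
  qed simp
  moreover have "c = of_int e - (\<Sum>i<N. of_int (d i) * b i)"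
    using has_mean_unique[OF f(2) jump_form_has_mean[OF form]] .
  ultimately show ?thesis by (simp add: rotation_group_diff)
qed

lemma remove_null_jumps:
  assumes f: "int_continuous X f" "has_mean X f c"
    and Br: "\<And>a g. g \<in> rotation_group \<alpha> \<Longrightarrow> a + g \<in> Br \<longleftrightarrow> a \<in> Br"
    and zero: "\<And>a. a \<in> Br \<Longrightarrow> a \<in> gap_values h \<Longrightarrow> jump_sum f a = 0"
  shows "\<exists>k e. int_continuous X k \<and> has_mean X k e \<and> c - e \<in> rotation_group \<alpha> \<and> (\<forall>a\<in>Br. jump k a = 0)"
proof -
  obtain e N d b where form: "jump_form f e N d b" using exists_jump_form[OF f(1)] by blast
  have b: "b i \<in> gap_values h" if "i < N" for i using form that by (simp add: jump_form_def)
  let ?I = "{i. i < N \<and> b i \<in> Br}"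
  have cl: "(\<Sum>i\<in>{i \<in> ?I. b i - b j \<in> rotation_group \<alpha>}. d i) = 0" if j: "j \<in> ?I" for j
  proof -
    have "b i \<in> Br" if "b j - b i \<in> rotation_group \<alpha>" for i
      using Br[OF that, of "b i"] j by simp
    moreover have "b i - b j \<in> rotation_group \<alpha> \<longleftrightarrow> b j - b i \<in> rotation_group \<alpha>" for i
      using rotation_group_minus[of "b i - b j" \<alpha>] rotation_group_minus[of "b j - b i" \<alpha>] by auto
    ultimately have "{i \<in> ?I. b i - b j \<in> rotation_group \<alpha>} = {i. i < N \<and> b j - b i \<in> rotation_group \<alpha>}" by auto
    then show ?thesis using zero[of "b j"] b[of j] j jump_form_jump_sum[OF form, of "b j"] by simp
  qed
  have s0: "(\<Sum>i\<in>?I. d i) = 0" by (rule class_sums_zero_imp_sum_zero[OF irrational _ cl]) auto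
  have sb: "(\<Sum>i\<in>?I. of_int (d i) * b i) \<in> rotation_group \<alpha>"
    by (rule weighted_sum_in_rotation_group[OF _ cl]) auto
  define d' where "d' i = (if b i \<in> Br then 0 else d i)" for i
  have split: "(\<Sum>i<N. d i) = (\<Sum>i\<in>?I. d i) + (\<Sum>i<N. d' i)"
  proof -
    have "(\<Sum>i\<in>?I. d i) = (\<Sum>i<N. if b i \<in> Br then d i else 0)" by (rule sum.mono_neutral_cong_left) auto
    then show ?thesis by (simp add: d'_def flip: sum.distrib) (rule sum.cong, auto)
  qed
  have splitb: "(\<Sum>i<N. of_int (d i) * b i) = (\<Sum>i\<in>?I. of_int (d i) * b i) + (\<Sum>i<N. of_int (d' i) * b i)"
  proof -
    have "(\<Sum>i\<in>?I. of_int (d i) * b i) = (\<Sum>i<N. if b i \<in> Br then of_int (d i) * b i else 0)" by (rule sum.mono_neutral_cong_left) auto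
    then show ?thesis by (simp add: d'_def flip: sum.distrib) (rule sum.cong, auto)
  qed
  have d': "(\<Sum>i<N. d' i) = 0" using split s0 form by (simp add: jump_form_def)
  show ?thesis
  proof (rule int_function_of_form[OF b d'])
    fix k assume k: "continuous_on (circle_proj ` growth_points h) (\<lambda>x. real_of_int (k x))"
      "\<And>s a. k (split_pt h s a) = e + (\<Sum>i<N. d' i * fl s (a - b i))"
    have kf: "jump_form k e N d' b" unfolding jump_form_def using b d' k(2) by simp
    have "jump k a = 0" if "a \<in> Br" for a
    proof -
      have "d' i = 0" if "a - b i \<in> \<int>" for i
      proof -
        have "a - b i \<in> rotation_group \<alpha>" using that by (auto elim!: Ints_cases)
        then have "b i \<in> Br" using Br[of "a - b i" "b i"] \<open>a \<in> Br\<close> by simp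
        then show ?thesis by (simp add: d'_def)
      qed
      then show ?thesis unfolding jump_form_jump[OF kf] by (intro sum.neutral) auto
    qed
    moreover have "has_mean X k (of_int e - (\<Sum>i<N. of_int (d' i) * b i))" by (rule jump_form_has_mean[OF kf])
    moreover have "c - (of_int e - (\<Sum>i<N. of_int (d' i) * b i)) \<in> rotation_group \<alpha>"
    proof -
      have "c = of_int e - (\<Sum>i<N. of_int (d i) * b i)"
        using has_mean_unique[OF f(2) jump_form_has_mean[OF form]] .
      then have "c - (of_int e - (\<Sum>i<N. of_int (d' i) * b i)) = - (\<Sum>i\<in>?I. of_int (d i) * b i)"
        using splitb by simp
      then show ?thesis using rotation_group_minus[OF sb] by simp
    qed
    ultimately show ?thesis using k(1) unfolding int_continuous_eq by blast
  qed
qed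

text \<open>The witness is the floor based at a minus the floor based at a'.\<close>

lemma gap_difference_mean:
  assumes "a \<in> gap_values h" "a' \<in> gap_values h"
  shows "a' - a \<in> mean_values X"
proof -
  define b where "b i = (if i = 0 then a else a')" for i :: nat
  define d :: "nat \<Rightarrow> int" where "d i = (if i = 0 then 1 else - 1)" for i
  have d: "(\<Sum>i<2. d i) = 0" by (simp add: d_def numeral_2_eq_2)
  have b: "b i \<in> gap_values h" for i using assms by (simp add: b_def)
  show ?thesis
  proof (rule int_function_of_form[OF b d, of 0])
    fix k assume k: "continuous_on (circle_proj ` growth_points h) (\<lambda>x. real_of_int (k x))"
      "\<And>s a. k (split_pt h s a) = 0 + (\<Sum>i<2. d i * fl s (a - b i))"
    have kf: "jump_form k 0 2 d b" unfolding jump_form_def using b d k(2) by simp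
    have "of_int 0 - (\<Sum>i<2. of_int (d i) * b i) = a' - a" by (simp add: numeral_2_eq_2 d_def b_def)
    then have "has_mean X k (a' - a)" using jump_form_has_mean[OF kf] by simp
    then show ?thesis using k(1) by (intro mean_valuesI[of k]) (simp_all add: int_continuous_eq)
  qed
qed

lemma alpha_in_mean_values: "\<alpha> \<in> mean_values X"
proof -
  obtain a where "a \<in> gap_values h" using gaps_nonempty by blast
  then show ?thesis using gap_difference_mean[of a "a + \<alpha>"] gaps_invariant by simp
qed

text \<open>Integrals only see differences of gap values (and integers); the base point 0 is what
  makes single gap values appear.\<close>

lemma mean_values_span:
  assumes "0 \<in> gap_values h"
  shows "mean_values X = Q.span (gap_values h)"
proof
  show "Q.span (gap_values h) \<subseteq> mean_values X"
    using gap_difference_mean[OF assms] by (intro Q.span_minimal mean_values_subspace) auto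
  show "mean_values X \<subseteq> Q.span (gap_values h)"
  proof
    fix r assume "r \<in> mean_values X"
    then obtain n f where n: "0 < (n::nat)" "int_continuous X f" "has_mean X f (real n * r)"
      unfolding mean_values_def by blast
    obtain e N d b where form: "jump_form f e N d b" using exists_jump_form[OF n(2)] by blast
    have "1 \<in> gap_values h" using gap_add_int[of 0 1] assms by simp
    then have 1: "rat_scale (of_int e) 1 \<in> Q.span (gap_values h)" by (intro Q.span_scale Q.span_base)
    have 2: "(\<Sum>i<N. rat_scale (of_int (d i)) (b i)) \<in> Q.span (gap_values h)"
      using form by (intro Q.span_sum Q.span_scale Q.span_base) (auto simp: jump_form_def)
    have "real n * r = of_int e - (\<Sum>i<N. of_int (d i) * b i)"
      using has_mean_unique[OF n(3) jump_form_has_mean[OF form]] .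
    then have "real n * r \<in> Q.span (gap_values h)"
      using Q.span_diff[OF 1 2] by (simp add: rat_scale_of_int)
    then have "rat_scale (1 / of_nat n) (real n * r) \<in> Q.span (gap_values h)" by (rule Q.span_scale)
    then show "r \<in> Q.span (gap_values h)" using n(1) by (simp add: rat_scale_def of_rat_divide)
  qed
qed

end

lemma of_int_Sum_any: "real_of_int (Sum_any v) = Sum_any (\<lambda>j. real_of_int (v j))"
  by (simp add: Sum_any.expand_set)

lemma int_eventually_neq: "\<forall>\<^sub>F k in at_top. k \<noteq> (n::int)" "\<forall>\<^sub>F k in at_bot. k \<noteq> (n::int)"
proof -
  show "\<forall>\<^sub>F k in at_top. k \<noteq> n" using eventually_gt_at_top[of n] by eventually_elim simp
  show "\<forall>\<^sub>F k in at_bot. k \<noteq> n" using eventually_le_at_bot[of "n - 1"] by eventually_elim simp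
qed

section \<open>The rotation factor, eigenvalues and asymptotic pairs\<close>

context split_system
begin

abbreviation "K \<equiv> circle_proj ` growth_points h"

lemma continuous_map_eq_on: "continuous_map (sys_top X) euclidean E \<longleftrightarrow> continuous_on K E"
  by (simp add: top_eq)

lemma rotation_factor: "\<exists>E. continuous_on K E \<and> (\<forall>s a. E (split_pt h s a) = circle_proj a)"
proof -
  obtain E where E: "\<And>t. E (circle_proj t) = circle_proj (h t)"
    using circle_descend[of "\<lambda>t. circle_proj (h t)"] by (auto simp: h_add_int)
  have "continuous_on K E"
    by (rule continuous_on_circle_quotient[OF growth_closed, of "\<lambda>t. circle_proj (h t)"])
      (simp_all add: growth_add_int E continuous_on_circle_proj continuous_on_subset[OF cont])
  then show ?thesis using E by (auto simp: split_pt_def)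
qed

lemma eigenvalue_alpha: "eigenvalue X \<alpha>"
proof -
  obtain E where E: "continuous_on K E" "\<And>s a. E (split_pt h s a) = circle_proj a"
    using rotation_factor by blast
  show ?thesis unfolding eigenvalue_def continuous_map_eq_on
    by (intro exI[of _ E] conjI ballI E(1); elim pointsE) (simp_all add: E(2) sys_map_split circle_proj_add mult.commute)
qed

text \<open>Uniform continuity transfers the asymptotics of the two sides to every continuous real
  function.\<close>

lemma side_diff_tendsto:
  fixes g :: "complex \<Rightarrow> real"
  assumes g: "continuous_on K g" and cof: "\<And>n::int. \<forall>\<^sub>F k in F. k \<noteq> n"
  shows "((\<lambda>j::int. g (split_pt h True (a + of_int j * \<alpha>)) - g (split_pt h False (a + of_int j * \<alpha>))) \<longlongrightarrow> 0) F"
proof (rule tendstoI)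
  fix \<epsilon> :: real assume e: "0 < \<epsilon>"
  obtain \<delta> where d: "\<delta> > 0" "\<And>x x'. x \<in> K \<Longrightarrow> x' \<in> K \<Longrightarrow> dist x' x < \<delta> \<Longrightarrow> dist (g x') (g x) < \<epsilon>"
    using compact_uniformly_continuous[OF g compact_image_growth] e unfolding uniformly_continuous_on_def by metis
  have inK: "split_pt h s b \<in> K" for s b using split_in_points points_eq by simp
  have "\<forall>\<^sub>F k in F. dist (dist (split_pt h True (a + of_int k * \<alpha>)) (split_pt h False (a + of_int k * \<alpha>))) 0 < \<delta>"
    by (rule tendstoD[OF split_pts_asymptotic[OF irrational cof] d(1)])
  then show "\<forall>\<^sub>F j in F. dist (g (split_pt h True (a + of_int j * \<alpha>)) - g (split_pt h False (a + of_int j * \<alpha>))) 0 < \<epsilon>"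
  proof eventually_elim
    case (elim k)
    then have "dist (g (split_pt h True (a + of_int k * \<alpha>))) (g (split_pt h False (a + of_int k * \<alpha>))) < \<epsilon>"
      by (intro d(2) inK) (simp add: dist_real_def)
    then show ?case by (simp add: dist_real_def)
  qed
qed

lemma bounded_on_K:
  fixes g :: "complex \<Rightarrow> real"
  assumes "continuous_on K g"
  obtains B where "\<And>x. x \<in> K \<Longrightarrow> \<bar>g x\<bar> \<le> B"
proof -
  have "bounded (g ` K)" using compact_continuous_image[OF assms compact_image_growth] by (rule compact_imp_bounded)
  then obtain B where "\<forall>x\<in>g ` K. norm x \<le> B" unfolding bounded_iff by blast
  then show thesis by (intro that[of B]) auto
qed

lemma sys_map_continuous_on: "continuous_on K (sys_map X)"
  using sys_map_cont unfolding top_eq continuous_map_in_subtopology by simp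

text \<open>A real logarithm g of the eigenfunction turns \<beta> + g - g \<circ> S into an
  integer-valued function of mean \<beta>. Its jumps along a gap orbit telescope to 0, since g is
  asymptotically equal on the two sides, so all index sums vanish.\<close>

lemma eigenvalue_in_rotation_group:
  assumes "eigenvalue X \<beta>"
  shows "\<beta> \<in> rotation_group \<alpha>"
proof -
  obtain E :: "complex \<Rightarrow> complex" where E: "continuous_on K E"
    "\<And>x. x \<in> K \<Longrightarrow> norm (E x) = 1" "\<And>x. x \<in> K \<Longrightarrow> E (sys_map X x) = circle_proj \<beta> * E x"
    using assms unfolding eigenvalue_def continuous_map_eq_on points_eq by blast
  obtain g where g: "continuous_on K g" "\<And>x. x \<in> K \<Longrightarrow> E x = circle_proj (g x)"
    using real_logarithm[OF E(1,2)] by blast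
  have SK: "sys_map X x \<in> K" if "x \<in> K" for x using sys_map_in that points_eq by simp
  \<comment> \<open>The expression is an integer on the space by the eigenvalue equation; the floor
    only supplies the type.\<close>
  define f where "f x = \<lfloor>\<beta> + g x - g (sys_map X x)\<rfloor>" for x
  have f: "real_of_int (f x) = \<beta> + g x - g (sys_map X x)" if x: "x \<in> K" for x
  proof -
    have "circle_proj (\<beta> + g x) = circle_proj (g (sys_map X x))"
      using E(3)[OF x] g(2)[OF x] g(2)[OF SK[OF x]] by (simp add: circle_proj_add)
    then obtain m where "\<beta> + g x = g (sys_map X x) + of_int m" by (rule circle_proj_eqE)
    then show ?thesis by (simp add: f_def)
  qed
  have "continuous_on K (\<lambda>x. \<beta> + g x - g (sys_map X x))"
    using SK by (intro continuous_intros g(1) continuous_on_compose2[OF g(1) sys_map_continuous_on]) auto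
  then have cf: "int_continuous X f" unfolding int_continuous_eq by (rule continuous_on_eq) (simp add: f)
  obtain B where B: "\<And>x. x \<in> K \<Longrightarrow> \<bar>g x\<bar> \<le> B" using bounded_on_K[OF g(1)] by blast
  have mean: "has_mean X f \<beta>"
  proof (rule has_mean_bounded_birkhoff)
    fix n x assume x: "x \<in> points X"
    have xk: "(sys_map X ^^ k) x \<in> K" for k using sys_pow_in[OF x] points_eq by simp
    have "real_of_int (birkhoff X f n x) = real n * \<beta> + g x - g ((sys_map X ^^ n) x)"
    proof (induction n)
      case (Suc n)
      then show ?case using f[OF xk[of n]] by (simp add: birkhoff_def algebra_simps)
    qed (simp add: birkhoff_def)
    then show "\<bar>real_of_int (birkhoff X f n x) - real n * \<beta>\<bar> \<le> 2 * B"
      using B[OF xk[of n]] B[OF xk[of 0]] by simp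
  qed
  have inK: "split_pt h s b \<in> K" for s b using split_in_points points_eq by simp
  have "jump_sum f a = 0" for a
  proof -
    have "Sum_any (\<lambda>n. real_of_int (jump f (a + of_int n * \<alpha>))) = 0"
    proof (rule telescoping_Sum_any)
      let ?u = "\<lambda>j::int. g (split_pt h True (a + of_int j * \<alpha>)) - g (split_pt h False (a + of_int j * \<alpha>))"
      show "real_of_int (jump f (a + of_int j * \<alpha>)) = ?u j - ?u (j + 1)" for j
        unfolding jump_def of_int_diff f[OF inK] sys_map_split by (simp add: algebra_simps)
      show "finite {j. real_of_int (jump f (a + of_int j * \<alpha>)) \<noteq> 0}"
        using finite_jump_support[OF cf, of a] by simp
      show "(?u \<longlongrightarrow> 0) at_top" "(?u \<longlongrightarrow> 0) at_bot"
        by (intro side_diff_tendsto g(1) int_eventually_neq)+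
    qed
    then show ?thesis unfolding jump_sum_def of_int_Sum_any[symmetric] by simp
  qed
  then show ?thesis by (intro jump_sum_zero_imp_mean[OF cf mean])
qed

lemma asymptotic_split: "asymptotic X (split_pt h s a) (split_pt h s' a)"
  unfolding asymptotic_def mdist_eq sys_iter_split
  by (intro conjI split_pts_asymptotic irrational int_eventually_neq)

text \<open>The rotation is an isometry, so asymptotic points have the same image in the rotation
  factor and can differ only in their side.\<close>

lemma asymptotic_imp_gap:
  assumes x: "x \<in> points X" "x' \<in> points X" "x \<noteq> x'" and as: "asymptotic X x x'"
  shows "\<exists>a s. a \<in> gap_values h \<and> x = split_pt h s a \<and> x' = split_pt h (\<not> s) a"
proof -
  obtain s a where xa: "x = split_pt h s a" using pointsE[OF x(1)] .
  obtain s' a' where xa': "x' = split_pt h s' a'" using pointsE[OF x(2)] .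
  obtain E where E: "continuous_on K E" "\<And>s a. E (split_pt h s a) = circle_proj a"
    using rotation_factor by blast
  have inK: "split_pt h s b \<in> K" for s b using split_in_points points_eq by simp
  have "dist (circle_proj a) (circle_proj a') \<le> 0 + \<epsilon>" if e: "0 < \<epsilon>" for \<epsilon>
  proof -
    obtain \<delta> where d: "\<delta> > 0" "\<And>x x'. x \<in> K \<Longrightarrow> x' \<in> K \<Longrightarrow> dist x' x < \<delta> \<Longrightarrow> dist (E x') (E x) < \<epsilon>"
      using compact_uniformly_continuous[OF E(1) compact_image_growth] e unfolding uniformly_continuous_on_def by metis
    have "((\<lambda>n. dist (sys_iter X n x) (sys_iter X n x')) \<longlongrightarrow> 0) at_top"
      using as by (simp add: asymptotic_def mdist_eq)
    then have "\<forall>\<^sub>F n in at_top. dist (dist (sys_iter X n x) (sys_iter X n x')) 0 < \<delta>"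
      using d(1) by (rule tendstoD)
    then obtain n where n: "dist (sys_iter X n x) (sys_iter X n x') < \<delta>"
      using eventually_happens[of _ "at_top :: int filter"] by (auto simp: dist_real_def)
    then have "dist (E (sys_iter X n x)) (E (sys_iter X n x')) < \<epsilon>"
      unfolding xa xa' sys_iter_split by (intro d(2) inK)
    then have "dist (circle_proj (a + of_int n * \<alpha>)) (circle_proj (a' + of_int n * \<alpha>)) < \<epsilon>"
      unfolding xa xa' sys_iter_split E(2) .
    then have "norm ((circle_proj a - circle_proj a') * circle_proj (of_int n * \<alpha>)) < \<epsilon>"
      by (simp add: circle_proj_add dist_norm algebra_simps)
    then show ?thesis by (simp add: norm_mult dist_norm)
  qed
  then have "dist (circle_proj a) (circle_proj a') \<le> 0" by (rule field_le_epsilon)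
  then obtain m where m: "a = a' + of_int m" using circle_proj_eqE[of a a'] by auto
  have x'2: "x' = split_pt h s' a" by (simp add: xa' m split_add_int)
  have "s \<noteq> s'" "a \<in> gap_values h"
    using x(3) unfolding xa x'2 split_eq_iff by auto
  then show ?thesis using xa x'2 by (intro exI[of _ a] exI[of _ s]) auto
qed

end

section \<open>Torsion of quotients of image groups\<close>

lemma torsion_Mod_iff:
  assumes "comm_group G" "subgroup H G"
  shows "torsion_group (G Mod H) \<longleftrightarrow> (\<forall>x\<in>carrier G. \<exists>n::nat. 0 < n \<and> x [^]\<^bsub>G\<^esub> n \<in> H)"
proof -
  interpret G: comm_group G by fact
  interpret N: normal H G using G.subgroup_imp_normal assms(2) .
  have "(H #>\<^bsub>G\<^esub> x) [^]\<^bsub>G Mod H\<^esub> n = \<one>\<^bsub>G Mod H\<^esub> \<longleftrightarrow> x [^]\<^bsub>G\<^esub> n \<in> H" if "x \<in> carrier G" for x and n :: nat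
    unfolding N.FactGroup_pow[OF that] one_FactGroup
    using G.coset_join1[OF _ _ assms(2)] G.coset_join2[OF _ assms(2)] that by blast
  then show ?thesis
    unfolding torsion_group_def carrier_FactGroup by auto
qed

text \<open>Powers in the group with restricted carrier agree with those in \<open>D\<close>, so
  torsion can be tested on elements of \<open>G\<close>.\<close>

lemma torsion_hom_image_iff:
  assumes G: "group G" and D: "comm_group D" and hom: "\<Phi> \<in> hom G D" and N: "subgroup N G"
  shows "torsion_group (D\<lparr>carrier := \<Phi> ` carrier G\<rparr> Mod (\<Phi> ` N)) \<longleftrightarrow>
    (\<forall>f\<in>carrier G. \<exists>n::nat. 0 < n \<and> \<Phi> f [^]\<^bsub>D\<^esub> n \<in> \<Phi> ` N)"
proof -
  interpret G: group G by fact
  interpret D: comm_group D by fact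
  interpret gh: group_hom G D \<Phi> by unfold_locales (rule hom)
  have sub: "subgroup (\<Phi> ` carrier G) D" by (rule gh.img_is_subgroup)
  have "group (D\<lparr>carrier := \<Phi> ` carrier G\<rparr>)" using D.subgroup_imp_group[OF sub] .
  then have cD: "comm_group (D\<lparr>carrier := \<Phi> ` carrier G\<rparr>)"
    by (rule group.group_comm_groupI) (use subgroup.subset[OF sub] in \<open>auto intro: D.m_comm\<close>)
  have "subgroup (\<Phi> ` N) D" by (rule gh.subgroup_img_is_subgroup[OF N])
  then have "subgroup (\<Phi> ` N) (D\<lparr>carrier := \<Phi> ` carrier G\<rparr>)"
    using sub subgroup.subset[OF N] by (intro D.subgroup_incl) auto
  then have "torsion_group (D\<lparr>carrier := \<Phi> ` carrier G\<rparr> Mod (\<Phi> ` N)) \<longleftrightarrow>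
    (\<forall>x\<in>\<Phi> ` carrier G. \<exists>n::nat. 0 < n \<and> x [^]\<^bsub>D\<lparr>carrier := \<Phi> ` carrier G\<rparr>\<^esub> n \<in> \<Phi> ` N)"
    using torsion_Mod_iff[OF cD] by simp
  then show ?thesis by (simp add: D.nat_pow_consistent[symmetric])
qed

section \<open>Infinitesimal 2-asymptotic factors of split systems\<close>

context compact_system
begin

lemma factor_sys_iter:
  assumes p: "factor_map X Y p" and Y: "is_system Y" and x: "x \<in> points X"
  shows "p (sys_iter X n x) = sys_iter Y n (p x)"
proof -
  interpret Y: compact_system Y by standard (rule Y)
  have px: "p x \<in> points Y" if "x \<in> points X" for x using p that by (auto simp: factor_map_def)
  have ps: "p (sys_map X x) = sys_map Y (p x)" if "x \<in> points X" for x using p that by (auto simp: factor_map_def)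
  show ?thesis
  proof (induction n rule: int_induct[of _ 0])
    case (step1 i)
    then show ?case using sys_iter_Suc[OF x, of i] Y.sys_iter_Suc[OF px[OF x], of i] ps[OF sys_iter_in[OF x, of i]] by simp
  next
    case (step2 i)
    have "sys_map Y (p (sys_iter X (i - 1) x)) = sys_map Y (sys_iter Y (i - 1) (p x))"
      using step2 sys_iter_Suc[OF x, of "i - 1"] Y.sys_iter_Suc[OF px[OF x], of "i - 1"] ps[OF sys_iter_in[OF x, of "i - 1"]] by simp
    then show ?case using bij_betw_imp_inj_on[OF Y.sys_map_bij]
      by (elim inj_onD) (simp_all add: px x sys_iter_in Y.sys_iter_in)
  qed simp
qed

lemma sys_iter_add:
  assumes x: "x \<in> points X"
  shows "sys_iter X m (sys_iter X n x) = sys_iter X (m + n) x"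
proof (induction m rule: int_induct[of _ 0])
  case base show ?case by simp
next
  case (step1 i)
  have "sys_iter X (i + 1) (sys_iter X n x) = sys_map X (sys_iter X i (sys_iter X n x))"
    by (rule sys_iter_Suc) (rule sys_iter_in[OF x])
  also have "\<dots> = sys_map X (sys_iter X (i + n) x)" by (simp only: step1)
  also have "\<dots> = sys_iter X (i + n + 1) x" by (rule sys_iter_Suc[OF x, symmetric])
  also have "i + n + 1 = i + 1 + n" by simp
  finally show ?case .
next
  case (step2 i)
  have "sys_map X (sys_iter X (i - 1) (sys_iter X n x)) = sys_iter X (i - 1 + 1) (sys_iter X n x)"
    by (rule sys_iter_Suc[symmetric]) (rule sys_iter_in[OF x])
  also have "\<dots> = sys_iter X (i + n) x" using step2 by simp
  also have "i + n = i - 1 + n + 1" by simp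
  also have "sys_iter X (i - 1 + n + 1) x = sys_map X (sys_iter X (i - 1 + n) x)" by (rule sys_iter_Suc[OF x])
  finally show ?case using bij_betw_imp_inj_on[OF sys_map_bij]
    by (elim inj_onD) (simp_all add: sys_iter_in x)
qed

text \<open>The choice is made from the trace of the orbit on B, which is the same set for all
  points of the orbit, so they all select the same representative.\<close>

lemma exists_orbit_representatives:
  assumes B: "B \<subseteq> points X"
  shows "\<exists>R. orbit_representatives X B R"
proof -
  define orb where "orb y = {z \<in> B. \<exists>n. z = sys_iter X n y}" for y
  define r where "r y = (SOME z. z \<in> orb y)" for y
  have self: "y \<in> orb y" if "y \<in> B" for y
  proof -
    have "y = sys_iter X 0 y" by simp
    then show ?thesis using that unfolding orb_def by blast
  qed
  have eq: "orb z = orb y" if y: "y \<in> B" and z: "z \<in> orb y" for y z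
  proof -
    obtain n where n: "z = sys_iter X n y" "z \<in> B" using z unfolding orb_def by blast
    have yX: "y \<in> points X" using y B by auto
    show ?thesis
    proof (intro equalityI subsetI)
      fix w assume "w \<in> orb z"
      then obtain m where m: "w = sys_iter X m z" "w \<in> B" unfolding orb_def by blast
      have "w = sys_iter X (m + n) y" unfolding m(1) n(1) by (rule sys_iter_add[OF yX])
      then show "w \<in> orb y" using m(2) unfolding orb_def by blast
    next
      fix w assume "w \<in> orb y"
      then obtain m where m: "w = sys_iter X m y" "w \<in> B" unfolding orb_def by blast
      have "w = sys_iter X (m - n) z" unfolding m(1) n(1) sys_iter_add[OF yX] by simp
      then show "w \<in> orb z" using m(2) unfolding orb_def by blast
    qed
  qed
  have r: "r y \<in> orb y" if "y \<in> B" for y unfolding r_def using self[OF that] by (rule someI)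
  have "\<exists>!z. z \<in> r ` B \<and> (\<exists>n. z = sys_iter X n y)" if y: "y \<in> B" for y
  proof (rule ex1I[of _ "r y"])
    show "r y \<in> r ` B \<and> (\<exists>n. r y = sys_iter X n y)" using y r[OF y] unfolding orb_def by blast
    fix z assume z: "z \<in> r ` B \<and> (\<exists>n. z = sys_iter X n y)"
    then obtain w where w: "w \<in> B" "z = r w" by auto
    have "z \<in> orb w" using r w by simp
    then have "z \<in> B" unfolding orb_def by blast
    have "orb z = orb w" using eq[OF w(1) \<open>z \<in> orb w\<close>] .
    have "z \<in> orb y" using z \<open>z \<in> B\<close> unfolding orb_def by blast
    then have "orb z = orb y" by (rule eq[OF y])
    then have "orb w = orb y" using \<open>orb z = orb w\<close> by simp
    then show "z = r y" unfolding w(2) r_def by simp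
  qed
  moreover have "r ` B \<subseteq> B" using r unfolding orb_def by blast
  ultimately show ?thesis unfolding orbit_representatives_def by (intro exI[of _ "r ` B"] conjI ballI)
qed

end

lemma (in split_system) jump_sum_cong:
  assumes "\<And>x. x \<in> points X \<Longrightarrow> f x = g x"
  shows "jump_sum f a = jump_sum g a"
  by (simp add: jump_sum_def jump_def assms)

lemma restrict_eq_iff: "(\<lambda>y\<in>R. a y) = (\<lambda>y\<in>R. b y) \<longleftrightarrow> (\<forall>y\<in>R. a y = b y)"
  by (auto simp: restrict_def fun_eq_iff)

lemma finite_if_all_equal: "(\<And>x y. x \<in> S \<Longrightarrow> y \<in> S \<Longrightarrow> x = y) \<Longrightarrow> finite S"
proof (cases "S = {}")
  case False
  assume eq: "\<And>x y. x \<in> S \<Longrightarrow> y \<in> S \<Longrightarrow> x = y"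
  obtain x where "x \<in> S" using False by blast
  then have "S \<subseteq> {x}" using eq by blast
  then show ?thesis by (rule finite_subset) simp
qed simp

text \<open>The factor \<open>Y\<close> is left general: the locale serves both to recognize 2-AI
  maps onto any system and to exploit those between split systems.\<close>

locale two_asymptotic_factor = split_system +
  fixes Y :: "'b system" and p :: "complex \<Rightarrow> 'b" and R :: "'b set" and u v :: "'b \<Rightarrow> complex"
  assumes two_as: "two_asymptotic X Y p" and systemY: "is_system Y"
    and reps: "orbit_representatives Y (branch_points X Y p) R"
    and fibers: "\<And>y. y \<in> R \<Longrightarrow> u y \<noteq> v y \<and> fiber X p y = {u y, v y}"
begin

lemma factor: "factor_map X Y p"
  using two_as by (simp add: two_asymptotic_def)

sublocale Y: compact_system Y
  by standard (rule systemY)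

lemma p_in: "x \<in> points X \<Longrightarrow> p x \<in> points Y"
  using factor by (auto simp: factor_map_def)

text \<open>The ordering of a fiber need not follow the orientation of the circle; which side comes
  first decides the sign of the index.\<close>

definition "side_of y = (SOME s. \<exists>a. a \<in> gap_values h \<and> u y = split_pt h s a \<and> v y = split_pt h (\<not> s) a)"
definition "gap_of y = (SOME a. a \<in> gap_values h \<and> u y = split_pt h (side_of y) a \<and> v y = split_pt h (\<not> side_of y) a)"

lemma branch_fiber:
  assumes "y \<in> branch_points X Y p" "x \<in> points X" "x' \<in> points X" "x \<noteq> x'" "p x = y" "p x' = y"
  shows "\<exists>a s. a \<in> gap_values h \<and> x = split_pt h s a \<and> x' = split_pt h (\<not> s) a"
proof -
  obtain w w' where w: "w \<noteq> w'" "fiber X p y = {w, w'}" "asymptotic X w w'"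
    using two_as assms(1) unfolding two_asymptotic_def by blast
  have "x \<in> {w, w'}" "x' \<in> {w, w'}" using w(2) assms by (auto simp: fiber_def)
  then consider "x = w" "x' = w'" | "x = w'" "x' = w" using assms(4) by blast
  then show ?thesis
  proof cases
    case 1 then show ?thesis using asymptotic_imp_gap assms w(3) by blast
  next
    case 2
    then obtain a s where "a \<in> gap_values h" "x' = split_pt h s a" "x = split_pt h (\<not> s) a"
      using asymptotic_imp_gap[of w w'] assms w(3) by blast
    then show ?thesis by (intro exI[of _ a] exI[of _ "\<not> s"]) auto
  qed
qed

lemma gap_of:
  assumes y: "y \<in> R"
  shows "gap_of y \<in> gap_values h" "u y = split_pt h (side_of y) (gap_of y)" "v y = split_pt h (\<not> side_of y) (gap_of y)"
proof -
  have "y \<in> branch_points X Y p" using y reps by (auto simp: orbit_representatives_def)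
  moreover have "u y \<in> fiber X p y" "v y \<in> fiber X p y" using fibers[OF y] by auto
  ultimately have "\<exists>a s. a \<in> gap_values h \<and> u y = split_pt h s a \<and> v y = split_pt h (\<not> s) a"
    using fibers[OF y] by (intro branch_fiber) (auto simp: fiber_def)
  then have "\<exists>s a. a \<in> gap_values h \<and> u y = split_pt h s a \<and> v y = split_pt h (\<not> s) a" by blast
  then have "\<exists>a. a \<in> gap_values h \<and> u y = split_pt h (side_of y) a \<and> v y = split_pt h (\<not> side_of y) a"
    unfolding side_of_def by (rule someI_ex)
  then have "gap_of y \<in> gap_values h \<and> u y = split_pt h (side_of y) (gap_of y) \<and> v y = split_pt h (\<not> side_of y) (gap_of y)"
    unfolding gap_of_def by (rule someI_ex)
  then show "gap_of y \<in> gap_values h" "u y = split_pt h (side_of y) (gap_of y)" "v y = split_pt h (\<not> side_of y) (gap_of y)"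
    by auto
qed

lemma p_gap_of: "y \<in> R \<Longrightarrow> p (split_pt h s (gap_of y)) = y"
proof -
  assume y: "y \<in> R"
  have "u y \<in> fiber X p y" "v y \<in> fiber X p y" using fibers[OF y] by auto
  then have "p (u y) = y" "p (v y) = y" by (auto simp: fiber_def)
  then show ?thesis using gap_of[OF y] by (cases "s = side_of y") auto
qed

definition "idx f y = (if side_of y then 1 else - 1) * jump_sum f (gap_of y)"

lemma idx_eq:
  assumes f: "int_continuous X f" and y: "y \<in> R"
  shows "Sum_any (\<lambda>n. f (sys_iter X n (u y)) - f (sys_iter X n (v y))) = idx f y"
proof (cases "side_of y")
  case True
  then show ?thesis using gap_of[OF y] by (simp add: idx_def jump_sum_def jump_def sys_iter_split)
next
  case False
  then have "Sum_any (\<lambda>n. f (sys_iter X n (u y)) - f (sys_iter X n (v y))) = Sum_any (\<lambda>n. (- 1) * jump f (gap_of y + of_int n * \<alpha>))"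
    using gap_of[OF y] by (simp add: jump_def sys_iter_split)
  also have "\<dots> = (- 1) * jump_sum f (gap_of y)"
    unfolding jump_sum_def by (rule Sum_any_right_distrib[symmetric]) (rule finite_jump_support[OF f])
  finally show ?thesis using False by (simp add: idx_def)
qed

lemma idx_add: "int_continuous X f \<Longrightarrow> int_continuous X g \<Longrightarrow> idx (\<lambda>x. f x + g x) y = idx f y + idx g y"
  by (simp add: idx_def jump_sum_add)

lemma idx_scale: "int_continuous X f \<Longrightarrow> idx (\<lambda>x. k * f x) y = k * idx f y"
  by (simp add: idx_def jump_sum_scale)

lemma idx_shift: "int_continuous X f \<Longrightarrow> idx (\<lambda>x. f (sys_map X x)) y = idx f y"
  by (simp add: idx_def jump_sum_shift)

lemma idx_cong:
  assumes "\<And>x. x \<in> points X \<Longrightarrow> f x = g x"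
  shows "idx f y = idx g y"
  using jump_sum_cong[of f g "gap_of y"] assms by (simp add: idx_def)

text \<open>The index map before passing to cosets; all computations with \<open>index_map\<close>
  are done through it.\<close>

definition "\<Phi> f = (\<lambda>y\<in>R. idx f y)"

lemma \<Phi>_coboundary:
  assumes "int_continuous X f" "int_continuous X w"
  shows "\<Phi> (\<lambda>x\<in>points X. f x + (w x - w (sys_map X x))) = \<Phi> f"
proof -
  have sw: "int_continuous X (\<lambda>x. w (sys_map X x))" by (rule int_continuous_compose[OF sys_map_cont assms(2)])
  have d: "int_continuous X (\<lambda>x. - 1 * w (sys_map X x))" by (rule int_continuous_scale[OF sw])
  have "idx (\<lambda>x\<in>points X. f x + (w x - w (sys_map X x))) y = idx f y" for y
  proof -
    have "idx (\<lambda>x\<in>points X. f x + (w x - w (sys_map X x))) y = idx (\<lambda>x. f x + (w x + - 1 * w (sys_map X x))) y"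
      by (rule idx_cong) simp
    also have "\<dots> = idx f y + (idx w y + idx (\<lambda>x. - 1 * w (sys_map X x)) y)"
      using idx_add[OF assms(1) int_continuous_add[OF assms(2) d]] idx_add[OF assms(2) d] by simp
    also have "idx (\<lambda>x. - 1 * w (sys_map X x)) y = - idx w y"
      using idx_scale[OF sw, of "- 1"] idx_shift[OF assms(2)] by simp
    also have "idx f y + (idx w y + - idx w y) = idx f y" by simp
    finally show ?thesis .
  qed
  then show ?thesis unfolding \<Phi>_def by (intro restrict_ext)
qed

lemma index_map_class:
  assumes f: "f \<in> carrier IF"
  shows "index_map X R u v (coinv_class X f) = \<Phi> f"
proof -
  have cf: "int_continuous X f" using f by (simp add: IF_carrier)
  let ?J = "\<lambda>f. \<lambda>y\<in>R. Sum_any (\<lambda>n::int. f (sys_iter X n (u y)) - f (sys_iter X n (v y)))"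
  have J: "?J k = \<Phi> f" if k: "k \<in> coinv_class X f" for k
  proof -
    obtain w where w: "w \<in> carrier IF" "k = (\<lambda>x\<in>points X. f x + (w x - w (sys_map X x)))"
      using k coinv_class_iff[OF f] by blast
    have cw: "int_continuous X w" using w by (simp add: IF_carrier)
    have "(\<lambda>x\<in>points X. f x + (w x - w (sys_map X x))) \<in> carrier IF"
      by (intro IF_restrict int_continuous_add int_continuous_diff cf cw int_continuous_compose[OF sys_map_cont])
    then have "int_continuous X k" using w(2) by (simp add: IF_carrier)
    then have "?J k = \<Phi> k" unfolding \<Phi>_def by (intro restrict_ext) (rule idx_eq)
    also have "\<dots> = \<Phi> f" unfolding w(2) by (rule \<Phi>_coboundary[OF cf cw])
    finally show ?thesis .
  qed
  have "?J ` coinv_class X f = {\<Phi> f}"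
  proof (intro equalityI subsetI)
    fix t assume "t \<in> ?J ` coinv_class X f"
    then obtain k where "t = ?J k" "k \<in> coinv_class X f" by (rule imageE)
    then show "t \<in> {\<Phi> f}" by (simp only: J singleton_iff)
  next
    fix t assume "t \<in> {\<Phi> f}"
    then have "t = ?J f" by (simp only: J[OF coinv_class_self[OF f]] singleton_iff)
    then show "t \<in> ?J ` coinv_class X f" using coinv_class_self[OF f] by (rule image_eqI)
  qed
  then show ?thesis unfolding index_map_def by simp
qed

text \<open>Only finitely many base points occur in f, and the orbit of each contains the gap of at
  most one representative, because gaps on one orbit lie over one orbit of \<open>Y\<close>.\<close>

lemma finite_idx_support:
  assumes f: "int_continuous X f"
  shows "finite {y \<in> R. idx f y \<noteq> 0}"
proof -
  obtain c N d b where form: "jump_form f c N d b" using exists_jump_form[OF f] by blast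
  have "{y \<in> R. idx f y \<noteq> 0} \<subseteq> (\<Union>i<N. {y \<in> R. gap_of y - b i \<in> rotation_group \<alpha>})"
  proof clarify
    fix y assume y: "y \<in> R" "idx f y \<noteq> 0"
    then have "jump_sum f (gap_of y) \<noteq> 0" by (auto simp: idx_def)
    then have "{i. i < N \<and> gap_of y - b i \<in> rotation_group \<alpha>} \<noteq> {}"
      unfolding jump_form_jump_sum[OF form] by force
    then show "y \<in> (\<Union>i<N. {y \<in> R. gap_of y - b i \<in> rotation_group \<alpha>})" using y by auto
  qed
  moreover have "finite {y \<in> R. gap_of y - b i \<in> rotation_group \<alpha>}" for i
  proof -
    have "y = y'" if "y \<in> R" "y' \<in> R" "gap_of y - b i \<in> rotation_group \<alpha>" "gap_of y' - b i \<in> rotation_group \<alpha>" for y y'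
    proof -
      have "gap_of y' - gap_of y \<in> rotation_group \<alpha>" using rotation_group_diff[OF that(4,3)] by simp
      then obtain m k where mk: "gap_of y' - gap_of y = of_int m + of_int k * \<alpha>" by (rule rotation_groupE)
      then have "gap_of y' = (gap_of y + of_int k * \<alpha>) + of_int m" by simp
      then have "split_pt h True (gap_of y') = sys_iter X k (split_pt h True (gap_of y))"
        by (simp only: split_add_int sys_iter_split)
      then have y': "y' = sys_iter Y k y"
        using factor_sys_iter[OF factor systemY, of "split_pt h True (gap_of y)" k] p_gap_of[OF that(1), of True]
          p_gap_of[OF that(2), of True] by simp
      have yB: "y \<in> branch_points X Y p" using reps that(1) by (auto simp: orbit_representatives_def)
      then have "y \<in> points Y" by (simp add: branch_points_def)
      have "y = sys_iter Y 0 y" by simp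
      then have 1: "y \<in> R \<and> (\<exists>n. y = sys_iter Y n y)" using that(1) by blast
      have 2: "y' \<in> R \<and> (\<exists>n. y' = sys_iter Y n y)" using that(2) y' by blast
      have "\<exists>!r. r \<in> R \<and> (\<exists>n. r = sys_iter Y n y)"
        using reps yB unfolding orbit_representatives_def by simp
      then show ?thesis by (rule ex1E) (metis 1 2)
    qed
    then show ?thesis by (intro finite_if_all_equal) blast
  qed
  then have "finite (\<Union>i<N. {y \<in> R. gap_of y - b i \<in> rotation_group \<alpha>})" by (intro finite_UN_I) auto
  ultimately show ?thesis by (rule finite_subset)
qed

abbreviation "DS \<equiv> sum_group R (\<lambda>_. integer_group)"

lemma DS_comm_group: "comm_group DS"
  by (rule group.group_comm_groupI) (auto simp: sum_group group_integer_group algebra_simps)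

lemma DS_carrier: "carrier DS = {x \<in> R \<rightarrow>\<^sub>E UNIV. finite {y \<in> R. x y \<noteq> 0}}"
  by (simp add: carrier_sum_group group_integer_group)

lemma \<Phi>_hom: "\<Phi> \<in> hom IF DS"
proof (rule homI)
  fix f assume "f \<in> carrier IF"
  then have "int_continuous X f" by (simp add: IF_carrier)
  then have "finite {y \<in> R. idx f y \<noteq> 0}" by (rule finite_idx_support)
  moreover have "{y \<in> R. \<Phi> f y \<noteq> 0} = {y \<in> R. idx f y \<noteq> 0}" by (auto simp: \<Phi>_def)
  ultimately show "\<Phi> f \<in> carrier DS" unfolding DS_carrier by (simp add: \<Phi>_def)
next
  fix f g assume "f \<in> carrier IF" "g \<in> carrier IF"
  then have c: "int_continuous X f" "int_continuous X g" by (auto simp: IF_carrier)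
  have "idx (\<lambda>x\<in>points X. f x + g x) y = idx f y + idx g y" for y
    using idx_add[OF c, of y] idx_cong[of "\<lambda>x\<in>points X. f x + g x" "\<lambda>x. f x + g x" y] by simp
  then show "\<Phi> (f \<otimes>\<^bsub>IF\<^esub> g) = \<Phi> f \<otimes>\<^bsub>DS\<^esub> \<Phi> g"
    by (auto simp: \<Phi>_def IF_mult)
qed

lemma index_map_hom: "index_map X R u v \<in> hom (coinvariants X) DS"
proof (rule homI)
  fix a assume "a \<in> carrier (coinvariants X)"
  then show "index_map X R u v a \<in> carrier DS"
    using \<Phi>_hom by (auto simp: coinvariants_carrier index_map_class hom_def)
next
  fix a b assume "a \<in> carrier (coinvariants X)" "b \<in> carrier (coinvariants X)"
  then obtain f g where fg: "f \<in> carrier IF" "g \<in> carrier IF" "a = coinv_class X f" "b = coinv_class X g"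
    by (auto simp: coinvariants_carrier)
  have "f \<otimes>\<^bsub>IF\<^esub> g \<in> carrier IF"
    using fg comm_group.axioms(2)[OF IF_group] by (simp add: group.subgroup_self subgroup.m_closed)
  then show "index_map X R u v (a \<otimes>\<^bsub>coinvariants X\<^esub> b) = index_map X R u v a \<otimes>\<^bsub>DS\<^esub> index_map X R u v b"
    unfolding fg(3,4) coinv_class_mult[OF fg(1,2)] index_map_class[OF fg(1)] index_map_class[OF fg(2)]
    using index_map_class[of "f \<otimes>\<^bsub>IF\<^esub> g"] hom_mult[OF \<Phi>_hom fg(1,2)] by simp
qed

abbreviation "NF \<equiv> {f \<in> carrier IF. has_mean X f 0}"

lemma NF_subgroup: "subgroup NF IF"
proof -
  interpret G: comm_group IF by (rule IF_group)
  show ?thesis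
  proof (rule G.subgroupI)
    show "NF \<noteq> {}"
    proof -
      have "has_mean X \<one>\<^bsub>IF\<^esub> 0" unfolding IF_one using has_mean_const[of 0] unfolding of_int_0 by (simp cong: has_mean_cong)
      then show ?thesis using G.one_closed by blast
    qed
  next
    fix a assume a: "a \<in> NF"
    define b where "b = (\<lambda>x\<in>points X. - 1 * a x)"
    have b: "b \<in> carrier IF" unfolding b_def using a by (intro IF_restrict int_continuous_scale) (auto simp: IF_carrier)
    have "b \<otimes>\<^bsub>IF\<^esub> a = \<one>\<^bsub>IF\<^esub>" by (auto simp: IF_mult IF_one b_def)
    then have "inv\<^bsub>IF\<^esub> a = b" using a b by (intro G.inv_equality) auto
    moreover have "has_mean X b 0"
    proof -
      have "has_mean X (\<lambda>x. - 1 * a x) (of_int (- 1) * 0)" using a by (intro has_mean_scale) auto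
      then show ?thesis unfolding b_def mult_zero_right by (simp cong: has_mean_cong)
    qed
    ultimately show "inv\<^bsub>IF\<^esub> a \<in> NF" using b by simp
  next
    fix a b assume ab: "a \<in> NF" "b \<in> NF"
    have "has_mean X (\<lambda>x. a x + b x) (0 + 0)" using ab by (intro has_mean_add) auto
    then have "has_mean X (a \<otimes>\<^bsub>IF\<^esub> b) 0" unfolding IF_mult add_0_left by (simp cong: has_mean_cong)
    then show "a \<otimes>\<^bsub>IF\<^esub> b \<in> NF" using ab by auto
  qed auto
qed

text \<open>Every continuous integer function on a split system has a mean, so the states see
  nothing but the mean.\<close>

lemma infinitesimals_eq: "infinitesimals X = coinv_class X ` NF"
proof
  show "infinitesimals X \<subseteq> coinv_class X ` NF"
  proof
    fix g assume g: "g \<in> infinitesimals X"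
    then obtain f where f: "f \<in> carrier IF" "g = coinv_class X f"
      by (auto simp: infinitesimals_def coinvariants_carrier)
    have "has_mean X f 0"
    proof (rule infinitesimal_has_mean_0[OF _ f(1)])
      show "\<exists>c. has_mean X k c" if "k \<in> carrier IF" for k
        using that exists_mean by (simp add: IF_carrier)
      show "coinv_class X f \<in> infinitesimals X" using g f(2) by simp
    qed
    then show "g \<in> coinv_class X ` NF" using f by auto
  qed
qed (auto intro: infinitesimalI)

lemma \<Phi>_pow:
  assumes "f \<in> carrier IF"
  shows "\<Phi> f [^]\<^bsub>DS\<^esub> (n::nat) = (\<lambda>y\<in>R. int n * idx f y)"
proof -
  interpret D: comm_group DS by (rule DS_comm_group)
  show ?thesis
  proof (induction n)
    case 0
    show ?case unfolding D.nat_pow_0 one_sum_group by (intro restrict_ext) simp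
  next
    case (Suc n)
    show ?case unfolding D.nat_pow_Suc Suc mult_sum_group
      by (intro restrict_ext) (simp add: \<Phi>_def algebra_simps)
  qed
qed

lemma torsion_iff:
  "torsion_group (DS\<lparr>carrier := index_map X R u v ` carrier (coinvariants X)\<rparr> Mod (index_map X R u v ` infinitesimals X))
   \<longleftrightarrow> (\<forall>f\<in>carrier IF. \<exists>n::nat. 0 < n \<and> (\<exists>g\<in>NF. \<forall>y\<in>R. int n * idx f y = idx g y))"
proof -
  have 1: "index_map X R u v ` carrier (coinvariants X) = \<Phi> ` carrier IF"
    by (simp add: coinvariants_carrier image_image index_map_class)
  have 2: "index_map X R u v ` infinitesimals X = \<Phi> ` NF"
    by (simp add: infinitesimals_eq image_image index_map_class)
  have "\<Phi> f [^]\<^bsub>DS\<^esub> n \<in> \<Phi> ` NF \<longleftrightarrow> (\<exists>g\<in>NF. \<forall>y\<in>R. int n * idx f y = idx g y)" if "f \<in> carrier IF" for f and n :: nat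
  proof -
    have "(\<lambda>y\<in>R. int n * idx f y) = \<Phi> g \<longleftrightarrow> (\<forall>y\<in>R. int n * idx f y = idx g y)" for g
      unfolding \<Phi>_def by (rule restrict_eq_iff)
    then show ?thesis unfolding \<Phi>_pow[OF that] image_iff by simp
  qed
  then show ?thesis unfolding 1 2
    using torsion_hom_image_iff[OF comm_group.axioms(2)[OF IF_group] DS_comm_group \<Phi>_hom NF_subgroup] by simp
qed

text \<open>If r is the mean of f and n r is the mean of some k on \<open>Y\<close>, then n f - k
  \<circ> p is infinitesimal. It has the index of n f, since k \<circ> p takes equal values on the
  two points of a fiber.\<close>

lemma two_AI_if_mean_values:
  assumes "mean_values X \<subseteq> mean_values Y"
  shows "two_AI X Y p"
proof -
  have "\<exists>n::nat. 0 < n \<and> (\<exists>g\<in>NF. \<forall>y\<in>R. int n * idx f y = idx g y)" if f: "f \<in> carrier IF" for f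
  proof -
    have cf: "int_continuous X f" using f by (simp add: IF_carrier)
    obtain r where r: "has_mean X f r" using exists_mean[OF cf] by blast
    then have "r \<in> mean_values Y" using mean_valuesI[OF cf] assms by blast
    then obtain n k where n: "0 < (n::nat)" "int_continuous Y k" "has_mean Y k (real n * r)"
      unfolding mean_values_def by blast
    have ck: "int_continuous X (\<lambda>x. k (p x))" by (rule int_continuous_factor[OF factor n(2)])
    have mk: "has_mean X (\<lambda>x. k (p x)) (real n * r)" using has_mean_factor[OF factor] n(3) by blast
    define g where "g = (\<lambda>x\<in>points X. int n * f x - k (p x))"
    have g: "g \<in> carrier IF" unfolding g_def by (intro IF_restrict int_continuous_diff int_continuous_scale cf ck)
    have "has_mean X (\<lambda>x. int n * f x - k (p x)) (of_int (int n) * r - real n * r)"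
      by (intro has_mean_diff has_mean_scale r mk)
    moreover have "of_int (int n) * r - real n * r = 0" by simp
    ultimately have "has_mean X g 0" unfolding g_def by (simp only:) (simp cong: has_mean_cong)
    moreover have "int n * idx f y = idx g y" if y: "y \<in> R" for y
    proof -
      have "jump (\<lambda>x. k (p x)) (gap_of y + of_int j * \<alpha>) = 0" for j
      proof -
        have "p (split_pt h s (gap_of y + of_int j * \<alpha>)) = sys_iter Y j y" for s
          using factor_sys_iter[OF factor systemY, of "split_pt h s (gap_of y)" j] p_gap_of[OF y]
          by (simp add: sys_iter_split)
        then show ?thesis by (simp add: jump_def)
      qed
      then have "idx (\<lambda>x. k (p x)) y = 0" by (simp add: idx_def jump_sum_def)
      moreover have "idx g y = idx (\<lambda>x. int n * f x + (- 1) * k (p x)) y" unfolding g_def by (rule idx_cong) simp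
      moreover have "\<dots> = int n * idx f y + (- 1) * idx (\<lambda>x. k (p x)) y"
        using idx_add[OF int_continuous_scale[OF cf] int_continuous_scale[OF ck], of "int n" "- 1" y]
        unfolding idx_scale[OF cf] idx_scale[OF ck] .
      ultimately show ?thesis by simp
    qed
    ultimately show ?thesis using n(1) g by blast
  qed
  then have "torsion_group (DS\<lparr>carrier := index_map X R u v ` carrier (coinvariants X)\<rparr> Mod (index_map X R u v ` infinitesimals X))"
    unfolding torsion_iff by blast
  then show ?thesis unfolding two_AI_def Let_def
    by (intro conjI exI[of _ R] exI[of _ u] exI[of _ v] ballI two_as reps fibers index_map_hom) (simp_all add: fibers)
qed

end

section \<open>Recognizing and exploiting 2-AI factor maps\<close>

lemma two_AI_intro:
  assumes X: "split_system h \<alpha> X" and Y: "is_system Y" and two: "two_asymptotic X Y p"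
    and mean: "mean_values X \<subseteq> mean_values Y"
  shows "two_AI X Y p"
proof -
  interpret X: split_system h \<alpha> X by (rule X)
  interpret Y: compact_system Y by standard (rule Y)
  have "branch_points X Y p \<subseteq> points Y" by (auto simp: branch_points_def)
  then obtain R where R: "orbit_representatives Y (branch_points X Y p) R"
    using Y.exists_orbit_representatives by blast
  have "\<forall>y. \<exists>w. y \<in> R \<longrightarrow> fst w \<noteq> snd w \<and> fiber X p y = {fst w, snd w}"
  proof
    fix y
    show "\<exists>w. y \<in> R \<longrightarrow> fst w \<noteq> snd w \<and> fiber X p y = {fst w, snd w}"
    proof (cases "y \<in> R")
      case True
      then have "y \<in> branch_points X Y p" using R by (auto simp: orbit_representatives_def)
      then obtain x x' where "x \<noteq> x'" "fiber X p y = {x, x'}"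
        using two unfolding two_asymptotic_def by blast
      then show ?thesis by (intro exI[of _ "(x, x')"]) simp
    qed simp
  qed
  then obtain w where w: "\<And>y. y \<in> R \<Longrightarrow> fst (w y) \<noteq> snd (w y) \<and> fiber X p y = {fst (w y), snd (w y)}"
    by metis
  interpret F: two_asymptotic_factor h \<alpha> X Y p R "\<lambda>y. fst (w y)" "\<lambda>y. snd (w y)"
    by unfold_locales (use two Y R w in auto)
  show ?thesis by (rule F.two_AI_if_mean_values[OF mean])
qed

lemma rotation_group_subset_mean_values:
  assumes "compact_system Y" "\<alpha> \<in> mean_values Y"
  shows "rotation_group \<alpha> \<subseteq> mean_values Y"
proof
  interpret Y: compact_system Y by fact
  fix g assume "g \<in> rotation_group \<alpha>"
  then obtain m k where g: "g = of_int m + of_int k * \<alpha>" by (rule rotation_groupE)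
  have "rat_scale (of_int m) 1 + rat_scale (of_int k) \<alpha> \<in> mean_values Y"
    by (intro Q.subspace_add[OF Y.mean_values_subspace] Q.subspace_scale[OF Y.mean_values_subspace] Y.one_in_mean_values assms(2))
  then show "g \<in> mean_values Y" by (simp add: g rat_scale_of_int)
qed

lemma rotation_group_swap:
  assumes "\<beta> \<in> rotation_group \<alpha>" "\<beta> \<notin> \<rat>"
  obtains j l :: int where "j \<noteq> 0" "of_int j * \<alpha> = \<beta> - of_int l"
proof -
  obtain l j where lj: "\<beta> = of_int l + of_int j * \<alpha>" using assms(1) by (rule rotation_groupE)
  have "j \<noteq> 0"
  proof
    assume "j = 0"
    then have "\<beta> = of_int l" using lj by simp
    then show False using assms(2) by simp
  qed
  then show thesis using that[of j l] lj by simp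
qed

text \<open>A multiple of f has the index of an infinitesimal g over the branch points. Subtracting
  g keeps the mean and kills this index; the jumps across closed gaps can then be removed at the
  cost of an element of Z + Z \<alpha>, and the result descends to \<open>Y\<close>.\<close>

lemma two_AI_elim:
  assumes X: "split_system h \<alpha> X" and Y: "split_system k \<beta> Y" and two: "two_AI X Y p"
  shows "mean_values X = mean_values Y" "\<beta> \<in> rotation_group \<alpha>"
proof -
  interpret X: split_system h \<alpha> X by (rule X)
  interpret SY: split_system k \<beta> Y by (rule Y)
  obtain R u v where R: "orbit_representatives Y (branch_points X Y p) R"
    and uv: "\<forall>y\<in>R. u y \<noteq> v y \<and> fiber X p y = {u y, v y}"
    and tor: "torsion_group (sum_group R (\<lambda>_. integer_group)\<lparr>carrier := index_map X R u v ` carrier (coinvariants X)\<rparr> Mod (index_map X R u v ` infinitesimals X))"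
    using two unfolding two_AI_def Let_def by blast
  have two_as: "two_asymptotic X Y p" using two by (simp add: two_AI_def)
  interpret F: two_asymptotic_factor h \<alpha> X Y p R u v
    by unfold_locales (use two_as SY.is_system R uv in auto)
  note factor = F.factor
  have pY: "p x \<in> points Y" if "x \<in> points X" for x using F.p_in[OF that] .
  show beta: "\<beta> \<in> rotation_group \<alpha>"
    by (rule X.eigenvalue_in_rotation_group[OF X.eigenvalue_factor[OF factor SY.eigenvalue_alpha]])
  \<comment> \<open>With j \<noteq> 0 the number \<alpha> becomes a rational combination of mean
    values of \<open>Y\<close>. Thus the elements of Z + Z \<alpha> that are lost in removing jumps
    are mean values of \<open>Y\<close> as well.\<close>
  obtain j l where jl: "j \<noteq> 0" "of_int j * \<alpha> = \<beta> - of_int l"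
    using rotation_group_swap[OF beta SY.irrational] .
  note sub = SY.mean_values_subspace
  have "rat_scale (1 / of_int j) (\<beta> - rat_scale (of_int l) 1) \<in> mean_values Y"
    by (intro Q.subspace_scale[OF sub] Q.subspace_diff[OF sub] SY.alpha_in_mean_values SY.one_in_mean_values)
  moreover have "rat_scale (1 / of_int j) (\<beta> - rat_scale (of_int l) 1) = \<alpha>"
    using jl by (simp add: rat_scale_of_int) (simp add: rat_scale_def of_rat_divide jl(2)[symmetric])
  ultimately have "\<alpha> \<in> mean_values Y" by simp
  then have \<Gamma>: "rotation_group \<alpha> \<subseteq> mean_values Y"
    by (rule rotation_group_subset_mean_values[OF SY.compact_system_axioms])
  define Br where "Br = {a \<in> gap_values h. p (split_pt h True a) = p (split_pt h False a)}"
  have p_group: "\<exists>n. \<forall>s a. p (split_pt h s (a + g)) = sys_iter Y n (p (split_pt h s a))" if g: "g \<in> rotation_group \<alpha>" for g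
  proof -
    obtain m n where mn: "g = of_int m + of_int n * \<alpha>" using g by (rule rotation_groupE)
    have "p (split_pt h s (a + g)) = sys_iter Y n (p (split_pt h s a))" for s a
    proof -
      have "a + g = (a + of_int n * \<alpha>) + of_int m" by (simp add: mn)
      then have "split_pt h s (a + g) = sys_iter X n (split_pt h s a)"
        by (simp only: X.split_add_int X.sys_iter_split)
      then show ?thesis using X.factor_sys_iter[OF factor SY.is_system, of "split_pt h s a" n] by simp
    qed
    then show ?thesis by blast
  qed
  have Br_add: "a + g \<in> Br" if g: "g \<in> rotation_group \<alpha>" and a: "a \<in> Br" for a g
  proof -
    obtain n where n: "\<And>s a. p (split_pt h s (a + g)) = sys_iter Y n (p (split_pt h s a))"
      using p_group[OF g] by blast
    show ?thesis using a X.gap_add_group[OF g, of a] by (simp add: Br_def n)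
  qed
  have Br: "a + g \<in> Br \<longleftrightarrow> a \<in> Br" if "g \<in> rotation_group \<alpha>" for a g
    using Br_add[OF that, of a] Br_add[OF rotation_group_minus[OF that], of "a + g"] by auto
  have "r \<in> mean_values Y" if r: "r \<in> mean_values X" for r
  proof -
    obtain n f where n: "0 < (n::nat)" "int_continuous X f" "has_mean X f (real n * r)"
      using r unfolding mean_values_def by blast
    define f' where "f' = restrict f (points X)"
    have f': "f' \<in> carrier X.IF" unfolding f'_def by (rule X.IF_restrict[OF n(2)])
    have cf': "int_continuous X f'" using f' by (simp add: X.IF_carrier)
    have mf': "has_mean X f' (real n * r)"
      using n(3) X.has_mean_cong[of f' f "real n * r"] by (simp add: f'_def)
    obtain m g where m: "0 < (m::nat)" and g: "g \<in> F.NF" and mg: "\<And>y. y \<in> R \<Longrightarrow> int m * F.idx f' y = F.idx g y"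
      using tor f' unfolding F.torsion_iff by blast
    have cg: "int_continuous X g" using g by (simp add: X.IF_carrier)
    define kf where "kf x = int m * f' x + (- 1) * g x" for x
    have ckf: "int_continuous X kf" unfolding kf_def by (intro int_continuous_add int_continuous_scale cf' cg)
    have mkf: "has_mean X kf (of_int (int m) * (real n * r) + of_int (- 1) * 0)"
      unfolding kf_def using g by (intro X.has_mean_add X.has_mean_scale mf') auto
    have idx0: "F.idx kf y = 0" if "y \<in> R" for y
    proof -
      have "F.idx kf y = F.idx (\<lambda>x. int m * f' x) y + F.idx (\<lambda>x. (- 1) * g x) y"
        unfolding kf_def by (rule F.idx_add[OF int_continuous_scale[OF cf'] int_continuous_scale[OF cg]])
      also have "\<dots> = int m * F.idx f' y + (- 1) * F.idx g y"
        by (simp only: F.idx_scale[OF cf'] F.idx_scale[OF cg])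
      finally show ?thesis using mg[OF that] by simp
    qed
    \<comment> \<open>Every closed gap lies on the orbit of the gap of some representative, and
      index sums are constant along orbits.\<close>
    have zero: "X.jump_sum kf a = 0" if a: "a \<in> Br" for a
    proof -
      have ag: "a \<in> gap_values h" and pa: "p (split_pt h True a) = p (split_pt h False a)" using a by (auto simp: Br_def)
      define y where "y = p (split_pt h True a)"
      have ne: "split_pt h True a \<noteq> split_pt h False a" using ag by (simp add: X.split_eq_iff)
      have fib: "split_pt h s a \<in> fiber X p y" for s using pa by (cases s) (auto simp: fiber_def y_def)
      have "\<not> is_singleton (fiber X p y)"
      proof
        assume "is_singleton (fiber X p y)"
        then obtain z where "fiber X p y = {z}" by (rule is_singletonE)
        then show False using fib[of True] fib[of False] ne by simp
      qed
      then have yB: "y \<in> branch_points X Y p" unfolding branch_points_def using pY by (simp add: y_def)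
      have "\<exists>!r. r \<in> R \<and> (\<exists>n. r = sys_iter Y n y)" using R yB unfolding orbit_representatives_def by simp
      then obtain r i where r: "r \<in> R" "r = sys_iter Y i y" by (elim ex1E conjE exE)
      define g where "g = F.gap_of r"
      have "p (split_pt h True (a + of_int i * \<alpha>)) = r"
        using X.factor_sys_iter[OF factor SY.is_system, of "split_pt h True a" i] r(2)
        by (simp add: X.sys_iter_split y_def)
      then have "split_pt h True (a + of_int i * \<alpha>) \<in> fiber X p r" by (simp add: fiber_def)
      then have "split_pt h True (a + of_int i * \<alpha>) \<in> {u r, v r}" using F.fibers[OF r(1)] by simp
      then have "\<exists>s. split_pt h True (a + of_int i * \<alpha>) = split_pt h s g"
        using F.gap_of(2,3)[OF r(1)] unfolding g_def by auto
      then have "a + of_int i * \<alpha> - g \<in> \<int>" by (auto simp: X.split_eq_iff)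
      then obtain e where "a + of_int i * \<alpha> - g = of_int e" by (elim Ints_cases)
      then have eq: "g = a + (of_int (- e) + of_int i * \<alpha>)" by simp
      have "X.jump_sum kf g = X.jump_sum kf a"
        unfolding eq by (rule X.jump_sum_add_group[OF ckf]) (rule rotation_groupI, rule refl)
      moreover have "X.jump_sum kf g = 0" using idx0[OF r(1)] by (auto simp: F.idx_def g_def split: if_splits)
      ultimately show ?thesis by simp
    qed
    obtain q e where q: "int_continuous X q" "has_mean X q e"
      and ce: "(of_int (int m) * (real n * r) + of_int (- 1) * 0) - e \<in> rotation_group \<alpha>"
      and qj: "\<forall>a\<in>Br. X.jump q a = 0"
      using X.remove_null_jumps[OF ckf mkf Br zero] by blast
    have q_fib: "q x = q x'" if x: "x \<in> points X" "x' \<in> points X" "p x = p x'" for x x'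
    proof (cases "x = x'")
      case False
      have "\<not> is_singleton (fiber X p (p x))"
      proof
        assume "is_singleton (fiber X p (p x))"
        then obtain z where "fiber X p (p x) = {z}" by (rule is_singletonE)
        moreover have "x \<in> fiber X p (p x)" "x' \<in> fiber X p (p x)" using x by (auto simp: fiber_def)
        ultimately show False using False by simp
      qed
      then have "p x \<in> branch_points X Y p" unfolding branch_points_def using pY[OF x(1)] by simp
      then have "\<exists>a s. a \<in> gap_values h \<and> x = split_pt h s a \<and> x' = split_pt h (\<not> s) a"
        by (rule F.branch_fiber[OF _ x(1,2) False refl x(3)[symmetric]])
      then obtain a s where a: "a \<in> gap_values h" "x = split_pt h s a" "x' = split_pt h (\<not> s) a" by blast
      have "p (split_pt h True a) = p (split_pt h False a)" using x(3) a(2,3) by (cases s) auto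
      then have "X.jump q a = 0" using qj a(1) by (simp add: Br_def)
      then show ?thesis using a(2,3) by (cases s) (auto simp: X.jump_def)
    qed simp
    define q' where "q' y = q (SOME x. x \<in> points X \<and> p x = y)" for y
    have q': "q' (p x) = q x" if x: "x \<in> points X" for x
    proof -
      define z where "z = (SOME z. z \<in> points X \<and> p z = p x)"
      have z: "z \<in> points X \<and> p z = p x"
        unfolding z_def by (rule someI[of "\<lambda>z. z \<in> points X \<and> p z = p x" x]) (simp add: x)
      have "q' (p x) = q z" by (simp only: q'_def z_def)
      also have "q z = q x" by (rule q_fib) (use z x in simp_all)
      finally show ?thesis .
    qed
    \<comment> \<open>A continuous map from a compact space to a Hausdorff space is closed, so
      continuity passes from q to the function q' that it induces on \<open>Y\<close>.\<close>
    have "Hausdorff_space (sys_top Y)" unfolding SY.top_eq by (simp add: Hausdorff_space_subtopology)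
    then have closed_map: "closed_map (sys_top X) (sys_top Y) p"
      using factor X.compact_space by (intro continuous_imp_closed_map) (simp_all add: factor_map_def)
    have cq': "int_continuous Y q'"
      unfolding int_continuous_iff
    proof
      fix j
      have "openin (sys_top X) {x \<in> points X. q x = j}" using q(1) by (simp add: int_continuous_iff)
      then have "closedin (sys_top X) (topspace (sys_top X) - {x \<in> points X. q x = j})" by (rule openin_closedin_eq[THEN iffD1, THEN conjunct2])
      then have "closedin (sys_top Y) (p ` (topspace (sys_top X) - {x \<in> points X. q x = j}))"
        using closed_map by (simp add: closed_map_def)
      then have "openin (sys_top Y) (topspace (sys_top Y) - p ` (topspace (sys_top X) - {x \<in> points X. q x = j}))"
        by (rule openin_diff[OF openin_topspace])
      moreover have "topspace (sys_top Y) - p ` (topspace (sys_top X) - {x \<in> points X. q x = j}) = {y \<in> points Y. q' y = j}"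
      proof (intro equalityI subsetI)
        fix y assume y: "y \<in> topspace (sys_top Y) - p ` (topspace (sys_top X) - {x \<in> points X. q x = j})"
        then have "y \<in> p ` points X" using factor by (simp add: factor_map_def)
        then obtain x where x: "x \<in> points X" "y = p x" by blast
        then have "q x = j" using y by auto
        then show "y \<in> {y \<in> points Y. q' y = j}" using x q' pY by simp
      next
        fix y assume "y \<in> {y \<in> points Y. q' y = j}"
        then have y: "y \<in> points Y" "q' y = j" by auto
        have "y \<notin> p ` (topspace (sys_top X) - {x \<in> points X. q x = j})"
        proof
          assume "y \<in> p ` (topspace (sys_top X) - {x \<in> points X. q x = j})"
          then obtain x where "x \<in> points X" "q x \<noteq> j" "y = p x" by auto
          then show False using y q' by simp
        qed
        then show "y \<in> topspace (sys_top Y) - p ` (topspace (sys_top X) - {x \<in> points X. q x = j})" using y by simp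
      qed
      ultimately show "openin (sys_top Y) {y \<in> points Y. q' y = j}" by simp
    qed
    obtain c' where c': "has_mean Y q' c'" using SY.exists_mean[OF cq'] by blast
    have "has_mean X (\<lambda>x. q' (p x)) c'" using X.has_mean_factor[OF factor] c' by blast
    then have "has_mean X q c'" using X.has_mean_cong[of "\<lambda>x. q' (p x)" q c'] q' by blast
    then have "e = c'" using X.has_mean_unique q(2) by blast
    then have e: "e \<in> mean_values Y" using SY.mean_valuesI[OF cq'] c' by simp
    have "(of_int (int m) * (real n * r) + of_int (- 1) * 0) - e + e \<in> mean_values Y"
      using ce \<Gamma> e by (intro Q.subspace_add[OF sub]) auto
    then have "real (m * n) * r \<in> mean_values Y" by (simp add: mult.assoc)
    then have "rat_scale (1 / of_nat (m * n)) (real (m * n) * r) \<in> mean_values Y" by (rule Q.subspace_scale[OF sub])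
    moreover have "rat_scale (1 / of_nat (m * n)) (real (m * n) * r) = r"
      unfolding rat_scale_def of_rat_divide of_rat_1 of_rat_of_nat_eq using m n(1) by simp
    ultimately show ?thesis by simp
  qed
  then show "mean_values X = mean_values Y" using X.mean_values_factor[OF factor] by blast
qed

text \<open>Keeping side and value glues the two sides of exactly those gaps that \<open>k\<close>
  lacks; these pairs are asymptotic.\<close>

lemma split_refinement:
  assumes X: "split_system h \<alpha> X" and Y: "split_system k \<alpha> Y" and gaps: "gap_values k \<subseteq> gap_values h"
  shows "\<exists>p. two_asymptotic X Y p"
proof -
  interpret X: split_system h \<alpha> X by (rule X)
  interpret Y: split_system k \<alpha> Y by (rule Y)
  obtain p where p: "continuous_on (circle_proj ` growth_points h) p" "\<And>s a. p (split_pt h s a) = split_pt k s (a + 0)"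
    using circle_transfer[OF X.degree_one Y.degree_one, of 0] gaps by auto
  have ps: "p (split_pt h s a) = split_pt k s a" for s a using p(2)[of s a] by simp
  have pX: "p x \<in> points Y" if x: "x \<in> points X" for x
  proof -
    obtain s a where "x = split_pt h s a" using X.pointsE[OF x] .
    then show ?thesis by (simp add: ps)
  qed
  have factor: "factor_map X Y p"
    unfolding factor_map_def
  proof (intro conjI ballI)
    show "continuous_map (sys_top X) (sys_top Y) p"
      unfolding X.top_eq Y.top_eq continuous_map_in_subtopology
      using p(1) pX by (simp add: X.points_eq Y.points_eq image_subset_iff)
    show "p ` points X = points Y"
    proof (intro equalityI subsetI)
      fix y assume "y \<in> points Y"
      then obtain s a where "y = split_pt k s a" by (rule Y.pointsE)
      then have "y = p (split_pt h s a)" by (simp add: ps)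
      then show "y \<in> p ` points X" by simp
    qed (use pX in auto)
    fix x assume "x \<in> points X"
    then obtain s a where "x = split_pt h s a" by (rule X.pointsE)
    then show "p (sys_map X x) = sys_map Y (p x)" by (simp add: ps X.sys_map_split Y.sys_map_split)
  qed
  have br: "\<exists>a\<in>gap_values h. y = split_pt k True a \<and> fiber X p y = {split_pt h True a, split_pt h False a}"
    if y: "y \<in> branch_points X Y p" for y
  proof -
    have yY: "y \<in> points Y" and ns: "\<not> is_singleton (fiber X p y)" using y by (auto simp: branch_points_def)
    obtain s a where ya: "y = split_pt k s a" using Y.pointsE[OF yY] .
    have memb: "\<exists>s'. x = split_pt h s' a" if x: "x \<in> fiber X p y" for x
    proof -
      have "x \<in> points X" and px: "p x = y" using x by (auto simp: fiber_def)
      then obtain s' a' where x': "x = split_pt h s' a'" using X.pointsE by blast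
      have "split_pt k s' a' = split_pt k s a" using px ya x' by (simp add: ps)
      then have "a' - a \<in> \<int>" by (simp add: Y.split_eq_iff)
      then have "split_pt h s' (a + (a' - a)) = split_pt h s' a" by (rule X.split_add_Ints)
      then show ?thesis using x' by auto
    qed
    have x0: "split_pt h s a \<in> fiber X p y" by (simp add: fiber_def ps ya)
    then have "fiber X p y \<noteq> {split_pt h s a}" using ns by auto
    then obtain x1 where x1: "x1 \<in> fiber X p y" "x1 \<noteq> split_pt h s a" using x0 by blast
    obtain s' where s': "x1 = split_pt h s' a" using memb[OF x1(1)] by blast
    have ss: "s' \<noteq> s"
    proof
      assume "s' = s"
      then show False using x1(2) s' by simp
    qed
    have ag: "a \<in> gap_values h" using x1(2) s' X.split_eq_iff[of s' a s a] by auto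
    have both: "split_pt h t a \<in> fiber X p y" for t using x0 x1(1) s' ss by (cases "t = s") auto
    then have "y = p (split_pt h True a)" by (simp add: fiber_def)
    moreover have "fiber X p y = {split_pt h True a, split_pt h False a}"
    proof (intro equalityI subsetI)
      fix x assume "x \<in> fiber X p y"
      then obtain t where "x = split_pt h t a" using memb by blast
      then show "x \<in> {split_pt h True a, split_pt h False a}" by (cases t) auto
    qed (use both in auto)
    ultimately show ?thesis using ag ps by auto
  qed
  have "branch_points X Y p \<subseteq> (\<lambda>a. split_pt k True a) ` gap_values h" using br by blast
  then have "countable (branch_points X Y p)"
    using X.countable_gap_values countable_subset by blast
  moreover have "\<exists>x x'. x \<noteq> x' \<and> fiber X p y = {x, x'} \<and> asymptotic X x x'" if y: "y \<in> branch_points X Y p" for y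
  proof -
    obtain a where a: "a \<in> gap_values h" "fiber X p y = {split_pt h True a, split_pt h False a}" using br[OF y] by blast
    have "split_pt h True a \<noteq> split_pt h False a" using a(1) by (simp add: X.split_eq_iff)
    then show ?thesis using a(2) X.asymptotic_split by blast
  qed
  ultimately show ?thesis using factor unfolding two_asymptotic_def by blast
qed

text \<open>Complex conjugation reverses the circle and exchanges the sides. It is a conjugacy, so
  it has no branch points and is a factor map in both directions, which makes the mean values
  agree.\<close>

lemma split_reflection:
  assumes X: "split_system h \<alpha> X"
  shows "\<exists>Y k. split_system k (- \<alpha>) Y \<and> gap_values k = uminus ` gap_values h \<and> (\<exists>p. two_AI X Y p)"
proof -
  interpret X: split_system h \<alpha> X by (rule X)
  define k where "k t = - h (- t)" for t
  have "degree_one k"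
  proof
    show "continuous_on UNIV k" unfolding k_def
      by (intro continuous_intros continuous_on_compose2[OF X.cont]) auto
    show "mono k" unfolding k_def by (intro monoI) (simp add: X.h_mono)
    show "k (t + 1) = k t + 1" for t using X.h_add_int[of "- t" "- 1"] by (simp add: k_def)
  qed
  then interpret K: degree_one k .
  have left: "left_pt k a = - right_pt h (- a)" for a
  proof (rule antisym)
    show "left_pt k a \<le> - right_pt h (- a)" by (rule K.left_le) (simp add: k_def)
    have "h (- left_pt k a) = - a" using K.h_left[of a] by (simp add: k_def)
    then have "- left_pt k a \<le> right_pt h (- a)" by (intro X.le_right) simp
    then show "- right_pt h (- a) \<le> left_pt k a" by simp
  qed
  have right: "right_pt k a = - left_pt h (- a)" for a
  proof (rule antisym)
    show "- left_pt h (- a) \<le> right_pt k a" by (rule K.le_right) (simp add: k_def)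
    have "h (- right_pt k a) = - a" using K.h_right[of a] by (simp add: k_def)
    then have "left_pt h (- a) \<le> - right_pt k a" by (intro X.left_le) simp
    then show "right_pt k a \<le> - left_pt h (- a)" by simp
  qed
  have split: "split_pt k s a = cnj (split_pt h (\<not> s) (- a))" for s a
    by (auto simp: split_pt_def side_pt_def left right circle_proj_minus)
  have gaps: "a \<in> gap_values k \<longleftrightarrow> - a \<in> gap_values h" for a
    by (simp add: gap_values_def left right)
  define Y :: "complex system" where
    "Y = (submetric euclidean_metric (circle_proj ` growth_points k), \<lambda>z. cnj (sys_map X (cnj z)))"
  have "split_system k (- \<alpha>) Y"
  proof
    show "- \<alpha> \<notin> \<rat>" using X.irrational by simp
    show "gap_values k \<noteq> {}"
    proof -
      obtain a where "a \<in> gap_values h" using X.gaps_nonempty by blast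
      then have "- a \<in> gap_values k" by (simp add: gaps)
      then show ?thesis by blast
    qed
    show "a + - \<alpha> \<in> gap_values k \<longleftrightarrow> a \<in> gap_values k" for a
      using X.gaps_invariant[of "- a"] by (simp add: gaps algebra_simps)
    show "fst Y = submetric euclidean_metric (circle_proj ` growth_points k)" by (simp add: Y_def)
    show "sys_map Y (split_pt k s a) = split_pt k s (a + - \<alpha>)" for s a
      by (simp add: Y_def split X.sys_map_split algebra_simps)
  qed
  then interpret Y: split_system k "- \<alpha>" Y .
  have split': "split_pt h s a = cnj (split_pt k (\<not> s) (- a))" for s a by (simp add: split)
  have cX: "cnj x \<in> points Y" if x: "x \<in> points X" for x
  proof -
    obtain s a where "x = split_pt h s a" using X.pointsE[OF x] .
    then have "cnj x = split_pt k (\<not> s) (- a)" by (simp add: split')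
    then show ?thesis by simp
  qed
  have cY: "cnj y \<in> points X" if y: "y \<in> points Y" for y
  proof -
    obtain s a where "y = split_pt k s a" using Y.pointsE[OF y] .
    then have "cnj y = split_pt h (\<not> s) (- a)" by (simp add: split)
    then show ?thesis by simp
  qed
  have fX: "factor_map X Y cnj"
    unfolding factor_map_def
  proof (intro conjI ballI)
    show "continuous_map (sys_top X) (sys_top Y) cnj"
      unfolding X.top_eq Y.top_eq continuous_map_in_subtopology
      using cX by (auto simp: X.points_eq Y.points_eq intro!: continuous_intros)
    show "cnj ` points X = points Y"
    proof (intro equalityI subsetI)
      fix y assume "y \<in> points Y"
      then show "y \<in> cnj ` points X" using cY[of y] by (intro image_eqI[of _ _ "cnj y"]) auto
    qed (use cX in auto)
  qed (simp add: Y_def)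
  have fY: "factor_map Y X cnj"
    unfolding factor_map_def
  proof (intro conjI ballI)
    show "continuous_map (sys_top Y) (sys_top X) cnj"
      unfolding X.top_eq Y.top_eq continuous_map_in_subtopology
      using cY by (auto simp: X.points_eq Y.points_eq intro!: continuous_intros)
    show "cnj ` points Y = points X"
    proof (intro equalityI subsetI)
      fix x assume "x \<in> points X"
      then show "x \<in> cnj ` points Y" using cX[of x] by (intro image_eqI[of _ _ "cnj x"]) auto
    qed (use cY in auto)
  qed (simp add: Y_def)
  have "branch_points X Y cnj = {}"
  proof -
    have "fiber X cnj y = {cnj y}" if "y \<in> points Y" for y
      using cY[OF that] by (auto simp: fiber_def)
    then show ?thesis by (simp add: branch_points_def)
  qed
  then have "two_asymptotic X Y cnj" using fX by (simp add: two_asymptotic_def)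
  then have "two_AI X Y cnj"
    by (rule two_AI_intro[OF X Y.is_system _ Y.mean_values_factor[OF fY]])
  moreover have "gap_values k = uminus ` gap_values h"
  proof (intro equalityI subsetI)
    fix a assume "a \<in> gap_values k"
    then show "a \<in> uminus ` gap_values h" using gaps by (intro image_eqI[of _ _ "- a"]) auto
  qed (auto simp: gaps)
  ultimately show ?thesis using Y.split_system_axioms by blast
qed

section \<open>Suspensions\<close>

context compact_system
begin

abbreviation "PT \<equiv> prod_topology (sys_top X) euclideanreal"

lemma susp_class_iter:
  assumes x: "x \<in> points X"
  shows "susp_class X (sys_iter X n x, s) = susp_class X (x, s + of_int n)"
proof -
  have "(sys_iter X m (sys_iter X n x), s - of_int m) = (sys_iter X (m + n) x, s + of_int n - of_int (m + n))" for m
    using sys_iter_add[OF x, of m n] by simp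
  then have "susp_class X (sys_iter X n x, s) = {(sys_iter X (m + n) x, s + of_int n - of_int (m + n)) | m. True}"
    by (simp add: susp_class_def)
  also have "\<dots> = {(sys_iter X m x, s + of_int n - of_int m) | m. True}"
  proof (intro equalityI subsetI)
    fix z assume "z \<in> {(sys_iter X m x, s + of_int n - of_int m) | m. True}"
    then obtain m where "z = (sys_iter X m x, s + of_int n - of_int m)" by blast
    then have "z = (sys_iter X ((m - n) + n) x, s + of_int n - of_int ((m - n) + n))" by simp
    then show "z \<in> {(sys_iter X (m + n) x, s + of_int n - of_int (m + n)) | m. True}" by blast
  qed blast
  finally show ?thesis by (simp add: susp_class_def)
qed

lemma susp_class_step:
  assumes x: "x \<in> points X"
  shows "susp_class X (sys_map X x, s) = susp_class X (x, s + 1)"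
  using susp_class_iter[OF x, of 1 s] sys_iter_Suc[OF x, of 0] by simp

lemma susp_class_eqD:
  assumes "susp_class X (x, s) = susp_class X (x', s')" "x' \<in> points X"
  shows "\<exists>n. x' = sys_iter X n x \<and> s' = s - of_int n"
proof -
  have "(x', s') = (sys_iter X 0 x', s' - of_int 0)" by simp
  then have "(x', s') \<in> susp_class X (x', s')" unfolding susp_class_def by blast
  then have "(x', s') \<in> susp_class X (x, s)" using assms by simp
  then show ?thesis by (auto simp: susp_class_def)
qed

lemma susp_flow_class: "susp_flow t (susp_class X (x, s)) = susp_class X (x, s + t)"
proof -
  have "susp_flow t (susp_class X (x, s)) = {(sys_iter X n x, s - of_int n + t) | n. True}"
    by (auto simp: susp_flow_def susp_class_def)
  also have "\<dots> = susp_class X (x, s + t)" by (simp add: susp_class_def algebra_simps)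
  finally show ?thesis .
qed

lemma topspace_suspension: "topspace (suspension X) = susp_class X ` (points X \<times> UNIV)"
proof
  show "topspace (suspension X) \<subseteq> susp_class X ` (points X \<times> UNIV)"
    using openin_topspace[of "suspension X"] unfolding openin_suspension by blast
  have "{p \<in> points X \<times> UNIV. susp_class X p \<in> susp_class X ` (points X \<times> UNIV)} = topspace PT"
    by auto
  then have "openin (suspension X) (susp_class X ` (points X \<times> UNIV))"
    unfolding openin_suspension by (simp only: openin_topspace) simp
  then show "susp_class X ` (points X \<times> UNIV) \<subseteq> topspace (suspension X)" by (rule openin_subset)
qed

lemma quotient_map_susp_class: "quotient_map PT (suspension X) (susp_class X)"
  unfolding quotient_map_def topspace_suspension
proof (intro conjI allI impI)
  show "susp_class X ` topspace PT = susp_class X ` (points X \<times> UNIV)" by simp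
  fix U assume "U \<subseteq> susp_class X ` (points X \<times> UNIV)"
  then show "openin PT {x \<in> topspace PT. susp_class X x \<in> U} = openin (suspension X) U"
    unfolding openin_suspension by simp
qed

lemma susp_points: 
  assumes "c \<in> topspace (suspension X)"
  obtains x s where "x \<in> points X" "c = susp_class X (x, s)"
  using assms unfolding topspace_suspension by auto

lemma susp_class_in: "x \<in> points X \<Longrightarrow> susp_class X (x, s) \<in> topspace (suspension X)"
  unfolding topspace_suspension by blast

end

section \<open>Affine maps between suspensions\<close>

lemma circle_proj_section: 
  fixes t :: real and x :: complex
  assumes "norm x = 1"
  shows "circle_proj (t + Arg (x / circle_proj t) / (2 * pi)) = x"
proof -
  have n: "norm (x / circle_proj t) = 1" using assms by (simp add: norm_divide)
  then have "x / circle_proj t \<noteq> 0" by auto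
  then have "cis (Arg (x / circle_proj t)) = x / circle_proj t" using n by (simp add: cis_Arg sgn_div_norm)
  then show ?thesis by (simp add: circle_proj_add) (simp add: circle_proj_def)
qed

text \<open>The time axis is not compact, so the quotient argument for the circle is replaced by
  local sections: near each point of the circle, away from the cut of \<open>Arg\<close>, the
  argument lifts back to P.\<close>

lemma openin_circle_product:
  fixes P :: "real set" and W :: "(complex \<times> real) set"
  assumes per: "\<And>t n. t \<in> P \<Longrightarrow> t + of_int n \<in> P"
    and sub: "W \<subseteq> (circle_proj ` P) \<times> UNIV"
    and op: "openin (top_of_set (P \<times> UNIV)) {p \<in> P \<times> UNIV. (circle_proj (fst p), snd p) \<in> W}"
  shows "openin (top_of_set ((circle_proj ` P) \<times> UNIV)) W"
proof -
  let ?S = "(circle_proj ` P) \<times> (UNIV :: real set)"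
  let ?O = "{p \<in> P \<times> UNIV. (circle_proj (fst p), snd p) \<in> W}"
  define sec where "sec t = (\<lambda>x. t + Arg (x / circle_proj t) / (2 * pi))" for t
  define N where "N t = {x::complex. x / circle_proj t \<notin> \<real>\<^sub>\<le>\<^sub>0}" for t
  have oN: "open (N t)" for t
  proof -
    have "N t = (\<lambda>x. x / circle_proj t) -` (- \<real>\<^sub>\<le>\<^sub>0)" by (auto simp: N_def)
    moreover have "open \<dots>" by (intro open_vimage continuous_intros) auto
    ultimately show ?thesis by simp
  qed
  have in_P: "sec t x \<in> P" if "x \<in> circle_proj ` P" for t x
  proof -
    from that obtain u where u: "u \<in> P" "x = circle_proj u" by blast
    have "circle_proj (sec t x) = circle_proj u" using circle_proj_section[of x t] u(2) by (simp add: sec_def)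
    then obtain m where "sec t x = u + of_int m" by (rule circle_proj_eqE)
    then show ?thesis using per u(1) by simp
  qed
  have sec: "circle_proj (sec t x) = x" if "x \<in> circle_proj ` P" for t x
    using that circle_proj_section[of x t] by (auto simp: sec_def)
  have W_eq: "W = (\<Union>t\<in>P. {p \<in> ?S \<inter> (N t \<times> UNIV). (sec t (fst p), snd p) \<in> ?O})"
  proof (intro equalityI subsetI)
    fix p assume p: "p \<in> W"
    then obtain t where t: "t \<in> P" "fst p = circle_proj t" using sub by auto
    have "1 \<notin> (\<real>\<^sub>\<le>\<^sub>0 :: complex set)" by simp
    then have "fst p \<in> N t" using t by (simp add: N_def)
    moreover have "(sec t (fst p), snd p) \<in> ?O"
    proof -
      have x: "fst p \<in> circle_proj ` P" using t by simp
      have "(circle_proj (sec t (fst p)), snd p) = p" using sec[OF x] by simp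
      then show ?thesis using p in_P[OF x] by simp
    qed
    ultimately show "p \<in> (\<Union>t\<in>P. {p \<in> ?S \<inter> (N t \<times> UNIV). (sec t (fst p), snd p) \<in> ?O})"
      using t p sub by (intro UN_I[of t]) auto
  next
    fix p assume "p \<in> (\<Union>t\<in>P. {p \<in> ?S \<inter> (N t \<times> UNIV). (sec t (fst p), snd p) \<in> ?O})"
    then obtain t where "fst p \<in> circle_proj ` P" "(circle_proj (sec t (fst p)), snd p) \<in> W" by auto
    then show "p \<in> W" using sec by simp
  qed
  have "openin (top_of_set ?S) {p \<in> ?S \<inter> (N t \<times> UNIV). (sec t (fst p), snd p) \<in> ?O}" for t
  proof -
    let ?S' = "?S \<inter> (N t \<times> UNIV)"
    have "continuous_on ?S' (\<lambda>p. (sec t (fst p), snd p))"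
      unfolding sec_def by (intro continuous_intros continuous_on_subset[OF continuous_on_Arg]) (auto simp: N_def)
    moreover have "(\<lambda>p. (sec t (fst p), snd p)) ` ?S' \<subseteq> P \<times> UNIV" using in_P by auto
    ultimately have "openin (top_of_set ?S') (?S' \<inter> (\<lambda>p. (sec t (fst p), snd p)) -` ?O)"
      by (intro continuous_openin_preimage[OF _ _ op]) auto
    moreover have "?S' \<inter> (\<lambda>p. (sec t (fst p), snd p)) -` ?O = {p \<in> ?S'. (sec t (fst p), snd p) \<in> ?O}" by blast
    moreover have "openin (top_of_set ?S) ?S'" using oN[of t] by (intro openin_open_Int open_Times) auto
    ultimately show ?thesis using openin_trans by simp
  qed
  then show ?thesis by (subst W_eq) (intro openin_Union, blast)
qed


context split_system
begin

lemma PT_eq: "PT = top_of_set (K \<times> UNIV)"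
  by (simp add: top_eq prod_topology_subtopology)

end

text \<open>In the coordinates (s, a, r) the map is linear. The hypothesis \<open>inv1\<close> says
  that it respects a \<mapsto> a + m for integers m, and \<open>inv2\<close> that it respects the
  identification of (a, r) with (a + n \<alpha>, r - n).\<close>

lemma suspension_map_exists:
  assumes X: "split_system h \<alpha> X" and Y: "split_system k \<beta> Y" and \<kappa>: "0 < \<kappa>"
    and gaps: "\<And>a. \<kappa> * a \<in> gap_values k \<Longrightarrow> a \<in> gap_values h"
    and inv1: "\<And>s b r m. susp_class Y (split_pt k s (b + \<kappa> * of_int m), r + \<nu> * of_int m) = susp_class Y (split_pt k s b, r)"
    and inv2: "\<And>s b r n. susp_class Y (split_pt k s (b + \<kappa> * (of_int n * \<alpha>)), r - \<rho> * of_int n + \<nu> * (of_int n * \<alpha>)) = susp_class Y (split_pt k s b, r)"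
  shows "\<exists>H. continuous_map (suspension X) (suspension Y) H \<and>
    (\<forall>s a r. H (susp_class X (split_pt h s a, r)) = susp_class Y (split_pt k s (\<kappa> * a), \<rho> * r + \<nu> * a))"
proof -
  interpret X: split_system h \<alpha> X by (rule X)
  interpret Y: split_system k \<beta> Y by (rule Y)
  have wd: "susp_class Y (split_pt k s (\<kappa> * a), \<rho> * r + \<nu> * a) = susp_class Y (split_pt k s' (\<kappa> * a'), \<rho> * r' + \<nu> * a')"
    if eq: "susp_class X (split_pt h s a, r) = susp_class X (split_pt h s' a', r')" for s a r s' a' r'
  proof -
    obtain n where n: "split_pt h s' a' = sys_iter X n (split_pt h s a)" "r' = r - of_int n"
      using X.susp_class_eqD[OF eq] by auto
    then have "split_pt h s' a' = split_pt h s (a + of_int n * \<alpha>)" by (simp add: X.sys_iter_split)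
    then have "a' - (a + of_int n * \<alpha>) \<in> \<int>" and side: "s' = s \<or> a' \<notin> gap_values h"
      by (simp_all add: X.split_eq_iff)
    then obtain m where "a' - (a + of_int n * \<alpha>) = of_int m" by (elim Ints_cases)
    then have a': "a' = a + of_int n * \<alpha> + of_int m" by simp
    have "split_pt k s' (\<kappa> * a') = split_pt k s (\<kappa> * a')"
      using side gaps[of a'] by (auto simp: Y.split_eq_iff)
    then have "susp_class Y (split_pt k s' (\<kappa> * a'), \<rho> * r' + \<nu> * a') = susp_class Y (split_pt k s (\<kappa> * a'), \<rho> * r' + \<nu> * a')"
      by simp
    also have "\<dots> = susp_class Y (split_pt k s ((\<kappa> * a + \<kappa> * (of_int n * \<alpha>)) + \<kappa> * of_int m), (\<rho> * r + \<nu> * a - \<rho> * of_int n + \<nu> * (of_int n * \<alpha>)) + \<nu> * of_int m)"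
      by (simp add: a' n(2) algebra_simps)
    also have "\<dots> = susp_class Y (split_pt k s (\<kappa> * a + \<kappa> * (of_int n * \<alpha>)), \<rho> * r + \<nu> * a - \<rho> * of_int n + \<nu> * (of_int n * \<alpha>))"
      by (rule inv1)
    also have "\<dots> = susp_class Y (split_pt k s (\<kappa> * a), \<rho> * r + \<nu> * a)"
      by (rule inv2)
    finally show ?thesis by simp
  qed
  define H where "H c = (SOME d. \<exists>s a r. c = susp_class X (split_pt h s a, r) \<and> d = susp_class Y (split_pt k s (\<kappa> * a), \<rho> * r + \<nu> * a))" for c
  have H: "H (susp_class X (split_pt h s a, r)) = susp_class Y (split_pt k s (\<kappa> * a), \<rho> * r + \<nu> * a)" for s a r
  proof -
    let ?P = "\<lambda>d. \<exists>s' a' r'. susp_class X (split_pt h s a, r) = susp_class X (split_pt h s' a', r') \<and> d = susp_class Y (split_pt k s' (\<kappa> * a'), \<rho> * r' + \<nu> * a')"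
    have "?P (SOME d. ?P d)" by (rule someI[of ?P "susp_class Y (split_pt k s (\<kappa> * a), \<rho> * r + \<nu> * a)"]) blast
    then obtain s' a' r' where e: "susp_class X (split_pt h s a, r) = susp_class X (split_pt h s' a', r')"
      and d: "(SOME d. ?P d) = susp_class Y (split_pt k s' (\<kappa> * a'), \<rho> * r' + \<nu> * a')" by blast
    show ?thesis unfolding H_def d using wd[OF e] by simp
  qed
  obtain T where T: "continuous_on (growth_points h) T" "\<And>s a. T (side_pt h s a) = side_pt k s (\<kappa> * a + 0)"
    using monotone_transfer[OF X.degree_one Y.degree_one \<kappa>, of 0] gaps by auto
  have T': "circle_proj (T (side_pt h s a)) = split_pt k s (\<kappa> * a)" for s a using T(2)[of s a] by (simp add: split_pt_def)
  have "continuous_map (suspension X) (suspension Y) H"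
    unfolding continuous_map
  proof (intro conjI allI impI)
    show "H ` topspace (suspension X) \<subseteq> topspace (suspension Y)"
    proof
      fix d assume "d \<in> H ` topspace (suspension X)"
      then obtain c where c: "c \<in> topspace (suspension X)" "d = H c" by blast
      obtain x r where x: "x \<in> points X" "c = susp_class X (x, r)" using X.susp_points[OF c(1)] .
      obtain s a where "x = split_pt h s a" using X.pointsE[OF x(1)] .
      then show "d \<in> topspace (suspension Y)" using c x H Y.susp_class_in by simp
    qed
    fix U assume U: "openin (suspension Y) U"
    define W where "W = {p \<in> points X \<times> UNIV. H (susp_class X p) \<in> U}"
    define V where "V = {p \<in> points Y \<times> UNIV. susp_class Y p \<in> U}"
    have V: "openin (top_of_set (Y.K \<times> UNIV)) V" using U Y.PT_eq unfolding openin_suspension V_def by simp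
    \<comment> \<open>The map lifted to the line times the time axis, where continuity is known from
      \<open>monotone_transfer\<close>.\<close>
    let ?g = "\<lambda>p. (circle_proj (T (fst p)), \<rho> * snd p + \<nu> * h (fst p))"
    have cont: "continuous_on (growth_points h \<times> UNIV) ?g"
      by (intro continuous_intros continuous_on_compose2[OF T(1)] continuous_on_compose2[OF X.cont]) auto
    have gY: "?g ` (growth_points h \<times> UNIV) \<subseteq> Y.K \<times> UNIV"
    proof clarsimp
      fix t assume "t \<in> growth_points h"
      then obtain s where "t = side_pt h s (h t)" by (rule X.growthE)
      then have "circle_proj (T t) = split_pt k s (\<kappa> * h t)" using T' by metis
      then show "circle_proj (T t) \<in> Y.K" using Y.split_in_points Y.points_eq by simp
    qed
    have "openin (top_of_set (growth_points h \<times> UNIV)) ((growth_points h \<times> UNIV) \<inter> ?g -` V)"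
      by (rule continuous_openin_preimage[OF cont _ V]) (use gY in auto)
    moreover have "(growth_points h \<times> UNIV) \<inter> ?g -` V = {p \<in> growth_points h \<times> UNIV. (circle_proj (fst p), snd p) \<in> W}"
    proof -
      have "?g p \<in> V \<longleftrightarrow> (circle_proj (fst p), snd p) \<in> W" if p: "fst p \<in> growth_points h" for p
      proof -
        obtain s where s: "fst p = side_pt h s (h (fst p))" using X.growthE[OF p] .
        have 1: "circle_proj (fst p) = split_pt h s (h (fst p))" using s by (simp add: split_pt_def)
        have 2: "circle_proj (T (fst p)) = split_pt k s (\<kappa> * h (fst p))" using T'[of s "h (fst p)"] s by simp
        show ?thesis unfolding 1 2 by (simp add: H V_def W_def)
      qed
      then show ?thesis by auto
    qed
    moreover have "W \<subseteq> X.K \<times> UNIV" by (auto simp: W_def X.points_eq)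
    ultimately have "openin (top_of_set (X.K \<times> UNIV)) W"
      by (intro openin_circle_product) (simp_all add: X.growth_add_int)
    then have W: "openin X.PT W" by (simp add: X.PT_eq)
    let ?U = "{c \<in> topspace (suspension X). H c \<in> U}"
    have "{p \<in> points X \<times> UNIV. susp_class X p \<in> ?U} = W"
      unfolding X.topspace_suspension W_def by auto
    then show "openin (suspension X) ?U"
      unfolding openin_suspension using W X.topspace_suspension by auto
  qed
  then show ?thesis using H by blast
qed

text \<open>The map (a, r) \<mapsto> (a / \<alpha>, \<alpha> r + a) exchanges the two circles of the
  suspension. A full turn a \<mapsto> a + 1 in X becomes a return of the flow in Y, and the
  identification with (a + \<alpha>, r - 1) becomes a full turn in Y. Time is multiplied by
  \<alpha>, whose positivity keeps the orientation of the orbits.\<close>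

lemma flow_equivalent_inversion:
  assumes X: "split_system h \<alpha> X" and Y: "split_system k (- 1 / \<alpha>) Y" and \<alpha>: "0 < \<alpha>"
    and gaps: "gap_values k = (\<lambda>a. a / \<alpha>) ` gap_values h"
  shows "flow_equivalent X Y"
proof -
  interpret X: split_system h \<alpha> X by (rule X)
  interpret Y: split_system k "- 1 / \<alpha>" Y by (rule Y)
  have gaps': "a / \<alpha> \<in> gap_values k \<longleftrightarrow> a \<in> gap_values h" for a using \<alpha> by (auto simp: gaps)
  have Yit: "susp_class Y (split_pt k s (b + of_int n * (- 1 / \<alpha>)), r) = susp_class Y (split_pt k s b, r + of_int n)" for s b r n
    using Y.susp_class_iter[of "split_pt k s b" n r] by (simp add: Y.sys_iter_split)
  have Xit: "susp_class X (split_pt h s (b + of_int n * \<alpha>), r) = susp_class X (split_pt h s b, r + of_int n)" for s b r n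
    using X.susp_class_iter[of "split_pt h s b" n r] by (simp add: X.sys_iter_split)
  have "\<exists>H. continuous_map (suspension X) (suspension Y) H \<and>
    (\<forall>s a r. H (susp_class X (split_pt h s a, r)) = susp_class Y (split_pt k s (1 / \<alpha> * a), \<alpha> * r + 1 * a))"
  proof (rule suspension_map_exists[OF X Y])
    show "0 < 1 / \<alpha>" using \<alpha> by simp
    show "a \<in> gap_values h" if "1 / \<alpha> * a \<in> gap_values k" for a using that gaps'[of a] by simp
    show "susp_class Y (split_pt k s (b + 1 / \<alpha> * of_int m), r + 1 * of_int m) = susp_class Y (split_pt k s b, r)" for s b r m
      using Yit[of s b "- m" "r + of_int m"] by simp
    show "susp_class Y (split_pt k s (b + 1 / \<alpha> * (of_int n * \<alpha>)), r - \<alpha> * of_int n + 1 * (of_int n * \<alpha>)) = susp_class Y (split_pt k s b, r)" for s b r n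
      using \<alpha> by (simp add: Y.split_add_int)
  qed
  then obtain H where H: "continuous_map (suspension X) (suspension Y) H"
    "\<And>s a r. H (susp_class X (split_pt h s a, r)) = susp_class Y (split_pt k s (1 / \<alpha> * a), \<alpha> * r + 1 * a)"
    by blast
  have "\<exists>G. continuous_map (suspension Y) (suspension X) G \<and>
    (\<forall>s a r. G (susp_class Y (split_pt k s a, r)) = susp_class X (split_pt h s (\<alpha> * a), 1 / \<alpha> * r + (- 1) * a))"
  proof (rule suspension_map_exists[OF Y X \<alpha>])
    show "a \<in> gap_values k" if "\<alpha> * a \<in> gap_values h" for a using that gaps'[of "\<alpha> * a"] \<alpha> by simp
    show "susp_class X (split_pt h s (b + \<alpha> * of_int m), r + - 1 * of_int m) = susp_class X (split_pt h s b, r)" for s b r m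
      using Xit[of s b m "r - of_int m"] by (simp add: mult.commute)
    show "susp_class X (split_pt h s (b + \<alpha> * (of_int n * (- 1 / \<alpha>))), r - 1 / \<alpha> * of_int n + - 1 * (of_int n * (- 1 / \<alpha>))) = susp_class X (split_pt h s b, r)" for s b r n
      using \<alpha> X.split_add_int[of s b "- n"] by simp
  qed
  then obtain G where G: "continuous_map (suspension Y) (suspension X) G"
    "\<And>s a r. G (susp_class Y (split_pt k s a, r)) = susp_class X (split_pt h s (\<alpha> * a), 1 / \<alpha> * r + (- 1) * a)"
    by blast
  have repX: "\<exists>s a r. c = susp_class X (split_pt h s a, r)" if "c \<in> topspace (suspension X)" for c
    using that X.susp_points X.pointsE by metis
  have repY: "\<exists>s a r. c = susp_class Y (split_pt k s a, r)" if "c \<in> topspace (suspension Y)" for c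
    using that Y.susp_points Y.pointsE by metis
  have GH: "G (H c) = c" if "c \<in> topspace (suspension X)" for c
  proof -
    obtain s a r where "c = susp_class X (split_pt h s a, r)" using repX[OF \<open>c \<in> topspace (suspension X)\<close>] by blast
    then show ?thesis using \<alpha> by (simp add: H(2) G(2) field_simps)
  qed
  have HG: "H (G c) = c" if "c \<in> topspace (suspension Y)" for c
  proof -
    obtain s a r where "c = susp_class Y (split_pt k s a, r)" using repY[OF \<open>c \<in> topspace (suspension Y)\<close>] by blast
    then show ?thesis using \<alpha> by (simp add: H(2) G(2) field_simps)
  qed
  have "homeomorphic_maps (suspension X) (suspension Y) H G"
    unfolding homeomorphic_maps_def using H(1) G(1) GH HG by blast
  then have hom: "homeomorphic_map (suspension X) (suspension Y) H" using homeomorphic_map_maps by blast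
  have flow: "H (susp_flow t c) = susp_flow (\<alpha> * t) (H c)" if "c \<in> topspace (suspension X)" for c t
  proof -
    obtain s a r where "c = susp_class X (split_pt h s a, r)" using repX[OF \<open>c \<in> topspace (suspension X)\<close>] by blast
    then show ?thesis by (simp add: X.susp_flow_class Y.susp_flow_class H(2) algebra_simps)
  qed
  show ?thesis
    unfolding flow_equivalent_def
  proof (intro exI[of _ H] conjI ballI hom)
    fix c assume c: "c \<in> topspace (suspension X)"
    have "H ` flow_orbit c = (\<lambda>t. susp_flow t (H c)) ` range (\<lambda>t. \<alpha> * t)"
      unfolding flow_orbit_def image_image by (simp add: flow[OF c])
    also have "range (\<lambda>t. \<alpha> * t) = UNIV"
    proof -
      have "t \<in> range (\<lambda>t. \<alpha> * t)" for t using \<alpha> by (intro image_eqI[of _ _ "t / \<alpha>"]) auto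
      then show ?thesis by blast
    qed
    finally show "H ` flow_orbit c = flow_orbit (H c)" by (simp add: flow_orbit_def)
    show "\<exists>g::real \<Rightarrow> real. continuous_on UNIV g \<and> strict_mono g \<and> (\<forall>t. H (susp_flow t c) = susp_flow (g t) (H c))"
      using \<alpha> flow[OF c] by (intro exI[of _ "\<lambda>t. \<alpha> * t"]) (auto intro!: continuous_intros strict_monoI)
  qed
qed

section \<open>Winding numbers along leaves of the suspension\<close>

lemma circle_proj_Im:
  assumes "norm (exp w) = 1"
  shows "exp w = circle_proj (Im w / (2 * pi))"
proof -
  have "exp (Re w) = 1" using assms by (simp add: norm_exp_eq_Re)
  then have "Re w = 0" by simp
  then have "exp w = cis (Im w)" by (simp add: exp_eq_polar)
  then show ?thesis by (simp add: circle_proj_def)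
qed

lemma integer_valued_constant:
  fixes f :: "real \<Rightarrow> real"
  assumes "continuous_on S f" "connected S" "\<And>s. s \<in> S \<Longrightarrow> f s \<in> \<int>" "s \<in> S" "t \<in> S"
  shows "f s = f t"
proof -
  have "f constant_on S"
  proof (rule continuous_discrete_range_constant[OF assms(2,1)])
    fix x assume x: "x \<in> S"
    have "1 \<le> norm (f y - f x)" if y: "y \<in> S" "f y \<noteq> f x" for y
    proof -
      obtain m where m: "f x = of_int m" using assms(3)[OF x] by (elim Ints_cases)
      obtain n where n: "f y = of_int n" using assms(3)[OF y(1)] by (elim Ints_cases)
      have "n \<noteq> m" using y(2) m n by auto
      then have "1 \<le> \<bar>n - m\<bar>" by linarith
      then have "1 \<le> real_of_int \<bar>n - m\<bar>" by linarith
      then show ?thesis by (simp add: m n)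
    qed
    then show "\<exists>e>0. \<forall>y. y \<in> S \<and> f y \<noteq> f x \<longrightarrow> e \<le> norm (f y - f x)"
      by (intro exI[of _ 1]) auto
  qed
  then show ?thesis using assms(4,5) by (auto simp: constant_on_def)
qed

text \<open>The difference of two lifts is continuous with integer values, hence constant on a
  connected set.\<close>

lemma lifts_parallel:
  fixes f g :: "real \<Rightarrow> real"
  assumes "continuous_on S f" "continuous_on S g" "connected S" "\<And>s. s \<in> S \<Longrightarrow> circle_proj (f s) = circle_proj (g s)"
    "s \<in> S" "t \<in> S"
  shows "f s - f t = g s - g t"
proof -
  have "f s - g s = f t - g t"
    by (rule integer_valued_constant[of S "\<lambda>s. f s - g s"])
      (use assms in \<open>auto intro!: continuous_intros simp flip: circle_proj_eq_iff\<close>)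
  then show ?thesis by simp
qed

text \<open>An integer-valued function on the base corresponds to a circle-valued map on the suspension, and
  its mean to the speed at which this map winds along the flow lines.  Reparametrizing time
  multiplies all these speeds by a common factor, which is what makes them useful for flow equivalence.\<close>

definition susp_circle_map :: "'a system \<Rightarrow> (('a \<times> real) set \<Rightarrow> complex) \<Rightarrow> bool" where
  "susp_circle_map X c \<longleftrightarrow> continuous_map (suspension X) euclidean c \<and> (\<forall>p\<in>topspace (suspension X). norm (c p) = 1)"

definition leaf_lift :: "'a system \<Rightarrow> (('a \<times> real) set \<Rightarrow> complex) \<Rightarrow> 'a \<Rightarrow> (real \<Rightarrow> real) \<Rightarrow> bool" where
  "leaf_lift X c x l \<longleftrightarrow> continuous_on UNIV l \<and> (\<forall>s. circle_proj (l s) = c (susp_class X (x, s)))"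

definition leaf_mean :: "'a system \<Rightarrow> (('a \<times> real) set \<Rightarrow> complex) \<Rightarrow> real \<Rightarrow> bool" where
  "leaf_mean X c r \<longleftrightarrow> (\<forall>x\<in>points X. \<forall>l. leaf_lift X c x l \<longrightarrow> ((\<lambda>s. l s / s) \<longlongrightarrow> r) at_top)"

context compact_system
begin

lemma susp_descend:
  fixes C :: "'a \<times> real \<Rightarrow> 'b"
  assumes "\<And>x s. x \<in> points X \<Longrightarrow> C (sys_map X x, s) = C (x, s + 1)"
  shows "\<exists>c. \<forall>x\<in>points X. \<forall>s. c (susp_class X (x, s)) = C (x, s :: real)"
proof (intro exI ballI allI)
  fix x and s :: real assume x: "x \<in> points X"
  have inv: "C (sys_iter X n x, r) = C (x, r + of_int n)" for n r
  proof (induction n arbitrary: r rule: int_induct[of _ 0])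
    case (step1 i)
    have "C (sys_iter X (i + 1) x, r) = C (sys_iter X i x, r + 1)"
      unfolding sys_iter_Suc[OF x] by (rule assms) (rule sys_iter_in[OF x])
    then show ?case using step1 by (simp add: algebra_simps)
  next
    case (step2 i)
    have "C (sys_iter X (i - 1 + 1) x, r - 1) = C (sys_iter X (i - 1) x, (r - 1) + 1)"
      unfolding sys_iter_Suc[OF x, of "i - 1"] by (rule assms) (rule sys_iter_in[OF x])
    then show ?case using step2 by (simp add: algebra_simps)
  qed simp
  have "(x, s) = (sys_iter X 0 x, s - of_int 0)" by simp
  then have "(x, s) \<in> susp_class X (x, s)" unfolding susp_class_def by blast
  then have "(SOME p. p \<in> susp_class X (x, s)) \<in> susp_class X (x, s)" by (rule someI)
  then obtain n where n: "(SOME p. p \<in> susp_class X (x, s)) = (sys_iter X n x, s - of_int n)"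
    by (auto simp: susp_class_def)
  show "(\<lambda>K. C (SOME p. p \<in> K)) (susp_class X (x, s)) = C (x, s)"
    unfolding n by (simp add: inv)
qed

lemma leaf_mean_lift:
  assumes c: "susp_circle_map X c" and x: "x \<in> points X"
  shows "\<exists>l. leaf_lift X c x l"
proof -
  have "continuous_map euclideanreal PT (\<lambda>s. (x, s))" using x by (intro continuous_map_pairedI) auto
  then have "continuous_map euclideanreal euclidean ((c \<circ> susp_class X) \<circ> (\<lambda>s. (x, s)))"
    using c quotient_imp_continuous_map[OF quotient_map_susp_class]
    unfolding susp_circle_map_def by (intro continuous_map_compose) auto
  then have cont: "continuous_on UNIV (\<lambda>s. c (susp_class X (x, s)))"
    by (simp add: o_def)
  have n: "norm (c (susp_class X (x, s))) = 1" for s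
    using c susp_class_in[OF x] unfolding susp_circle_map_def by blast
  then have "c (susp_class X (x, s)) \<noteq> 0" for s by (metis norm_zero zero_neq_one)
  then obtain g where g: "continuous_on UNIV g" "\<And>s. c (susp_class X (x, s)) = exp (g s)"
    using continuous_logarithm_on_contractible[OF cont contractible_UNIV] by (metis UNIV_I)
  have "leaf_lift X c x (\<lambda>s. Im (g s) / (2 * pi))"
    unfolding leaf_lift_def using g(1) n
    by (auto intro!: continuous_intros simp: g(2) simp flip: circle_proj_Im)
  then show ?thesis by blast
qed

lemma leaf_mean_unique:
  assumes c: "susp_circle_map X c" and "leaf_mean X c r" "leaf_mean X c r'"
  shows "r = r'"
proof -
  obtain x where x: "x \<in> points X" using points_nonempty by blast
  obtain l where l: "leaf_lift X c x l" using leaf_mean_lift[OF c x] by blast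
  have "((\<lambda>s. l s / s) \<longlongrightarrow> r) at_top" "((\<lambda>s. l s / s) \<longlongrightarrow> r') at_top"
    using assms(2,3) x l unfolding leaf_mean_def by blast+
  then show ?thesis by (rule tendsto_unique[rotated]) simp
qed

end

context split_system
begin

lemma susp_circle_map_iff:
  "susp_circle_map X c \<longleftrightarrow> continuous_on (K \<times> UNIV) (\<lambda>p. c (susp_class X p)) \<and>
     (\<forall>x\<in>K. \<forall>s. norm (c (susp_class X (x, s))) = 1)"
proof -
  have "continuous_map (suspension X) euclidean c \<longleftrightarrow> continuous_map PT euclidean (c \<circ> susp_class X)"
    using continuous_compose_quotient_map_eq[OF quotient_map_susp_class] by blast
  also have "\<dots> \<longleftrightarrow> continuous_on (K \<times> UNIV) (\<lambda>p. c (susp_class X p))"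
    unfolding PT_eq by (simp add: o_def)
  finally show ?thesis unfolding susp_circle_map_def topspace_suspension points_eq by auto
qed

lemma susp_circle_map_descend:
  assumes inv: "\<And>x s. x \<in> points X \<Longrightarrow> C (sys_map X x, s) = C (x, s + 1)"
    and cont: "continuous_on (K \<times> UNIV) C" and norm: "\<And>x s. x \<in> points X \<Longrightarrow> norm (C (x, s)) = 1"
  shows "\<exists>c. susp_circle_map X c \<and> (\<forall>x\<in>points X. \<forall>s. c (susp_class X (x, s)) = C (x, s :: real))"
proof -
  obtain c where c: "\<And>x s. x \<in> points X \<Longrightarrow> c (susp_class X (x, s)) = C (x, s)"
    using susp_descend[of C] inv by blast
  have "continuous_on (K \<times> UNIV) (\<lambda>p. c (susp_class X p))"
    by (rule continuous_on_eq[OF cont]) (auto simp: c points_eq)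
  then have "susp_circle_map X c" unfolding susp_circle_map_iff using c norm by (simp add: points_eq)
  then show ?thesis using c by blast
qed

text \<open>Over the base there is a logarithm g of the circle map. Continue it along the flow for
  one unit of time: its mismatch with g at the return point is the integer function F, and the mean
  of F is the winding speed. The cocycle identity is recorded so that the two sides of a gap can be
  compared later.\<close>

lemma winding_cocycle:
  assumes c: "susp_circle_map X c"
  shows "\<exists>F g r. int_continuous X F \<and> continuous_on K g \<and> has_mean X F r \<and> leaf_mean X c r \<and>
    (\<forall>x\<in>points X. \<forall>l. leaf_lift X c x l \<longrightarrow>
      (\<forall>j::int. real_of_int (F (sys_iter X j x)) = l (of_int j + 1) - l (of_int j) - g (sys_iter X (j + 1) x) + g (sys_iter X j x)))"
proof -
  have cc: "continuous_on (K \<times> UNIV) (\<lambda>p. c (susp_class X p))"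
    and cn: "\<And>x s. x \<in> K \<Longrightarrow> norm (c (susp_class X (x, s))) = 1"
    using c unfolding susp_circle_map_iff by blast+
  have SK: "sys_map X x \<in> K" if "x \<in> K" for x using sys_map_in that points_eq by simp
  have c0: "continuous_on K (\<lambda>x. c (susp_class X (x, 0)))"
    by (rule continuous_on_compose2[OF cc]) (auto intro!: continuous_intros)
  obtain g where g: "continuous_on K g" "\<And>x. x \<in> K \<Longrightarrow> c (susp_class X (x, 0)) = circle_proj (g x)"
    using real_logarithm[OF c0 cn] by blast
  let ?h = "\<lambda>p. c (susp_class X (snd p, fst p))"
  let ?f = "\<lambda>x. \<i> * complex_of_real (2 * pi * g x)"
  have ch: "continuous_on ({0..1} \<times> K) ?h"
    by (rule continuous_on_compose2[OF cc]) (auto intro!: continuous_intros)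
  have hm: "?h \<in> {0..1} \<times> K \<rightarrow> - {0}"
  proof (rule Pi_I)
    fix z :: "real \<times> complex" assume "z \<in> {0..1} \<times> K"
    then have "norm (?h z) = 1" by (intro cn) auto
    then show "?h z \<in> - {0}" by (metis ComplI norm_zero singletonD zero_neq_one)
  qed
  have h0: "?h (0, y) = exp (?f y)" if "y \<in> K" for y
    using g(2)[OF that] by (simp add: circle_proj_def cis_conv_exp)
  have cf: "continuous_on K ?f" by (intro continuous_intros g(1))
  have fim: "?f \<in> K \<rightarrow> UNIV" by simp
  \<comment> \<open>Homotopy lifting through \<open>exp\<close>, uniform in the base point and
    started at the logarithm on the base.\<close>
  have "\<exists>w. continuous_on ({0..1} \<times> K) w \<and> (\<forall>y\<in>K. w (0, y) = ?f y) \<and> (\<forall>z\<in>{0..1} \<times> K. ?h z = exp (w z))"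
  proof (rule covering_space_lift_homotopy[OF covering_space_exp_punctured_plane ch hm h0 cf fim])
    fix w assume "continuous_on ({0..1} \<times> K) w" "\<And>y. y \<in> K \<Longrightarrow> w (0, y) = ?f y"
      "\<And>z. z \<in> {0..1} \<times> K \<Longrightarrow> ?h z = exp (w z)"
    then show ?thesis by (intro exI[of _ w] conjI ballI)
  qed
  then obtain w where w: "continuous_on ({0..1} \<times> K) w" "\<And>y. y \<in> K \<Longrightarrow> w (0, y) = ?f y"
    "\<And>z. z \<in> {0..1} \<times> K \<Longrightarrow> ?h z = exp (w z)"
    by blast
  define \<theta> where "\<theta> z = Im (w z) / (2 * pi)" for z
  have \<theta>_cont: "continuous_on ({0..1} \<times> K) \<theta>" unfolding \<theta>_def by (intro continuous_intros w(1)) auto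
  have \<theta>0: "\<theta> (0, y) = g y" if "y \<in> K" for y using w(2)[OF that] by (simp add: \<theta>_def)
  have \<theta>: "circle_proj (\<theta> (s, y)) = c (susp_class X (y, s))" if "y \<in> K" "0 \<le> s" "s \<le> 1" for s y
  proof -
    have e: "c (susp_class X (y, s)) = exp (w (s, y))" using w(3)[of "(s, y)"] that by simp
    then have "norm (exp (w (s, y))) = 1" using cn[OF that(1), of s] by simp
    then show ?thesis unfolding e \<theta>_def by (rule circle_proj_Im[symmetric])
  qed
  define F where "F x = \<lfloor>\<theta> (1, x) - g (sys_map X x)\<rfloor>" for x
  have F: "real_of_int (F x) = \<theta> (1, x) - g (sys_map X x)" if x: "x \<in> K" for x
  proof -
    have "circle_proj (\<theta> (1, x)) = c (susp_class X (x, 0 + 1))" using \<theta>[OF x, of 1] by simp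
    also have "\<dots> = c (susp_class X (sys_map X x, 0))" using susp_class_step[of x 0] x by (simp add: points_eq)
    also have "\<dots> = circle_proj (g (sys_map X x))" using g(2)[OF SK[OF x]] by simp
    finally obtain m where "\<theta> (1, x) = g (sys_map X x) + of_int m" by (rule circle_proj_eqE)
    then show ?thesis by (simp add: F_def)
  qed
  have "continuous_on K (\<lambda>x. \<theta> (1, x) - g (sys_map X x))"
  proof (intro continuous_on_diff)
    show "continuous_on K (\<lambda>x. \<theta> (1, x))"
      by (rule continuous_on_compose2[OF \<theta>_cont]) (auto intro!: continuous_intros)
    show "continuous_on K (\<lambda>x. g (sys_map X x))"
      by (rule continuous_on_compose2[OF g(1) sys_map_continuous_on]) (use SK in blast)
  qed
  then have intF: "int_continuous X F" unfolding int_continuous_eq by (rule continuous_on_eq) (simp add: F)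
  obtain r where r: "has_mean X F r" using exists_mean[OF intF] by blast
  have "compact (\<theta> ` ({0..1} \<times> K))" by (intro compact_continuous_image \<theta>_cont compact_Times compact_Icc compact_image_growth)
  then have "bounded (\<theta> ` ({0..1} \<times> K))" by (rule compact_imp_bounded)
  then obtain B where B0: "\<forall>z\<in>\<theta> ` ({0..1} \<times> K). norm z \<le> B" unfolding bounded_iff by blast
  have B: "\<bar>\<theta> (s, y)\<bar> \<le> B" if "y \<in> K" "0 \<le> s" "s \<le> 1" for s y
  proof -
    have "\<theta> (s, y) \<in> \<theta> ` ({0..1} \<times> K)" using that by (intro imageI) simp
    then show ?thesis using B0 by (metis real_norm_def)
  qed
  \<comment> \<open>During one unit of time every lift along a leaf moves as the common lift
    \<theta> does at the current base point.\<close>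
  have local: "l (of_int j + s) - l (of_int j) = \<theta> (s, sys_iter X j x) - \<theta> (0, sys_iter X j x)"
    if l: "leaf_lift X c x l" and x: "x \<in> points X" and s: "0 \<le> s" "s \<le> 1" for l x s and j :: int
  proof -
    let ?y = "sys_iter X j x"
    have y: "?y \<in> K" using sys_iter_in[OF x] points_eq by simp
    have lc: "continuous_on UNIV l" and lp: "\<And>s. circle_proj (l s) = c (susp_class X (x, s))"
      using l unfolding leaf_lift_def by blast+
    have "l (of_int j + s) - l (of_int j + 0) = \<theta> (s, ?y) - \<theta> (0, ?y)"
    proof (rule lifts_parallel[of "{0..1}" "\<lambda>s. l (of_int j + s)" "\<lambda>s. \<theta> (s, ?y)"])
      show "continuous_on {0..1} (\<lambda>s. l (of_int j + s))"
        by (rule continuous_on_compose2[OF lc]) (auto intro!: continuous_intros)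
      show "continuous_on {0..1} (\<lambda>s. \<theta> (s, ?y))"
      proof (rule continuous_on_compose2[OF \<theta>_cont])
        show "(\<lambda>s. (s, ?y)) ` {0..1} \<subseteq> {0..1} \<times> K" using y by blast
      qed (intro continuous_intros)
      fix u :: real assume u: "u \<in> {0..1}"
      have "circle_proj (l (of_int j + u)) = c (susp_class X (x, u + of_int j))"
        unfolding lp by (simp only: add.commute)
      also have "\<dots> = c (susp_class X (?y, u))" by (simp only: susp_class_iter[OF x, of j u])
      also have "\<dots> = circle_proj (\<theta> (u, ?y))" using u by (intro \<theta>[OF y, symmetric]) simp_all
      finally show "circle_proj (l (of_int j + u)) = circle_proj (\<theta> (u, ?y))" .
    qed (use s in simp_all)
    then show ?thesis by simp
  qed
  have coc: "real_of_int (F (sys_iter X j x)) = l (of_int j + 1) - l (of_int j) - g (sys_iter X (j + 1) x) + g (sys_iter X j x)"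
    if l: "leaf_lift X c x l" and x: "x \<in> points X" for l x j
  proof -
    have y: "sys_iter X j x \<in> K" using sys_iter_in[OF x] points_eq by simp
    show ?thesis using local[OF l x, of 1 j] F[OF y] \<theta>0[OF y] sys_iter_Suc[OF x, of j] by simp
  qed
  have "leaf_mean X c r"
    unfolding leaf_mean_def
  proof (intro ballI allI impI)
    fix x l assume x: "x \<in> points X" and l: "leaf_lift X c x l"
    have xK: "(sys_map X ^^ n) x \<in> K" for n using sys_pow_in[OF x] points_eq by simp
    obtain Bg where Bg: "\<And>x. x \<in> K \<Longrightarrow> \<bar>g x\<bar> \<le> Bg" using bounded_on_K[OF g(1)] by blast
    have birk: "l (real n) - l 0 = real_of_int (birkhoff X F n x) + g ((sys_map X ^^ n) x) - g x" for n
    proof (induction n)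
      case (Suc n)
      have "real_of_int (F ((sys_map X ^^ n) x)) = l (real n + 1) - l (real n) - g ((sys_map X ^^ Suc n) x) + g ((sys_map X ^^ n) x)"
        using coc[OF l x, of "int n"] sys_iter_nat[of n] sys_iter_nat[of "Suc n"] by (simp add: add.commute)
      then show ?case using Suc by (simp add: birkhoff_def algebra_simps)
    qed (simp add: birkhoff_def)
    define A where "A = 2 * \<bar>B\<bar> + 2 * \<bar>Bg\<bar> + \<bar>l 0\<bar> + \<bar>r\<bar>"
    \<comment> \<open>At integer times the lift is a Birkhoff sum up to bounded terms, and in
      between it moves by a bounded amount; hence it has the mean of F as its speed.\<close>
    have bound: "\<bar>l s - r * s\<bar> \<le> A + \<bar>real_of_int (birkhoff X F (nat \<lfloor>s\<rfloor>) x) - real (nat \<lfloor>s\<rfloor>) * r\<bar>" if s: "0 \<le> s" for s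
    proof -
      define n where "n = nat \<lfloor>s\<rfloor>"
      have n: "real n \<le> s" "s \<le> real n + 1" using s unfolding n_def by linarith+
      have y: "sys_iter X (int n) x \<in> K" using sys_iter_in[OF x] points_eq by simp
      have "l (real n + (s - real n)) - l (real n) = \<theta> (s - real n, sys_iter X (int n) x) - \<theta> (0, sys_iter X (int n) x)"
        using local[OF l x, of "s - real n" "int n"] n by simp
      then have 1: "\<bar>l s - l (real n)\<bar> \<le> 2 * \<bar>B\<bar>"
        using B[OF y, of "s - real n"] B[OF y, of 0] n by simp
      have 2: "\<bar>l (real n) - real_of_int (birkhoff X F n x)\<bar> \<le> \<bar>l 0\<bar> + 2 * \<bar>Bg\<bar>"
        using birk[of n] Bg[OF xK[of n]] Bg[OF xK[of 0]] by simp
      have "\<bar>r * (s - real n)\<bar> \<le> \<bar>r\<bar> * 1" unfolding abs_mult using n by (intro mult_left_mono) auto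
      moreover have "r * (s - real n) = r * s - real n * r" by (simp add: algebra_simps)
      ultimately have 3: "\<bar>real n * r - r * s\<bar> \<le> \<bar>r\<bar>" by simp
      show ?thesis unfolding n_def[symmetric] A_def using 1 2 3 by linarith
    qed
    show "((\<lambda>s. l s / s) \<longlongrightarrow> r) at_top"
    proof (rule tendstoI)
      fix \<epsilon> :: real assume e: "0 < \<epsilon>"
      then have e3: "0 < \<epsilon> / 3" by simp
      obtain M where M: "\<And>n x. n \<ge> M \<Longrightarrow> x \<in> points X \<Longrightarrow> \<bar>real_of_int (birkhoff X F n x) - real n * r\<bar> \<le> \<epsilon> / 3 * real n"
        using r e3 unfolding has_mean_def by blast
      have "\<forall>\<^sub>F s in at_top. max (real M) (max 1 (3 * A / \<epsilon>)) \<le> s" by (rule eventually_ge_at_top)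
      then show "\<forall>\<^sub>F s in at_top. dist (l s / s) r < \<epsilon>"
      proof eventually_elim
        case (elim s)
        then have s: "real M \<le> s" "1 \<le> s" "3 * A / \<epsilon> \<le> s" by auto
        have "M \<le> nat \<lfloor>s\<rfloor>" using s(1) by linarith
        then have "\<bar>real_of_int (birkhoff X F (nat \<lfloor>s\<rfloor>) x) - real (nat \<lfloor>s\<rfloor>) * r\<bar> \<le> \<epsilon> / 3 * real (nat \<lfloor>s\<rfloor>)"
          using M x by blast
        also have "\<dots> \<le> \<epsilon> / 3 * s" using e s(2) by (intro mult_left_mono) auto
        finally have "\<bar>l s - r * s\<bar> \<le> A + \<epsilon> / 3 * s" using bound[of s] s(2) by linarith
        moreover have "3 * A \<le> \<epsilon> * s" using s(3) e by (simp add: field_simps)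
        moreover have "0 < \<epsilon> * s" using e s(2) by simp
        ultimately have "\<bar>l s - r * s\<bar> < \<epsilon> * s" by linarith
        then have lt: "\<bar>l s - r * s\<bar> / s < \<epsilon>" using s(2) by (subst pos_divide_less_eq) auto
        have "l s / s - r = (l s - r * s) / s" using s(2) by (simp add: field_simps)
        then have "dist (l s / s) r = \<bar>l s - r * s\<bar> / s" using s(2) by (simp add: dist_real_def abs_divide)
        then show ?case using lt by simp
      qed
    qed
  qed
  then show ?thesis using intF g(1) r coc by blast
qed

lemma exists_leaf_mean: "susp_circle_map X c \<Longrightarrow> \<exists>r\<in>mean_values X. leaf_mean X c r"
  using winding_cocycle mean_valuesI by blast

text \<open>During the j-th unit of time the circle map winds as often as F prescribes at the j-th
  iterate, at constant speed. At integer times it equals 1, so the pieces fit together.\<close>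

lemma realize_mean:
  assumes F: "int_continuous X F" "has_mean X F r"
  shows "\<exists>c. susp_circle_map X c \<and> leaf_mean X c r"
proof -
  define C where "C p = circle_proj (frac (snd p) * of_int (F (sys_iter X \<lfloor>snd p\<rfloor> (fst p))))" for p
  have inv: "C (sys_map X x, s) = C (x, s + 1)" if "x \<in> points X" for x s
    using sys_iter_step[OF that, of "\<lfloor>s\<rfloor>"] by (simp add: C_def frac_def)
  have piece: "C (x, s) = circle_proj ((s - of_int j) * of_int (F (sys_iter X j x)))" if s: "of_int j \<le> s" "s \<le> of_int j + 1" for x s j
  proof (cases "s = of_int j + 1")
    case True
    then have "(s - of_int j) * of_int (F (sys_iter X j x)) \<in> \<int>" by simp
    then have "circle_proj ((s - of_int j) * of_int (F (sys_iter X j x))) = 1" by (simp only: circle_proj_eq_1_iff)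
    then show ?thesis using True by (simp add: C_def frac_def)
  next
    case False
    then have "\<lfloor>s\<rfloor> = j" using s by (intro floor_unique) auto
    then show ?thesis by (simp add: C_def frac_def)
  qed
  have iter_cont: "continuous_on K (sys_iter X j)" for j
  proof -
    have "\<And>a. a + of_int j * \<alpha> \<in> gap_values h \<Longrightarrow> a \<in> gap_values h" by (simp add: gap_add_alpha)
    then obtain p where p: "continuous_on K p" "\<And>s a. p (split_pt h s a) = split_pt h s (a + of_int j * \<alpha>)"
      using circle_transfer[OF degree_one degree_one, of "of_int j * \<alpha>"] by blast
    have "p x = sys_iter X j x" if "x \<in> K" for x
    proof -
      from that obtain s a where "x = split_pt h s a" unfolding image_growth by blast
      then show ?thesis by (simp add: p(2) sys_iter_split)
    qed
    then show ?thesis by (rule continuous_on_eq[OF p(1)])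
  qed
  have Fj: "continuous_on K (\<lambda>x. real_of_int (F (sys_iter X j x)))" for j
    using F(1) unfolding int_continuous_eq
    by (rule continuous_on_compose2[OF _ iter_cont]) (use sys_iter_in points_eq in auto)
  have pc: "continuous_on (K \<times> {of_int j..of_int j + 1}) C" for j
  proof -
    have "continuous_on (K \<times> {of_int j..of_int j + 1}) (\<lambda>p. circle_proj ((snd p - of_int j) * of_int (F (sys_iter X j (fst p)))))"
      by (intro continuous_intros continuous_on_compose2[OF Fj]) auto
    then show ?thesis by (rule continuous_on_eq) (auto simp: piece)
  qed
  have "continuous_on (K \<times> UNIV) C"
    unfolding continuous_on_eq_continuous_within
  proof
    fix p assume p: "p \<in> K \<times> (UNIV :: real set)"
    \<comment> \<open>Both pieces next to the time \<open>j\<close> are used, since the time of p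
      may be the integer at which they meet.\<close>
    define j where "j = \<lfloor>snd p\<rfloor>"
    have sp: "of_int (j - 1) < snd p" "snd p < of_int j + 1" unfolding j_def by linarith+
    have cl: "closed (K \<times> {a..b})" for a b :: real by (intro closed_Times compact_imp_closed[OF compact_image_growth]) auto
    have "continuous_on (K \<times> {of_int (j - 1)..of_int (j - 1) + 1} \<union> K \<times> {of_int j..of_int j + 1}) C"
      by (intro continuous_on_closed_Un cl pc)
    then have "continuous_on (K \<times> {of_int (j - 1)<..<of_int j + 1}) C"
      by (rule continuous_on_subset) auto
    moreover have "p \<in> K \<times> {of_int (j - 1)<..<of_int j + 1}" using p sp by (simp add: mem_Times_iff)
    ultimately have "continuous (at p within (K \<times> {of_int (j - 1)<..<of_int j + 1})) C"
      unfolding continuous_on_eq_continuous_within by blast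
    moreover have "at p within (K \<times> {of_int (j - 1)<..<of_int j + 1}) = at p within (K \<times> UNIV)"
      by (rule at_within_nhd[of _ "UNIV \<times> {of_int (j - 1)<..<of_int j + 1}"]) (use sp in \<open>auto simp: mem_Times_iff open_Times\<close>)
    ultimately show "continuous (at p within (K \<times> UNIV)) C" by simp
  qed
  moreover have "norm (C (x, s)) = 1" for x s by (simp add: C_def)
  ultimately have "\<exists>c. susp_circle_map X c \<and> (\<forall>x\<in>points X. \<forall>s. c (susp_class X (x, s)) = C (x, s))"
    by (intro susp_circle_map_descend[OF inv])
  then obtain c where c: "susp_circle_map X c" "\<And>x s. x \<in> points X \<Longrightarrow> c (susp_class X (x, s)) = C (x, s)"
    by blast
  obtain r' where r': "leaf_mean X c r'" using exists_leaf_mean[OF c(1)] by blast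
  obtain x where x: "x \<in> points X" using points_nonempty by blast
  obtain l where l: "leaf_lift X c x l" using leaf_mean_lift[OF c(1) x] by blast
  have step: "l (of_int j + 1) - l (of_int j) = of_int (F (sys_iter X j x))" for j
  proof -
    have "l (of_int j + 1) - l (of_int j) = (of_int j + 1 - of_int j) * of_int (F (sys_iter X j x)) - (of_int j - of_int j) * of_int (F (sys_iter X j x))"
    proof (rule lifts_parallel[of "{real_of_int j..real_of_int j + 1}" l "\<lambda>s. (s - real_of_int j) * real_of_int (F (sys_iter X j x))"])
      show "continuous_on {real_of_int j..real_of_int j + 1} l" using l unfolding leaf_lift_def by (blast intro: continuous_on_subset)
      show "continuous_on {real_of_int j..real_of_int j + 1} (\<lambda>s. (s - real_of_int j) * real_of_int (F (sys_iter X j x)))" by (intro continuous_intros)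
      fix s :: real assume "s \<in> {real_of_int j..real_of_int j + 1}"
      then show "circle_proj (l s) = circle_proj ((s - real_of_int j) * real_of_int (F (sys_iter X j x)))"
        using l c(2)[OF x] piece[of j s x] by (simp add: leaf_lift_def)
    qed auto
    then show ?thesis by simp
  qed
  have birk: "l (real n) = l 0 + real_of_int (birkhoff X F n x)" for n
  proof (induction n)
    case (Suc n)
    then show ?case using step[of "int n"] sys_iter_nat[of n] by (simp add: birkhoff_def add.commute)
  qed (simp add: birkhoff_def)
  have lim1: "(\<lambda>n. l (real n) / real n) \<longlonglongrightarrow> r'"
  proof -
    have "((\<lambda>s. l s / s) \<longlongrightarrow> r') at_top" using r' x l unfolding leaf_mean_def by blast
    then show ?thesis by (rule filterlim_compose[OF _ filterlim_real_sequentially])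
  qed
  have lim2: "(\<lambda>n. l (real n) / real n) \<longlonglongrightarrow> r"
  proof -
    have "(\<lambda>n. real_of_int (birkhoff X F n x) / real n) \<longlonglongrightarrow> r"
    proof (rule LIMSEQ_I)
      fix \<epsilon> :: real assume e: "0 < \<epsilon>"
      then have e2: "0 < \<epsilon> / 2" by simp
      obtain M where M: "\<And>n x. n \<ge> M \<Longrightarrow> x \<in> points X \<Longrightarrow> \<bar>real_of_int (birkhoff X F n x) - real n * r\<bar> \<le> \<epsilon> / 2 * real n"
        using F(2) e2 unfolding has_mean_def by blast
      show "\<exists>no. \<forall>n\<ge>no. norm (real_of_int (birkhoff X F n x) / real n - r) < \<epsilon>"
      proof (intro exI[of _ "Suc M"] allI impI)
        fix n assume n: "Suc M \<le> n"
        then have n0: "0 < real n" by simp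
        have "real_of_int (birkhoff X F n x) / real n - r = (real_of_int (birkhoff X F n x) - real n * r) / real n"
          using n0 by (simp add: field_simps)
        then have "norm (real_of_int (birkhoff X F n x) / real n - r) = \<bar>real_of_int (birkhoff X F n x) - real n * r\<bar> / real n"
          using n0 by (simp add: abs_divide)
        also have "\<dots> \<le> (\<epsilon> / 2 * real n) / real n" using M[of n x] x n n0 by (intro divide_right_mono) auto
        also have "\<dots> = \<epsilon> / 2" using n0 by simp
        finally show "norm (real_of_int (birkhoff X F n x) / real n - r) < \<epsilon>" using e by linarith
      qed
    qed
    moreover have "(\<lambda>n. l 0 / real n) \<longlonglongrightarrow> 0" by (rule lim_const_over_n)
    ultimately have "(\<lambda>n. l 0 / real n + real_of_int (birkhoff X F n x) / real n) \<longlonglongrightarrow> 0 + r" by (intro tendsto_add)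
    then show ?thesis by (simp add: birk add_divide_distrib)
  qed
  have "r = r'" using LIMSEQ_unique[OF lim2 lim1] .
  then show ?thesis using c(1) r' by blast
qed

end

section \<open>Clock and rotation phase on the suspension\<close>

context split_system
begin

lemma time_map:
  shows "\<exists>c. susp_circle_map X c \<and> (\<forall>x\<in>points X. \<forall>s. c (susp_class X (x, s)) = circle_proj s)"
proof -
  have "\<exists>c. susp_circle_map X c \<and> (\<forall>x\<in>points X. \<forall>s. c (susp_class X (x, s)) = (\<lambda>p. circle_proj (snd p)) (x, s))"
    by (rule susp_circle_map_descend) (auto intro!: continuous_intros)
  then show ?thesis by simp
qed

text \<open>The phase a + \<alpha> r does not change under (a + \<alpha>, r - 1), so the rotation
  factor extends to the suspension, where it winds with speed \<alpha>.\<close>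

lemma rotation_time_map:
  shows "\<exists>c. susp_circle_map X c \<and> (\<forall>s a r. c (susp_class X (split_pt h s a, r)) = circle_proj (a + \<alpha> * r))"
proof -
  obtain E where E: "continuous_on K E" "\<And>s a. E (split_pt h s a) = circle_proj a"
    using rotation_factor by blast
  let ?C = "\<lambda>p. E (fst p) * circle_proj (\<alpha> * snd p)"
  have "\<exists>c. susp_circle_map X c \<and> (\<forall>x\<in>points X. \<forall>s. c (susp_class X (x, s)) = ?C (x, s))"
  proof (rule susp_circle_map_descend)
    fix x s assume "x \<in> points X"
    then obtain t a where x: "x = split_pt h t a" by (rule pointsE)
    show "?C (sys_map X x, s) = ?C (x, s + 1)"
      by (simp add: x sys_map_split E(2) distrib_left circle_proj_add)
    show "norm (?C (x, s)) = 1" by (simp add: x E(2) norm_mult)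
  next
    show "continuous_on (K \<times> UNIV) ?C"
      by (intro continuous_intros continuous_on_compose2[OF E(1)]) auto
  qed
  then show ?thesis by (auto simp: E(2) circle_proj_add)
qed

end

lemma susp_circle_map_compose:
  assumes "susp_circle_map Y c" "continuous_map (suspension X) (suspension Y) H"
  shows "susp_circle_map X (c \<circ> H)"
  using assms continuous_map_compose[of "suspension X" "suspension Y" H euclidean c]
    continuous_map_image_subset_topspace[OF assms(2)]
  unfolding susp_circle_map_def by auto

lemma leaf_mean_cong:
  assumes "compact_system X" "\<And>p. p \<in> topspace (suspension X) \<Longrightarrow> c p = c' p"
  shows "leaf_mean X c r \<longleftrightarrow> leaf_mean X c' r"
proof -
  interpret compact_system X by fact
  have "leaf_lift X c x l \<longleftrightarrow> leaf_lift X c' x l" if "x \<in> points X" for x l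
    using assms(2)[OF susp_class_in[OF that]] by (simp add: leaf_lift_def)
  then show ?thesis by (simp add: leaf_mean_def)
qed

text \<open>The number \<rho> is the mean speed of the clock of Y seen from X. Pulling circle maps
  back multiplies winding speeds by \<rho>, which compares the mean values. That \<rho> and \<rho>
  \<beta> lie in Z + Z \<alpha> follows because the winding functions of the clock and of the phase
  of Y have vanishing index sums on X.\<close>

lemma flow_equivalent_elim:
  assumes X: "split_system h \<alpha> X" and Y: "split_system k \<beta> Y" and flow: "flow_equivalent X Y"
  shows "\<exists>\<rho>. \<rho> \<noteq> 0 \<and> mean_values X = (*) \<rho> ` mean_values Y \<and> \<rho> \<in> rotation_group \<alpha> \<and> \<rho> * \<beta> \<in> rotation_group \<alpha>"
proof -
  interpret X: split_system h \<alpha> X by (rule X)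
  interpret Y: split_system k \<beta> Y by (rule Y)
  obtain H where hom: "homeomorphic_map (suspension X) (suspension Y) H"
    and orb: "\<forall>c\<in>topspace (suspension X). H ` flow_orbit c = flow_orbit (H c) \<and>
      (\<exists>g::real \<Rightarrow> real. continuous_on UNIV g \<and> strict_mono g \<and> (\<forall>t. H (susp_flow t c) = susp_flow (g t) (H c)))"
    using flow unfolding flow_equivalent_def by blast
  obtain G where HG: "homeomorphic_maps (suspension X) (suspension Y) H G"
    using hom unfolding homeomorphic_map_maps by blast
  have cH: "continuous_map (suspension X) (suspension Y) H" and cG: "continuous_map (suspension Y) (suspension X) G"
    and GH: "\<And>p. p \<in> topspace (suspension X) \<Longrightarrow> G (H p) = p"
    using HG unfolding homeomorphic_maps_def by blast+
  have leaf: "\<exists>y \<gamma>. y \<in> points Y \<and> continuous_on UNIV \<gamma> \<and> strict_mono \<gamma> \<and>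
      (\<forall>s. H (susp_class X (x, s)) = susp_class Y (y, \<gamma> s))" if x: "x \<in> points X" for x
  proof -
    let ?c = "susp_class X (x, 0)"
    have c: "?c \<in> topspace (suspension X)" by (rule X.susp_class_in[OF x])
    then have "H ?c \<in> topspace (suspension Y)" using continuous_map_image_subset_topspace[OF cH] by blast
    then obtain y s0 where y: "y \<in> points Y" "H ?c = susp_class Y (y, s0)" by (rule Y.susp_points)
    obtain g :: "real \<Rightarrow> real" where g: "continuous_on UNIV g" "strict_mono g" "\<And>t. H (susp_flow t ?c) = susp_flow (g t) (H ?c)"
      using orb c by blast
    have "H (susp_class X (x, s)) = susp_class Y (y, s0 + g s)" for s
      using g(3)[of s] by (simp add: X.susp_flow_class y(2) Y.susp_flow_class)
    moreover have "continuous_on UNIV (\<lambda>s. s0 + g s)" by (intro continuous_intros g(1))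
    moreover have "strict_mono (\<lambda>s. s0 + g s)" using g(2) by (simp add: strict_mono_def)
    ultimately show ?thesis using y(1) by blast
  qed
  obtain U where U: "susp_circle_map Y U" "\<And>y s. y \<in> points Y \<Longrightarrow> U (susp_class Y (y, s)) = circle_proj s"
    using Y.time_map by blast
  have UH: "susp_circle_map X (U \<circ> H)" by (rule susp_circle_map_compose[OF U(1) cH])
  obtain \<rho> where \<rho>: "leaf_mean X (U \<circ> H) \<rho>" using X.exists_leaf_mean[OF UH] by blast
  have \<gamma>_lim: "((\<lambda>s. \<gamma> s / s) \<longlongrightarrow> \<rho>) at_top"
    if "x \<in> points X" "y \<in> points Y" "continuous_on UNIV \<gamma>" "\<And>s. H (susp_class X (x, s)) = susp_class Y (y, \<gamma> s)" for x y \<gamma>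
  proof -
    have "leaf_lift X (U \<circ> H) x \<gamma>" using that U(2) by (simp add: leaf_lift_def)
    then show ?thesis using \<rho> that(1) unfolding leaf_mean_def by blast
  qed
  obtain V where V: "susp_circle_map X V" "\<And>x s. x \<in> points X \<Longrightarrow> V (susp_class X (x, s)) = circle_proj s"
    using X.time_map by blast
  have VG: "susp_circle_map Y (V \<circ> G)" by (rule susp_circle_map_compose[OF V(1) cG])
  have \<gamma>_top: "filterlim \<gamma> at_top at_top"
    if x: "x \<in> points X" and y: "y \<in> points Y" and c: "continuous_on UNIV \<gamma>" "strict_mono \<gamma>"
      and H: "\<And>s. H (susp_class X (x, s)) = susp_class Y (y, \<gamma> s)" for x y \<gamma>
  proof -
    \<comment> \<open>If the clock of Y stayed bounded along a forward flow line, the clock of X,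
      pulled back to Y, would stay bounded there too, on a compact piece of a leaf. But it measures
      the time s.\<close>
    have unb: "\<exists>s. M < \<gamma> s" for M
    proof (rule ccontr)
      assume "\<not> (\<exists>s. M < \<gamma> s)"
      then have M: "\<gamma> s \<le> M" for s by (simp add: not_less)
      obtain l where l: "leaf_lift Y (V \<circ> G) y l" using Y.leaf_mean_lift[OF VG y] by blast
      have lc: "continuous_on UNIV l" using l by (simp add: leaf_lift_def)
      have "compact (l ` {\<gamma> 0..M})"
        by (intro compact_continuous_image continuous_on_subset[OF lc] compact_Icc) auto
      then have "bounded (l ` {\<gamma> 0..M})" by (rule compact_imp_bounded)
      then obtain B where B: "\<forall>z\<in>l ` {\<gamma> 0..M}. norm z \<le> B" unfolding bounded_iff by blast
      have par: "l (\<gamma> s) - l (\<gamma> 0) = s - 0" for s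
      proof (rule lifts_parallel[of UNIV "\<lambda>s. l (\<gamma> s)" "\<lambda>s. s"])
        show "continuous_on UNIV (\<lambda>s. l (\<gamma> s))" by (rule continuous_on_compose2[OF lc c(1)]) auto
        fix s :: real
        have "circle_proj (l (\<gamma> s)) = V (G (susp_class Y (y, \<gamma> s)))" using l by (simp add: leaf_lift_def)
        also have "\<dots> = V (susp_class X (x, s))" by (simp only: H[of s, symmetric] GH[OF X.susp_class_in[OF x]])
        finally show "circle_proj (l (\<gamma> s)) = circle_proj s" using V(2)[OF x] by simp
      qed auto
      have "\<bar>l (\<gamma> s)\<bar> \<le> B" if "0 \<le> s" for s
      proof -
        have "\<gamma> s \<in> {\<gamma> 0..M}" using M c(2) that by (simp add: strict_mono_less_eq)
        then show ?thesis using B by auto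
      qed
      from this[of "2 * \<bar>B\<bar> + 1"] this[of 0] par[of "2 * \<bar>B\<bar> + 1"] show False by linarith
    qed
    show ?thesis
      unfolding filterlim_at_top
    proof
      fix M
      obtain s0 where s0: "M < \<gamma> s0" using unb by blast
      have "\<forall>\<^sub>F s in at_top. s0 \<le> s" by (rule eventually_ge_at_top)
      then show "\<forall>\<^sub>F s in at_top. M \<le> \<gamma> s"
      proof eventually_elim
        case (elim s)
        then have "\<gamma> s0 \<le> \<gamma> s" using c(2) by (simp add: strict_mono_less_eq)
        then show ?case using s0 by linarith
      qed
    qed
  qed
  \<comment> \<open>A chain rule at infinity: l (\<gamma> s) / s is the product of \<gamma> s / s
    and l (\<gamma> s) / \<gamma> s.\<close>
  have comp: "leaf_mean X (c \<circ> H) (\<rho> * r)" if c: "susp_circle_map Y c" "leaf_mean Y c r" for c r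
  proof -
    obtain x where x: "x \<in> points X" using X.points_nonempty by blast
    obtain y \<gamma> where y: "y \<in> points Y" and \<gamma>: "continuous_on UNIV \<gamma>" "strict_mono \<gamma>"
      and H: "\<And>s. H (susp_class X (x, s)) = susp_class Y (y, \<gamma> s)" using leaf[OF x] by blast
    obtain l where l: "leaf_lift Y c y l" using Y.leaf_mean_lift[OF c(1) y] by blast
    have lc: "continuous_on UNIV l" using l by (simp add: leaf_lift_def)
    have "continuous_on UNIV (\<lambda>s. l (\<gamma> s))" by (rule continuous_on_compose2[OF lc \<gamma>(1)]) auto
    then have lift: "leaf_lift X (c \<circ> H) x (\<lambda>s. l (\<gamma> s))" using l H by (simp add: leaf_lift_def)
    obtain r' where r': "leaf_mean X (c \<circ> H) r'"
      using X.exists_leaf_mean[OF susp_circle_map_compose[OF c(1) cH]] by blast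
    have lim': "((\<lambda>s. l (\<gamma> s) / s) \<longlongrightarrow> r') at_top" using r' x lift unfolding leaf_mean_def by blast
    have g1: "((\<lambda>s. \<gamma> s / s) \<longlongrightarrow> \<rho>) at_top" by (rule \<gamma>_lim[OF x y \<gamma>(1) H])
    have g2: "filterlim \<gamma> at_top at_top" by (rule \<gamma>_top[OF x y \<gamma> H])
    have "((\<lambda>s. l s / s) \<longlongrightarrow> r) at_top" using c(2) y l unfolding leaf_mean_def by blast
    then have g3: "((\<lambda>s. l (\<gamma> s) / \<gamma> s) \<longlongrightarrow> r) at_top" by (rule filterlim_compose[OF _ g2])
    have "((\<lambda>s. (\<gamma> s / s) * (l (\<gamma> s) / \<gamma> s)) \<longlongrightarrow> \<rho> * r) at_top" by (rule tendsto_mult[OF g1 g3])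
    moreover have "\<forall>\<^sub>F s in at_top. (\<gamma> s / s) * (l (\<gamma> s) / \<gamma> s) = l (\<gamma> s) / s"
    proof -
      have "\<forall>\<^sub>F s in at_top. 1 \<le> \<gamma> s" using g2 by (simp add: filterlim_at_top)
      then show ?thesis by eventually_elim auto
    qed
    ultimately have "((\<lambda>s. l (\<gamma> s) / s) \<longlongrightarrow> \<rho> * r) at_top" using tendsto_cong by fast
    then have "r' = \<rho> * r" by (rule tendsto_unique[OF trivial_limit_at_top_linorder lim'])
    then show ?thesis using r' by simp
  qed
  have scm: "susp_circle_map Y (c \<circ> G)" and GHc: "\<And>p. p \<in> topspace (suspension X) \<Longrightarrow> (c \<circ> G \<circ> H) p = c p"
    if "susp_circle_map X c" for c
    using susp_circle_map_compose[OF that cG] GH by auto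
  \<comment> \<open>Every circle map on the suspension of X is a pullback along \<open>H\<close>,
    namely of its composition with \<open>G\<close>.\<close>
  have sub1: "\<exists>r'\<in>mean_values Y. r = \<rho> * r'" if c: "susp_circle_map X c" "leaf_mean X c r" for c r
  proof -
    obtain r' where r': "r' \<in> mean_values Y" "leaf_mean Y (c \<circ> G) r'" using Y.exists_leaf_mean[OF scm[OF c(1)]] by blast
    have "leaf_mean X (c \<circ> G \<circ> H) (\<rho> * r')" by (rule comp[OF scm[OF c(1)] r'(2)])
    then have "leaf_mean X c (\<rho> * r')"
      using leaf_mean_cong[OF X.compact_system_axioms, of "c \<circ> G \<circ> H" c] GHc[OF c(1)] by blast
    then have "r = \<rho> * r'" using X.leaf_mean_unique[OF c(1) c(2)] by blast
    then show ?thesis using r'(1) by blast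
  qed
  interpret Q: vector_space rat_scale by (rule vector_space_rat_scale)
  have scale_inv: "r \<in> mean_values Z" if "compact_system Z" "real n * r \<in> mean_values Z" "0 < (n::nat)" for Z r n
  proof -
    have "rat_scale (1 / of_nat n) (real n * r) \<in> mean_values Z"
      by (rule Q.subspace_scale[OF compact_system.mean_values_subspace[OF that(1)] that(2)])
    then show ?thesis using that(3) by (simp add: rat_scale_def of_rat_divide)
  qed
  have V_eq: "mean_values X = (*) \<rho> ` mean_values Y"
  proof (intro equalityI subsetI)
    fix r assume "r \<in> mean_values X"
    then obtain n F where n: "0 < (n::nat)" "int_continuous X F" "has_mean X F (real n * r)"
      unfolding mean_values_def by blast
    obtain c where c: "susp_circle_map X c" "leaf_mean X c (real n * r)" using X.realize_mean[OF n(2,3)] by blast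
    obtain r' where r': "r' \<in> mean_values Y" "real n * r = \<rho> * r'" using sub1[OF c] by blast
    have "real n * (r' / real n) = r'" using n(1) by simp
    then have "r' / real n \<in> mean_values Y" using scale_inv[OF Y.compact_system_axioms, of n "r' / real n"] r'(1) n(1) by simp
    moreover have "r = \<rho> * (r' / real n)" using r'(2) n(1) by (simp add: field_simps)
    ultimately show "r \<in> (*) \<rho> ` mean_values Y" by blast
  next
    fix r assume "r \<in> (*) \<rho> ` mean_values Y"
    then obtain r' where r': "r' \<in> mean_values Y" "r = \<rho> * r'" by blast
    obtain n F where n: "0 < (n::nat)" "int_continuous Y F" "has_mean Y F (real n * r')"
      using r'(1) unfolding mean_values_def by blast
    obtain c where c: "susp_circle_map Y c" "leaf_mean Y c (real n * r')" using Y.realize_mean[OF n(2,3)] by blast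
    have cH': "susp_circle_map X (c \<circ> H)" by (rule susp_circle_map_compose[OF c(1) cH])
    obtain r'' where r'': "r'' \<in> mean_values X" "leaf_mean X (c \<circ> H) r''" using X.exists_leaf_mean[OF cH'] by blast
    have "r'' = \<rho> * (real n * r')" using X.leaf_mean_unique[OF cH' r''(2) comp[OF c]] .
    then have "real n * r \<in> mean_values X" using r''(1) r'(2) by (simp add: mult.left_commute)
    then show "r \<in> mean_values X" by (rule scale_inv[OF X.compact_system_axioms _ n(1)])
  qed
  have "\<rho> \<noteq> 0"
  proof
    assume "\<rho> = 0"
    then have "1 \<in> (\<lambda>x. 0 * x) ` mean_values Y" using X.one_in_mean_values V_eq by simp
    then show False by auto
  qed
  obtain E where E: "susp_circle_map Y E" "\<And>s a r. E (susp_class Y (split_pt k s a, r)) = circle_proj (a + \<beta> * r)"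
    using Y.rotation_time_map by blast
  have EH: "susp_circle_map X (E \<circ> H)" by (rule susp_circle_map_compose[OF E(1) cH])
  have meanE: "leaf_mean Y E \<beta>"
  proof -
    obtain r where r: "leaf_mean Y E r" using Y.exists_leaf_mean[OF E(1)] by blast
    have "leaf_lift Y E (split_pt k True 0) (\<lambda>s. 0 + \<beta> * s)"
      by (auto simp: leaf_lift_def E(2) intro!: continuous_intros)
    then have "((\<lambda>s. (0 + \<beta> * s) / s) \<longlongrightarrow> r) at_top"
      using r Y.split_in_points unfolding leaf_mean_def by blast
    moreover have "\<forall>\<^sub>F s in at_top. (0 + \<beta> * s) / s = \<beta>"
      using eventually_gt_at_top[of 0] by eventually_elim simp
    then have "((\<lambda>s. (0 + \<beta> * s) / s) \<longlongrightarrow> \<beta>) at_top" by (rule tendsto_eventually)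
    ultimately have "r = \<beta>" by (rule tendsto_unique[rotated]) simp
    then show ?thesis using r by simp
  qed
  obtain FE gE rE where FE: "int_continuous X FE" "continuous_on X.K gE" "has_mean X FE rE" "leaf_mean X (E \<circ> H) rE"
    and cocE: "\<forall>x\<in>points X. \<forall>l. leaf_lift X (E \<circ> H) x l \<longrightarrow>
      (\<forall>j::int. real_of_int (FE (sys_iter X j x)) = l (of_int j + 1) - l (of_int j) - gE (sys_iter X (j + 1) x) + gE (sys_iter X j x))"
    using X.winding_cocycle[OF EH] by blast
  obtain FU gU rU where FU: "int_continuous X FU" "continuous_on X.K gU" "has_mean X FU rU" "leaf_mean X (U \<circ> H) rU"
    and cocU: "\<forall>x\<in>points X. \<forall>l. leaf_lift X (U \<circ> H) x l \<longrightarrow>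
      (\<forall>j::int. real_of_int (FU (sys_iter X j x)) = l (of_int j + 1) - l (of_int j) - gU (sys_iter X (j + 1) x) + gU (sys_iter X j x))"
    using X.winding_cocycle[OF UH] by blast
  have rE: "rE = \<rho> * \<beta>" using X.leaf_mean_unique[OF EH FE(4) comp[OF E(1) meanE]] .
  have rU: "rU = \<rho>" using X.leaf_mean_unique[OF UH FU(4) \<rho>] .
  \<comment> \<open>The leaves through the two sides of a gap may carry different time changes. In
    the winding of the phase minus \<beta> times that of the clock they cancel, and what remains
    telescopes. So the index sum of \<open>FE\<close> is \<beta> times that of \<open>FU\<close>,
    and as both are integers and \<beta> is irrational, both vanish.\<close>
  have jumps: "X.jump_sum FE a = 0 \<and> X.jump_sum FU a = 0" for a
  proof -
    have side: "\<exists>b \<gamma>. \<forall>j::int. real_of_int (FU (split_pt h s (a + of_int j * \<alpha>))) =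
          \<gamma> (real_of_int j + 1) - \<gamma> (real_of_int j) - gU (split_pt h s (a + of_int (j + 1) * \<alpha>)) + gU (split_pt h s (a + of_int j * \<alpha>)) \<and>
        real_of_int (FE (split_pt h s (a + of_int j * \<alpha>))) =
          (b + \<beta> * \<gamma> (real_of_int j + 1)) - (b + \<beta> * \<gamma> (real_of_int j)) - gE (split_pt h s (a + of_int (j + 1) * \<alpha>)) + gE (split_pt h s (a + of_int j * \<alpha>))" for s
    proof -
      have x: "split_pt h s a \<in> points X" by simp
      obtain y \<gamma> where y: "y \<in> points Y" and \<gamma>: "continuous_on UNIV \<gamma>"
        and H: "\<And>r. H (susp_class X (split_pt h s a, r)) = susp_class Y (y, \<gamma> r)" using leaf[OF x] by blast
      obtain t b where yb: "y = split_pt k t b" using Y.pointsE[OF y] .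
      have lU: "leaf_lift X (U \<circ> H) (split_pt h s a) \<gamma>" using \<gamma> H U(2)[OF y] by (simp add: leaf_lift_def)
      have lE: "leaf_lift X (E \<circ> H) (split_pt h s a) (\<lambda>r. b + \<beta> * \<gamma> r)"
        unfolding leaf_lift_def using H by (auto simp: yb E(2) intro!: continuous_intros \<gamma>)
      show ?thesis
        using bspec[OF cocU x, THEN spec, THEN mp, OF lU] bspec[OF cocE x, THEN spec, THEN mp, OF lE]
        unfolding X.sys_iter_split by (intro exI[of _ b] exI[of _ \<gamma>]) blast
    qed
    obtain bR \<gamma>R where R: "\<And>j::int. real_of_int (FU (split_pt h True (a + of_int j * \<alpha>))) =
          \<gamma>R (real_of_int j + 1) - \<gamma>R (real_of_int j) - gU (split_pt h True (a + of_int (j + 1) * \<alpha>)) + gU (split_pt h True (a + of_int j * \<alpha>))"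
        "\<And>j::int. real_of_int (FE (split_pt h True (a + of_int j * \<alpha>))) =
          (bR + \<beta> * \<gamma>R (real_of_int j + 1)) - (bR + \<beta> * \<gamma>R (real_of_int j)) - gE (split_pt h True (a + of_int (j + 1) * \<alpha>)) + gE (split_pt h True (a + of_int j * \<alpha>))"
      using side[of True] by blast
    obtain bL \<gamma>L where L: "\<And>j::int. real_of_int (FU (split_pt h False (a + of_int j * \<alpha>))) =
          \<gamma>L (real_of_int j + 1) - \<gamma>L (real_of_int j) - gU (split_pt h False (a + of_int (j + 1) * \<alpha>)) + gU (split_pt h False (a + of_int j * \<alpha>))"
        "\<And>j::int. real_of_int (FE (split_pt h False (a + of_int j * \<alpha>))) =
          (bL + \<beta> * \<gamma>L (real_of_int j + 1)) - (bL + \<beta> * \<gamma>L (real_of_int j)) - gE (split_pt h False (a + of_int (j + 1) * \<alpha>)) + gE (split_pt h False (a + of_int j * \<alpha>))"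
      using side[of False] by blast
    define dE where "dE j = gE (split_pt h True (a + of_int j * \<alpha>)) - gE (split_pt h False (a + of_int j * \<alpha>))" for j :: int
    define dU where "dU j = gU (split_pt h True (a + of_int j * \<alpha>)) - gU (split_pt h False (a + of_int j * \<alpha>))" for j :: int
    define jE where "jE j = X.jump FE (a + of_int j * \<alpha>)" for j :: int
    define jU where "jU j = X.jump FU (a + of_int j * \<alpha>)" for j :: int
    have finE: "finite {j. jE j \<noteq> 0}" unfolding jE_def by (rule X.finite_jump_support[OF FE(1)])
    have finU: "finite {j. jU j \<noteq> 0}" unfolding jU_def by (rule X.finite_jump_support[OF FU(1)])
    have tele: "real_of_int (jE j) + (- \<beta>) * real_of_int (jU j) = (dE j - \<beta> * dU j) - (dE (j + 1) - \<beta> * dU (j + 1))" for j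
      unfolding jE_def jU_def X.jump_def of_int_diff R L dE_def dU_def by (simp add: algebra_simps)
    have fin: "finite {j. real_of_int (jE j) + (- \<beta>) * real_of_int (jU j) \<noteq> 0}"
      by (rule finite_subset[OF _ finite_UnI[OF finE finU]]) auto
    have lim: "((\<lambda>j. dE j - \<beta> * dU j) \<longlongrightarrow> 0) F" if "\<And>n::int. \<forall>\<^sub>F k in F. k \<noteq> n" for F
    proof -
      have "((\<lambda>j. dE j - \<beta> * dU j) \<longlongrightarrow> 0 - \<beta> * 0) F" unfolding dE_def dU_def
        by (intro tendsto_intros X.side_diff_tendsto FE(2) FU(2) that)
      then show ?thesis by simp
    qed
    have "Sum_any (\<lambda>j. real_of_int (jE j) + (- \<beta>) * real_of_int (jU j)) = 0"
      by (rule telescoping_Sum_any[OF tele fin lim lim]) (rule int_eventually_neq)+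
    moreover have "Sum_any (\<lambda>j. real_of_int (jE j) + (- \<beta>) * real_of_int (jU j)) =
        Sum_any (\<lambda>j. real_of_int (jE j)) + Sum_any (\<lambda>j. (- \<beta>) * real_of_int (jU j))"
    proof (rule Sum_any.distrib)
      show "finite {j. real_of_int (jE j) \<noteq> 0}" using finE by simp
      show "finite {j. (- \<beta>) * real_of_int (jU j) \<noteq> 0}" by (rule finite_subset[OF _ finU]) auto
    qed
    moreover have "Sum_any (\<lambda>j. (- \<beta>) * real_of_int (jU j)) = (- \<beta>) * Sum_any (\<lambda>j. real_of_int (jU j))"
      by (rule Sum_any_right_distrib[symmetric]) (use finU in simp)
    ultimately have e: "real_of_int (X.jump_sum FE a) + (- real_of_int (X.jump_sum FU a)) * \<beta> = 0"
      unfolding X.jump_sum_def jE_def[symmetric] jU_def[symmetric] of_int_Sum_any by simp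
    have "real_of_int (X.jump_sum FE a) \<in> \<rat>" "- real_of_int (X.jump_sum FU a) \<in> \<rat>" by simp_all
    then show ?thesis using irrational_lin_eq[OF Y.irrational _ _ e] by simp
  qed
  have "rE \<in> rotation_group \<alpha>" by (rule X.jump_sum_zero_imp_mean[OF FE(1,3)]) (use jumps in blast)
  moreover have "rU \<in> rotation_group \<alpha>" by (rule X.jump_sum_zero_imp_mean[OF FU(1,3)]) (use jumps in blast)
  ultimately show ?thesis using \<open>\<rho> \<noteq> 0\<close> V_eq rE rU by blast
qed

section \<open>Denjoy systems are split systems\<close>

lemma mono_dense_imp_continuous:
  fixes h :: "real \<Rightarrow> real"
  assumes "mono h" and dense: "\<And>x y. x < y \<Longrightarrow> \<exists>t. x < h t \<and> h t < y"
  shows "continuous_on UNIV h"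
  unfolding continuous_on_iff
proof (intro ballI allI impI)
  fix t \<epsilon> :: real assume e: "0 < \<epsilon>"
  have less: "s < u" if "h s < h u" for s u using monoD[OF assms(1), of u s] that by force
  obtain t1 where t1: "h t < h t1" "h t1 < h t + \<epsilon>" using dense[of "h t" "h t + \<epsilon>"] e by auto
  obtain t0 where t0: "h t - \<epsilon> < h t0" "h t0 < h t" using dense[of "h t - \<epsilon>" "h t"] e by auto
  have lt: "t0 < t" "t < t1" using less t0 t1 by auto
  show "\<exists>d>0. \<forall>x'\<in>UNIV. dist x' t < d \<longrightarrow> dist (h x') (h t) < \<epsilon>"
  proof (intro exI[of _ "min (t - t0) (t1 - t)"] conjI ballI impI)
    fix x assume "dist x t < min (t - t0) (t1 - t)"
    then have "t0 \<le> x" "x \<le> t1" by (auto simp: dist_real_def)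
    then have "h t0 \<le> h x" "h x \<le> h t1" using monoD[OF assms(1)] by auto
    then show "dist (h x) (h t) < \<epsilon>" using t0 t1 by (simp add: dist_real_def)
  qed (use lt in auto)
qed

section \<open>Poincare's semiconjugacy for a lift\<close>

locale circle_lift_map =
  fixes f :: "real \<Rightarrow> real" and \<alpha> :: real
  assumes cont: "continuous_on UNIV f" and strict: "strict_mono f" and period: "\<And>t. f (t + 1) = f t + 1"
    and rot: "\<And>t. (\<lambda>n. (f ^^ n) t / real n) \<longlonglongrightarrow> \<alpha>" and irrational: "\<alpha> \<notin> \<rat>"
begin

sublocale D: degree_one f
  by standard (use cont period strict in \<open>auto intro: strict_mono_mono\<close>)

lemma iter_add_int: "(f ^^ n) (t + of_int m) = (f ^^ n) t + of_int m"
  by (induction n) (auto simp: D.h_add_int)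

lemma iter_mono: "s \<le> t \<Longrightarrow> (f ^^ n) s \<le> (f ^^ n) t"
  by (induction n) (auto simp: D.h_mono)

lemma rot_subseq: "0 < N \<Longrightarrow> (\<lambda>j. (f ^^ (j * N)) u / real (j * N)) \<longlonglongrightarrow> \<alpha>"
proof -
  assume "0 < N"
  then have "strict_mono (\<lambda>j. j * N)" by (simp add: strict_mono_def)
  from LIMSEQ_subseq_LIMSEQ[OF rot[of u] this] show ?thesis by (simp only: o_def)
qed

lemma lin_limit: "0 < N \<Longrightarrow> (\<lambda>j. (u + real j * c) / real (j * N)) \<longlonglongrightarrow> c / real N"
proof -
  assume N: "0 < N"
  have "(\<lambda>j. (u / real N) / real j + c / real N) \<longlonglongrightarrow> 0 + c / real N"
    by (intro tendsto_add lim_const_over_n tendsto_const)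
  moreover have "\<forall>\<^sub>F j in sequentially. (u / real N) / real j + c / real N = (u + real j * c) / real (j * N)"
    using eventually_gt_at_top[of 0] by eventually_elim (use N in \<open>simp add: field_simps\<close>)
  ultimately show ?thesis using tendsto_cong by force
qed

text \<open>A gain of at least c in N steps repeats itself, by monotonicity and periodicity, and so
  bounds the average displacement from below.\<close>

lemma rot_ge:
  assumes "u + of_int c \<le> (f ^^ N) u"
  shows "of_int c \<le> real N * \<alpha>"
proof (cases "N = 0")
  case True then show ?thesis using assms by simp
next
  case False
  then have N: "0 < N" by simp
  have "u + real j * of_int c \<le> (f ^^ (j * N)) u" for j
  proof (induction j)
    case (Suc j)
    have "u + real (Suc j) * of_int c = (u + of_int c) + of_int (int j * c)" by (simp add: algebra_simps)
    also have "\<dots> \<le> (f ^^ N) u + of_int (int j * c)" using assms by simp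
    also have "\<dots> = (f ^^ N) (u + of_int (int j * c))" by (simp only: iter_add_int)
    also have "\<dots> \<le> (f ^^ N) ((f ^^ (j * N)) u)" using Suc by (intro iter_mono) simp
    also have "\<dots> = (f ^^ (Suc j * N)) u" by (simp add: funpow_add)
    finally show ?case .
  qed simp
  then have "(u + real j * of_int c) / real (j * N) \<le> (f ^^ (j * N)) u / real (j * N)" for j
    by (intro divide_right_mono) auto
  then have "of_int c / real N \<le> \<alpha>"
    by (intro LIMSEQ_le[OF lin_limit[OF N] rot_subseq[OF N]]) auto
  then show ?thesis using N by (simp add: field_simps)
qed

lemma rot_le:
  assumes "(f ^^ N) u \<le> u + of_int c"
  shows "real N * \<alpha> \<le> of_int c"
proof (cases "N = 0")
  case True then show ?thesis using assms by simp
next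
  case False
  then have N: "0 < N" by simp
  have "(f ^^ (j * N)) u \<le> u + real j * of_int c" for j
  proof (induction j)
    case (Suc j)
    have "(f ^^ (Suc j * N)) u = (f ^^ N) ((f ^^ (j * N)) u)" by (simp add: funpow_add)
    also have "\<dots> \<le> (f ^^ N) (u + of_int (int j * c))" using Suc by (intro iter_mono) simp
    also have "\<dots> = (f ^^ N) u + of_int (int j * c)" by (simp only: iter_add_int)
    also have "\<dots> \<le> (u + of_int c) + of_int (int j * c)" using assms by simp
    also have "\<dots> = u + real (Suc j) * of_int c" by (simp add: algebra_simps)
    finally show ?case .
  qed simp
  then have "(f ^^ (j * N)) u / real (j * N) \<le> (u + real j * of_int c) / real (j * N)" for j
    by (intro divide_right_mono) auto
  then have "\<alpha> \<le> of_int c / real N"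
    by (intro LIMSEQ_le[OF rot_subseq[OF N] lin_limit[OF N]]) auto
  then show ?thesis using N by (simp add: field_simps)
qed

text \<open>The later of the two orbit points is an iterate of the earlier one, so the comparison is
  one of displacements.\<close>

lemma orbit_order:
  assumes "(f ^^ n) 0 + of_int m \<le> (f ^^ n') 0 + of_int m'"
  shows "real n * \<alpha> + of_int m \<le> real n' * \<alpha> + of_int m'"
proof (cases "n \<le> n'")
  case True
  then have "(f ^^ n') 0 = (f ^^ (n' - n)) ((f ^^ n) 0)" by (metis funpow_add le_add_diff_inverse2 o_apply)
  then have "(f ^^ n) 0 + of_int (m - m') \<le> (f ^^ (n' - n)) ((f ^^ n) 0)" using assms by simp
  then have "of_int (m - m') \<le> real (n' - n) * \<alpha>" by (rule rot_ge)
  then show ?thesis using True by (simp add: of_nat_diff algebra_simps)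
next
  case False
  then have "(f ^^ n) 0 = (f ^^ (n - n')) ((f ^^ n') 0)" by (metis funpow_add le_add_diff_inverse2 nat_le_linear o_apply)
  then have "(f ^^ (n - n')) ((f ^^ n') 0) \<le> (f ^^ n') 0 + of_int (m' - m)" using assms by simp
  then have "real (n - n') * \<alpha> \<le> of_int (m' - m)" by (rule rot_le)
  then show ?thesis using False by (simp add: of_nat_diff algebra_simps)
qed

text \<open>Poincare's semiconjugacy: the position of \<open>t\<close> among the points of the lifted orbit of \<open>0\<close>
  is the position of its image among the points \<open>n \<alpha> + m\<close>.\<close>

definition "below t = {real n * \<alpha> + of_int m | n m. (f ^^ n) 0 + of_int m \<le> t}"
definition "semiconj t = Sup (below t)"

lemma belowI: "(f ^^ n) 0 + of_int m \<le> t \<Longrightarrow> real n * \<alpha> + of_int m \<in> below t"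
  by (auto simp: below_def)

lemma below_nonempty: "below t \<noteq> {}"
  using belowI[of 0 "\<lfloor>t\<rfloor>" t] by auto

lemma below_bound:
  assumes "x \<in> below t" "t \<le> (f ^^ n) 0 + of_int m"
  shows "x \<le> real n * \<alpha> + of_int m"
proof -
  obtain n' m' where "x = real n' * \<alpha> + of_int m'" "(f ^^ n') 0 + of_int m' \<le> t" using assms(1) by (auto simp: below_def)
  then show ?thesis using orbit_order[of n' m' n m] assms(2) by simp
qed

lemma below_bdd: "bdd_above (below t)"
  using below_bound[of _ t 0 "\<lceil>t\<rceil>"] by (intro bdd_aboveI[of _ "of_int \<lceil>t\<rceil>"]) auto

lemma below_le: "x \<in> below t \<Longrightarrow> x \<le> semiconj t"
  unfolding semiconj_def by (rule cSup_upper[OF _ below_bdd])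

lemma semiconj_le: "(\<And>x. x \<in> below t \<Longrightarrow> x \<le> y) \<Longrightarrow> semiconj t \<le> y"
  unfolding semiconj_def by (rule cSup_least[OF below_nonempty])

lemma semiconj_orbit: "semiconj ((f ^^ n) 0 + of_int m) = real n * \<alpha> + of_int m"
  by (intro antisym semiconj_le below_le belowI below_bound[of _ "(f ^^ n) 0 + of_int m"]) auto

lemma semiconj_mono: "mono semiconj"
  by (intro monoI semiconj_le below_le) (force simp: below_def)

lemma semiconj_period: "semiconj (t + 1) = semiconj t + 1"
proof (rule antisym)
  show "semiconj (t + 1) \<le> semiconj t + 1"
  proof (rule semiconj_le)
    fix x assume "x \<in> below (t + 1)"
    then obtain n m where "x = real n * \<alpha> + of_int m" "(f ^^ n) 0 + of_int m \<le> t + 1" by (auto simp: below_def)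
    then show "x \<le> semiconj t + 1" using below_le[OF belowI[of n "m - 1" t]] by simp
  qed
  have "semiconj t \<le> semiconj (t + 1) - 1"
  proof (rule semiconj_le)
    fix x assume "x \<in> below t"
    then obtain n m where "x = real n * \<alpha> + of_int m" "(f ^^ n) 0 + of_int m \<le> t" by (auto simp: below_def)
    then show "x \<le> semiconj (t + 1) - 1" using below_le[OF belowI[of n "m + 1" "t + 1"]] by simp
  qed
  then show "semiconj t + 1 \<le> semiconj (t + 1)" by simp
qed

lemma semiconj_dense:
  assumes "x < y"
  shows "\<exists>t. x < semiconj t \<and> semiconj t < y"
  using irrational_orbit_dense[OF irrational assms] semiconj_orbit by metis

lemma semiconj_degree_one: "degree_one semiconj"
  by standard (use mono_dense_imp_continuous[OF semiconj_mono semiconj_dense] semiconj_mono semiconj_period in auto)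

text \<open>Applying f moves the orbit of 0 one step on. For the upper bound, the integer points,
  with n = 0, have no predecessor in the forward orbit; they are approximated from below by orbit
  points with positive time.\<close>

lemma semiconj_step: "semiconj (f t) = semiconj t + \<alpha>"
proof (rule antisym)
  have pos: "x \<le> semiconj t + \<alpha>" if x: "x = real (Suc n) * \<alpha> + of_int m" "(f ^^ Suc n) 0 + of_int m \<le> f t" for x n m
  proof -
    have "f ((f ^^ n) 0 + of_int m) \<le> f t" using x(2) by (simp add: D.h_add_int)
    then have "(f ^^ n) 0 + of_int m \<le> t" using strict by (simp add: strict_mono_less_eq)
    then have "real n * \<alpha> + of_int m \<le> semiconj t" by (intro below_le belowI)
    then show ?thesis using x(1) by (simp add: algebra_simps)
  qed
  show "semiconj (f t) \<le> semiconj t + \<alpha>"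
  proof (rule semiconj_le)
    fix x assume "x \<in> below (f t)"
    then obtain n m where x: "x = real n * \<alpha> + of_int m" "(f ^^ n) 0 + of_int m \<le> f t" by (auto simp: below_def)
    show "x \<le> semiconj t + \<alpha>"
    proof (cases n)
      case (Suc n')
      then show ?thesis using pos[of x n' m] x by simp
    next
      case 0
      then have xm: "x = of_int m" "of_int m \<le> f t" using x by simp_all
      show ?thesis
      proof (rule ccontr)
        assume "\<not> ?thesis"
        then obtain k m' where k: "0 < k" "semiconj t + \<alpha> < of_nat k * \<alpha> + of_int m'" "of_nat k * \<alpha> + of_int m' < x"
          using irrational_orbit_dense[OF irrational, of "semiconj t + \<alpha>" x] by (metis not_le)
        obtain k' where k': "k = Suc k'" using k(1) gr0_conv_Suc by blast
        have "(f ^^ k) 0 + of_int m' \<le> of_int m"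
          using orbit_order[of 0 m k m'] k(3) xm(1) by force
        then have "real (Suc k') * \<alpha> + of_int m' \<le> semiconj t + \<alpha>"
          using pos[of "real (Suc k') * \<alpha> + of_int m'" k' m'] xm(2) k' by simp
        then show False using k(2) k' by simp
      qed
    qed
  qed
  have "semiconj t \<le> semiconj (f t) - \<alpha>"
  proof (rule semiconj_le)
    fix x assume "x \<in> below t"
    then obtain n m where x: "x = real n * \<alpha> + of_int m" "(f ^^ n) 0 + of_int m \<le> t" by (auto simp: below_def)
    have "(f ^^ Suc n) 0 + of_int m \<le> f t" using D.h_mono[OF x(2)] by (simp add: D.h_add_int)
    then have "real (Suc n) * \<alpha> + of_int m \<le> semiconj (f t)" by (intro below_le belowI)
    then show "x \<le> semiconj (f t) - \<alpha>" using x(1) by (simp add: algebra_simps)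
  qed
  then show "semiconj t + \<alpha> \<le> semiconj (f t)" by simp
qed

end

text \<open>Two lifts differ by a constant integer m, hence their n-th iterates by n m.\<close>

lemma rotation_number_lifts:
  assumes f: "increasing_lift F f" and f': "increasing_lift F f'"
    and \<alpha>: "\<And>t. (\<lambda>n. (f ^^ n) t / real n) \<longlonglongrightarrow> \<alpha>" and \<alpha>': "\<And>t. (\<lambda>n. (f' ^^ n) t / real n) \<longlonglongrightarrow> \<alpha>'"
  shows "\<alpha>' - \<alpha> \<in> \<int>"
proof -
  have par: "f' t - f' 0 = f t - f 0" for t
    by (rule lifts_parallel[of UNIV]) (use f f' in \<open>auto simp: increasing_lift_def\<close>)
  have "circle_proj (f' 0) = circle_proj (f 0)" using f f' unfolding increasing_lift_def by metis
  then obtain m where m: "f' 0 = f 0 + of_int m" by (rule circle_proj_eqE)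
  have eq: "f' t = f t + of_int m" for t using par[of t] m by simp
  interpret D: degree_one f
    by standard (use f in \<open>auto simp: increasing_lift_def intro: strict_mono_mono\<close>)
  have it: "(f' ^^ n) 0 = (f ^^ n) 0 + of_int (int n * m)" for n
  proof (induction n)
    case (Suc n)
    have "f' ((f ^^ n) 0 + of_int (int n * m)) = f ((f ^^ n) 0) + of_int (int n * m) + of_int m"
      unfolding eq D.h_add_int ..
    then show ?case using Suc by (simp add: algebra_simps)
  qed simp
  have "(\<lambda>n. (f ^^ n) 0 / real n + of_int m) \<longlonglongrightarrow> \<alpha> + of_int m" by (intro tendsto_intros \<alpha>)
  moreover have "\<forall>\<^sub>F n in sequentially. (f ^^ n) 0 / real n + of_int m = (f' ^^ n) 0 / real n"
    using eventually_gt_at_top[of 0] by eventually_elim (simp add: it add_divide_distrib)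
  ultimately have "(\<lambda>n. (f' ^^ n) 0 / real n) \<longlonglongrightarrow> \<alpha> + of_int m" using tendsto_cong by fast
  then have "\<alpha>' = \<alpha> + of_int m" using LIMSEQ_unique[OF \<alpha>'] by blast
  then show ?thesis by simp
qed

text \<open>Gaps exist because a semiconjugacy without plateaus would be strictly increasing and
  descend to a conjugacy with the rotation.\<close>

lemma denjoy_semiconjugacy:
  assumes F: "denjoy_homeomorphism F" and rot: "has_rotation_number F \<alpha>"
  shows "\<exists>f h. increasing_lift F f \<and> degree_one h \<and> (\<forall>t. h (f t) = h t + \<alpha>) \<and> \<alpha> \<notin> \<rat> \<and> gap_values h \<noteq> {}"
proof -
  obtain \<alpha>' where \<alpha>': "\<alpha>' \<notin> \<rat>" "has_rotation_number F \<alpha>'" "\<not> conjugate_on_circle F (rotation \<alpha>')"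
    using F unfolding denjoy_homeomorphism_def by blast
  obtain f where f: "increasing_lift F f" "\<And>t. (\<lambda>n. (f ^^ n) t / real n) \<longlonglongrightarrow> \<alpha>"
    using rot unfolding has_rotation_number_def by blast
  obtain f' where f': "increasing_lift F f'" "\<And>t. (\<lambda>n. (f' ^^ n) t / real n) \<longlonglongrightarrow> \<alpha>'"
    using \<alpha>'(2) unfolding has_rotation_number_def by blast
  have int: "\<alpha>' - \<alpha> \<in> \<int>" by (rule rotation_number_lifts[OF f(1) f'(1) f(2) f'(2)])
  have irr: "\<alpha> \<notin> \<rat>"
  proof
    assume "\<alpha> \<in> \<rat>"
    moreover have "\<alpha>' - \<alpha> \<in> \<rat>" using int Ints_subset_Rats by blast
    ultimately have "\<alpha> + (\<alpha>' - \<alpha>) \<in> \<rat>" by (rule Rats_add)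
    then show False using \<alpha>'(1) by simp
  qed
  \<comment> \<open>The definition excludes a conjugacy for some representative of the rotation
    number; integers do not change the rotation.\<close>
  have nconj: "\<not> conjugate_on_circle F (rotation \<alpha>)"
  proof -
    have "circle_proj \<alpha> = circle_proj \<alpha>'" using int unfolding circle_proj_eq_iff by (metis Ints_minus minus_diff_eq)
    then have "rotation \<alpha> = rotation \<alpha>'" by (simp add: rotation_def fun_eq_iff)
    then show ?thesis using \<alpha>'(3) by simp
  qed
  interpret L: circle_lift_map f \<alpha>
    by standard (use f irr in \<open>auto simp: increasing_lift_def\<close>)
  let ?h = L.semiconj
  interpret H: degree_one ?h by (rule L.semiconj_degree_one)
  have "gap_values ?h \<noteq> {}"
  proof
    assume "gap_values ?h = {}"
    then have all: "growth_points ?h = UNIV" using H.not_growthD(1) by blast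
    have smono: "?h s < ?h t" if "s < t" for s t
    proof -
      have "(s + t) / 2 \<in> growth_points ?h" using all by simp
      moreover have "s < (s + t) / 2" "(s + t) / 2 < t" using that by auto
      ultimately show ?thesis unfolding growth_points_def by blast
    qed
    obtain \<psi> where \<psi>: "\<And>t. \<psi> (circle_proj t) = circle_proj (?h t)"
      using circle_descend[of "\<lambda>t. circle_proj (?h t)"] by (auto simp: H.h_add_int)
    have "continuous_on (circle_proj ` UNIV) \<psi>"
      by (rule continuous_on_circle_quotient[of UNIV "\<lambda>t. circle_proj (?h t)"])
        (simp_all add: \<psi> continuous_on_circle_proj[OF H.cont])
    then have c: "continuous_on circle \<psi>" by (simp add: range_circle_proj)
    have im: "\<psi> ` circle = circle"
    proof (intro equalityI subsetI)
      fix z assume "z \<in> \<psi> ` circle"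
      then show "z \<in> circle" unfolding range_circle_proj[symmetric] by (auto simp: \<psi>)
    next
      fix z assume "z \<in> circle"
      then obtain t where t: "z = circle_proj t" using circle_proj_surj by blast
      obtain u where "?h u = t" using H.h_surj by blast
      then have "z = \<psi> (circle_proj u)" by (simp add: t \<psi>)
      then show "z \<in> \<psi> ` circle" using circle_proj_in_circle by blast
    qed
    have inj: "inj_on \<psi> circle"
    proof (rule inj_onI)
      fix z w assume zw: "z \<in> circle" "w \<in> circle" "\<psi> z = \<psi> w"
      obtain s t where st: "z = circle_proj s" "w = circle_proj t" using circle_proj_surj zw(1,2) by blast
      then have "circle_proj (?h s) = circle_proj (?h t)" using zw(3) by (simp add: \<psi>)
      then obtain m where "?h s = ?h t + of_int m" by (rule circle_proj_eqE)
      then have "?h s = ?h (t + of_int m)" by (simp only: H.h_add_int)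
      then have "s = t + of_int m" using smono by (metis less_irrefl linorder_less_linear)
      then show "z = w" using st by simp
    qed
    obtain \<psi>' where "homeomorphism circle circle \<psi> \<psi>'"
      using homeomorphism_compact[OF compact_sphere c im inj] by blast
    moreover have "\<psi> (F z) = rotation \<alpha> (\<psi> z)" if z: "z \<in> circle" for z
    proof -
      obtain t where t: "z = circle_proj t" using circle_proj_surj z by blast
      then have "F z = circle_proj (f t)" using f(1) by (simp add: increasing_lift_def)
      then show ?thesis by (simp add: t \<psi> L.semiconj_step rotation_def circle_proj_add)
    qed
    ultimately show False using nconj unfolding conjugate_on_circle_def by blast
  qed
  then show ?thesis using f(1) H.degree_one_axioms L.semiconj_step irr by blast
qed

section \<open>The minimal set and uniqueness of the semiconjugacy\<close>

locale denjoy_data =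
  fixes F :: "complex \<Rightarrow> complex" and f h :: "real \<Rightarrow> real" and \<alpha> :: real
  assumes lift: "increasing_lift F f" and degree_one: "degree_one h" and step: "\<And>t. h (f t) = h t + \<alpha>"
    and irr: "\<alpha> \<notin> \<rat>" and gaps: "gap_values h \<noteq> {}"
begin

sublocale H: degree_one h by (rule degree_one)

sublocale f: degree_one f
  by standard (use lift in \<open>auto simp: increasing_lift_def intro: strict_mono_mono\<close>)

lemma f_strict: "f s < f t \<longleftrightarrow> s < t"
  using lift by (simp add: increasing_lift_def strict_mono_less)

lemma f_le: "f s \<le> f t \<longleftrightarrow> s \<le> t"
  using lift by (simp add: increasing_lift_def strict_mono_less_eq)

lemma F_proj: "F (circle_proj t) = circle_proj (f t)"
  using lift by (simp add: increasing_lift_def)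

text \<open>The increasing bijection f maps the fiber of h over a onto the fiber over a + \<alpha>,
  hence ends to ends.\<close>

lemma f_left: "f (left_pt h a) = left_pt h (a + \<alpha>)"
proof (rule antisym)
  show "left_pt h (a + \<alpha>) \<le> f (left_pt h a)" by (rule H.left_le) (simp add: step)
  obtain u where u: "f u = left_pt h (a + \<alpha>)" using f.h_surj by blast
  then have "h u = a" using step[of u] by simp
  then have "left_pt h a \<le> u" by (intro H.left_le) simp
  then show "f (left_pt h a) \<le> left_pt h (a + \<alpha>)" unfolding u[symmetric] f_le .
qed

lemma f_right: "f (right_pt h a) = right_pt h (a + \<alpha>)"
proof (rule antisym)
  show "f (right_pt h a) \<le> right_pt h (a + \<alpha>)" by (rule H.le_right) (simp add: step)
  obtain u where u: "f u = right_pt h (a + \<alpha>)" using f.h_surj by blast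
  then have "h u = a" using step[of u] by simp
  then have "u \<le> right_pt h a" by (intro H.le_right) simp
  then show "right_pt h (a + \<alpha>) \<le> f (right_pt h a)" unfolding u[symmetric] f_le .
qed

lemma F_split: "F (split_pt h s a) = split_pt h s (a + \<alpha>)"
  by (simp add: split_pt_def side_pt_def F_proj f_left f_right)

lemma gap_step: "a + \<alpha> \<in> gap_values h \<longleftrightarrow> a \<in> gap_values h"
  by (simp add: gap_values_def f_left[symmetric] f_right[symmetric] f_strict)

abbreviation "K \<equiv> circle_proj ` growth_points h"

lemma K_subset: "K \<subseteq> circle"
  using circle_proj_in_circle by blast

lemma F_iter: "(F ^^ n) (circle_proj t) = circle_proj ((f ^^ n) t)"
  by (induction n) (auto simp: F_proj)

lemma h_iter: "h ((f ^^ n) t) = h t + of_nat n * \<alpha>"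
  by (induction n) (auto simp: step algebra_simps)

text \<open>If E missed a point of K, it would miss an interval at whose ends h differs. By density
  some forward iterate of a point of E has, modulo 1, its value under h strictly between, and then
  lies in that interval.\<close>

lemma invariant_contains:
  assumes E: "E \<subseteq> circle" "closed E" "E \<noteq> {}" "F ` E \<subseteq> E"
  shows "K \<subseteq> E"
proof
  fix z assume "z \<in> K"
  then obtain t where t: "t \<in> growth_points h" "z = circle_proj t" by blast
  show "z \<in> E"
  proof (rule ccontr)
    assume z: "z \<notin> E"
    have "continuous_on UNIV circle_proj" by (intro continuous_intros)
    then have "open (circle_proj -` (- E))" using E(2) by (intro open_vimage) auto
    moreover have "t \<in> circle_proj -` (- E)" using z t by simp
    ultimately obtain e where e: "e > 0" "ball t e \<subseteq> circle_proj -` (- E)" using open_contains_ball by blast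
    have "h (t - e) < h (t + e)" using t(1) e(1) unfolding growth_points_def by simp
    obtain w where w: "w \<in> E" using E(3) by blast
    then obtain s where s: "w = circle_proj s" using E(1) circle_proj_surj by blast
    have "h (t - e) - h s < h (t + e) - h s" using \<open>h (t - e) < h (t + e)\<close> by simp
    then obtain n :: nat and m :: int where nm: "0 < n" "h (t - e) - h s < of_nat n * \<alpha> + of_int m" "of_nat n * \<alpha> + of_int m < h (t + e) - h s"
      by (rule irrational_orbit_dense[OF irr])
    define u where "u = (f ^^ n) s + of_int m"
    have "h u = h s + of_nat n * \<alpha> + of_int m" by (simp add: u_def H.h_add_int h_iter)
    then have "h (t - e) < h u" "h u < h (t + e)" using nm by auto
    then have "t - e < u" "u < t + e" by (auto dest: H.h_less_imp)
    then have "u \<in> ball t e" by (auto simp: dist_real_def)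
    then have "circle_proj u \<notin> E" using e(2) by auto
    moreover have "(F ^^ n) w \<in> E" for n
    proof (induction n)
      case (Suc n) then show ?case using E(4) by auto
    qed (simp add: w)
    then have "circle_proj u \<in> E" using F_iter[of n s] s by (metis Ints_of_int circle_proj_add_int u_def)
    ultimately show False by blast
  qed
qed

lemma minimal_K: "minimal_set F K"
  unfolding minimal_set_def
proof (intro conjI allI impI)
  show "closed K" using compact_imp_closed[OF H.compact_image_growth] .
  show "K \<noteq> {}" using H.side_in_growth by blast
  show "F ` K = K"
  proof (intro equalityI subsetI)
    fix z assume "z \<in> F ` K"
    then obtain s a where "z = F (split_pt h s a)" unfolding H.image_growth by blast
    then have "z = split_pt h s (a + \<alpha>)" by (simp add: F_split)
    then show "z \<in> K" unfolding H.image_growth by blast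
  next
    fix z assume "z \<in> K"
    then obtain s a where "z = split_pt h s a" unfolding H.image_growth by blast
    then have "z = F (split_pt h s (a - \<alpha>))" by (simp add: F_split)
    moreover have "split_pt h s (a - \<alpha>) \<in> K" unfolding H.image_growth by blast
    ultimately show "z \<in> F ` K" by blast
  qed
  fix E assume E: "E \<subseteq> K \<and> closed E \<and> E \<noteq> {} \<and> F ` E = E"
  then have "K \<subseteq> E" using K_subset by (intro invariant_contains) auto
  then show "E = K" using E by blast
qed (rule K_subset)

lemma denjoy_set_eq: "denjoy_set F = K"
  unfolding denjoy_set_def
proof (rule the_equality[of "minimal_set F", OF minimal_K])
  fix E assume E: "minimal_set F E"
  then have "K \<subseteq> E" unfolding minimal_set_def by (intro invariant_contains) auto
  then show "E = K" using E minimal_K unfolding minimal_set_def by metis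
qed

lemma split_system_of:
  assumes "fst X = fst (denjoy_system F)" "\<And>z. z \<in> denjoy_set F \<Longrightarrow> sys_map X z = F z"
  shows "split_system h \<alpha> X"
proof
  show "sys_map X (split_pt h s a) = split_pt h s (a + \<alpha>)" for s a
  proof -
    have "split_pt h s a \<in> denjoy_set F" unfolding denjoy_set_eq H.image_growth by blast
    then show ?thesis using assms(2) F_split by simp
  qed
qed (use irr gaps gap_step assms(1) denjoy_set_eq in \<open>auto simp: denjoy_system_def\<close>)

text \<open>The quotient of the two semiconjugacies \<open>H'\<close> and \<open>H0\<close> is
  invariant under F. Its non-empty level sets are closed and invariant, so all of them contain K and
  there is only one. On a component of the complement, \<open>H0\<close> has a connected and
  countable image, hence is constant.\<close>

lemma image_gap_components:
  assumes H': "continuous_on circle H'" "\<And>z. z \<in> circle \<Longrightarrow> H' (F z) = rotation \<alpha> (H' z)" "H' ` circle = circle"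
  shows "\<exists>\<theta>. (\<Union>C\<in>components (circle - denjoy_set F). H' ` closure C) = circle_proj ` ((+) \<theta> ` gap_values h)"
proof -
  obtain H0 where H0: "\<And>t. H0 (circle_proj t) = circle_proj (h t)"
    using circle_descend[of "\<lambda>t. circle_proj (h t)"] by (auto simp: H.h_add_int)
  have "continuous_on (circle_proj ` UNIV) H0"
    by (rule continuous_on_circle_quotient[of UNIV "\<lambda>t. circle_proj (h t)"])
      (simp_all add: H0 continuous_on_circle_proj[OF H.cont])
  then have cH0: "continuous_on circle H0" by (simp add: range_circle_proj)
  have nH0: "norm (H0 z) = 1" if z: "z \<in> circle" for z
  proof -
    obtain t where "z = circle_proj t" using circle_proj_surj z by blast
    then show ?thesis by (simp add: H0)
  qed
  have H0F: "H0 (F z) = circle_proj \<alpha> * H0 z" "F z \<in> circle" if z: "z \<in> circle" for z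
  proof -
    obtain t where "z = circle_proj t" using circle_proj_surj z by blast
    then show "H0 (F z) = circle_proj \<alpha> * H0 z" "F z \<in> circle"
      by (simp_all add: H0 F_proj step circle_proj_add mult.commute)
  qed
  define \<phi> where "\<phi> z = H' z / H0 z" for z
  have c\<phi>: "continuous_on circle \<phi>" unfolding \<phi>_def
    by (intro continuous_on_divide H'(1) cH0) (use nH0 in force)
  have \<phi>F: "\<phi> (F z) = \<phi> z" if "z \<in> circle" for z
    using H'(2)[OF that] H0F(1)[OF that] by (simp add: \<phi>_def rotation_def)
  define z0 where "z0 = split_pt h True 0"
  have z0K: "z0 \<in> K" unfolding z0_def H.image_growth by blast
  have const: "\<phi> z = \<phi> z0" if z: "z \<in> circle" for z
  proof -
    let ?E = "{w \<in> circle. \<phi> w = \<phi> z}"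
    have "closed ?E" by (rule continuous_closed_preimage_constant[OF c\<phi> closed_sphere])
    moreover have "F ` ?E \<subseteq> ?E" using \<phi>F H0F(2) by auto
    ultimately have "K \<subseteq> ?E" using z by (intro invariant_contains) auto
    then show ?thesis using z0K by auto
  qed
  have "norm (\<phi> z0) = 1"
  proof -
    have z0c: "z0 \<in> circle" using z0K K_subset by blast
    then have "H' z0 \<in> circle" using H'(3) by blast
    then show ?thesis using nH0[OF z0c] by (simp add: \<phi>_def norm_divide)
  qed
  then obtain \<theta> where \<theta>: "\<phi> z0 = circle_proj \<theta>" using circle_proj_surj[of "\<phi> z0"] by auto
  have H'eq: "H' z = circle_proj \<theta> * H0 z" if z: "z \<in> circle" for z
  proof -
    have "H0 z \<noteq> 0" using nH0[OF z] by auto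
    then have "H' z = \<phi> z * H0 z" by (simp add: \<phi>_def)
    also have "\<phi> z = circle_proj \<theta>" using const[OF z] \<theta> by simp
    finally show ?thesis .
  qed
  have K_iff: "circle_proj t \<in> K \<longleftrightarrow> t \<in> growth_points h" for t
  proof
    assume "circle_proj t \<in> K"
    then obtain u where u: "u \<in> growth_points h" "circle_proj t = circle_proj u" by blast
    obtain m where "t = u + of_int m" using circle_proj_eqE[OF u(2)] .
    then show "t \<in> growth_points h" using u(1) by (simp add: H.growth_add_int)
  qed blast
  have gap_im: "H0 z \<in> circle_proj ` gap_values h" if z: "z \<in> circle - K" for z
  proof -
    obtain t where t: "z = circle_proj t" using circle_proj_surj z by blast
    then have "t \<notin> growth_points h" using z K_iff by blast
    then have "h t \<in> gap_values h" by (rule H.not_growthD)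
    then show ?thesis by (simp add: t H0)
  qed
  have comp: "H' ` closure C \<subseteq> circle_proj ` ((+) \<theta> ` gap_values h)" if C: "C \<in> components (circle - K)" for C
  proof -
    have sub: "C \<subseteq> circle - K" and con: "connected C" and ne: "C \<noteq> {}"
      using in_components_subset[OF C] in_components_connected[OF C] in_components_nonempty[OF C] by auto
    have "C \<subseteq> circle" using sub by blast
    then have "connected (H0 ` C)" by (rule connected_continuous_image[OF continuous_on_subset[OF cH0] con])
    have "H0 ` C \<subseteq> circle_proj ` gap_values h"
    proof (rule image_subsetI)
      fix z assume "z \<in> C"
      then show "H0 z \<in> circle_proj ` gap_values h" by (rule gap_im[OF subsetD[OF sub]])
    qed
    then have cnt: "countable (H0 ` C)" by (rule countable_subset[OF _ countable_image[OF H.countable_gap_values]])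
    obtain c where c: "c \<in> C" using ne by auto
    have "H0 z = H0 c" if "z \<in> C" for z
    proof (rule ccontr)
      assume "H0 z \<noteq> H0 c"
      then have "uncountable (H0 ` C)"
        by (rule connected_uncountable[OF \<open>connected (H0 ` C)\<close> imageI[OF that] imageI[OF c]])
      then show False using cnt by contradiction
    qed
    then have "C \<subseteq> {w \<in> circle. H0 w = H0 c}" using sub by blast
    moreover have "closed {w \<in> circle. H0 w = H0 c}" by (rule continuous_closed_preimage_constant[OF cH0 closed_sphere])
    ultimately have cl: "closure C \<subseteq> {w \<in> circle. H0 w = H0 c}" by (rule closure_minimal)
    obtain a where a: "a \<in> gap_values h" "H0 c = circle_proj a" using gap_im[OF subsetD[OF sub c]] by auto
    show ?thesis
    proof
      fix w assume "w \<in> H' ` closure C"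
      then obtain z where z: "z \<in> closure C" "w = H' z" by blast
      have "z \<in> circle" "H0 z = H0 c" using cl z(1) by blast+
      then have "w = circle_proj \<theta> * circle_proj a" using H'eq[of z] a(2) z(2) by simp
      then have "w = circle_proj (\<theta> + a)" by (simp add: circle_proj_add)
      then show "w \<in> circle_proj ` ((+) \<theta> ` gap_values h)" using a(1) by blast
    qed
  qed
  have "w \<in> (\<Union>C\<in>components (circle - K). H' ` closure C)" if w: "w \<in> circle_proj ` ((+) \<theta> ` gap_values h)" for w
  proof -
    obtain a where a: "a \<in> gap_values h" "w = circle_proj (\<theta> + a)" using w by blast
    obtain t where t: "t \<notin> growth_points h" "h t = a" using H.gapE[OF a(1)] .
    have "circle_proj t \<in> circle - K" using t(1) K_iff circle_proj_in_circle by blast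
    then have "circle_proj t \<in> \<Union> (components (circle - K))" by (simp add: Union_components)
    then obtain C where C: "C \<in> components (circle - K)" "circle_proj t \<in> C" by blast
    have "w = H' (circle_proj t)" using a(2) t(2) H'eq[of "circle_proj t"] by (simp add: H0 circle_proj_add)
    moreover have "circle_proj t \<in> closure C" using C(2) closure_subset by (rule subsetD[rotated])
    ultimately show ?thesis using C(1) by blast
  qed
  then have "circle_proj ` ((+) \<theta> ` gap_values h) \<subseteq> (\<Union>C\<in>components (circle - K). H' ` closure C)"
    by (rule subsetI)
  moreover have "(\<Union>C\<in>components (circle - K). H' ` closure C) \<subseteq> circle_proj ` ((+) \<theta> ` gap_values h)"
    by (rule UN_least) (rule comp)
  ultimately show ?thesis unfolding denjoy_set_eq by (intro exI[of _ \<theta>] equalityI)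
qed

end

text \<open>Corresponds to turning the semiconjugacy by \<theta>; it brings 0, or the given set of
  invariants, into the gap values.\<close>

lemma split_shift:
  assumes "split_system h \<alpha> X"
  shows "split_system (\<lambda>t. h t + \<theta>) \<alpha> X" "gap_values (\<lambda>t. h t + \<theta>) = (+) \<theta> ` gap_values h"
proof -
  interpret X: split_system h \<alpha> X by fact
  let ?k = "\<lambda>t. h t + \<theta>"
  have eq: "h t + \<theta> = a \<longleftrightarrow> h t = a - \<theta>" for t a by auto
  have lr: "left_pt ?k a = left_pt h (a - \<theta>)" "right_pt ?k a = right_pt h (a - \<theta>)" for a
    by (simp_all add: left_pt_def right_pt_def eq)
  then have gaps: "a \<in> gap_values ?k \<longleftrightarrow> a - \<theta> \<in> gap_values h" for a by (simp add: gap_values_def)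
  show g: "gap_values ?k = (+) \<theta> ` gap_values h"
  proof (intro equalityI subsetI)
    fix a assume "a \<in> gap_values ?k"
    then show "a \<in> (+) \<theta> ` gap_values h" using gaps by (intro image_eqI[of _ _ "a - \<theta>"]) auto
  qed (auto simp: gaps)
  have growth: "growth_points ?k = growth_points h" by (simp add: growth_points_def)
  show "split_system ?k \<alpha> X"
  proof
    show "continuous_on UNIV ?k" by (intro continuous_intros X.cont)
    show "mono ?k" using X.h_mono by (intro monoI) simp
    show "?k (t + 1) = ?k t + 1" for t using X.period by simp
    show "\<alpha> \<notin> \<rat>" by (rule X.irrational)
    show "gap_values ?k \<noteq> {}" using g X.gaps_nonempty by simp
    show "a + \<alpha> \<in> gap_values ?k \<longleftrightarrow> a \<in> gap_values ?k" for a
    proof -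
      have "a + \<alpha> - \<theta> = (a - \<theta>) + \<alpha>" by simp
      then show ?thesis unfolding gaps using X.gaps_invariant[of "a - \<theta>"] by metis
    qed
    show "fst X = submetric euclidean_metric (circle_proj ` growth_points ?k)" by (simp add: growth X.space)
    show "sys_map X (split_pt ?k s a) = split_pt ?k s (a + \<alpha>)" for s a
    proof -
      have sp: "split_pt ?k s b = split_pt h s (b - \<theta>)" for b
        unfolding split_pt_def side_pt_def lr ..
      have "a + \<alpha> - \<theta> = (a - \<theta>) + \<alpha>" by simp
      then show ?thesis unfolding sp using X.sys_map_split[of s "a - \<theta>"] by metis
    qed
  qed
qed

lemma is_denjoy_system_imp_split:
  assumes "is_denjoy_system X"
  shows "\<exists>h \<alpha>. split_system h \<alpha> X"
proof -
  obtain F where F: "denjoy_homeomorphism F" "fst X = fst (denjoy_system F)" "\<forall>z\<in>denjoy_set F. sys_map X z = F z"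
    using assms unfolding is_denjoy_system_def by blast
  obtain \<alpha> where "has_rotation_number F \<alpha>" using F(1) unfolding denjoy_homeomorphism_def by blast
  then obtain f h where fh: "increasing_lift F f" "degree_one h" "\<forall>t. h (f t) = h t + \<alpha>" "\<alpha> \<notin> \<rat>" "gap_values h \<noteq> {}"
    using denjoy_semiconjugacy[OF F(1)] by blast
  interpret D: denjoy_data F f h \<alpha> by (rule denjoy_data.intro) (use fh in auto)
  show ?thesis using D.split_system_of[of X] F by blast
qed

text \<open>The turn \<theta> comes from comparing the semiconjugacy that defines A with
  Poincare's.\<close>

lemma denjoy_invariants_imp_split:
  assumes "denjoy_invariants F \<alpha> A"
  shows "\<exists>h. split_system h \<alpha> (denjoy_system F) \<and> gap_values h = circle_lift A \<and> 0 \<in> gap_values h"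
proof -
  have F: "denjoy_homeomorphism F" "has_rotation_number F \<alpha>" and A0: "circle_proj 0 \<in> A"
    using assms unfolding denjoy_invariants_def by blast+
  obtain H' where H': "continuous_on circle H'" "H' ` circle = circle" "\<forall>z\<in>circle. H' (F z) = rotation \<alpha> (H' z)"
    and A: "A = (\<Union>C\<in>components (circle - denjoy_set F). H' ` closure C)"
    using assms unfolding denjoy_invariants_def by blast
  obtain f h where fh: "increasing_lift F f" "degree_one h" "\<forall>t. h (f t) = h t + \<alpha>" "\<alpha> \<notin> \<rat>" "gap_values h \<noteq> {}"
    using denjoy_semiconjugacy[OF F] by blast
  interpret D: denjoy_data F f h \<alpha> by (rule denjoy_data.intro) (use fh in auto)
  obtain \<theta> where \<theta>: "A = circle_proj ` ((+) \<theta> ` gap_values h)"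
    using D.image_gap_components[OF H'(1) _ H'(2)] H'(3) A by blast
  have X: "split_system h \<alpha> (denjoy_system F)"
    by (rule D.split_system_of) (auto simp: denjoy_system_def)
  let ?k = "\<lambda>t. h t + \<theta>"
  have K: "split_system ?k \<alpha> (denjoy_system F)" and g: "gap_values ?k = (+) \<theta> ` gap_values h"
    using split_shift[OF X, of \<theta>] by auto
  interpret K: split_system ?k \<alpha> "denjoy_system F" by (rule K)
  have "gap_values ?k = circle_lift A"
  proof (intro equalityI subsetI)
    fix a assume "a \<in> gap_values ?k"
    then show "a \<in> circle_lift A" unfolding circle_lift_def \<theta> g by blast
  next
    fix a assume "a \<in> circle_lift A"
    then obtain b where b: "b \<in> gap_values ?k" "circle_proj a = circle_proj b" unfolding circle_lift_def \<theta> g by blast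
    obtain m where "a = b + of_int m" using circle_proj_eqE[OF b(2)] .
    then show "a \<in> gap_values ?k" using b(1) K.gap_add_int by simp
  qed
  moreover have "0 \<in> circle_lift A" using A0 by (simp add: circle_lift_def)
  ultimately show ?thesis using K by blast
qed

section \<open>Existence of split systems with prescribed gap values\<close>

text \<open>The function is t plus the series of \<lfloor>t - e i\<rfloor> with weights 1/2, 1/4,
  ..., where e enumerates \<Gamma> in [0,1). The linear term gives slope at least 1 and the series
  the jumps; each contributes 1 to the gain of 2 over a period.\<close>

lemma jump_function_exists:
  fixes \<Gamma> :: "real set"
  assumes "countable \<Gamma>" "\<Gamma> \<noteq> {}" and per: "\<And>a m. a + of_int m \<in> \<Gamma> \<longleftrightarrow> a \<in> \<Gamma>"
  shows "\<exists>\<phi> :: real \<Rightarrow> real. (\<forall>t u. t < u \<longrightarrow> \<phi> t + (u - t) \<le> \<phi> u) \<and> (\<forall>t. \<phi> (t + 1) = \<phi> t + 2) \<and>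
    (\<forall>a\<in>\<Gamma>. \<exists>w>0. \<forall>t<a. \<phi> t + w \<le> \<phi> a) \<and>
    (\<forall>a. a \<notin> \<Gamma> \<longrightarrow> (\<forall>w>0. \<exists>d>0. \<phi> (a + d) - \<phi> (a - d) < w))"
proof -
  let ?B = "\<Gamma> \<inter> {0..<1}"
  have frac: "frac a \<in> ?B" if "a \<in> \<Gamma>" for a
    using per[of a "- \<lfloor>a\<rfloor>"] that by (simp add: frac_def) linarith
  have B: "countable ?B" "?B \<noteq> {}" using assms(1,2) frac by blast+
  \<comment> \<open>If the set is finite the enumeration repeats itself, which only enlarges
    jumps.\<close>
  define e where "e = from_nat_into ?B"
  have e: "range e = ?B" unfolding e_def using B by (rule range_from_nat_into[rotated])
  have e_in: "e i \<in> \<Gamma>" "0 \<le> e i" "e i < 1" for i using e rangeI[of e i] by auto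
  define g :: "nat \<Rightarrow> real \<Rightarrow> real" where "g i t = (1/2) ^ Suc i * of_int \<lfloor>t - e i\<rfloor>" for i t
  have half: "summable (\<lambda>i. (1/2 :: real) ^ Suc i)" "(suminf (\<lambda>i. (1/2 :: real) ^ Suc i)) = 1"
    using power_half_series sums_summable sums_unique by (blast, metis)
  have sg: "summable (\<lambda>i. g i t)" for t
  proof (rule summable_comparison_test')
    show "summable (\<lambda>i. (1/2 :: real) ^ Suc i * (\<bar>t\<bar> + 2))" by (rule summable_mult2[OF half(1)])
    fix i
    have "\<bar>of_int \<lfloor>t - e i\<rfloor>\<bar> \<le> \<bar>t\<bar> + 2" using e_in(2,3)[of i] by linarith
    then show "norm (g i t) \<le> (1/2) ^ Suc i * (\<bar>t\<bar> + 2)"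
      by (simp add: g_def abs_mult mult_left_mono)
  qed
  have g_mono: "g i t \<le> g i u" if "t \<le> u" for i t u
    unfolding g_def using that by (intro mult_left_mono) (auto intro: floor_mono)
  define \<phi> where "\<phi> t = t + (suminf (\<lambda>i. g i t))" for t
  have "\<phi> t + (u - t) \<le> \<phi> u" if "t < u" for t u
    using suminf_le[of "\<lambda>i. g i t" "\<lambda>i. g i u"] g_mono[of t u] that sg by (simp add: \<phi>_def)
  moreover have "\<phi> (t + 1) = \<phi> t + 2" for t
  proof -
    have "g i (t + 1) = g i t + (1/2) ^ Suc i" for i
    proof -
      have "\<lfloor>t + 1 - e i\<rfloor> = \<lfloor>t - e i\<rfloor> + 1" by linarith
      then show ?thesis by (simp add: g_def algebra_simps)
    qed
    then have "(suminf (\<lambda>i. g i (t + 1))) = (suminf (\<lambda>i. g i t + (1/2) ^ Suc i))" by simp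
    also have "\<dots> = (suminf (\<lambda>i. g i t)) + 1" using suminf_add[OF sg half(1), of t] half(2) by simp
    finally show ?thesis by (simp add: \<phi>_def)
  qed
  moreover have "\<exists>w>0. \<forall>t<a. \<phi> t + w \<le> \<phi> a" if a: "a \<in> \<Gamma>" for a
  proof -
    obtain i where i: "e i = frac a" using frac[OF a] e by (metis rangeE)
    have "\<phi> t + (1/2) ^ Suc i \<le> \<phi> a" if t: "t < a" for t
    proof -
      have "(\<Sum>k\<in>{i}. g k a - g k t) \<le> (suminf (\<lambda>k. g k a - g k t))"
        using sg g_mono[of t a] t by (intro sum_le_suminf summable_diff) auto
      moreover have "(suminf (\<lambda>k. g k a - g k t)) = (suminf (\<lambda>k. g k a)) - (suminf (\<lambda>k. g k t))"
        using suminf_diff[OF sg sg] by simp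
      moreover have "(1/2) ^ Suc i \<le> g i a - g i t"
      proof -
        have ai: "a - e i = of_int \<lfloor>a\<rfloor>" by (simp add: i frac_def)
        then have "\<lfloor>t - e i\<rfloor> < \<lfloor>a\<rfloor>" using t by (simp add: floor_less_iff)
        then have "\<lfloor>t - e i\<rfloor> + 1 \<le> \<lfloor>a - e i\<rfloor>" unfolding ai by simp
        then have "1 \<le> real_of_int \<lfloor>a - e i\<rfloor> - of_int \<lfloor>t - e i\<rfloor>" by linarith
        from mult_left_mono[OF this, of "(1/2) ^ Suc i"] show ?thesis
          by (simp add: g_def algebra_simps)
      qed
      ultimately show ?thesis using t by (simp add: \<phi>_def)
    qed
    then show ?thesis by (intro exI[of _ "(1/2) ^ Suc i"]) auto
  qed
  moreover have "\<exists>d>0. \<phi> (a + d) - \<phi> (a - d) < w" if a: "a \<notin> \<Gamma>" and w: "0 < w" for a w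
  proof -
    \<comment> \<open>Off \<Gamma> every summand is continuous, and for d < 1/4 its variation is at
      most its weight; Tannery's theorem exchanges limit and series.\<close>
    let ?F = "at_right (0::real)"
    let ?D = "\<lambda>k d. g k (a + d) - g k (a - d)"
    have lim: "((\<lambda>d. ?D k d) \<longlongrightarrow> 0) ?F" for k
    proof -
      have "a - e k \<notin> \<int>"
      proof
        assume "a - e k \<in> \<int>"
        then obtain m where "a - e k = of_int m" by (elim Ints_cases)
        then have "a = e k + of_int m" by simp
        then show False using a per[of "e k" m] e_in(1) by simp
      qed
      then have c: "isCont (\<lambda>x. real_of_int \<lfloor>x\<rfloor>) (a - e k)" using continuous_floor by (simp add: o_def)
      have "((\<lambda>d. a + d - e k) \<longlongrightarrow> a + 0 - e k) ?F" "((\<lambda>d. a - d - e k) \<longlongrightarrow> a - 0 - e k) ?F"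
        by (intro tendsto_intros)+
      then have "((\<lambda>d. a + d - e k) \<longlongrightarrow> a - e k) ?F" "((\<lambda>d. a - d - e k) \<longlongrightarrow> a - e k) ?F"
        by simp_all
      from isCont_tendsto_compose[OF c this(1)] isCont_tendsto_compose[OF c this(2)]
      have "((\<lambda>d. ?D k d) \<longlongrightarrow> (1/2) ^ Suc k * of_int \<lfloor>a - e k\<rfloor> - (1/2) ^ Suc k * of_int \<lfloor>a - e k\<rfloor>) ?F"
        unfolding g_def by (intro tendsto_intros)
      then show ?thesis by simp
    qed
    have bound: "eventually (\<lambda>(k, d). norm (?D k d) \<le> (1/2) ^ Suc k) (at_top \<times>\<^sub>F ?F)"
      unfolding eventually_prod_filter
    proof (intro exI conjI allI impI)
      show "eventually (\<lambda>_::nat. True) at_top" by simp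
      show "eventually (\<lambda>d. d \<in> {0<..<1/4}) ?F" by (rule eventually_at_right_real) simp
      fix k :: nat and d :: real assume d: "d \<in> {0<..<1/4}"
      have "0 < d" "d < 1/4" using d by auto
      then have "\<lfloor>a + d - e k\<rfloor> \<le> \<lfloor>a - d - e k\<rfloor> + 1" "\<lfloor>a - d - e k\<rfloor> \<le> \<lfloor>a + d - e k\<rfloor>"
        by linarith+
      then have "\<bar>real_of_int \<lfloor>a + d - e k\<rfloor> - of_int \<lfloor>a - d - e k\<rfloor>\<bar> \<le> 1" by linarith
      then have "(1/2) ^ Suc k * \<bar>real_of_int \<lfloor>a + d - e k\<rfloor> - of_int \<lfloor>a - d - e k\<rfloor>\<bar> \<le> (1/2) ^ Suc k * 1"
        by (rule mult_left_mono) simp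
      moreover have "?D k d = (1/2) ^ Suc k * (real_of_int \<lfloor>a + d - e k\<rfloor> - of_int \<lfloor>a - d - e k\<rfloor>)"
        by (simp only: g_def right_diff_distrib)
      then have "\<bar>?D k d\<bar> = (1/2) ^ Suc k * \<bar>real_of_int \<lfloor>a + d - e k\<rfloor> - of_int \<lfloor>a - d - e k\<rfloor>\<bar>"
        by (simp only: abs_mult abs_of_nonneg zero_le_power zero_le_divide_1_iff zero_le_numeral)
      ultimately show "case (k, d) of (k, d) \<Rightarrow> norm (?D k d) \<le> (1/2) ^ Suc k" by simp
    qed
    have "((\<lambda>d. suminf (\<lambda>k. ?D k d)) \<longlongrightarrow> (suminf (\<lambda>k. 0))) ?F"
      using tannerys_theorem[of ?D "\<lambda>_. 0" ?F "\<lambda>k. (1/2) ^ Suc k", OF lim bound half(1)] by simp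
    then have "((\<lambda>d. 2 * d + (suminf (\<lambda>k. ?D k d))) \<longlongrightarrow> 2 * 0 + (suminf (\<lambda>k. 0))) ?F" by (intro tendsto_intros)
    then have "\<forall>\<^sub>F d in ?F. 2 * d + (suminf (\<lambda>k. ?D k d)) < w" using w by (intro order_tendstoD(2)) auto
    moreover have "\<forall>\<^sub>F d in ?F. 0 < d" by (rule eventually_at_right_less)
    ultimately have "\<forall>\<^sub>F d in ?F. 0 < d \<and> 2 * d + (suminf (\<lambda>k. ?D k d)) < w" by eventually_elim simp
    then obtain d where d: "0 < d" "2 * d + (suminf (\<lambda>k. ?D k d)) < w"
      using eventually_happens'[of ?F] by force
    have "(suminf (\<lambda>k. ?D k d)) = (suminf (\<lambda>k. g k (a + d))) - (suminf (\<lambda>k. g k (a - d)))" using suminf_diff[OF sg sg] by simp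
    then show ?thesis using d by (intro exI[of _ d]) (simp add: \<phi>_def)
  qed
  ultimately show ?thesis by (intro exI[of _ \<phi>]) blast
qed

text \<open>The map is the generalized inverse of a strictly increasing function that jumps exactly on \<open>\<Gamma>\<close>.\<close>

lemma degree_one_with_gap_values:
  assumes "countable \<Gamma>" "\<Gamma> \<noteq> {}" and per: "\<And>a m. a + of_int m \<in> \<Gamma> \<longleftrightarrow> a \<in> \<Gamma>"
  shows "\<exists>h. degree_one h \<and> gap_values h = \<Gamma>"
proof -
  obtain \<phi> :: "real \<Rightarrow> real" where \<phi>: "(\<forall>t u. t < u \<longrightarrow> \<phi> t + (u - t) \<le> \<phi> u) \<and> (\<forall>t. \<phi> (t + 1) = \<phi> t + 2) \<and>
    (\<forall>a\<in>\<Gamma>. \<exists>w>0. \<forall>t<a. \<phi> t + w \<le> \<phi> a) \<and>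
    (\<forall>a. a \<notin> \<Gamma> \<longrightarrow> (\<forall>w>0. \<exists>d>0. \<phi> (a + d) - \<phi> (a - d) < w))"
    using jump_function_exists[OF assms] by (elim exE)
  have expand: "\<And>t u. t < u \<Longrightarrow> \<phi> t + (u - t) \<le> \<phi> u"
    and \<phi>1: "\<And>t. \<phi> (t + 1) = \<phi> t + 2"
    and jump: "\<And>a. a \<in> \<Gamma> \<Longrightarrow> \<exists>w>0. \<forall>t<a. \<phi> t + w \<le> \<phi> a"
    and small_jump: "\<And>a w. a \<notin> \<Gamma> \<Longrightarrow> 0 < w \<Longrightarrow> \<exists>d>0. \<phi> (a + d) - \<phi> (a - d) < w"
    using \<phi> by simp_all
  \<comment> \<open>The factor 2 matches the gain of \<phi> over a period and gives h degree
    one.\<close>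
  define h where "h s = Sup {t. \<phi> t \<le> 2 * s}" for s
  have ne: "{t. \<phi> t \<le> 2 * s} \<noteq> {}" for s
  proof -
    let ?t = "min (-1) (2 * s - \<phi> 0)"
    have "\<phi> ?t + (0 - ?t) \<le> \<phi> 0" by (rule expand) simp
    then have "\<phi> ?t \<le> 2 * s" by linarith
    then show ?thesis by blast
  qed
  have bdd: "bdd_above {t. \<phi> t \<le> 2 * s}" for s
  proof (rule bdd_aboveI)
    fix t assume "t \<in> {t. \<phi> t \<le> 2 * s}"
    then show "t \<le> max 0 (2 * s - \<phi> 0)" using expand[of 0 t] by fastforce
  qed
  have above: "2 * s < \<phi> t" if "h s < t" for s t
  proof (rule ccontr)
    assume "\<not> 2 * s < \<phi> t"
    then have "t \<le> h s" unfolding h_def by (intro cSup_upper bdd) simp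
    then show False using that by simp
  qed
  have below: "\<phi> t \<le> 2 * s" if lt: "t < h s" for s t
  proof -
    obtain u where "\<phi> u \<le> 2 * s" "t < u" using less_cSupD[OF ne lt[unfolded h_def]] by auto
    then show ?thesis using expand[of t u] by linarith
  qed
  have hI: "h s = v" if b: "\<And>t. t < v \<Longrightarrow> \<phi> t \<le> 2 * s" and a: "\<And>t. v < t \<Longrightarrow> 2 * s \<le> \<phi> t" for s v
  proof (rule antisym; rule ccontr)
    assume "\<not> h s \<le> v"
    then obtain u where u: "v < u" "u < h s" using dense[of v "h s"] by auto
    obtain t where "v < t" "t < u" using dense[OF u(1)] by auto
    then show False using a[of t] below[OF u(2)] expand[of t u] by simp
  next
    assume "\<not> v \<le> h s"
    then obtain t where "h s < t" "t < v" using dense[of "h s" v] by auto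
    then show False using b[of t] above[of s t] by simp
  qed
  \<comment> \<open>As \<phi> has slope at least 1, its inverse, taken at 2 s, has slope at most
    2.\<close>
  have lip: "h s' \<le> h s + 2 * (s' - s)" if "s \<le> s'" for s s'
  proof (rule ccontr)
    assume "\<not> h s' \<le> h s + 2 * (s' - s)"
    then obtain u where u: "h s + 2 * (s' - s) < u" "u < h s'" using dense[of "h s + 2 * (s' - s)" "h s'"] by auto
    define t where "t = u - 2 * (s' - s)"
    have "h s < t" using u by (simp add: t_def)
    then have "2 * s < \<phi> t" by (rule above)
    moreover have "\<phi> t + 2 * (s' - s) \<le> \<phi> u" using expand[of t u] that by (cases "s = s'") (auto simp: t_def)
    ultimately show False using below[OF u(2)] by (simp add: algebra_simps)
  qed
  have mono: "h s \<le> h s'" if "s \<le> s'" for s s'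
  proof (rule ccontr)
    assume "\<not> h s \<le> h s'"
    then obtain u where "h s' < u" "u < h s" using dense[of "h s'" "h s"] by auto
    then show False using above[of s' u] below[of u s] that by simp
  qed
  have "2-lipschitz_on UNIV h"
  proof (rule lipschitz_onI)
    fix s s' :: real
    show "dist (h s) (h s') \<le> 2 * dist s s'"
    proof (cases "s \<le> s'")
      case True
      then show ?thesis using lip[OF True] mono[OF True] by (simp add: dist_real_def)
    next
      case False
      then have "s' \<le> s" by simp
      then show ?thesis using lip[of s' s] mono[of s' s] by (simp add: dist_real_def)
    qed
  qed simp
  then have "continuous_on UNIV h" by (rule lipschitz_on_continuous_on)
  moreover have "h (s + 1) = h s + 1" for s
  proof (rule hI)
    fix t
    have \<phi>: "\<phi> t = \<phi> (t - 1) + 2" using \<phi>1[of "t - 1"] by simp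
    show "\<phi> t \<le> 2 * (s + 1)" if "t < h s + 1" using below[of "t - 1" s] that \<phi> by simp
    show "2 * (s + 1) \<le> \<phi> t" if "h s + 1 < t" using above[of s "t - 1"] that \<phi> by simp
  qed
  ultimately have deg: "degree_one h" 
    by (intro degree_one.intro monoI mono)
  then interpret degree_one h .
  have "a \<in> gap_values h" if a: "a \<in> \<Gamma>" for a
  proof -
    \<comment> \<open>A jump of size at least w at a yields a plateau of h that contains
      [(\<phi> a - w) / 2, \<phi> a / 2].\<close>
    obtain w where w: "0 < w" "\<And>t. t < a \<Longrightarrow> \<phi> t + w \<le> \<phi> a" using jump[OF a] by auto
    have up: "\<phi> a < \<phi> t" if "a < t" for t using expand[OF that] that by linarith
    have "h (\<phi> a / 2) = a"
    proof (rule hI)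
      show "\<phi> t \<le> 2 * (\<phi> a / 2)" if "t < a" for t using w(2)[OF that] w(1) by simp
      show "2 * (\<phi> a / 2) \<le> \<phi> t" if "a < t" for t using up[OF that] by simp
    qed
    then have "\<phi> a / 2 \<le> right_pt h a" by (intro le_right) simp
    moreover have "h (\<phi> a / 2 - w / 2) = a"
    proof (rule hI)
      show "\<phi> t \<le> 2 * (\<phi> a / 2 - w / 2)" if "t < a" for t using w(2)[OF that] by simp
      show "2 * (\<phi> a / 2 - w / 2) \<le> \<phi> t" if "a < t" for t using up[OF that] w(1) by simp
    qed
    then have "left_pt h a \<le> \<phi> a / 2 - w / 2" by (intro left_le) simp
    ultimately show ?thesis using w(1) unfolding gap_values_def by simp
  qed
  moreover have "a \<in> \<Gamma>" if a: "a \<in> gap_values h" for a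
  proof (rule ccontr)
    assume "a \<notin> \<Gamma>"
    then have "\<exists>d>0. \<phi> (a + d) - \<phi> (a - d) < 2 * (right_pt h a - left_pt h a)"
      by (rule small_jump) (use a in \<open>simp add: gap_values_def\<close>)
    then obtain d where d: "0 < d" "\<phi> (a + d) - \<phi> (a - d) < 2 * (right_pt h a - left_pt h a)"
      by auto
    have "\<phi> (a - d) \<le> 2 * left_pt h a" by (rule below) (simp add: d)
    moreover have "2 * right_pt h a < \<phi> (a + d)" by (rule above) (simp add: d)
    ultimately show False using d(2) by simp
  qed
  ultimately have "gap_values h = \<Gamma>" by (intro equalityI subsetI)
  then show ?thesis using deg by (intro exI conjI)
qed

lemma split_system_exists:
  assumes "\<alpha> \<notin> \<rat>" "countable \<Gamma>" "\<Gamma> \<noteq> {}" "\<And>a m. a + of_int m \<in> \<Gamma> \<longleftrightarrow> a \<in> \<Gamma>"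
    "\<And>a. a + \<alpha> \<in> \<Gamma> \<longleftrightarrow> a \<in> \<Gamma>"
  shows "\<exists>h X. split_system h \<alpha> X \<and> gap_values h = \<Gamma>"
proof -
  obtain h where h: "degree_one h" "gap_values h = \<Gamma>" using degree_one_with_gap_values[OF assms(2-4)] by blast
  have "a \<in> gap_values h" if "a + \<alpha> \<in> gap_values h" for a using that assms(5) h(2) by simp
  then obtain S where S: "\<And>s a. S (split_pt h s a) = split_pt h s (a + \<alpha>)"
    using circle_transfer[OF h(1) h(1)] by metis
  have "split_map h \<alpha>"
    using h assms by (intro split_map.intro split_map_axioms.intro) auto
  then have "split_system h \<alpha> (submetric euclidean_metric (circle_proj ` growth_points h), S)"
    by (intro split_system.intro split_system_axioms.intro) (simp_all add: S)
  then show ?thesis using h(2) by blast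
qed

section \<open>Isogenies between split systems\<close>

text \<open>Linear combinations are coded by finite lists of coefficients and vectors.\<close>

lemma countable_rat_span:
  assumes "countable S"
  shows "countable (Q.span S)"
proof -
  define f :: "(rat \<times> real) list \<Rightarrow> real" where "f xs = (\<Sum>(q, a)\<leftarrow>xs. rat_scale q a)" for xs
  let ?L = "lists ((UNIV :: rat set) \<times> S)"
  have "Q.span S \<subseteq> f ` ?L"
  proof (rule Q.span_minimal)
    show "S \<subseteq> f ` ?L"
    proof
      fix a assume "a \<in> S"
      then show "a \<in> f ` ?L" by (intro image_eqI[of _ _ "[(1, a)]"]) (auto simp: f_def)
    qed
    show "Q.subspace (f ` ?L)"
    proof (rule Q.subspaceI)
      show "0 \<in> f ` ?L" by (rule image_eqI[of _ _ "[]"]) (auto simp: f_def)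
      fix x assume x: "x \<in> f ` ?L"
      show "x + y \<in> f ` ?L" if y: "y \<in> f ` ?L" for y
      proof -
        obtain xs ys where "xs \<in> ?L" "x = f xs" "ys \<in> ?L" "y = f ys" using x y by blast
        then show ?thesis by (intro image_eqI[of _ _ "xs @ ys"]) (auto simp: f_def)
      qed
      show "rat_scale c x \<in> f ` ?L" for c
      proof -
        obtain xs where xs: "xs \<in> ?L" "x = f xs" using x by blast
        have "f (map (\<lambda>(q, a). (c * q, a)) xs) = rat_scale c (f xs)"
          by (induction xs) (auto simp: f_def rat_scale_def of_rat_mult algebra_simps)
        moreover have "map (\<lambda>(q, a). (c * q, a)) xs \<in> ?L" using xs(1) by auto
        ultimately show ?thesis using xs(2) by (intro image_eqI[of _ _ "map (\<lambda>(q, a). (c * q, a)) xs"]) auto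
      qed
    qed
  qed
  moreover have "countable ?L"
  proof (intro countable_lists countable_SIGMA)
    show "countable (UNIV :: rat set)" by (rule countableI_type)
  qed (rule assms)
  ultimately show ?thesis using countable_subset countable_image by metis
qed

section \<open>Rational subspaces of the line\<close>

lemma subspace_scale_iff:
  assumes "Q.subspace V" "q \<noteq> 0"
  shows "of_rat q * x \<in> V \<longleftrightarrow> x \<in> V"
proof -
  have *: "of_rat c * y \<in> V" if "y \<in> V" for c y
    using Q.subspace_scale[OF assms(1) that] by (simp add: rat_scale_def)
  show ?thesis
  proof
    assume "of_rat q * x \<in> V"
    moreover have "of_rat (inverse q) * (of_rat q * x) = of_rat (inverse q * q) * x"
      by (simp only: of_rat_mult mult.assoc)
    moreover have "inverse q * q = 1" using assms(2) by simp
    ultimately show "x \<in> V" using *[of "of_rat q * x" "inverse q"] by (simp only: of_rat_1 mult_1)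
  qed (rule *)
qed

lemma subspace_rational:
  assumes "Q.subspace V" "1 \<in> V"
  shows "of_rat q \<in> V"
  using Q.subspace_scale[OF assms, of q] by (simp add: rat_scale_def)

lemma subspace_add_of_int_iff:
  assumes "Q.subspace V" "1 \<in> V"
  shows "a + of_int m \<in> V \<longleftrightarrow> a \<in> V"
proof -
  have "of_int m \<in> V" for m using subspace_rational[OF assms, of "of_int m"] by simp
  then show ?thesis using Q.subspace_add[OF assms(1), of a "of_int m"]
      Q.subspace_diff[OF assms(1), of "a + of_int m" "of_int m"] by auto
qed

lemma subspace_divide:
  assumes "Q.subspace V"
  shows "Q.subspace ((\<lambda>x. x / c) ` V)"
proof (rule Q.subspaceI)
  show "0 \<in> (\<lambda>x. x / c) ` V" using Q.subspace_0[OF assms] by (intro image_eqI[of _ _ 0]) auto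
  fix x assume "x \<in> (\<lambda>x. x / c) ` V"
  then obtain x' where x: "x' \<in> V" "x = x' / c" by blast
  show "x + y \<in> (\<lambda>x. x / c) ` V" if "y \<in> (\<lambda>x. x / c) ` V" for y
  proof -
    obtain y' where y: "y' \<in> V" "y = y' / c" using \<open>y \<in> _\<close> by blast
    show ?thesis using Q.subspace_add[OF assms x(1) y(1)] x(2) y(2)
      by (intro image_eqI[of _ _ "x' + y'"]) (simp_all add: add_divide_distrib)
  qed
  show "rat_scale q x \<in> (\<lambda>x. x / c) ` V" for q
    using Q.subspace_scale[OF assms x(1), of q] x(2)
    by (intro image_eqI[of _ _ "rat_scale q x'"]) (simp_all add: rat_scale_def)
qed

lemma subspace_divide_rat:
  assumes "Q.subspace V" "q \<noteq> 0"
  shows "(\<lambda>x. x / of_rat q) ` V = V"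
proof (intro equalityI subsetI)
  fix x assume "x \<in> V"
  then show "x \<in> (\<lambda>x. x / of_rat q) ` V"
    using subspace_scale_iff[OF assms] assms(2) by (intro image_eqI[of _ _ "of_rat q * x"]) auto
next
  fix x assume "x \<in> (\<lambda>x. x / of_rat q) ` V"
  then obtain y where y: "y \<in> V" "x = y / of_rat q" by blast
  then have "of_rat q * x \<in> V" using assms(2) by simp
  then show "x \<in> V" using subspace_scale_iff[OF assms] by simp
qed

lemma split_system_shift_rotation:
  assumes "split_system h \<alpha> X" "\<beta> = \<alpha> + of_int l"
  shows "split_system h \<beta> X"
proof -
  interpret split_system h \<alpha> X by fact
  show ?thesis
  proof
    show "\<beta> \<notin> \<rat>" using irrational assms(2) by (metis Rats_diff Rats_of_int add_diff_cancel_right')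
    show "gap_values h \<noteq> {}" by (rule gaps_nonempty)
    fix a
    have eq: "a + \<beta> = (a + \<alpha>) + of_int l" by (simp add: assms(2))
    show "a + \<beta> \<in> gap_values h \<longleftrightarrow> a \<in> gap_values h"
      unfolding eq gap_add_int by (rule gaps_invariant)
    show "sys_map X (split_pt h s a) = split_pt h s (a + \<beta>)" for s
      unfolding eq split_add_int by (rule sys_map_split)
  qed (rule space)
qed

lemma subspace_split_system_exists:
  assumes "\<alpha> \<notin> \<rat>" "Q.subspace V" "countable V" "1 \<in> V" "\<alpha> \<in> V"
  shows "\<exists>h X. split_system h \<alpha> X \<and> gap_values h = V"
proof (rule split_system_exists[OF assms(1,3)])
  show "V \<noteq> {}" using assms(4) by blast
  show "a + of_int m \<in> V \<longleftrightarrow> a \<in> V" for a m by (rule subspace_add_of_int_iff[OF assms(2,4)])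
  show "a + \<alpha> \<in> V \<longleftrightarrow> a \<in> V" for a
    using Q.subspace_add[OF assms(2) _ assms(5), of a] Q.subspace_diff[OF assms(2) _ assms(5), of "a + \<alpha>"] by auto
qed

text \<open>Only the rotation number and the span are recorded: systems with equal data are 2-AI
  equivalent, so the gap values themselves need not be followed through a chain. The base point 0
  makes the span equal to the space of mean values.\<close>

definition realizes :: "real \<Rightarrow> real set \<Rightarrow> complex system \<Rightarrow> bool" where
  "realizes \<alpha> V X \<longleftrightarrow> (\<exists>h. split_system h \<alpha> X \<and> 0 \<in> gap_values h \<and> Q.span (gap_values h) = V)"

lemma realizes_imp:
  assumes "realizes \<alpha> V X"
  shows "is_system X" "zero_dimensional X" "mean_values X = V" "\<alpha> \<notin> \<rat>" "Q.subspace V" "countable V"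
    "1 \<in> V" "\<alpha> \<in> V"
proof -
  obtain h where h: "split_system h \<alpha> X" "0 \<in> gap_values h" "Q.span (gap_values h) = V"
    using assms unfolding realizes_def by blast
  interpret split_system h \<alpha> X by (rule h)
  show "is_system X" "zero_dimensional X" "\<alpha> \<notin> \<rat>" by (rule is_system zero_dimensional irrational)+
  show V: "mean_values X = V" using mean_values_span h(2,3) by simp
  show "Q.subspace V" "1 \<in> V" "\<alpha> \<in> V"
    using mean_values_subspace one_in_mean_values alpha_in_mean_values unfolding V by blast+
  show "countable V" using countable_rat_span[OF countable_gap_values] h(3) by simp
qed

lemma realizes_exists:
  assumes "\<alpha> \<notin> \<rat>" "Q.subspace V" "countable V" "1 \<in> V" "\<alpha> \<in> V"
  obtains h X where "realizes \<alpha> V X" "split_system h \<alpha> X" "gap_values h = V"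
proof -
  obtain h X where h: "split_system h \<alpha> X" "gap_values h = V"
    using subspace_split_system_exists[OF assms] by blast
  moreover have "realizes \<alpha> V X"
    unfolding realizes_def using h Q.subspace_0[OF assms(2)] Q.span_eq_iff[of V] assms(2)
    by (intro exI[of _ h] conjI) simp_all
  ultimately show ?thesis using that by blast
qed

text \<open>The integer \<open>l\<close> is free because the rotation number matters only modulo
  1.\<close>

lemma realizes_power:
  assumes "realizes \<alpha> V X" "0 < m" "\<beta> = of_nat m * \<alpha> + of_int l"
  shows "realizes \<beta> V (sys_power X m)"
proof -
  obtain h where h: "split_system h \<alpha> X" "0 \<in> gap_values h" "Q.span (gap_values h) = V"
    using assms unfolding realizes_def by blast
  have "split_system h (of_nat m * \<alpha>) (sys_power X m)"
    by (rule split_system.power_split_system[OF h(1) assms(2)])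
  then have "split_system h \<beta> (sys_power X m)" by (rule split_system_shift_rotation) (rule assms(3))
  then show ?thesis using h(2,3) unfolding realizes_def by blast
qed

text \<open>The system whose gap values are all of V refines both, and the refinements keep the mean
  values.\<close>

lemma realizes_two_AI_equivalent:
  assumes X: "realizes \<alpha> V X" and Y: "realizes \<alpha> V Y"
  shows "two_AI_equivalent_in is_system X Y"
proof -
  note V = realizes_imp[OF X]
  obtain m M where M: "realizes \<alpha> V M" "split_system m \<alpha> M" "gap_values m = V"
    using realizes_exists[OF V(4-8)] by metis
  have ex: "\<exists>p. two_AI M Z p" if Z: "realizes \<alpha> V Z" for Z
  proof -
    obtain h where h: "split_system h \<alpha> Z" "Q.span (gap_values h) = V"
      using Z unfolding realizes_def by blast
    have "gap_values h \<subseteq> gap_values m" using Q.span_superset[of "gap_values h"] h(2) M(3) by simp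
    then obtain p where p: "two_asymptotic M Z p" using split_refinement[OF M(2) h(1)] by blast
    have "two_AI M Z p"
      by (rule two_AI_intro[OF M(2) realizes_imp(1)[OF Z] p]) (simp add: realizes_imp(3)[OF Z] realizes_imp(3)[OF M(1)])
    then show ?thesis by blast
  qed
  obtain p q where "two_AI M X p" "two_AI M Y q" using ex[OF X] ex[OF Y] by blast
  then show ?thesis
    unfolding two_AI_equivalent_in_def using V(1) realizes_imp(1)[OF Y] realizes_imp(1)[OF M(1)]
    by (intro conjI r_into_equivclp) blast+
qed

lemma two_AI_imp_isogenous:
  assumes "is_system X" "is_system Y" "two_AI_equivalent_in is_system (sys_power X m) (sys_power Y n)" "0 < m" "0 < n"
  shows "isogenous_in is_system X Y"
  unfolding isogenous_in_def virtually_two_AI_equivalent_in_def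
  using assms by (intro conjI r_into_rtranclp) blast+

lemma isogenous_in_trans:
  "isogenous_in P X Y \<Longrightarrow> isogenous_in P Y Z \<Longrightarrow> isogenous_in P X Z"
  unfolding isogenous_in_def using rtranclp_trans by fast

lemma sys_power_one: "sys_power X 1 = X"
  by (simp add: sys_power_def)

lemma reflection_isogenous:
  assumes X: "realizes \<alpha> V X"
  shows "\<exists>Y. realizes (- \<alpha>) V Y \<and> isogenous_in is_system X Y"
proof -
  obtain h where h: "split_system h \<alpha> X" "0 \<in> gap_values h" "Q.span (gap_values h) = V"
    using X unfolding realizes_def by blast
  obtain Y k p where Y: "split_system k (- \<alpha>) Y" "gap_values k = uminus ` gap_values h" "two_AI X Y p"
    using split_reflection[OF h(1)] by blast
  have sub: "Q.span (uminus ` S) \<subseteq> Q.span S" for S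
  proof (rule Q.span_minimal)
    show "uminus ` S \<subseteq> Q.span S" using Q.span_neg Q.span_base by blast
  qed simp
  have "Q.span (uminus ` gap_values h) = V"
    using sub[of "gap_values h"] sub[of "uminus ` gap_values h"] h(3) by (simp add: image_image)
  moreover have "0 \<in> uminus ` gap_values h" using h(2) by force
  ultimately have rY: "realizes (- \<alpha>) V Y" unfolding realizes_def using Y(1,2) by auto
  \<comment> \<open>X itself is the common extension; its 2-AI map onto itself is the trivial
    refinement.\<close>
  obtain q where "two_asymptotic X X q" using split_refinement[OF h(1) h(1)] by blast
  then have "two_AI X X q" by (rule two_AI_intro[OF h(1) realizes_imp(1)[OF X]]) simp
  then have "two_AI_equivalent_in is_system X Y"
    unfolding two_AI_equivalent_in_def using realizes_imp(1)[OF X] realizes_imp(1)[OF rY] Y(3)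
    by (intro conjI r_into_equivclp) blast+
  then have "isogenous_in is_system X Y"
    using two_AI_imp_isogenous[of X Y 1 1, unfolded sys_power_one] realizes_imp(1)[OF X] realizes_imp(1)[OF rY]
    by simp
  then show ?thesis using rY by blast
qed

text \<open>With p = a / b and q = c / d one has b d \<beta> = a d \<alpha> + b c, so the powers
  with exponents a d of X and b d of Y have the same rotation number modulo 1.\<close>

lemma affine_pos_isogenous:
  assumes X: "realizes \<alpha> V X" and Y: "realizes \<beta> V Y" and "\<beta> = of_rat p * \<alpha> + of_rat q" "0 < p"
  shows "isogenous_in is_system X Y"
proof -
  obtain a b where p: "p = Fract a b" "0 < b" by (metis Rat_cases)
  obtain c d where q: "q = Fract c d" "0 < d" by (metis Rat_cases)
  have a: "0 < a" using \<open>0 < p\<close> p by (simp add: zero_less_Fract_iff)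
  have eq: "of_nat (nat (b * d)) * \<beta> = of_nat (nat (a * d)) * \<alpha> + of_int (b * c)"
    using p(2) q(2) a by (simp add: assms(3) p(1) q(1) of_rat_rat field_simps)
  have 1: "realizes (of_nat (nat (a * d)) * \<alpha> + of_int (b * c)) V (sys_power X (nat (a * d)))"
    by (rule realizes_power[OF X, where l = "b * c"]) (use a q(2) in auto)
  have 2: "realizes (of_nat (nat (b * d)) * \<beta>) V (sys_power Y (nat (b * d)))"
    by (rule realizes_power[OF Y, where l = 0]) (use p(2) q(2) in auto)
  show ?thesis
    using two_AI_imp_isogenous[OF realizes_imp(1)[OF X] realizes_imp(1)[OF Y]
        realizes_two_AI_equivalent[OF 1 2[unfolded eq]]] a p(2) q(2) by simp
qed

lemma affine_isogenous:
  assumes X: "realizes \<alpha> V X" and Y: "realizes \<beta> V Y" and \<beta>: "\<beta> = of_rat p * \<alpha> + of_rat q" and "p \<noteq> 0"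
  shows "isogenous_in is_system X Y"
proof (cases "0 < p")
  case True
  then show ?thesis by (rule affine_pos_isogenous[OF X Y \<beta>])
next
  case False
  obtain Z where Z: "realizes (- \<alpha>) V Z" "isogenous_in is_system X Z" using reflection_isogenous[OF X] by blast
  have "\<beta> = of_rat (- p) * (- \<alpha>) + of_rat q" using \<beta> by (simp add: of_rat_minus)
  then have "isogenous_in is_system Z Y" using False \<open>p \<noteq> 0\<close> by (intro affine_pos_isogenous[OF Z(1) Y]) auto
  then show ?thesis using Z(2) isogenous_in_trans by blast
qed

lemma irrational_affine:
  assumes "\<alpha> \<notin> \<rat>" "p \<noteq> 0"
  shows "of_rat p * \<alpha> + of_rat q \<notin> \<rat>"
proof
  assume "of_rat p * \<alpha> + of_rat q \<in> \<rat>"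
  then have "(of_rat p * \<alpha> + of_rat q - of_rat q) / of_rat p \<in> \<rat>" by (intro Rats_divide Rats_diff Rats_of_rat)
  then show False using assms by simp
qed

text \<open>The inversion exchanges gap values V and V / \<alpha> exactly, so both systems are first
  replaced by ones that have all of these as gap values. The remaining passage from - 1 / \<alpha>
  to \<beta> is affine.\<close>

lemma inversion_isogenous:
  assumes X: "realizes \<alpha> V X" and Y: "realizes \<beta> ((\<lambda>x. x / \<alpha>) ` V) Y" and "0 < \<alpha>"
    and \<beta>: "\<beta> = of_rat p / \<alpha> + of_rat q" "p \<noteq> 0"
  shows "isogenous_in is_system X Y"
proof -
  note V = realizes_imp[OF X] and W = realizes_imp[OF Y]
  obtain m M where M: "realizes \<alpha> V M" "split_system m \<alpha> M" "gap_values m = V"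
    using realizes_exists[OF V(4-8)] by metis
  have irr: "- 1 / \<alpha> \<notin> \<rat>"
  proof
    assume r: "- 1 / \<alpha> \<in> \<rat>"
    have "- 1 / (- 1 / \<alpha>) \<in> \<rat>" by (rule Rats_divide[OF _ r]) simp
    then show False using V(4) by simp
  qed
  have "- 1 / \<alpha> \<in> (\<lambda>x. x / \<alpha>) ` V" using Q.subspace_neg[OF V(5) V(7)] by (rule image_eqI[rotated]) simp
  then obtain n N where N: "realizes (- 1 / \<alpha>) ((\<lambda>x. x / \<alpha>) ` V) N" "split_system n (- 1 / \<alpha>) N"
    "gap_values n = (\<lambda>x. x / \<alpha>) ` V"
    using realizes_exists[OF irr W(5-7)] by metis
  have "flow_equivalent M N"
    by (rule flow_equivalent_inversion[OF M(2) N(2) \<open>0 < \<alpha>\<close>]) (simp add: N(3) M(3))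
  then have "isogenous_in is_system M N"
    unfolding isogenous_in_def using realizes_imp(1)[OF M(1)] realizes_imp(1)[OF N(1)]
    by (intro conjI r_into_rtranclp) blast+
  moreover have "isogenous_in is_system X M"
    by (rule affine_isogenous[OF X M(1), of 1 0]) auto
  moreover have "isogenous_in is_system N Y"
    by (rule affine_isogenous[OF N(1) Y, of "- p" q]) (use \<beta> in \<open>auto simp: of_rat_minus\<close>)
  ultimately show ?thesis using isogenous_in_trans by metis
qed

text \<open>For r \<noteq> 0 put c = r \<alpha> + s; then \<beta> = (q - p s / r) / c + p / r, that
  is, an affine change to c, an inversion and another affine change. The coefficient of 1 / c is
  non-zero because \<beta> is irrational.\<close>

lemma projective_isogenous:
  assumes X: "realizes \<alpha> V X" and Y: "realizes \<beta> ((\<lambda>x. x / (of_rat r * \<alpha> + of_rat s)) ` V) Y"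
    and \<beta>: "\<beta> = (of_rat p * \<alpha> + of_rat q) / (of_rat r * \<alpha> + of_rat s)"
  shows "isogenous_in is_system X Y"
proof (cases "r = 0")
  case True
  have s: "s \<noteq> 0" using realizes_imp(4)[OF Y] \<beta> True by auto
  have W: "(\<lambda>x. x / (of_rat r * \<alpha> + of_rat s)) ` V = V"
    using subspace_divide_rat[OF realizes_imp(5)[OF X] s] True by simp
  have "\<beta> = of_rat (p / s) * \<alpha> + of_rat (q / s)" using \<beta> True by (simp add: of_rat_divide add_divide_distrib)
  moreover have "p \<noteq> 0"
  proof
    assume "p = 0"
    then have "\<beta> = of_rat (q / s)" using \<beta> True by (simp add: of_rat_divide)
    then show False using realizes_imp(4)[OF Y] by simp
  qed
  ultimately show ?thesis using s by (intro affine_isogenous[OF X Y[unfolded W], of "p / s" "q / s"]) auto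
next
  case False
  note V = realizes_imp[OF X]
  define c where "c = of_rat r * \<alpha> + of_rat s"
  have c: "c \<notin> \<rat>" unfolding c_def by (rule irrational_affine[OF V(4) False])
  have \<alpha>: "\<alpha> = (c - of_rat s) / of_rat r" using False by (simp add: c_def)
  have \<beta>': "\<beta> = of_rat (q - p * s / r) / c + of_rat (p / r)"
  proof -
    have "c \<noteq> 0" using c by auto
    have "\<beta> = (of_rat p * \<alpha> + of_rat q) / c" using \<beta> by (simp only: c_def)
    then have "\<beta> = (of_rat p * ((c - of_rat s) / of_rat r) + of_rat q) / c" by (simp only: \<alpha>[symmetric])
    then show ?thesis using \<open>c \<noteq> 0\<close> False by (simp add: of_rat_diff of_rat_mult of_rat_divide field_simps)
  qed
  have e: "q - p * s / r \<noteq> 0"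
  proof
    assume "q - p * s / r = 0"
    then show False using \<beta>' realizes_imp(4)[OF Y] by simp
  qed
  have cV: "c \<in> V"
    unfolding c_def using subspace_scale_iff[OF V(5) False] V(8) subspace_rational[OF V(5,7)]
    by (intro Q.subspace_add[OF V(5)]) auto
  \<comment> \<open>Inversion is available for positive numbers only; the sign of c is adjusted in
    the affine step, which affects neither V nor V / c.\<close>
  define \<sigma> :: rat where "\<sigma> = (if 0 < c then 1 else - 1)"
  have \<sigma>: "\<sigma> \<noteq> 0" "\<sigma> * \<sigma> = 1" by (auto simp: \<sigma>_def)
  define d where "d = of_rat \<sigma> * c"
  have "c \<noteq> 0" using c by auto
  then have d: "0 < d" by (auto simp: d_def \<sigma>_def of_rat_minus)
  have "d \<notin> \<rat>" using irrational_affine[OF c \<sigma>(1), of 0] by (simp add: d_def)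
  moreover have "d \<in> V" unfolding d_def using subspace_scale_iff[OF V(5) \<sigma>(1)] cV by simp
  ultimately obtain n N where N: "realizes d V N" using realizes_exists[OF _ V(5-7)] by metis
  have "isogenous_in is_system X N"
  proof (rule affine_isogenous[OF X N])
    show "d = of_rat (\<sigma> * r) * \<alpha> + of_rat (\<sigma> * s)" by (simp add: d_def c_def of_rat_mult algebra_simps)
  qed (use \<sigma>(1) False in simp)
  moreover have "isogenous_in is_system N Y"
  proof (rule inversion_isogenous[OF N _ d])
    have "(\<lambda>x. x / c) ` V = (\<lambda>x. x / d) ` V"
    proof -
      have "(\<lambda>x. x / d) ` V = (\<lambda>x. x / c) ` ((\<lambda>x. x / of_rat \<sigma>) ` V)"
        by (simp add: image_image d_def)
      then show ?thesis by (simp add: subspace_divide_rat[OF V(5) \<sigma>(1)])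
    qed
    then show "realizes \<beta> ((\<lambda>x. x / d) ` V) Y" using Y by (simp add: c_def)
    have "of_rat \<sigma> / d = 1 / c" using \<sigma>(1) by (simp add: d_def)
    then have "of_rat (\<sigma> * (q - p * s / r)) / d = of_rat (q - p * s / r) / c"
      unfolding of_rat_mult by (metis mult.commute mult_1_right times_divide_eq_right)
    then show "\<beta> = of_rat (\<sigma> * (q - p * s / r)) / d + of_rat (p / r)" using \<beta>' by simp
    show "\<sigma> * (q - p * s / r) \<noteq> 0" using e \<sigma>(1) by simp
  qed
  ultimately show ?thesis by (rule isogenous_in_trans)
qed

section \<open>Invariants of isogeny\<close>

text \<open>The rational span of 1 and \<alpha>: coarser than Z + Z \<alpha>, it survives the
  passage to powers.\<close>

definition rat_plane :: "real \<Rightarrow> real set" where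
  "rat_plane \<alpha> = {of_rat p + of_rat q * \<alpha> | p q. True}"

lemma rat_planeI: "x = of_rat p + of_rat q * \<alpha> \<Longrightarrow> x \<in> rat_plane \<alpha>"
  by (auto simp: rat_plane_def)

lemma rat_planeE:
  assumes "x \<in> rat_plane \<alpha>"
  obtains p q where "x = of_rat p + of_rat q * \<alpha>"
  using assms by (auto simp: rat_plane_def)

lemma one_in_rat_plane: "1 \<in> rat_plane \<alpha>"
  by (rule rat_planeI[of _ 1 0]) simp

lemma self_in_rat_plane: "\<alpha> \<in> rat_plane \<alpha>"
  by (rule rat_planeI[of _ 0 1]) simp

lemma rotation_group_subset_rat_plane: "rotation_group \<alpha> \<subseteq> rat_plane \<alpha>"
proof
  fix x assume "x \<in> rotation_group \<alpha>"
  then obtain m k where "x = of_int m + of_int k * \<alpha>" by (rule rotation_groupE)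
  then show "x \<in> rat_plane \<alpha>" by (intro rat_planeI[of _ "of_int m" "of_int k"]) simp
qed

text \<open>Multiplication by \<rho> is linear, so its values on the generators 1 and \<beta>
  suffice.\<close>

lemma rat_plane_mult:
  assumes "\<rho> \<in> rat_plane \<alpha>" "\<rho> * \<beta> \<in> rat_plane \<alpha>" "x \<in> rat_plane \<beta>"
  shows "\<rho> * x \<in> rat_plane \<alpha>"
proof -
  obtain a b where ab: "\<rho> = of_rat a + of_rat b * \<alpha>" using assms(1) by (rule rat_planeE)
  obtain c d where cd: "\<rho> * \<beta> = of_rat c + of_rat d * \<alpha>" using assms(2) by (rule rat_planeE)
  obtain p q where pq: "x = of_rat p + of_rat q * \<beta>" using assms(3) by (rule rat_planeE)
  have "\<rho> * x = of_rat p * \<rho> + of_rat q * (\<rho> * \<beta>)" by (simp add: pq algebra_simps)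
  also have "\<dots> = of_rat p * (of_rat a + of_rat b * \<alpha>) + of_rat q * (of_rat c + of_rat d * \<alpha>)"
    unfolding cd by (simp only: ab)
  also have "\<dots> = of_rat (p * a + q * c) + of_rat (p * b + q * d) * \<alpha>"
    by (simp add: of_rat_add of_rat_mult algebra_simps)
  finally show ?thesis by (rule rat_planeI)
qed

lemma rat_plane_subset: "\<beta> \<in> rat_plane \<alpha> \<Longrightarrow> rat_plane \<beta> \<subseteq> rat_plane \<alpha>"
  using rat_plane_mult[of 1 \<alpha> \<beta>] one_in_rat_plane[of \<alpha>] by auto

lemma rat_plane_eq:
  assumes "\<beta> \<in> rotation_group \<alpha>" "\<beta> \<notin> \<rat>"
  shows "rat_plane \<alpha> = rat_plane \<beta>"
proof
  show "rat_plane \<beta> \<subseteq> rat_plane \<alpha>"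
    using assms(1) rotation_group_subset_rat_plane by (intro rat_plane_subset) blast
  obtain j l :: int where jl: "j \<noteq> 0" "of_int j * \<alpha> = \<beta> - of_int l" using rotation_group_swap[OF assms] .
  then have "\<alpha> = of_rat (- of_int l / of_int j) + of_rat (1 / of_int j) * \<beta>"
    by (simp add: of_rat_divide of_rat_minus field_simps)
  then show "rat_plane \<alpha> \<subseteq> rat_plane \<beta>" by (intro rat_plane_subset) (rule rat_planeI)
qed

lemma rat_plane_nat_mult: "0 < m \<Longrightarrow> rat_plane (of_nat m * \<alpha>) = rat_plane \<alpha>"
proof (intro equalityI rat_plane_subset)
  show "of_nat m * \<alpha> \<in> rat_plane \<alpha>" by (rule rat_planeI[of _ 0 "of_nat m"]) simp
  show "\<alpha> \<in> rat_plane (of_nat m * \<alpha>)" if "0 < m"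
    using that by (intro rat_planeI[of _ 0 "1 / of_nat m"]) (simp add: of_rat_divide)
qed

text \<open>A 2-AI map of X onto itself, read from one presentation to the other, puts \<beta> into
  Z + Z \<alpha>. The links of a chain can then be joined although each chooses its own presentation
  of the systems.\<close>

lemma split_rat_plane_unique:
  assumes "split_system h \<alpha> X" "split_system k \<beta> X"
  shows "rat_plane \<alpha> = rat_plane \<beta>"
proof -
  interpret X: split_system h \<alpha> X by fact
  interpret Y: split_system k \<beta> X by fact
  obtain p where "two_asymptotic X X p" using split_refinement[OF assms(1,1)] by blast
  then have "two_AI X X p" by (rule two_AI_intro[OF assms(1) X.is_system]) simp
  then show ?thesis by (intro rat_plane_eq two_AI_elim(2)[OF assms] Y.irrational)
qed

lemma split_normalize:
  assumes "split_system h \<alpha> X"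
  shows "\<exists>k. split_system k \<alpha> X \<and> 0 \<in> gap_values k"
proof -
  obtain a where a: "a \<in> gap_values h"
    using split_map.gaps_nonempty[OF split_system.axioms(1)[OF assms]] by blast
  have "0 \<in> (+) (- a) ` gap_values h" using a by force
  then show ?thesis using split_shift[OF assms, of "- a"] by auto
qed

text \<open>A power is presented by the same h, hence has the same gap values, and the span does not
  involve \<alpha>.\<close>

lemma mean_values_power:
  assumes "split_system h \<alpha> X" "0 < m"
  shows "mean_values (sys_power X m) = mean_values X"
proof -
  obtain k where k: "split_system k \<alpha> X" "0 \<in> gap_values k" using split_normalize[OF assms(1)] by blast
  show ?thesis
    using split_system.mean_values_span[OF k]
      split_system.mean_values_span[OF split_system.power_split_system[OF k(1) assms(2)] k(2)] by simp
qed

definition same_invariants :: "complex system \<Rightarrow> complex system \<Rightarrow> bool" where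
  "same_invariants X Y \<longleftrightarrow> (\<exists>h \<alpha> k \<beta>. split_system h \<alpha> X \<and> split_system k \<beta> Y \<and>
     mean_values X = mean_values Y \<and> rat_plane \<alpha> = rat_plane \<beta>)"

lemma same_invariants_sym: "same_invariants X Y \<Longrightarrow> same_invariants Y X"
  unfolding same_invariants_def by metis

lemma same_invariants_trans:
  assumes "same_invariants X Y" "same_invariants Y Z"
  shows "same_invariants X Z"
proof -
  obtain h \<alpha> k \<beta> where 1: "split_system h \<alpha> X" "split_system k \<beta> Y" "mean_values X = mean_values Y"
    "rat_plane \<alpha> = rat_plane \<beta>"
    using assms(1) unfolding same_invariants_def by (elim exE conjE)
  obtain k' \<beta>' l \<gamma> where 2: "split_system k' \<beta>' Y" "split_system l \<gamma> Z" "mean_values Y = mean_values Z"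
    "rat_plane \<beta>' = rat_plane \<gamma>"
    using assms(2) unfolding same_invariants_def by (elim exE conjE)
  have "rat_plane \<alpha> = rat_plane \<gamma>" using 1(4) 2(4) split_rat_plane_unique[OF 1(2) 2(1)] by simp
  moreover have "mean_values X = mean_values Z" using 1(3) 2(3) by simp
  ultimately show ?thesis unfolding same_invariants_def using 1(1) 2(2) by (intro exI conjI)
qed

lemma same_invariants_power:
  assumes "split_system h \<alpha> X" "0 < m"
  shows "same_invariants X (sys_power X m)"
  unfolding same_invariants_def
  using assms(1) split_system.power_split_system[OF assms] mean_values_power[OF assms, symmetric]
    rat_plane_nat_mult[OF assms(2), of \<alpha>, symmetric]
  by (intro exI conjI)

lemma two_AI_same_invariants:
  assumes X: "split_system h \<alpha> X" and Y: "split_system k \<beta> Y" and two: "two_AI X Y p"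
  shows "same_invariants X Y"
proof -
  interpret split_system k \<beta> Y by fact
  show ?thesis unfolding same_invariants_def
    using X Y two_AI_elim(1)[OF X Y two] rat_plane_eq[OF two_AI_elim(2)[OF X Y two] irrational]
    by (intro exI conjI)
qed

lemma two_AI_equivalent_same_invariants:
  assumes "two_AI_equivalent_in is_denjoy_system X Y"
  shows "same_invariants X Y"
proof -
  have D: "\<exists>h \<alpha>. split_system h \<alpha> Z" if "is_denjoy_system Z" for Z
    using is_denjoy_system_imp_split[OF that] .
  let ?r = "\<lambda>Y1 Y2. is_denjoy_system Y1 \<and> is_denjoy_system Y2 \<and>
    (\<exists>X p q. is_denjoy_system X \<and> two_AI X Y1 p \<and> two_AI X Y2 q)"
  have step: "same_invariants A B" if r: "?r A B" for A B
  proof -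
    obtain C p q where C: "is_denjoy_system C" "two_AI C A p" "two_AI C B q" using r by blast
    obtain h \<alpha> where h: "split_system h \<alpha> C" using D[OF C(1)] by blast
    obtain k \<beta> where k: "split_system k \<beta> A" using D r by blast
    obtain l \<gamma> where l: "split_system l \<gamma> B" using D r by blast
    show ?thesis
      using same_invariants_trans[OF same_invariants_sym[OF two_AI_same_invariants[OF h k C(2)]] two_AI_same_invariants[OF h l C(3)]] .
  qed
  have "is_denjoy_system X" and e: "equivclp ?r X Y" using assms unfolding two_AI_equivalent_in_def by auto
  then obtain h \<alpha> where h: "split_system h \<alpha> X" using D by blast
  from e show ?thesis
  proof (induction rule: equivclp_induct)
    case base
    show ?case unfolding same_invariants_def using h by blast
  next
    case (step A B)
    from step.hyps(2) have "same_invariants A B"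
    proof
      assume "?r A B"
      then show ?thesis by (rule \<open>\<And>A B. ?r A B \<Longrightarrow> same_invariants A B\<close>)
    next
      assume "?r B A"
      then show ?thesis by (rule same_invariants_sym[OF \<open>\<And>A B. ?r A B \<Longrightarrow> same_invariants A B\<close>])
    qed
    then show ?case by (rule same_invariants_trans[OF step.IH])
  qed
qed

text \<open>The factor \<rho> is 1 for 2-AI equivalences and the change of clock for flow
  equivalences. The relation is directed, as is the chain in \<open>isogenous_in\<close> along which
  it is composed.\<close>

definition commensurable :: "complex system \<Rightarrow> complex system \<Rightarrow> bool" where
  "commensurable X Y \<longleftrightarrow> (\<exists>h \<alpha> k \<beta> \<rho>. split_system h \<alpha> X \<and> split_system k \<beta> Y \<and> \<rho> \<noteq> 0 \<and>
     mean_values X = (*) \<rho> ` mean_values Y \<and> \<rho> \<in> rat_plane \<alpha> \<and> \<rho> * \<beta> \<in> rat_plane \<alpha>)"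

lemma same_invariants_commensurable:
  assumes "same_invariants X Y"
  shows "commensurable X Y"
proof -
  obtain h \<alpha> k \<beta> where 1: "split_system h \<alpha> X" "split_system k \<beta> Y" "mean_values X = mean_values Y"
    "rat_plane \<alpha> = rat_plane \<beta>"
    using assms unfolding same_invariants_def by (elim exE conjE)
  have "1 * \<beta> \<in> rat_plane \<alpha>" unfolding 1(4) using self_in_rat_plane by simp
  moreover have "mean_values X = (*) 1 ` mean_values Y" using 1(3) by simp
  ultimately show ?thesis
    unfolding commensurable_def using 1(1,2) one_in_rat_plane zero_neq_one[symmetric] by (intro exI conjI)
qed

lemma commensurable_trans:
  assumes "commensurable X Y" "commensurable Y Z"
  shows "commensurable X Z"
proof -
  obtain h \<alpha> k \<beta> \<rho> where 1: "split_system h \<alpha> X" "split_system k \<beta> Y" "\<rho> \<noteq> 0"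
    "mean_values X = (*) \<rho> ` mean_values Y" "\<rho> \<in> rat_plane \<alpha>" "\<rho> * \<beta> \<in> rat_plane \<alpha>"
    using assms(1) unfolding commensurable_def by (elim exE conjE)
  obtain k' \<beta>' l \<gamma> \<rho>' where 2: "split_system k' \<beta>' Y" "split_system l \<gamma> Z" "\<rho>' \<noteq> 0"
    "mean_values Y = (*) \<rho>' ` mean_values Z" "\<rho>' \<in> rat_plane \<beta>'" "\<rho>' * \<gamma> \<in> rat_plane \<beta>'"
    using assms(2) unfolding commensurable_def by (elim exE conjE)
  have eq: "rat_plane \<beta>' = rat_plane \<beta>" by (rule split_rat_plane_unique[OF 2(1) 1(2)])
  have "\<rho> * \<rho>' \<in> rat_plane \<alpha>" using rat_plane_mult[OF 1(5,6)] 2(5) eq by simp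
  moreover have "(\<rho> * \<rho>') * \<gamma> \<in> rat_plane \<alpha>" using rat_plane_mult[OF 1(5,6)] 2(6) eq by (simp add: mult.assoc)
  moreover have "mean_values X = (*) (\<rho> * \<rho>') ` mean_values Z" by (simp add: 1(4) 2(4) image_image mult.assoc)
  moreover have "\<rho> * \<rho>' \<noteq> 0" using 1(3) 2(3) by simp
  ultimately show ?thesis unfolding commensurable_def using 1(1) 2(2) by (intro exI conjI)
qed

lemma isogenous_imp_commensurable:
  assumes "isogenous_in is_denjoy_system X Y"
  shows "commensurable X Y"
proof -
  let ?r = "\<lambda>X1 X2. is_denjoy_system X1 \<and> is_denjoy_system X2 \<and>
    (virtually_two_AI_equivalent_in is_denjoy_system X1 X2 \<or> flow_equivalent X1 X2)"
  have one: "commensurable A B" if r: "?r A B" for A B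
  proof -
    obtain h \<alpha> where h: "split_system h \<alpha> A" using is_denjoy_system_imp_split r by blast
    obtain k \<beta> where k: "split_system k \<beta> B" using is_denjoy_system_imp_split r by blast
    from r consider "virtually_two_AI_equivalent_in is_denjoy_system A B" | "flow_equivalent A B" by blast
    then show ?thesis
    proof cases
      case 1
      then obtain m n where mn: "0 < m" "0 < n" "two_AI_equivalent_in is_denjoy_system (sys_power A m) (sys_power B n)"
        unfolding virtually_two_AI_equivalent_in_def by blast
      show ?thesis
        using same_invariants_trans[OF same_invariants_power[OF h mn(1)]
            same_invariants_trans[OF two_AI_equivalent_same_invariants[OF mn(3)]
              same_invariants_sym[OF same_invariants_power[OF k mn(2)]]]]
        by (rule same_invariants_commensurable)
    next
      case 2
      obtain \<rho> where \<rho>: "\<rho> \<noteq> 0" "mean_values A = (*) \<rho> ` mean_values B" "\<rho> \<in> rotation_group \<alpha>" "\<rho> * \<beta> \<in> rotation_group \<alpha>"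
        using flow_equivalent_elim[OF h k 2] by (elim exE conjE)
      have "\<rho> \<in> rat_plane \<alpha>" "\<rho> * \<beta> \<in> rat_plane \<alpha>"
        using \<rho>(3,4) rotation_group_subset_rat_plane by blast+
      then show ?thesis unfolding commensurable_def using h k \<rho>(1,2) by (intro exI conjI)
    qed
  qed
  have X: "is_denjoy_system X" and r: "?r\<^sup>*\<^sup>* X Y" using assms unfolding isogenous_in_def by auto
  obtain h \<alpha> where h: "split_system h \<alpha> X" using is_denjoy_system_imp_split[OF X] by blast
  from r show ?thesis
  proof (induction rule: rtranclp_induct)
    case base
    have "same_invariants X X" unfolding same_invariants_def using h by blast
    then show ?case by (rule same_invariants_commensurable)
  next
    case (step A B)
    show ?case by (rule commensurable_trans[OF step.IH one[OF step.hyps(2)]])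
  qed
qed

section \<open>Rational hulls on the circle\<close>

lemma circle_lift_proj:
  assumes "Q.subspace V" "1 \<in> V"
  shows "circle_lift (circle_proj ` V) = V"
proof (intro equalityI subsetI)
  fix t assume "t \<in> circle_lift (circle_proj ` V)"
  then obtain v where v: "v \<in> V" "circle_proj t = circle_proj v" by (auto simp: circle_lift_def)
  obtain m where "t = v + of_int m" using circle_proj_eqE[OF v(2)] .
  then show "t \<in> V" using v(1) subspace_add_of_int_iff[OF assms] by simp
qed (auto simp: circle_lift_def)

lemma circle_scale_proj:
  assumes "Q.subspace V" "1 \<in> V"
  shows "circle_scale (1 / c) (circle_proj ` V) = circle_proj ` (\<lambda>x. x / c) ` V"
  by (simp add: circle_scale_def circle_lift_proj[OF assms] image_image)

text \<open>Both sets contain the class of 0, so the rotated copy of W is a coset through 0; hence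
  \<theta> \<in> W and the rotation does nothing. Equality up to rotation thus becomes equality of
  subspaces of the line.\<close>

lemma rotation_proj_eq:
  assumes V: "Q.subspace V" "1 \<in> V" and W: "Q.subspace W" "1 \<in> W"
    and eq: "circle_proj ` V = rotation \<theta> ` circle_proj ` W"
  shows "V = W"
proof -
  have iff: "x \<in> V \<longleftrightarrow> x - \<theta> \<in> W" for x
  proof
    assume "x \<in> V"
    then obtain w where w: "w \<in> W" "circle_proj x = rotation \<theta> (circle_proj w)" using eq by blast
    then have "circle_proj x = circle_proj (\<theta> + w)" by (simp add: rotation_def circle_proj_add)
    then obtain m where "x = \<theta> + w + of_int m" by (rule circle_proj_eqE)
    then show "x - \<theta> \<in> W" using w(1) subspace_add_of_int_iff[OF W, of w m] by simp
  next
    assume "x - \<theta> \<in> W"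
    then have "rotation \<theta> (circle_proj (x - \<theta>)) \<in> circle_proj ` V" using eq by blast
    then have "circle_proj x \<in> circle_proj ` V" by (simp add: rotation_def flip: circle_proj_add)
    then have "x \<in> circle_lift (circle_proj ` V)" by (simp add: circle_lift_def)
    then show "x \<in> V" by (simp add: circle_lift_proj[OF V])
  qed
  have "- \<theta> \<in> W" using iff[of 0] Q.subspace_0[OF V(1)] by simp
  then have \<theta>: "\<theta> \<in> W" using Q.subspace_neg[OF W(1)] by force
  show ?thesis
  proof (intro equalityI subsetI)
    fix x assume "x \<in> V"
    then have "x - \<theta> \<in> W" using iff by simp
    then show "x \<in> W" using Q.subspace_add[OF W(1) _ \<theta>, of "x - \<theta>"] by simp
  next
    fix x assume "x \<in> W"
    then have "x - \<theta> \<in> W" by (rule Q.subspace_diff[OF W(1) _ \<theta>])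
    then show "x \<in> V" using iff by simp
  qed
qed

text \<open>If the determinant vanished, the rows would be proportional, and \<beta> would be their
  rational ratio.\<close>

lemma invertible_of_irrational:
  fixes M :: "rat^2^2"
  assumes "\<rho> = of_rat (M$2$1) * \<alpha> + of_rat (M$2$2)" "\<rho> * \<beta> = of_rat (M$1$1) * \<alpha> + of_rat (M$1$2)"
    "\<rho> \<noteq> 0" "\<beta> \<notin> \<rat>"
  shows "invertible M"
proof -
  have "det M \<noteq> 0"
  proof
    assume "det M = 0"
    then have d: "M$1$1 * M$2$2 = M$1$2 * M$2$1" by (simp add: det_2)
    obtain t where t: "M$1$1 = t * M$2$1" "M$1$2 = t * M$2$2"
    proof (cases "M$2$1 = 0")
      case True
      then have "M$2$2 \<noteq> 0" using assms(1,3) by auto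
      moreover from this have "M$1$1 = 0" using d True by simp
      ultimately show ?thesis using True that[of "M$1$2 / M$2$2"] by simp
    next
      case False
      then show ?thesis using d that[of "M$1$1 / M$2$1"] by (simp add: field_simps)
    qed
    have "\<rho> * \<beta> = of_rat t * \<rho>" unfolding assms(2) by (simp add: assms(1) t of_rat_mult algebra_simps)
    then have "\<beta> = of_rat t" using assms(3) by simp
    then show False using assms(4) by simp
  qed
  then show ?thesis by (simp add: invertible_det_nz)
qed

lemma denjoy_realizes:
  assumes "denjoy_invariants F \<alpha> A"
  shows "realizes \<alpha> (Q.span (circle_lift A)) (denjoy_system F)"
  using denjoy_invariants_imp_split[OF assms] unfolding realizes_def by auto

lemma projectively_related_isogenous:
  assumes D: "denjoy_invariants F\<^sub>0 \<alpha>\<^sub>0 A\<^sub>0" "denjoy_invariants F\<^sub>1 \<alpha>\<^sub>1 A\<^sub>1"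
    and rel: "projectively_related \<alpha>\<^sub>0 A\<^sub>0 \<alpha>\<^sub>1 A\<^sub>1"
  shows "isogenous (denjoy_system F\<^sub>0) (denjoy_system F\<^sub>1)"
proof -
  define V where "V = Q.span (circle_lift A\<^sub>0)"
  define W where "W = Q.span (circle_lift A\<^sub>1)"
  have X: "realizes \<alpha>\<^sub>0 V (denjoy_system F\<^sub>0)" unfolding V_def by (rule denjoy_realizes[OF D(1)])
  have Y: "realizes \<alpha>\<^sub>1 W (denjoy_system F\<^sub>1)" unfolding W_def by (rule denjoy_realizes[OF D(2)])
  note V = realizes_imp[OF X] and W = realizes_imp[OF Y]
  obtain M :: "rat^2^2" and \<theta> where M: "invertible M"
    "\<alpha>\<^sub>1 = (of_rat (M$1$1) * \<alpha>\<^sub>0 + of_rat (M$1$2)) / (of_rat (M$2$1) * \<alpha>\<^sub>0 + of_rat (M$2$2))"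
    "rational_hull A\<^sub>1 = rotation \<theta> ` circle_scale (1 / (of_rat (M$2$1) * \<alpha>\<^sub>0 + of_rat (M$2$2))) (rational_hull A\<^sub>0)"
    using rel unfolding projectively_related_def equal_up_to_rotation_def by (elim exE conjE)
  define c where "c = of_rat (M$2$1) * \<alpha>\<^sub>0 + of_rat (M$2$2)"
  have "c \<noteq> 0" using M(2) W(4) unfolding c_def by auto
  \<comment> \<open>Puts 1 into V / c, as is needed to recover this subspace from its projection to
    the circle.\<close>
  have "c \<in> V"
    unfolding c_def
    by (intro Q.subspace_add[OF V(5)] subspace_rational[OF V(5,7)])
       (use Q.subspace_scale[OF V(5) V(8), of "M$2$1"] in \<open>simp add: rat_scale_def\<close>)
  then have "1 \<in> (\<lambda>x. x / c) ` V" using \<open>c \<noteq> 0\<close> by (intro image_eqI[of _ _ c]) auto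
  moreover have "circle_proj ` W = rotation \<theta> ` circle_proj ` (\<lambda>x. x / c) ` V"
    using M(3) circle_scale_proj[OF V(5,7), of c] by (simp only: rational_hull_def V_def W_def c_def)
  ultimately have "W = (\<lambda>x. x / c) ` V"
    by (intro rotation_proj_eq[OF W(5,7) subspace_divide[OF V(5)]])
  then have "isogenous_in is_system (denjoy_system F\<^sub>0) (denjoy_system F\<^sub>1)"
    using projective_isogenous[OF X _ M(2)] Y unfolding c_def by simp
  then show ?thesis unfolding isogenous_def using V(2) W(2) by simp
qed

lemma isogenous_projectively_related:
  assumes D: "denjoy_invariants F\<^sub>0 \<alpha>\<^sub>0 A\<^sub>0" "denjoy_invariants F\<^sub>1 \<alpha>\<^sub>1 A\<^sub>1"
    and iso: "isogenous_in is_denjoy_system (denjoy_system F\<^sub>0) (denjoy_system F\<^sub>1)"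
  shows "projectively_related \<alpha>\<^sub>0 A\<^sub>0 \<alpha>\<^sub>1 A\<^sub>1"
proof -
  define V where "V = Q.span (circle_lift A\<^sub>0)"
  define W where "W = Q.span (circle_lift A\<^sub>1)"
  have X: "realizes \<alpha>\<^sub>0 V (denjoy_system F\<^sub>0)" unfolding V_def by (rule denjoy_realizes[OF D(1)])
  have Y: "realizes \<alpha>\<^sub>1 W (denjoy_system F\<^sub>1)" unfolding W_def by (rule denjoy_realizes[OF D(2)])
  note V = realizes_imp[OF X] and W = realizes_imp[OF Y]
  obtain h0 h1 where h: "split_system h0 \<alpha>\<^sub>0 (denjoy_system F\<^sub>0)" "split_system h1 \<alpha>\<^sub>1 (denjoy_system F\<^sub>1)"
    using X Y unfolding realizes_def by blast
  obtain h \<alpha> k \<beta> \<rho> where 1: "split_system h \<alpha> (denjoy_system F\<^sub>0)" "split_system k \<beta> (denjoy_system F\<^sub>1)" "\<rho> \<noteq> 0"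
    "mean_values (denjoy_system F\<^sub>0) = (*) \<rho> ` mean_values (denjoy_system F\<^sub>1)"
    "\<rho> \<in> rat_plane \<alpha>" "\<rho> * \<beta> \<in> rat_plane \<alpha>"
    using isogenous_imp_commensurable[OF iso] unfolding commensurable_def by (elim exE conjE)
  have \<alpha>: "rat_plane \<alpha> = rat_plane \<alpha>\<^sub>0" by (rule split_rat_plane_unique[OF 1(1) h(1)])
  have "\<alpha>\<^sub>1 \<in> rat_plane \<beta>"
    using self_in_rat_plane[of \<alpha>\<^sub>1] split_rat_plane_unique[OF 1(2) h(2)] by simp
  then have "\<rho> * \<alpha>\<^sub>1 \<in> rat_plane \<alpha>\<^sub>0" using rat_plane_mult[OF 1(5,6)] \<alpha> by simp
  then obtain q p where pq: "\<rho> * \<alpha>\<^sub>1 = of_rat q + of_rat p * \<alpha>\<^sub>0" by (rule rat_planeE)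
  obtain s r where rs: "\<rho> = of_rat s + of_rat r * \<alpha>\<^sub>0" using 1(5) unfolding \<alpha> by (rule rat_planeE)
  \<comment> \<open>The rows hold the coordinates of \<open>\<rho> * \<alpha>\<^sub>1\<close> and of
    \<rho> in the plane of \<open>\<alpha>\<^sub>0\<close>.\<close>
  define M :: "rat^2^2" where "M = vector [vector [p, q], vector [r, s]]"
  have M: "M$1$1 = p" "M$1$2 = q" "M$2$1 = r" "M$2$2 = s" by (simp_all add: M_def)
  have \<rho>: "\<rho> = of_rat (M$2$1) * \<alpha>\<^sub>0 + of_rat (M$2$2)" and \<rho>\<alpha>: "\<rho> * \<alpha>\<^sub>1 = of_rat (M$1$1) * \<alpha>\<^sub>0 + of_rat (M$1$2)"
    using pq rs by (simp_all add: M add.commute)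
  have "invertible M" by (rule invertible_of_irrational[OF \<rho> \<rho>\<alpha> 1(3) W(4)])
  moreover have "\<alpha>\<^sub>1 = (of_rat (M$1$1) * \<alpha>\<^sub>0 + of_rat (M$1$2)) / (of_rat (M$2$1) * \<alpha>\<^sub>0 + of_rat (M$2$2))"
    using 1(3) unfolding \<rho>\<alpha>[symmetric] \<rho>[symmetric] by simp
  moreover have "equal_up_to_rotation (rational_hull A\<^sub>1)
      (circle_scale (1 / (of_rat (M$2$1) * \<alpha>\<^sub>0 + of_rat (M$2$2))) (rational_hull A\<^sub>0))"
  proof -
    have "V = (*) \<rho> ` W" using 1(4) V(3) W(3) by simp
    then have W_eq: "(\<lambda>x. x / \<rho>) ` V = W" using 1(3) by (simp add: image_image)
    have "circle_scale (1 / \<rho>) (rational_hull A\<^sub>0) = rational_hull A\<^sub>1"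
      using circle_scale_proj[OF V(5,7), of \<rho>] unfolding W_eq by (simp only: rational_hull_def V_def W_def)
    moreover have "rotation 0 ` B = B" for B
      by (simp add: rotation_def circle_proj_def)
    ultimately show ?thesis unfolding \<rho>[symmetric] equal_up_to_rotation_def by metis
  qed
  ultimately show ?thesis unfolding projectively_related_def by blast
qed

theorem theorem1p3:
  fixes F\<^sub>0 F\<^sub>1 :: "complex \<Rightarrow> complex" and \<alpha>\<^sub>0 \<alpha>\<^sub>1 :: real and A\<^sub>0 A\<^sub>1 :: "complex set"
  assumes "denjoy_invariants F\<^sub>0 \<alpha>\<^sub>0 A\<^sub>0" and "denjoy_invariants F\<^sub>1 \<alpha>\<^sub>1 A\<^sub>1"
  shows "(projectively_related \<alpha>\<^sub>0 A\<^sub>0 \<alpha>\<^sub>1 A\<^sub>1 \<longrightarrow>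
            isogenous (denjoy_system F\<^sub>0) (denjoy_system F\<^sub>1)) \<and>
         (isogenous_in is_denjoy_system (denjoy_system F\<^sub>0) (denjoy_system F\<^sub>1) \<longrightarrow>
            projectively_related \<alpha>\<^sub>0 A\<^sub>0 \<alpha>\<^sub>1 A\<^sub>1)"
  using projectively_related_isogenous[OF assms] isogenous_projectively_related[OF assms] by blast

end
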